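(* For any $p\ge0$, $q\ge-p$, $a>0$ and $x\le a$, $$\mathbb{E}_x\left(e^{-pT_a^+-q\int_0^{T_a^+}1_{\{V_s<b\}}ds}\right)=\frac{\mathcal{R}^{(p,q)}(x)}{\mathcal{R}^{(p,q)}(a)},\qquad \mathbb{E}_x\left(e^{-pT_a^+-q\int_0^{T_a^+}1_{\{V_s>b\}}ds}\right)=\frac{\mathcal{L}^{(p,q)}(x)}{\mathcal{L}^{(p,q)}(a)},$$ where, for $x\in\mathbb{R}$, $$\mathcal{R}^{(p,q)}(x):=Z^{(p+q)}(x)-q\overline{\mathbb{W}}^{(p)}(x-b)-(p+q)\int_b^x\mathbb{W}^{(p)}(x-y)\left(q\overline{W}^{(p+q)}(y)-\delta W^{(p+q)}(y)\right)dy,$$ $$\mathcal{L}^{(p,q)}(x):=\mathcal{R}^{(p+q,-q)}(x)=Z^{(p)}(x)+q\overline{\mathbb{W}}^{(p+q)}(x-b)+p\int_b^x\mathbb{W}^{(p+q)}(x-y)\left(q\overline{W}^{(p)}(y)+\delta W^{(p)}(y)\right)dy.$$ In particular, for $x\le0$, $\mathcal{R}^{(p,q)}(x)=\mathcal{L}^{(p,q)}(x)=1$.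
   Context: Let $X=(X_t)_{t\ge0}$ be a spectrally negative Lévy process (no positive jumps, not the negative of a subordinator); $\mathbb{P}_x$ is its law when $X_0=x$, with expectation $\mathbb{E}_x$. Its Laplace exponent is $\psi(\theta)=\log\mathbb{E}_0[e^{\theta X_1}]=\gamma\theta+\frac{\sigma^2}{2}\theta^2+\int_{(-\infty,0)}(e^{\theta x}-1-\theta x1_{\{x>-1\}})\Pi(dx)$, $\theta\ge0$, with $\gamma\in\mathbb{R}$, $\sigma\ge0$ and Lévy measure $\Pi$ on $(-\infty,0)$, $\int(1\wedge x^2)\Pi(dx)<\infty$. If $X$ has paths of bounded variation, then $X_t=X_0+ct-S_t$ with $c:=\gamma-\int_{(-1,0)}x\,\Pi(dx)>0$ and $S$ a driftless subordinator. Fix $b>0$ and $\delta\ge0$, and assume $\delta<c$ whenever $X$ has paths of bounded variation. Put $Y_t:=X_t-\delta t$, a spectrally negative Lévy process with Laplace exponent $\psi_Y(\theta)=\psi(\theta)-\delta\theta$. Refracted-reflected process $V$ under $\mathbb{P}_x$ (reflected at $0$, refracted above $b$): Step 0: set $V_{0-}=x$; if $x\ge0$ set $\underline\tau:=0$ and go to Step 1, otherwise set $\overline\tau:=0$ and go to Step 2. Step 1: let $(\widetilde A_t)_{t\ge\underline\tau}$ be the refracted Lévy process started at time $\underline\tau$ at level $x$, i.e. the unique strong solution of $d\widetilde A_t=dX_t-\delta1_{\{\widetilde A_t>b\}}dt$ with $\widetilde A_{\underline\tau}=x$; let $\overline\tau:=\inf\{t>\underline\tau:\widetilde A_t<0\}$,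 set $V_t=\widetilde A_t$ for $\underline\tau\le t<\overline\tau$, and go to Step 2. Step 2: let $\widetilde U_t=(X_t-X_{\overline\tau})+\sup_{\overline\tau\le s\le t}(-(X_s-X_{\overline\tau}))\vee0$, $t\ge\overline\tau$, be the process reflected at $0$ started at time $\overline\tau$ at $0$; let $\underline\tau:=\inf\{t>\overline\tau:\widetilde U_t>b\}$, set $V_t=\widetilde U_t$ for $\overline\tau\le t<\underline\tau$, set $x=b$, and go to Step 1. For $a>0$, $T_a^+:=\inf\{t>0:V_t>a\}$ ($\inf\varnothing=\infty$); $T_a^+<\infty$ almost surely. Scale functions: for $q\ge0$, $\Phi(q):=\sup\{\lambda\ge0:\psi(\lambda)=q\}$ and $\varphi(q):=\sup\{\lambda\ge0:\psi_Y(\lambda)=q\}$. $W^{(q)}$ (resp. $\mathbb{W}^{(q)}$) is the scale function of $X$ (resp. $Y$): zero on $(-\infty,0)$, continuous and increasing on $[0,\infty)$, with $\int_0^\infty e^{-\theta x}W^{(q)}(x)dx=1/(\psi(\theta)-q)$ for $\theta>\Phi(q)$ (resp. $\int_0^\infty e^{-\theta x}\mathbb{W}^{(q)}(x)dx=1/(\psi_Y(\theta)-q)$ for $\theta>\varphi(q)$). Also, for $x\in\mathbb{R}$, $\overline{W}^{(q)}(x):=\int_0^xW^{(q)}(y)dy$, $\overline{\mathbb{W}}^{(q)}(x):=\int_0^x\mathbb{W}^{(q)}(y)dy$ and $Z^{(q)}(x):=1+q\overline{W}^{(q)}(x)$. Integrals $\int_b^x\mathbb{W}^{(q)}(x-y)\cdots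 dy$ vanish for $x\le b$. *)

theory Defs
  imports "HOL-Probability.Probability"
begin

section \<open>Spectrally negative Levy processes\<close>

definition cadlag :: "(real \<Rightarrow> real) \<Rightarrow> bool" where
  "cadlag f \<longleftrightarrow>
     (\<forall>t\<ge>0. (f \<longlongrightarrow> f t) (at_right t)) \<and>
     (\<forall>t>0. \<exists>l. (f \<longlongrightarrow> l) (at_left t))"

definition no_positive_jumps :: "(real \<Rightarrow> real) \<Rightarrow> bool" where
  "no_positive_jumps f \<longleftrightarrow> (\<forall>t>0. \<forall>l. (f \<longlongrightarrow> l) (at_left t) \<longrightarrow> f t \<le> l)"

text \<open>
  The time index ranges over the nonnegative reals; values of the process at negative times play
  no role. The measure \<open>M\<close> is the law under which the process starts at 0; the law of the
  process started at \<open>x\<close> is represented by the process \<open>x + X\<close> under \<open>M\<close>.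
\<close>

locale levy_process = prob_space M for M :: "'w measure" +
  fixes X :: "real \<Rightarrow> 'w \<Rightarrow> real"
  assumes random_variable_X: "\<And>t. 0 \<le> t \<Longrightarrow> X t \<in> borel_measurable M"
    and starts_at_0: "AE \<omega> in M. X 0 \<omega> = 0"
    and independent_increments:
      "\<And>(n::nat) (u::nat \<Rightarrow> real). 0 \<le> u 0 \<Longrightarrow> mono u \<Longrightarrow>
         indep_vars (\<lambda>_. borel) (\<lambda>i \<omega>. X (u (Suc i)) \<omega> - X (u i) \<omega>) {..<n}"
    and stationary_increments:
      "\<And>s t. 0 \<le> s \<Longrightarrow> s \<le> t \<Longrightarrow>
         distr M borel (\<lambda>\<omega>. X t \<omega> - X s \<omega>) = distr M borel (X (t - s))"
    and cadlag_paths: "AE \<omega> in M. cadlag (\<lambda>t. X t \<omega>)"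

definition subordinator :: "'w measure \<Rightarrow> (real \<Rightarrow> 'w \<Rightarrow> real) \<Rightarrow> bool" where
  "subordinator M S \<longleftrightarrow> levy_process M S \<and> (AE \<omega> in M. mono_on {0..} (\<lambda>t. S t \<omega>))"

locale spectrally_negative_levy_process = levy_process M X
  for M :: "'w measure" and X :: "real \<Rightarrow> 'w \<Rightarrow> real" +
  assumes no_positive_jumps_paths: "AE \<omega> in M. no_positive_jumps (\<lambda>t. X t \<omega>)"
    and not_negative_subordinator: "\<not> subordinator M (\<lambda>t \<omega>. - X t \<omega>)"

definition laplace_exponent :: "'w measure \<Rightarrow> (real \<Rightarrow> 'w \<Rightarrow> real) \<Rightarrow> real \<Rightarrow> real" where
  "laplace_exponent M X \<theta> = ln (LINT \<omega>|M. exp (\<theta> * X 1 \<omega>))"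

text \<open>A Levy measure on the negative half-line, as a Borel measure on the line without mass
  on the nonnegative numbers.\<close>

definition negative_levy_measure :: "real measure \<Rightarrow> bool" where
  "negative_levy_measure \<nu> \<longleftrightarrow>
     sets \<nu> = sets borel \<and> emeasure \<nu> {0..} = 0 \<and>
     (\<integral>\<^sup>+ x. ennreal (min 1 (x\<^sup>2)) \<partial>\<nu>) < \<infinity>"

definition levy_khintchine_exponent :: "real \<Rightarrow> real \<Rightarrow> real measure \<Rightarrow> real \<Rightarrow> real" where
  "levy_khintchine_exponent \<gamma> \<sigma> \<nu> \<theta> =
     \<gamma> * \<theta> + \<sigma>\<^sup>2 / 2 * \<theta>\<^sup>2
     + (LINT x|\<nu>. exp (\<theta> * x) - 1 - \<theta> * x * indicator {-1<..} x)"

definition has_levy_triplet ::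
  "'w measure \<Rightarrow> (real \<Rightarrow> 'w \<Rightarrow> real) \<Rightarrow> real \<Rightarrow> real \<Rightarrow> real measure \<Rightarrow> bool" where
  "has_levy_triplet M X \<gamma> \<sigma> \<nu> \<longleftrightarrow>
     0 \<le> \<sigma> \<and> negative_levy_measure \<nu> \<and>
     (\<forall>\<theta>\<ge>0. laplace_exponent M X \<theta> = levy_khintchine_exponent \<gamma> \<sigma> \<nu> \<theta>)"

definition bounded_variation_on :: "(real \<Rightarrow> real) \<Rightarrow> real \<Rightarrow> real \<Rightarrow> bool" where
  "bounded_variation_on f s t \<longleftrightarrow>
     (\<exists>B. \<forall>(n::nat) (u::nat \<Rightarrow> real). mono u \<longrightarrow> range u \<subseteq> {s..t} \<longrightarrow>
        (\<Sum>i<n. \<bar>f (u (Suc i)) - f (u i)\<bar>) \<le> B)"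

definition bounded_variation_paths :: "'w measure \<Rightarrow> (real \<Rightarrow> 'w \<Rightarrow> real) \<Rightarrow> bool" where
  "bounded_variation_paths M X \<longleftrightarrow>
     (AE \<omega> in M. \<forall>t\<ge>0. bounded_variation_on (\<lambda>s. X s \<omega>) 0 t)"

text \<open>The number \<open>c\<close> in the decomposition \<open>X\<^sub>t = X\<^sub>0 + c t - S\<^sub>t\<close> of a process with paths of
  bounded variation.\<close>

definition bv_drift :: "real \<Rightarrow> real measure \<Rightarrow> real" where
  "bv_drift \<gamma> \<nu> = \<gamma> - (LINT x:{-1<..<0}|\<nu>. x)"


section \<open>The refracted-reflected process\<close>

text \<open>The infimum of the times strictly after \<open>s\<close> at which \<open>Q\<close> holds, \<open>\<infinity>\<close> if there are none.\<close>

definition first_time_after :: "real \<Rightarrow> (real \<Rightarrow> bool) \<Rightarrow> ereal" where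
  "first_time_after s Q = (INF t\<in>{t. s < t \<and> Q t}. ereal t)"

text \<open>
  The equation \<open>dA\<^sub>t = dX\<^sub>t - \<delta> 1{A\<^sub>t > b} dt\<close>, \<open>A\<^sub>s = y\<close>, contains no stochastic integral and is
  read as an integral equation along a path \<open>\<xi>\<close> of \<open>X\<close>. For \<open>\<delta> \<ge> 0\<close> two solutions \<open>A\<close>, \<open>A'\<close> along the
  same path coincide on \<open>{s..}\<close>, since \<open>(A - A')\<^sup>2\<close> is nonincreasing; so the solution is a
  function of the path, and it is not necessary to ask for adaptedness.
\<close>

definition refracted_solution ::
  "real \<Rightarrow> real \<Rightarrow> (real \<Rightarrow> real) \<Rightarrow> real \<Rightarrow> real \<Rightarrow> (real \<Rightarrow> real) \<Rightarrow> bool" where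
  "refracted_solution \<delta> b \<xi> s y A \<longleftrightarrow>
     (\<forall>t\<ge>s. set_integrable lborel {s..t} (\<lambda>u. indicator {b<..} (A u) :: real) \<and>
            A t = y + (\<xi> t - \<xi> s) - \<delta> * (LINT u:{s..t}|lborel. indicator {b<..} (A u)))"

definition reflected_path :: "(real \<Rightarrow> real) \<Rightarrow> real \<Rightarrow> real \<Rightarrow> real" where
  "reflected_path \<xi> s t = (\<xi> t - \<xi> s) + (SUP u\<in>{s..t}. max (- (\<xi> u - \<xi> s)) 0)"

text \<open>
  \<open>enters_step1 \<delta> b \<xi> s y\<close>: the construction along the path \<open>\<xi>\<close> enters Step 1 (refraction) at
  time \<open>s\<close> and level \<open>y\<close>. \<open>enters_step2 \<delta> b \<xi> s\<close>: it enters Step 2 (reflection) at time \<open>s\<close>.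
  The first two rules are Step 0, the initial level being \<open>\<xi> 0\<close>.
\<close>

inductive enters_step1 :: "real \<Rightarrow> real \<Rightarrow> (real \<Rightarrow> real) \<Rightarrow> real \<Rightarrow> real \<Rightarrow> bool"
  and enters_step2 :: "real \<Rightarrow> real \<Rightarrow> (real \<Rightarrow> real) \<Rightarrow> real \<Rightarrow> bool"
  for \<delta> b :: real and \<xi> :: "real \<Rightarrow> real" where
  start_step1: "0 \<le> \<xi> 0 \<Longrightarrow> enters_step1 \<delta> b \<xi> 0 (\<xi> 0)"
| start_step2: "\<xi> 0 < 0 \<Longrightarrow> enters_step2 \<delta> b \<xi> 0"
| step1_to_step2:
    "enters_step1 \<delta> b \<xi> s y \<Longrightarrow> refracted_solution \<delta> b \<xi> s y A \<Longrightarrow>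
     first_time_after s (\<lambda>t. A t < 0) = ereal r \<Longrightarrow> enters_step2 \<delta> b \<xi> r"
| step2_to_step1:
    "enters_step2 \<delta> b \<xi> s \<Longrightarrow>
     first_time_after s (\<lambda>t. reflected_path \<xi> s t > b) = ereal r \<Longrightarrow> enters_step1 \<delta> b \<xi> r b"

definition refracted_reflected_path ::
  "real \<Rightarrow> real \<Rightarrow> (real \<Rightarrow> real) \<Rightarrow> (real \<Rightarrow> real) \<Rightarrow> bool" where
  "refracted_reflected_path \<delta> b \<xi> v \<longleftrightarrow>
     (\<forall>s y. enters_step1 \<delta> b \<xi> s y \<longrightarrow>
        (\<exists>A. refracted_solution \<delta> b \<xi> s y A \<and>
           (\<forall>t\<ge>s. ereal t < first_time_after s (\<lambda>t. A t < 0) \<longrightarrow> v t = A t))) \<and>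
     (\<forall>s. enters_step2 \<delta> b \<xi> s \<longrightarrow>
        (\<forall>t\<ge>s. ereal t < first_time_after s (\<lambda>t. reflected_path \<xi> s t > b) \<longrightarrow>
           v t = reflected_path \<xi> s t))"

text \<open>\<open>V\<close> is the refracted-reflected process driven by \<open>x + X\<close>, that is, by \<open>X\<close> under the law
  with starting point \<open>x\<close>.\<close>

definition refracted_reflected_process ::
  "'w measure \<Rightarrow> (real \<Rightarrow> 'w \<Rightarrow> real) \<Rightarrow> real \<Rightarrow> real \<Rightarrow> real \<Rightarrow> (real \<Rightarrow> 'w \<Rightarrow> real) \<Rightarrow> bool" where
  "refracted_reflected_process M X \<delta> b x V \<longleftrightarrow>
     (AE \<omega> in M. refracted_reflected_path \<delta> b (\<lambda>t. x + X t \<omega>) (\<lambda>t. V t \<omega>))"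

definition passage_above :: "real \<Rightarrow> (real \<Rightarrow> real) \<Rightarrow> ereal" where
  "passage_above a v = first_time_after 0 (\<lambda>t. v t > a)"

definition occupation_time :: "real set \<Rightarrow> real \<Rightarrow> (real \<Rightarrow> real) \<Rightarrow> real" where
  "occupation_time B T v = (LINT s:{0..T}|lborel. indicator B (v s))"

text \<open>The value chosen on \<open>T = \<infinity>\<close> is irrelevant: in the setting considered this is a null event.\<close>

definition passage_functional :: "real \<Rightarrow> real \<Rightarrow> real set \<Rightarrow> real \<Rightarrow> (real \<Rightarrow> real) \<Rightarrow> real" where
  "passage_functional p q B a v =
     (let T = passage_above a v in
      if T = \<infinity> then 0
      else exp (- p * real_of_ereal T - q * occupation_time B (real_of_ereal T) v))"

text \<open>
  The process \<open>V\<close> is determined by \<open>X\<close> only up to a null set, on which it is arbitrary, so a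
  functional of its path is in general measurable only with respect to the completion of \<open>M\<close>.
  The expectation is therefore taken under the completed measure.
\<close>

definition passage_expectation ::
  "'w measure \<Rightarrow> (real \<Rightarrow> 'w \<Rightarrow> real) \<Rightarrow> real \<Rightarrow> real \<Rightarrow> real set \<Rightarrow> real \<Rightarrow> real" where
  "passage_expectation M V p q B a =
     (LINT \<omega>|completion M. passage_functional p q B a (\<lambda>t. V t \<omega>))"


section \<open>Scale functions\<close>

definition right_inverse :: "(real \<Rightarrow> real) \<Rightarrow> real \<Rightarrow> real" where
  "right_inverse \<psi> q = Sup {l. 0 \<le> l \<and> \<psi> l = q}"

definition is_scale_function :: "(real \<Rightarrow> real) \<Rightarrow> real \<Rightarrow> (real \<Rightarrow> real) \<Rightarrow> bool" where
  "is_scale_function \<psi> q W \<longleftrightarrow>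
     (\<forall>x<0. W x = 0) \<and> continuous_on {0..} W \<and> mono_on {0..} W \<and>
     (\<forall>\<theta> > right_inverse \<psi> q.
        set_integrable lborel {0..} (\<lambda>x. exp (- \<theta> * x) * W x) \<and>
        (LINT x:{0..}|lborel. exp (- \<theta> * x) * W x) = 1 / (\<psi> \<theta> - q))"

text \<open>Below, \<open>W\<close> and \<open>WY\<close> are families of functions indexed by the killing rate.\<close>

definition W_bar :: "(real \<Rightarrow> real \<Rightarrow> real) \<Rightarrow> real \<Rightarrow> real \<Rightarrow> real" where
  "W_bar W q x = (LBINT y=ereal 0..ereal x. W q y)"

definition Z_scale :: "(real \<Rightarrow> real \<Rightarrow> real) \<Rightarrow> real \<Rightarrow> real \<Rightarrow> real" where
  "Z_scale W q x = 1 + q * W_bar W q x"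

definition R_fun ::
  "(real \<Rightarrow> real \<Rightarrow> real) \<Rightarrow> (real \<Rightarrow> real \<Rightarrow> real) \<Rightarrow> real \<Rightarrow> real \<Rightarrow> real \<Rightarrow> real \<Rightarrow> real \<Rightarrow> real" where
  "R_fun W WY \<delta> b p q x =
     Z_scale W (p + q) x - q * W_bar WY p (x - b)
     - (p + q) * (LINT y:{b..x}|lborel.
         WY p (x - y) * (q * W_bar W (p + q) y - \<delta> * W (p + q) y))"

definition L_fun ::
  "(real \<Rightarrow> real \<Rightarrow> real) \<Rightarrow> (real \<Rightarrow> real \<Rightarrow> real) \<Rightarrow> real \<Rightarrow> real \<Rightarrow> real \<Rightarrow> real \<Rightarrow> real \<Rightarrow> real" where
  "L_fun W WY \<delta> b p q x = R_fun W WY \<delta> b (p + q) (- q) x"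

end

theory Submission
 imports Defs "HOL-Real_Asymp.Real_Asymp"
begin

text \<open>Replace the path by the Euler chain of mesh 1/n driven by the increments of X: reflected at 0, with drift
 -\<delta> above b. The process enters the proof only through two inequalities that hold between any two times
 (rr_between) and force the chain to converge to V at almost every time. On the analytic side, the convolution
 form of the function R turns into a Laplace transform identity, and by uniqueness of Laplace transforms the
 generator of X maps the primitive of R to an explicit function. Hence the difference quotient of this
 primitive, a C^1 mollification of R, is annihilated by the discounted generator of V except near 0 and b.
 Summing along the chain stopped above a level just over a gives R(x) = R(a) E[discount] up to errors that are
 controlled by estimates for the time spent near 0 and b, the exit time and the overshoot. Letting the mesh
 tend to 0 sandwiches the discount at the passage time. The same estimates show that V spends no time at b, so
 the second identity is the first one with (p + q, -q) in place of (p, q).\<close>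

text \<open>\<open>R_fun\<close> is only locally Lipschitz: its slope may jump at 0 and at
  \<open>b\<close>, so no generator acts on it directly. The difference quotient of a primitive is
  C^1 but leaves a defect on windows of length h to the right of 0 and of \<open>b\<close>. As
  \<open>RQ\<close> is locally Lipschitz, the defect stays bounded when h tends to 0, so it suffices
  that little time is spent in small windows. There the condition \<delta> < c enters, in the form
  \<delta> W(0) < 1: the bump that measures the time near a level loses at most the fraction
  \<delta> W(0) to the refraction drift. The chain is a Borel function of finitely many independent
  increments, so conditioning on its past reduces to Fubini's theorem, whereas V is specified path
  by path and only almost surely. The price is a drift that jumps at \<open>b\<close>, for which the
  error is controlled by monotonicity on either side. In the limit Fatou's lemma bounds the mean of
  the discount factor Z from above, and also that of 1 - Z. The two bounds add up to 1, so both are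
  attained, and Z is seen to be measurable for the completion.\<close>

abbreviation (in prob_space) mean :: "('a \<Rightarrow> real) \<Rightarrow> real" (binder "EE " 10) where
 "mean \<equiv> expectation"

abbreviation eventually_seq :: "(nat \<Rightarrow> bool) \<Rightarrow> bool" (binder "EV " 10) where
 "EV n. P n \<equiv> eventually P sequentially"

section \<open>Integrals over adjacent intervals; oscillation of cadlag paths without upward
  jumps\<close>

lemma set_integral_split:
 fixes f :: "real => real"
 assumes "s <= v" "v <= u"
  and "set_integrable lborel {s..v} f" "set_integrable lborel {v..u} f"
 shows "set_integrable lborel {s..u} f"
  and "(LINT w:{s..u}|lborel. f w) = (LINT w:{s..v}|lborel. f w) + (LINT w:{v..u}|lborel. f w)"
proof -
 have e: "{s..u} = {s..v} \<union> {v..u}" using assms by auto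
 show "set_integrable lborel {s..u} f" unfolding e using assms by (intro set_integrable_Un) auto
 have "AE x in lborel. x \<noteq> v" by (rule AE_lborel_singleton)
 hence "AE x in lborel. \<not> (x \<in> {s..v} \<and> x \<in> {v..u})" by eventually_elim auto
 thus "(LINT w:{s..u}|lborel. f w) = (LINT w:{s..v}|lborel. f w) + (LINT w:{v..u}|lborel. f w)"
  unfolding e using assms by (intro set_integral_Un_AE) auto
qed

lemma set_integral_endpoint:
 fixes f g :: "real => real"
 assumes "\<And>w. s <= w ==> w < u ==> f w = g w"
 shows "set_integrable lborel {s..u} f \<longleftrightarrow> set_integrable lborel {s..u} g"
  and "(LINT w:{s..u}|lborel. f w) = (LINT w:{s..u}|lborel. g w)"
proof -
 have "indicator {s..u} w *\<^sub>R f w = indicator {s..u} w *\<^sub>R g w" if "w \<notin> {u}" for w using assms[of w] that by (cases "w \<in> {s..u}") auto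
 thus "set_integrable lborel {s..u} f \<longleftrightarrow> set_integrable lborel {s..u} g"
  and "(LINT w:{s..u}|lborel. f w) = (LINT w:{s..u}|lborel. g w)" unfolding set_integrable_def set_lebesgue_integral_def
  by (intro integrable_discrete_difference[where X="{u}"] integral_discrete_difference[where X="{u}"]; simp)+
qed

text \<open>Near a point the path varies by less than \<open>\<eta>/2\<close> about its limit on
  either side; across the point its jump is added, and this jump is downward, so upward increments
  stay below \<eta>. A Lebesgue number of a finite subcover gives \<open>h\<close>, and
  \<open>C\<close> consists of the centres of the subcover, the only places where a jump larger than
  \<eta> can sit.\<close>

lemma cadlag_modulus:
 fixes f :: "real => real"
 assumes f: "cadlag f" and np: "no_positive_jumps f" and "0 < \<eta>"
 obtains h C where "0 < h" "finite C"
  "\<And>s u. 0 <= s ==> s <= u ==> u <= t ==> u - s < h ==> f u - f s < \<eta>"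
  "\<And>s u. 0 <= s ==> s <= u ==> u <= t ==> u - s < h ==> {s<..u} \<inter> C = {} ==> \<bar>f u - f s\<bar> < \<eta>"
proof -
 have "\<exists>r>0. \<forall>s u. 0 <= s --> s <= u --> s \<in> ball c r --> u \<in> ball c r -->
   f u - f s < \<eta> \<and> (c \<notin> {s<..u} --> \<bar>f u - f s\<bar> < \<eta>)" if c: "c \<in> {0..t}" for c
 proof -
  have "(f \<longlongrightarrow> f c) (at_right c)" using f c by (auto simp: cadlag_def)
  hence "eventually (\<lambda>u. dist (f u) (f c) < \<eta>/2) (at_right c)" using half_gt_zero[OF `0 < \<eta>`] unfolding tendsto_iff by blast
  then obtain r1 where r1: "r1 > c" "\<And>u. c < u ==> u < r1 ==> dist (f u) (f c) < \<eta>/2" unfolding eventually_at_right_field by auto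
  have R: "\<bar>f u - f c\<bar> < \<eta>/2" if "c <= u" "u < r1" for u using r1(2)[of u] that `0 < \<eta>` by (cases "u = c") (auto simp: dist_real_def)
  \<comment> \<open>Time 0 has no left limit; there \<open>0 <= u\<close> and \<open>u < c\<close>
    exclude each other and dummy values serve.\<close>
  obtain l r2 where r2: "r2 < c" "f c <= l" "\<And>u. r2 < u ==> u < c ==> 0 <= u ==> \<bar>f u - l\<bar> < \<eta>/2"
  proof (cases "c = 0")
   case True
   thus ?thesis using that[of "-1" "f c"] by auto
  next
   case False
   hence "c > 0" using c by auto
   then obtain l where l: "(f \<longlongrightarrow> l) (at_left c)" using f by (auto simp: cadlag_def)
   hence "f c <= l" using np `c > 0` by (auto simp: no_positive_jumps_def)
   have "eventually (\<lambda>u. dist (f u) l < \<eta>/2) (at_left c)" using half_gt_zero[OF `0 < \<eta>`] l unfolding tendsto_iff by blast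
   then obtain r2 where "r2 < c" "\<And>u. r2 < u ==> u < c ==> dist (f u) l < \<eta>/2" unfolding eventually_at_left_field by auto
   thus ?thesis using that[of r2 l] `f c <= l` by (auto simp: dist_real_def)
  qed
  show ?thesis
  proof (intro exI[of _ "min (r1 - c) (c - r2)"] conjI allI impI)
   show "0 < min (r1 - c) (c - r2)" using r1 r2 by auto
  next
   fix s u
   assume a: "0 <= s" "s <= u" "s \<in> ball c (min (r1 - c) (c - r2))" "u \<in> ball c (min (r1 - c) (c - r2))"
   hence b: "r2 < s" "u < r1" by (auto simp: dist_real_def)
   show "f u - f s < \<eta>"
   proof (cases "c <= s")
    case True
    thus ?thesis using R[of s] R[of u] a b by (smt (verit) field_sum_of_halves)
   next
    case s: False
    show ?thesis
    proof (cases "c <= u")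
     case True
     thus ?thesis using R[of u] r2(2) r2(3)[of s] a b s unfolding abs_if by (smt (verit) field_sum_of_halves)
    next
     case False
     thus ?thesis using r2(3)[of s] r2(3)[of u] a b s unfolding abs_if by (smt (verit) field_sum_of_halves)
    qed
   qed
   show "\<bar>f u - f s\<bar> < \<eta>" if "c \<notin> {s<..u}"
   proof (cases "c <= s")
    case True
    thus ?thesis using R[of s] R[of u] a b by (smt (verit) field_sum_of_halves)
   next
    case False
    thus ?thesis using r2(3)[of s] r2(3)[of u] a b that unfolding abs_if by (smt (verit) field_sum_of_halves greaterThanAtMost_iff)
   qed
  qed
 qed
 then obtain r where r: "\<And>c. c \<in> {0..t} ==> 0 < r c"
  and P: "\<And>c s u. c \<in> {0..t} ==> 0 <= s ==> s <= u ==> s \<in> ball c (r c) ==> u \<in> ball c (r c) ==>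
   f u - f s < \<eta> \<and> (c \<notin> {s<..u} --> \<bar>f u - f s\<bar> < \<eta>)" by metis
 have "{0..t} \<subseteq> (\<Union>c\<in>{0..t}. ball c (r c))" using r by auto
 then obtain C where C: "C \<subseteq> {0..t}" "finite C" "{0..t} \<subseteq> (\<Union>c\<in>C. ball c (r c))" by (rule compactE_image[OF compact_Icc, rotated]) auto
 obtain h where h: "0 < h" "\<And>x. x \<in> {0..t} ==> \<exists>G\<in>(\<lambda>c. ball c (r c)) ` C. ball x h \<subseteq> G"
  by (rule Heine_Borel_lemma[OF compact_Icc, of 0 t "(\<lambda>c. ball c (r c)) ` C"]) (use C in auto)
 have "f u - f s < \<eta> \<and> ({s<..u} \<inter> C = {} --> \<bar>f u - f s\<bar> < \<eta>)"
  if "0 <= s" "s <= u" "u <= t" "u - s < h" for s u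
 proof -
  have "s \<in> {0..t}" using that by auto
  then obtain c where c: "c \<in> C" "ball s h \<subseteq> ball c (r c)" using h(2)[of s] by auto
  have "s \<in> ball c (r c)" "u \<in> ball c (r c)" using c(2) that `0 < h` by (auto simp: subset_eq dist_real_def)
  thus ?thesis using P[of c s u] c C that by blast
 qed
 thus ?thesis using that[of h C] h(1) C(2) by blast
qed

text \<open>Makes the supremum in \<open>reflected_path\<close> range over a bounded set, where
  \<open>SUP\<close> has its usual meaning.\<close>

lemma cadlag_bounded:
 assumes "cadlag f" "no_positive_jumps f"
 obtains B where "\<forall>s\<in>{0..t}. \<bar>f s\<bar> <= B"
proof -
 have loc: "\<exists>r>0. \<exists>B. \<forall>s. 0 <= s --> s \<in> ball c r --> \<bar>f s\<bar> <= B" if c: "c \<in> {0..t}" for c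
 proof -
  have "(f \<longlongrightarrow> f c) (at_right c)" using assms c by (auto simp: cadlag_def)
  hence "eventually (\<lambda>u. dist (f u) (f c) < 1) (at_right c)" unfolding tendsto_iff using zero_less_one by blast
  then obtain r1 where r1: "r1 > c" "\<And>u. c < u ==> u < r1 ==> dist (f u) (f c) < 1" unfolding eventually_at_right_field by auto
  obtain l r2 where r2: "r2 < c" "\<And>u. r2 < u ==> u < c ==> 0 <= u ==> \<bar>f u - l\<bar> < 1"
  proof (cases "c = 0")
   case True
   thus ?thesis using that[of "-1" 0] by auto
  next
   case False
   hence "c > 0" using c by auto
   then obtain l where l: "(f \<longlongrightarrow> l) (at_left c)" using assms by (auto simp: cadlag_def)
   have "eventually (\<lambda>u. dist (f u) l < 1) (at_left c)" using l unfolding tendsto_iff using zero_less_one by blast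
   then obtain r2 where "r2 < c" "\<And>u. r2 < u ==> u < c ==> dist (f u) l < 1" unfolding eventually_at_left_field by auto
   thus ?thesis using that[of r2 l] by (auto simp: dist_real_def)
  qed
  have "\<bar>f s\<bar> <= \<bar>f c\<bar> + \<bar>l\<bar> + 1" if "0 <= s" "s \<in> ball c (min (r1 - c) (c - r2))" for s using r1(2)[of s] r2(2)[of s] that
   by (cases s c rule: linorder_cases) (auto simp: dist_real_def)
  thus ?thesis using r1 r2 by (intro exI[of _ "min (r1 - c) (c - r2)"]) auto
 qed
 then obtain r B where r: "\<And>c. c \<in> {0..t} ==> 0 < r c"
  and P: "\<And>c s. c \<in> {0..t} ==> 0 <= s ==> s \<in> ball c (r c) ==> \<bar>f s\<bar> <= B c" by metis
 have "{0..t} \<subseteq> (\<Union>c\<in>{0..t}. ball c (r c))" using r by auto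
 then obtain C where C: "C \<subseteq> {0..t}" "finite C" "{0..t} \<subseteq> (\<Union>c\<in>C. ball c (r c))" by (rule compactE_image[OF compact_Icc, rotated]) auto
 show ?thesis
 proof (rule that[of "\<Sum>c\<in>C. \<bar>B c\<bar>"], rule ballI)
  fix s assume s: "s \<in> {0..t}"
  then obtain c where c: "c \<in> C" "s \<in> ball c (r c)" using C(3) by fastforce
  hence "\<bar>f s\<bar> <= B c" using P[of c s] C(1) s by auto
  also have "\<dots> <= \<bar>B c\<bar>" by simp
  also have "\<dots> <= (\<Sum>c\<in>C. \<bar>B c\<bar>)" using c C(2) by (intro member_le_sum) auto
  finally show "\<bar>f s\<bar> <= (\<Sum>c\<in>C. \<bar>B c\<bar>)" .
 qed
qed

subsection \<open>Refracted-reflected paths\<close>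

definition time_above :: "real => (real => real) => real => real => real" where
 "time_above b v s u = (LINT w:{s..u}|lborel. indicator {b<..} (v w))"

text \<open>The lower bound is the refracted increment, the upper one its reflection. Both hold in Step 1 and in Step 2
 and compose, so that the cycle structure of V is no longer needed once they are proved.\<close>

definition rr_between :: "real => real => (real => real) => (real => real) => real => real => bool" where
 "rr_between \<delta> b \<xi> v s u \<longleftrightarrow>
   0 <= v u \<and> set_integrable lborel {s..u} (\<lambda>w. indicator {b<..} (v w) :: real) \<and>
   v s + (\<xi> u - \<xi> s) - \<delta> * time_above b v s u <= v u \<and>
   (\<forall>C. (\<forall>w\<in>{s..u}. \<xi> u - \<xi> w <= C) -->
    v u <= max (v s + (\<xi> u - \<xi> s) - \<delta> * time_above b v s u) C)"

lemma time_above_nonneg: "0 <= time_above b v s u"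
 unfolding time_above_def set_lebesgue_integral_def by (intro Bochner_Integration.integral_nonneg) auto

lemma time_above_le:
 assumes "s <= u"
 shows "time_above b v s u <= u - s"
proof -
 have "time_above b v s u <= (LINT w|lborel. indicator {s..u} w)" unfolding time_above_def set_lebesgue_integral_def
 proof (rule integral_mono')
  show "integrable lborel (indicator {s..u} :: real => real)" by (intro integrable_real_indicator) (auto simp: emeasure_lborel_Icc_eq)
 qed (auto simp: indicator_def)
 thus ?thesis using assms by simp
qed

lemma time_above_eq_0:
 assumes "\<And>w. s <= w ==> w < u ==> v w <= b"
 shows "time_above b v s u = 0" "set_integrable lborel {s..u} (\<lambda>w. indicator {b<..} (v w) :: real)"
proof -
 have e: "(indicator {b<..} (v w) :: real) = 0" if "s <= w" "w < u" for w using assms[OF that] by auto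
 show "time_above b v s u = 0" unfolding time_above_def by (subst set_integral_endpoint(2)[OF e]) (auto simp: set_lebesgue_integral_def)
 show "set_integrable lborel {s..u} (\<lambda>w. indicator {b<..} (v w) :: real)" by (subst set_integral_endpoint(1)[OF e]) (auto simp: set_integrable_def)
qed

lemma time_above_eq_length:
 assumes "s <= u" "\<And>w. s <= w ==> w < u ==> b < v w"
 shows "time_above b v s u = u - s"
proof -
 have e: "(indicator {b<..} (v w) :: real) = 1" if "s <= w" "w < u" for w using assms(2)[OF that] by auto
 show ?thesis unfolding time_above_def using assms(1) by (subst set_integral_endpoint(2)[OF e]) (auto simp: set_lebesgue_integral_def)
qed

lemma rr_between_refl: "0 <= v s ==> rr_between \<delta> b \<xi> v s s" using time_above_eq_0[of s s v b] by (auto simp: rr_between_def)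

text \<open>The upper bound is stated for every bound \<open>C\<close> on the increments up to the
  endpoint. Subtracting the increment over \<open>{r..u}\<close> from \<open>C\<close> gives an
  admissible bound for \<open>{s..r}\<close>, and as the time above \<open>b\<close> is additive the
  two halves compose.\<close>

lemma rr_between_trans:
 assumes "0 <= \<delta>" "s <= r" "r <= u" and sr: "rr_between \<delta> b \<xi> v s r" and ru: "rr_between \<delta> b \<xi> v r u"
 shows "rr_between \<delta> b \<xi> v s u"
proof -
 have i: "set_integrable lborel {s..u} (\<lambda>w. indicator {b<..} (v w) :: real)"
  and t: "time_above b v s u = time_above b v s r + time_above b v r u" using set_integral_split[of s r u "\<lambda>w. indicator {b<..} (v w) :: real"] assms
  by (auto simp: rr_between_def time_above_def)
 have "v u <= max (v s + (\<xi> u - \<xi> s) - \<delta> * time_above b v s u) C"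
  if C: "\<forall>w\<in>{s..u}. \<xi> u - \<xi> w <= C" for C
 proof -
  have "\<forall>w\<in>{s..r}. \<xi> r - \<xi> w <= C - (\<xi> u - \<xi> r)" using C assms by (auto simp: algebra_simps)
  hence 1: "v r <= max (v s + (\<xi> r - \<xi> s) - \<delta> * time_above b v s r) (C - (\<xi> u - \<xi> r))" using sr by (auto simp: rr_between_def)
  have 2: "v u <= max (v r + (\<xi> u - \<xi> r) - \<delta> * time_above b v r u) C" using ru C assms by (auto simp: rr_between_def)
  have "0 <= \<delta> * time_above b v r u" using assms time_above_nonneg by simp
  thus ?thesis using 1 2 unfolding t by (auto simp: max_def algebra_simps split: if_splits)
 qed
 thus ?thesis using i t sr ru by (auto simp: rr_between_def algebra_simps)
qed

text \<open>Two cases are allowed at the endpoint: the solution is still nonnegative, or it has come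
  down to 0 or below and Step 2 has already reset the path to 0. Each \<open>C\<close> in the upper
  bound is nonnegative because \<open>u\<close> itself is among the times compared.\<close>

lemma rr_between_refracted:
 assumes sol: "refracted_solution \<delta> b \<xi> s0 y A" and "s0 <= s" "s <= u" "0 <= v s"
  and eq: "\<And>w. s <= w ==> w < u ==> v w = A w"
  and u: "(v u = A u \<and> 0 <= A u) \<or> (v u = 0 \<and> A u <= 0)"
 shows "rr_between \<delta> b \<xi> v s u"
proof (cases "s = u")
 case True
 thus ?thesis using assms rr_between_refl by blast
next
 case False
 hence "s < u" using assms by auto
 have i: "set_integrable lborel {s..u} (\<lambda>w. indicator {b<..} (A w) :: real)" by (rule set_integrable_subset[where A="{s0..u}"])
   (use sol assms in "auto simp: refracted_solution_def")
 have i2: "set_integrable lborel {s0..s} (\<lambda>w. indicator {b<..} (A w) :: real)" using sol assms by (auto simp: refracted_solution_def)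
 have "A s = y + (\<xi> s - \<xi> s0) - \<delta> * (LINT w:{s0..s}|lborel. indicator {b<..} (A w))"
  "A u = y + (\<xi> u - \<xi> s0) - \<delta> * (LINT w:{s0..u}|lborel. indicator {b<..} (A w))" using sol `s0 <= s` `s <= u` unfolding refracted_solution_def by auto
 hence "A u - A s = \<xi> u - \<xi> s - \<delta> * (LINT w:{s..u}|lborel. indicator {b<..} (A w))"
  using set_integral_split(2)[OF `s0 <= s` `s <= u` i2 i] by (simp add: algebra_simps)
 moreover have "(LINT w:{s..u}|lborel. indicator {b<..} (A w)) = time_above b v s u"
  unfolding time_above_def by (rule set_integral_endpoint(2)) (simp add: eq)
 ultimately have A: "A u = v s + (\<xi> u - \<xi> s) - \<delta> * time_above b v s u" using eq[of s] `s < u` by simp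
 have j: "set_integrable lborel {s..u} (\<lambda>w. indicator {b<..} (v w) :: real)"
  using i set_integral_endpoint(1)[of s u "\<lambda>w. indicator {b<..} (A w)" "\<lambda>w. indicator {b<..} (v w)"] eq by simp
 have "v u <= max (A u) C" if "\<forall>w\<in>{s..u}. \<xi> u - \<xi> w <= C" for C
 proof -
  have "0 <= C" using bspec[OF that, of u] `s <= u` by simp
  thus ?thesis using u by auto
 qed
 thus ?thesis unfolding rr_between_def using A j u by auto
qed

lemma bdd_above_reflected:
 fixes \<xi> :: "real => real"
 assumes "\<forall>w\<in>{0..u}. \<bar>\<xi> w\<bar> <= B" "0 <= s"
 shows "bdd_above ((\<lambda>w. max (- (\<xi> w - \<xi> s)) 0) ` {s..u})"
proof -
 have "max (- (\<xi> w - \<xi> s)) 0 <= \<bar>\<xi> s\<bar> + B" if "w \<in> {s..u}" for w using bspec[OF assms(1), of w] bspec[OF assms(1), of s] that `0 <= s` by auto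
 thus ?thesis by (intro bdd_aboveI2[where M="\<bar>\<xi> s\<bar> + B"]) auto
qed

text \<open>The running supremum up to \<open>u\<close> comes either from times up to
  \<open>s\<close> or from later times; in the second case \<open>\<xi> u - \<xi> w <= C\<close>
  bounds the reflected value by \<open>C\<close>.\<close>

lemma reflected_path_between:
 fixes \<xi> :: "real => real"
 assumes B: "\<forall>w\<in>{0..u}. \<bar>\<xi> w\<bar> <= B" and "0 <= s0" "s0 <= s" "s <= u"
 shows "0 <= reflected_path \<xi> s0 u"
  and "reflected_path \<xi> s0 s + (\<xi> u - \<xi> s) <= reflected_path \<xi> s0 u"
  and "\<And>C. \<forall>w\<in>{s..u}. \<xi> u - \<xi> w <= C ==> reflected_path \<xi> s0 u <= max (reflected_path \<xi> s0 s + (\<xi> u - \<xi> s)) C"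
proof -
 let ?g = "\<lambda>w. max (- (\<xi> w - \<xi> s0)) 0"
 have bu: "bdd_above (?g ` {s0..u})" by (rule bdd_above_reflected) (use assms in auto)
 have bs: "bdd_above (?g ` {s0..s})" by (rule bdd_above_mono[OF bu]) (use assms in auto)
 have "?g u <= (SUP w\<in>{s0..u}. ?g w)" by (rule cSUP_upper[OF _ bu]) (use assms in auto)
 thus "0 <= reflected_path \<xi> s0 u" by (auto simp: reflected_path_def)
 have m: "(SUP w\<in>{s0..s}. ?g w) <= (SUP w\<in>{s0..u}. ?g w)" by (rule cSUP_subset_mono) (use assms bu in auto)
 thus "reflected_path \<xi> s0 s + (\<xi> u - \<xi> s) <= reflected_path \<xi> s0 u" by (auto simp: reflected_path_def)
 fix C assume C: "\<forall>w\<in>{s..u}. \<xi> u - \<xi> w <= C"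
 have "(SUP w\<in>{s0..u}. ?g w) <= max (SUP w\<in>{s0..s}. ?g w) (C - (\<xi> u - \<xi> s0))"
 proof (rule cSUP_least)
  show "{s0..u} \<noteq> {}" using assms by auto
  fix w assume w: "w \<in> {s0..u}"
  have s0: "?g s0 <= (SUP w\<in>{s0..s}. ?g w)" by (rule cSUP_upper[OF _ bs]) (use assms in auto)
  show "?g w <= max (SUP w\<in>{s0..s}. ?g w) (C - (\<xi> u - \<xi> s0))"
  proof (cases "w <= s")
   case True
   hence "?g w <= (SUP w\<in>{s0..s}. ?g w)" by (intro cSUP_upper[OF _ bs]) (use w in auto)
   thus ?thesis by linarith
  next
   case False
   hence "\<xi> u - \<xi> w <= C" using C w by auto
   thus ?thesis using s0 by (auto simp: max_def)
  qed
 qed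
 thus "reflected_path \<xi> s0 u <= max (reflected_path \<xi> s0 s + (\<xi> u - \<xi> s)) C" by (auto simp: reflected_path_def max_def split: if_splits)
qed

lemma rr_between_reflected:
 assumes B: "\<forall>w\<in>{0..u}. \<bar>\<xi> w\<bar> <= B" and "0 <= s0" "s0 <= s" "s <= u"
  and eq: "\<And>w. s <= w ==> w <= u ==> v w = reflected_path \<xi> s0 w"
  and le: "\<And>w. s <= w ==> w < u ==> reflected_path \<xi> s0 w <= b"
 shows "rr_between \<delta> b \<xi> v s u"
proof -
 have v: "v u = reflected_path \<xi> s0 u" "v s = reflected_path \<xi> s0 s" using eq `s <= u` by auto
 have vle: "v w <= b" if "s <= w" "w < u" for w using eq[of w] le[of w] that by simp
 have t: "time_above b v s u = 0" "set_integrable lborel {s..u} (\<lambda>w. indicator {b<..} (v w) :: real)"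
  by (rule time_above_eq_0, rule vle, assumption+)+
 note r = reflected_path_between[OF B `0 <= s0` `s0 <= s` `s <= u`]
 show ?thesis unfolding rr_between_def v t(1) mult_zero_right diff_zero by (intro conjI allI impI r t(2)) assumption+
qed

lemma reflected_path_self: "reflected_path \<xi> s s = 0" by (simp add: reflected_path_def)

lemma first_time_after_ge: "ereal s <= first_time_after s Q" unfolding first_time_after_def by (intro INF_greatest) auto

lemma not_before_first_time_after:
 assumes "s < t" "ereal t < first_time_after s Q"
 shows "\<not> Q t"
proof
 assume "Q t"
 hence "first_time_after s Q <= ereal t" unfolding first_time_after_def using assms by (intro INF_lower) auto
 thus False using assms by auto
qed

lemma first_time_after_approx:
 assumes "first_time_after s Q < e"
 shows "\<exists>t. s < t \<and> Q t \<and> ereal t < e" using assms unfolding first_time_after_def INF_less_iff by auto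

lemma first_time_after_approx_right:
 assumes "first_time_after s Q = ereal r" "0 < e"
 shows "\<exists>t. s < t \<and> r <= t \<and> t < r + e \<and> Q t"
proof -
 obtain t where t: "s < t" "Q t" "ereal t < ereal (r + e)" using first_time_after_approx[of s Q "ereal (r + e)"] assms by auto
 have "first_time_after s Q <= ereal t" unfolding first_time_after_def using t by (intro INF_lower) auto
 thus ?thesis using t assms by auto
qed

lemma cadlag_right:
 assumes "cadlag f" "0 <= r" "0 < e"
 obtains h where "0 < h" "\<And>t. r <= t ==> t < r + h ==> \<bar>f t - f r\<bar> < e"
proof -
 have "(f \<longlongrightarrow> f r) (at_right r)" using assms by (auto simp: cadlag_def)
 hence "eventually (\<lambda>u. dist (f u) (f r) < e) (at_right r)" using assms unfolding tendsto_iff by blast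
 then obtain r1 where "r1 > r" "\<And>u. r < u ==> u < r1 ==> dist (f u) (f r) < e" unfolding eventually_at_right_field by auto
 hence "\<bar>f t - f r\<bar> < e" if "r <= t" "t < r + (r1 - r)" for t using that `0 < e` by (cases "t = r") (auto simp: dist_real_def)
 thus ?thesis using that[of "r1 - r"] `r1 > r` by auto
qed

lemma refracted_solution_increment:
 assumes "refracted_solution \<delta> b \<xi> s y A" "0 <= \<delta>" "s <= r" "r <= t"
 shows "\<bar>A t - A r - (\<xi> t - \<xi> r)\<bar> <= \<delta> * (t - r)"
  and "A r - y - (\<xi> r - \<xi> s) \<in> {- (\<delta> * (r - s))..0}"
proof -
 have i: "set_integrable lborel {r..t} (\<lambda>w. indicator {b<..} (A w) :: real)" by (rule set_integrable_subset[where A="{s..t}"])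
   (use assms in "auto simp: refracted_solution_def")
 have i2: "set_integrable lborel {s..r} (\<lambda>w. indicator {b<..} (A w) :: real)" using assms by (auto simp: refracted_solution_def)
 have e: "A r = y + (\<xi> r - \<xi> s) - \<delta> * (LINT w:{s..r}|lborel. indicator {b<..} (A w))"
  "A t = y + (\<xi> t - \<xi> s) - \<delta> * (LINT w:{s..t}|lborel. indicator {b<..} (A w))" using assms unfolding refracted_solution_def by auto
 hence "A t - A r - (\<xi> t - \<xi> r) = - (\<delta> * time_above b A r t)"
  using set_integral_split(2)[OF `s <= r` `r <= t` i2 i] by (simp add: algebra_simps time_above_def)
 thus "\<bar>A t - A r - (\<xi> t - \<xi> r)\<bar> <= \<delta> * (t - r)" using time_above_nonneg[of b A r t] time_above_le[of r t b A] assms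
  by (simp add: abs_mult mult_left_mono)
 have "A r - y - (\<xi> r - \<xi> s) = - (\<delta> * time_above b A s r)" using e(1) by (simp add: time_above_def)
 thus "A r - y - (\<xi> r - \<xi> s) \<in> {- (\<delta> * (r - s))..0}" using time_above_nonneg[of b A s r] time_above_le[of s r b A] assms by (simp add: mult_left_mono)
qed

text \<open>Properties of one fixed path. Everything about V up to the convergence of the chain is
  deterministic and holds on the almost sure event where these assumptions are met.\<close>

locale rr_path =
 fixes \<delta> b :: real and \<xi> v :: "real => real"
 assumes cad: "cadlag \<xi>" and no_up: "no_positive_jumps \<xi>"
  and path: "refracted_reflected_path \<delta> b \<xi> v"
  and b_pos: "0 < b" and \<delta>_nonneg: "0 <= \<delta>"
begin

lemma refracted_right:
 assumes sol: "refracted_solution \<delta> b \<xi> s y A" and "0 <= s" "s <= r" "0 < e"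
 obtains h where "0 < h" "\<And>t. r <= t ==> t < r + h ==> \<bar>A t - A r\<bar> < e"
proof -
 obtain h where h: "0 < h" "\<And>t. r <= t ==> t < r + h ==> \<bar>\<xi> t - \<xi> r\<bar> < e/2" using cadlag_right[OF cad, of r "e/2"] assms by auto
 have "\<bar>A t - A r\<bar> < e" if t: "r <= t" "t < r + min h (e / (2 * (\<delta> + 1)))" for t
 proof -
  have "(\<delta> + 1) * (t - r) <= (\<delta> + 1) * (e / (2 * (\<delta> + 1)))" using t \<delta>_nonneg by (intro mult_left_mono) auto
  also have "\<dots> = e/2" using \<delta>_nonneg by (simp add: field_simps)
  finally have "\<delta> * (t - r) <= e/2" using t by (simp add: algebra_simps)
  moreover have "\<bar>\<xi> t - \<xi> r\<bar> < e/2" using h t by auto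
  moreover have "\<bar>A t - A r - (\<xi> t - \<xi> r)\<bar> <= \<delta> * (t - r)" using refracted_solution_increment[OF sol \<delta>_nonneg] assms t by auto
  ultimately show ?thesis by linarith
 qed
 moreover have "0 < min h (e / (2 * (\<delta> + 1)))" using h assms \<delta>_nonneg by (auto intro!: divide_pos_pos)
 ultimately show ?thesis using that by blast
qed

lemma reflected_right:
 assumes "0 <= s" "s <= r" "0 < e"
 obtains h where "0 < h" "\<And>t. r <= t ==> t < r + h ==> \<bar>reflected_path \<xi> s t - reflected_path \<xi> s r\<bar> < e"
proof -
 obtain h where h: "0 < h" "\<And>t. r <= t ==> t < r + h ==> \<bar>\<xi> t - \<xi> r\<bar> < e/4" using cadlag_right[OF cad, of r "e/4"] assms by auto
 have "\<bar>reflected_path \<xi> s t - reflected_path \<xi> s r\<bar> < e" if t: "r <= t" "t < r + h" for t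
 proof -
  obtain B where B: "\<forall>w\<in>{0..t}. \<bar>\<xi> w\<bar> <= B" using cadlag_bounded[OF cad no_up] by blast
  have "\<forall>w\<in>{r..t}. \<xi> t - \<xi> w <= e/2"
  proof
   fix w assume "w \<in> {r..t}"
   hence "\<bar>\<xi> w - \<xi> r\<bar> < e/4" "\<bar>\<xi> t - \<xi> r\<bar> < e/4" using h t by auto
   thus "\<xi> t - \<xi> w <= e/2" by linarith
  qed
  hence "reflected_path \<xi> s t <= max (reflected_path \<xi> s r + (\<xi> t - \<xi> r)) (e/2)" using reflected_path_between(3)[OF B] assms t by blast
  moreover have "reflected_path \<xi> s r + (\<xi> t - \<xi> r) <= reflected_path \<xi> s t" using reflected_path_between(2)[OF B] assms t by blast
  moreover have "- (e/4) < \<xi> t - \<xi> r" "\<xi> t - \<xi> r < e/4" using h(2)[of t] t by linarith+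
  moreover have "0 <= reflected_path \<xi> s r" using reflected_path_between(1)[of r \<xi> B s s] B assms t by auto
  ultimately show ?thesis using `0 < e` by (auto simp: abs_less_iff max_def split: if_splits)
 qed
 thus ?thesis using that h(1) by blast
qed

lemma first_reflected_gt:
 assumes "0 <= s"
 shows "ereal s < first_time_after s (\<lambda>t. b < reflected_path \<xi> s t)"
proof (rule ccontr)
 assume "\<not> ?thesis"
 hence e: "first_time_after s (\<lambda>t. b < reflected_path \<xi> s t) = ereal s" using first_time_after_ge[of s "\<lambda>t. b < reflected_path \<xi> s t"] by auto
 obtain h where h: "0 < h" "\<And>t. s <= t ==> t < s + h ==> \<bar>reflected_path \<xi> s t - reflected_path \<xi> s s\<bar> < b"
  using reflected_right[of s s b] assms b_pos by auto
 obtain t where "s <= t" "t < s + h" "b < reflected_path \<xi> s t" using first_time_after_approx_right[OF e h(1)] by auto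
 thus False using h(2)[of t] by (auto simp: reflected_path_self)
qed

lemma path_step1:
 assumes "enters_step1 \<delta> b \<xi> s y"
 shows "\<exists>A. refracted_solution \<delta> b \<xi> s y A \<and>
  (\<forall>t\<ge>s. ereal t < first_time_after s (\<lambda>t. A t < 0) --> v t = A t)"
 using conjunct1[OF path[unfolded refracted_reflected_path_def], THEN spec, THEN spec, THEN mp, OF assms] .

lemma path_step2:
 assumes "enters_step2 \<delta> b \<xi> s" "s <= t" "ereal t < first_time_after s (\<lambda>t. b < reflected_path \<xi> s t)"
 shows "v t = reflected_path \<xi> s t" using conjunct2[OF path[unfolded refracted_reflected_path_def], THEN spec, THEN mp, OF assms(1)]
  assms(2,3) by simp

lemma step2_start:
 assumes "enters_step2 \<delta> b \<xi> s" "0 <= s"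
 shows "v s = 0"
proof -
 have "v s = reflected_path \<xi> s s" using path_step2[OF assms(1) order_refl first_reflected_gt[OF assms(2)]] .
 thus ?thesis by (simp add: reflected_path_self)
qed

end

lemma cadlag_up_modulus:
 fixes f :: "real => real"
 assumes "cadlag f" "no_positive_jumps f" "0 < \<eta>"
 obtains h where "0 < h"
  "\<forall>s u. 0 <= s \<and> s <= u \<and> u <= t \<and> u - s < h --> f u - f s < \<eta>"
proof (rule cadlag_modulus[OF assms, of t])
 fix h C
 assume "0 < h" and *: "\<And>s u. 0 <= s ==> s <= u ==> u <= t ==> u - s < h ==> f u - f s < \<eta>"
 show thesis by (rule that[OF `0 < h`]) (simp add: *)
qed

text \<open>The driving path cancels in \<open>A - B\<close>, which is therefore Lipschitz. After
  the last time with \<open>A <= B\<close> the path \<open>A\<close> lies above \<open>B\<close>, so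
  it spends at least as much time above \<open>b\<close> and the difference cannot grow. Uniqueness
  matters because the rule \<open>step1_to_step2\<close> admits an arbitrary solution, while the
  path follows one solution whose existence alone is given.\<close>

lemma refracted_solution_unique_le:
 assumes A: "refracted_solution \<delta> b \<xi> s y A" and B: "refracted_solution \<delta> b \<xi> s y B"
  and "0 <= \<delta>" "s <= t"
 shows "A t <= B t"
proof (rule ccontr)
 assume neg: "\<not> A t <= B t"
 define D where "D = (\<lambda>u. A u - B u)"
 have iA: "set_integrable lborel {r..u} (\<lambda>w. indicator {b<..} (A w) :: real)"
  and iB: "set_integrable lborel {r..u} (\<lambda>w. indicator {b<..} (B w) :: real)"
  if "s <= r" "r <= u" for r u by (rule set_integrable_subset[where A="{s..u}"];
    use A B that in "auto simp: refracted_solution_def")+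
 have inc: "D u - D r = - (\<delta> * (LINT w:{r..u}|lborel. indicator {b<..} (A w) - indicator {b<..} (B w)))"
  if "s <= r" "r <= u" for r u
 proof -
  have "A u - A r = \<xi> u - \<xi> r - \<delta> * (LINT w:{r..u}|lborel. indicator {b<..} (A w))"
   if A: "refracted_solution \<delta> b \<xi> s y A"
    and i: "\<And>r u. s <= r ==> r <= u ==> set_integrable lborel {r..u} (\<lambda>w. indicator {b<..} (A w) :: real)" for A
  proof -
   have "A r = y + (\<xi> r - \<xi> s) - \<delta> * (LINT w:{s..r}|lborel. indicator {b<..} (A w))"
    "A u = y + (\<xi> u - \<xi> s) - \<delta> * (LINT w:{s..u}|lborel. indicator {b<..} (A w))" using A `s <= r` `r <= u` unfolding refracted_solution_def by auto
   thus ?thesis using set_integral_split(2)[OF `s <= r` `r <= u` i i] `s <= r` `r <= u` by (simp add: algebra_simps)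
  qed
  from this[OF A iA] this[OF B iB] show ?thesis unfolding set_integral_diff(2)[OF iA[OF that] iB[OF that]] D_def by (simp add: algebra_simps)
 qed
 have "\<bar>D u - D r\<bar> <= 2 * \<delta> * (u - r)" if "s <= r" "r <= u" for r u using refracted_solution_increment(1)[OF A `0 <= \<delta>` that]
   refracted_solution_increment(1)[OF B `0 <= \<delta>` that] by (simp add: D_def)
 note inc_le = this
 have lip: "dist (D u) (D r) <= 2 * \<delta> * dist u r" if "s <= r" "s <= u" for r u using inc_le[of r u] inc_le[of u r] that
  by (cases r u rule: le_cases) (simp_all add: dist_real_def abs_minus_commute)
 have "continuous_on {s..t} D" unfolding continuous_on_iff
 proof (intro ballI allI impI)
  fix r e :: real assume r: "r \<in> {s..t}" and "0 < e"
  show "\<exists>d>0. \<forall>u\<in>{s..t}. dist u r < d --> dist (D u) (D r) < e"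
  proof (intro exI[of _ "e / (2 * \<delta> + 1)"] conjI ballI impI)
   show "0 < e / (2 * \<delta> + 1)" using `0 < e` `0 <= \<delta>` by simp
   fix u assume u: "u \<in> {s..t}" "dist u r < e / (2 * \<delta> + 1)"
   have "2 * \<delta> * dist u r <= (2 * \<delta> + 1) * dist u r" by (simp add: algebra_simps)
   also have "\<dots> < e" using u `0 <= \<delta>` by (simp add: pos_less_divide_eq mult.commute)
   finally show "dist (D u) (D r) < e" using lip[of r u] r u by auto
  qed
 qed
 hence "closed (D -` {..0} \<inter> {s..t})" by (simp add: continuous_on_closed_vimage)
 from closed_Int_compact[OF this compact_Icc[of s t]]
 have "compact ({s..t} \<inter> D -` {..0})" by (simp add: Int_commute Int_left_commute)
 moreover have "s \<in> {s..t} \<inter> D -` {..0}" using refracted_solution_increment(2)[OF A `0 <= \<delta>` order_refl order_refl]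
   refracted_solution_increment(2)[OF B `0 <= \<delta>` order_refl order_refl] `s <= t` by (simp add: D_def)
 ultimately obtain r where r: "r \<in> {s..t} \<inter> D -` {..0}" "\<And>u. u \<in> {s..t} \<inter> D -` {..0} ==> u <= r"
  using compact_attains_sup[of "{s..t} \<inter> D -` {..0}"] by blast
 have pos: "0 < D u" if "r < u" "u <= t" for u using r(2)[of u] r(1) that by (auto simp: not_le[symmetric])
 have "0 <= (LINT w:{r..t}|lborel. indicator {b<..} (A w) - indicator {b<..} (B w) :: real)" unfolding set_lebesgue_integral_def
 proof (rule integral_nonneg_AE)
  have "AE w in lborel. w \<noteq> r" by (rule AE_lborel_singleton)
  thus "AE w in lborel. 0 <= indicator {r..t} w *\<^sub>R (indicator {b<..} (A w) - indicator {b<..} (B w) :: real)"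
  proof eventually_elim
   case (elim w)
   show ?case using pos[of w] elim by (auto simp: indicator_def D_def)
  qed
 qed
 hence "D t - D r <= 0" using inc[of r t] r(1) `0 <= \<delta>` by simp
 thus False using r(1) neg by (simp add: D_def)
qed

lemma refracted_solution_unique:
 assumes "refracted_solution \<delta> b \<xi> s y A" "refracted_solution \<delta> b \<xi> s y B" "0 <= \<delta>" "s <= t"
 shows "A t = B t" using refracted_solution_unique_le[OF assms] refracted_solution_unique_le[OF assms(2,1,3,4)] by simp

context rr_path
begin

text \<open>Without upward jumps the reflected path cannot jump across \<open>b\<close>: its value
  at the exit time is exactly \<open>b\<close>, the level at which Step 1 starts. The last claim
  presupposes \<open>v r = b\<close>, which becomes known only from the Step 1 that begins at
  \<open>r\<close>.\<close>

lemma step2_segment: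
 assumes e2: "enters_step2 \<delta> b \<xi> s" and "0 <= s"
 defines "F \<equiv> first_time_after s (\<lambda>t. b < reflected_path \<xi> s t)"
 shows "\<And>r. F = ereal r ==> s < r \<and> enters_step1 \<delta> b \<xi> r b \<and> reflected_path \<xi> s r = b"
  and "\<And>s' u. s <= s' ==> s' <= u ==> ereal u < F ==> rr_between \<delta> b \<xi> v s' u"
  and "\<And>r s'. F = ereal r ==> v r = b ==> s <= s' ==> s' <= r ==> rr_between \<delta> b \<xi> v s' r"
proof -
 have v: "v t = reflected_path \<xi> s t" if "s <= t" "ereal t < F" for t using path_step2[OF e2] that unfolding F_def by blast
 have le: "reflected_path \<xi> s t <= b" if "s <= t" "ereal t < F" for t
 proof (cases "s = t")
  case True
  thus ?thesis using b_pos reflected_path_self[of \<xi> s] by simp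
 next
  case False
  thus ?thesis using not_before_first_time_after[of s t "\<lambda>t. b < reflected_path \<xi> s t"] that unfolding F_def by simp
 qed
 have last: "s < r" "reflected_path \<xi> s r = b" if F: "F = ereal r" for r
 proof -
  show "s < r" using first_reflected_gt[OF `0 <= s`] F unfolding F_def by (metis less_ereal.simps(1))
  have "b <= reflected_path \<xi> s r"
  proof (rule ccontr)
   assume "\<not> ?thesis"
   then obtain h where h: "0 < h" "\<And>t. r <= t ==> t < r + h ==>
     \<bar>reflected_path \<xi> s t - reflected_path \<xi> s r\<bar> < b - reflected_path \<xi> s r"
    using reflected_right[of s r "b - reflected_path \<xi> s r"] `0 <= s` `s < r` by auto
   obtain t where "r <= t" "t < r + h" "b < reflected_path \<xi> s t" using first_time_after_approx_right[OF F[unfolded F_def] h(1)] by auto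
   thus False using h(2)[of t] by auto
  qed
  have le_e: "reflected_path \<xi> s r <= b + e" if "0 < e" for e
  proof -
   have me: "0 < min e b" using that b_pos by auto
   obtain h where h: "0 < h"
     "\<forall>s u. 0 <= s \<and> s <= u \<and> u <= r \<and> u - s < h --> \<xi> u - \<xi> s < min e b" using cadlag_up_modulus[OF cad no_up me, of r] by blast
   define s' where "s' = max s (r - h/2)"
   have s': "s <= s'" "s' < r" "r - s' < h" using h(1) `s < r` by (auto simp: s'_def)
   obtain B where B: "\<forall>w\<in>{0..r}. \<bar>\<xi> w\<bar> <= B" using cadlag_bounded[OF cad no_up] by blast
   have "\<forall>w\<in>{s'..r}. \<xi> r - \<xi> w <= min e b"
    using h(2)[rule_format, of _ r] s' `0 <= s` by (auto intro!: less_imp_le simp del: min_less_iff_conj min.bounded_iff)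
   hence "reflected_path \<xi> s r <= max (reflected_path \<xi> s s' + (\<xi> r - \<xi> s')) (min e b)" using reflected_path_between(3)[OF B `0 <= s` s'(1)] s' by auto
   moreover have "\<xi> r - \<xi> s' < min e b" using h(2)[rule_format, of s' r] s' `0 <= s` by auto
   moreover have "reflected_path \<xi> s s' <= b" using le[of s'] s' F by auto
   ultimately show ?thesis using b_pos that by (auto simp: max_def split: if_splits)
  qed
  have "reflected_path \<xi> s r <= b" by (rule field_le_epsilon) (rule le_e)
  thus "reflected_path \<xi> s r = b" using `b <= reflected_path \<xi> s r` by (rule antisym)
 qed
 show "\<And>r. F = ereal r ==> s < r \<and> enters_step1 \<delta> b \<xi> r b \<and> reflected_path \<xi> s r = b"
  by (intro conjI last step2_to_step1[OF e2]) (simp_all add: F_def)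
 fix s'
 show "rr_between \<delta> b \<xi> v s' u" if "s <= s'" "s' <= u" "ereal u < F" for u
 proof -
  obtain B where B: "\<forall>w\<in>{0..u}. \<bar>\<xi> w\<bar> <= B" using cadlag_bounded[OF cad no_up] by blast
  have *: "ereal w < F" if "w <= u" for w using `ereal u < F` that by (metis ereal_less_eq(3) le_less_trans)
  show ?thesis
  proof (rule rr_between_reflected[OF B `0 <= s` `s <= s'` `s' <= u`])
   show "v w = reflected_path \<xi> s w" if "s' <= w" "w <= u" for w by (rule v) (use `s <= s'` that * in auto)
   show "reflected_path \<xi> s w <= b" if "s' <= w" "w < u" for w by (rule le) (use `s <= s'` that * in auto)
  qed
 qed
 show "rr_between \<delta> b \<xi> v s' r" if "F = ereal r" "v r = b" "s <= s'" "s' <= r" for r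
 proof -
  obtain B where B: "\<forall>w\<in>{0..r}. \<bar>\<xi> w\<bar> <= B" using cadlag_bounded[OF cad no_up] by blast
  show ?thesis
  proof (rule rr_between_reflected[OF B `0 <= s` `s <= s'` `s' <= r`])
   fix w assume "s' <= w" "w <= r"
   thus "v w = reflected_path \<xi> s w" using v[of w] last(2)[of r] that by (cases "w = r") auto
  next
   fix w assume "s' <= w" "w < r"
   thus "reflected_path \<xi> s w <= b" by (intro le) (use that in auto)
  qed
 qed
qed

text \<open>A start at level 0 may leave the half-line at once; then Step 1 prescribes no value at
  \<open>s\<close>, and the Step 2 that begins at \<open>s\<close> gives \<open>v s = 0 = y\<close>.
  The bound on the increment of \<xi> in the second claim is the drop per cycle on which the
  finiteness of the number of cycles rests.\<close>

lemma step1_segment: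
 assumes e1: "enters_step1 \<delta> b \<xi> s y" and "0 <= s" "0 <= y"
  and sol: "refracted_solution \<delta> b \<xi> s y A"
 defines "F \<equiv> first_time_after s (\<lambda>t. A t < 0)"
 shows "v s = y"
  and "\<And>r. F = ereal r ==> s <= r \<and> enters_step2 \<delta> b \<xi> r \<and> \<xi> r - \<xi> s <= - y + \<delta> * (r - s)"
  and "\<And>s' u. s <= s' ==> s' <= u ==> ereal u <= F ==> rr_between \<delta> b \<xi> v s' u"
  and "0 < y ==> ereal s < F"
proof -
 obtain B where solB: "refracted_solution \<delta> b \<xi> s y B"
  and vB: "\<And>t. s <= t ==> ereal t < first_time_after s (\<lambda>t. B t < 0) ==> v t = B t" using path_step1[OF e1] by blast
 have eqB: "B t = A t" if "s <= t" for t by (rule refracted_solution_unique[OF solB sol \<delta>_nonneg that])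
 have "first_time_after s (\<lambda>t. B t < 0) = first_time_after s (\<lambda>t. A t < 0)" unfolding first_time_after_def using eqB by (intro INF_cong) auto
 hence v: "\<And>t. s <= t ==> ereal t < first_time_after s (\<lambda>t. A t < 0) ==> v t = A t" using vB eqB by simp
 have As: "A s = y" using refracted_solution_increment(2)[OF sol \<delta>_nonneg, of s s] by auto
 have Fs: "ereal s <= F" unfolding F_def by (rule first_time_after_ge)
 have last: "enters_step2 \<delta> b \<xi> r" "A r <= 0" "\<xi> r - \<xi> s <= - y + \<delta> * (r - s)" "v r = 0" "s <= r"
  if F: "F = ereal r" for r
 proof -
  show e2: "enters_step2 \<delta> b \<xi> r" using step1_to_step2[OF e1 sol] F unfolding F_def by simp
  show "s <= r" using Fs F by simp
  thus "v r = 0" using step2_start[OF e2] `0 <= s` by simp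
  show "A r <= 0"
  proof (rule ccontr)
   assume "\<not> ?thesis"
   then obtain h where h: "0 < h" "\<And>t. r <= t ==> t < r + h ==> \<bar>A t - A r\<bar> < A r" using refracted_right[OF sol `0 <= s` `s <= r`, of "A r"] by auto
   obtain t where "r <= t" "t < r + h" "A t < 0" using first_time_after_approx_right[OF F[unfolded F_def] h(1)] by auto
   thus False using h(2)[of t] by auto
  qed
  thus "\<xi> r - \<xi> s <= - y + \<delta> * (r - s)" using refracted_solution_increment(2)[OF sol \<delta>_nonneg `s <= r`, of r] by auto
 qed
 show "v s = y"
 proof (cases "F = ereal s")
  case True
  thus ?thesis using last[of s] As `0 <= y` by auto
 next
  case False
  thus ?thesis using v[of s] Fs As unfolding F_def by auto
 qed
 have nn: "0 <= A t" "v t = A t" if "s <= t" "ereal t < F" for t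
 proof -
  show "v t = A t" using v[of t] that unfolding F_def by simp
  show "0 <= A t"
  proof (cases "s = t")
   case True
   thus ?thesis using As `0 <= y` by simp
  next
   case False
   thus ?thesis using not_before_first_time_after[of s t "\<lambda>t. A t < 0"] that unfolding F_def by simp
  qed
 qed
 show "rr_between \<delta> b \<xi> v s' u" if "s <= s'" "s' <= u" "ereal u <= F" for s' u
 proof (rule rr_between_refracted[OF sol `s <= s'` `s' <= u`])
  have *: "ereal w < F" if "w < u" for w using `ereal u <= F` that by (metis ereal_less_eq(3) less_le_trans less_ereal.simps(1))
  show "v w = A w" if "s' <= w" "w < u" for w using nn(2)[of w] *[of w] that `s <= s'` by auto
  show u: "v u = A u \<and> 0 <= A u \<or> v u = 0 \<and> A u <= 0"
  proof (cases "ereal u = F")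
   case True
   thus ?thesis using last[of u] by auto
  next
   case False
   thus ?thesis using nn[of u] that by auto
  qed
  show "0 <= v s'"
  proof (cases "s' = u")
   case True
   thus ?thesis using u by auto
  next
   case False
   thus ?thesis using nn[of s'] *[of s'] that by auto
  qed
 qed
 show "ereal s < F" if "0 < y"
 proof (rule ccontr)
  assume "\<not> ?thesis"
  hence "F = ereal s" using Fs by auto
  thus False using last[of s] As that by auto
 qed
 show "\<And>r. F = ereal r ==> s <= r \<and> enters_step2 \<delta> b \<xi> r \<and> \<xi> r - \<xi> s <= - y + \<delta> * (r - s)" using last by blast
qed

lemma step1_exists:
 assumes "enters_step1 \<delta> b \<xi> s y"
 obtains A where "refracted_solution \<delta> b \<xi> s y A" using path_step1[OF assms] by blast

definition covered :: "real => bool" where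
 "covered t \<longleftrightarrow> (\<forall>s' u. 0 <= s' --> s' <= u --> u <= t --> rr_between \<delta> b \<xi> v s' u)"

lemma covered_extend:
 assumes "covered s" "0 <= s" and seg: "\<And>s' u. s <= s' ==> s' <= u ==> u <= t ==> rr_between \<delta> b \<xi> v s' u"
 shows "covered t" unfolding covered_def
proof (intro allI impI)
 fix s' u :: real assume *: "0 <= s'" "s' <= u" "u <= t"
 consider "u <= s" | "s <= s'" | "s' <= s" "s <= u" by linarith
 thus "rr_between \<delta> b \<xi> v s' u"
 proof cases
  case 3
  thus ?thesis using rr_between_trans[OF \<delta>_nonneg, of s' s u] assms(1) seg[of s u] * unfolding covered_def by blast
 next
  case 1
  thus ?thesis using assms(1) * unfolding covered_def by blast
 next
  case 2
  thus ?thesis by (intro seg) (use * in auto)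
 qed
qed

text \<open>Joint induction over both predicates, with coverage of all earlier times as the
  invariant. New segments are glued on by \<open>rr_between_trans\<close>; the value of
  \<open>v\<close> at an exit from Step 2 is taken from the Step 1 that follows.\<close>

lemma enters_covers:
 shows "enters_step1 \<delta> b \<xi> s y ==> 0 <= s \<and> 0 <= y \<and> v 0 = max (\<xi> 0) 0 \<and> covered s"
  and "enters_step2 \<delta> b \<xi> r ==> 0 <= r \<and> v 0 = max (\<xi> 0) 0 \<and> covered r"
proof (induction rule: enters_step1_enters_step2.inducts)
 case start_step1
 hence e: "enters_step1 \<delta> b \<xi> 0 (\<xi> 0)" by (rule enters_step1_enters_step2.start_step1)
 obtain A where "refracted_solution \<delta> b \<xi> 0 (\<xi> 0) A" by (rule step1_exists[OF e])
 from step1_segment(1)[OF e order_refl start_step1 this] have v0: "v 0 = \<xi> 0" .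
 hence "rr_between \<delta> b \<xi> v 0 0" using start_step1 by (intro rr_between_refl) auto
 hence "covered 0" unfolding covered_def by (metis order.antisym order.trans)
 thus ?case using start_step1 v0 by simp
next
 case start_step2
 hence e: "enters_step2 \<delta> b \<xi> 0" by (rule enters_step1_enters_step2.start_step2)
 have v0: "v 0 = 0" using step2_start[OF e] by simp
 hence "rr_between \<delta> b \<xi> v 0 0" by (intro rr_between_refl) auto
 hence "covered 0" unfolding covered_def by (metis order.antisym order.trans)
 thus ?case using start_step2 v0 by simp
next
 case (step1_to_step2 s y A r)
 hence s: "0 <= s" "0 <= y" "covered s" by auto
 note seg = step1_segment[OF step1_to_step2(1) s(1,2) step1_to_step2(3)]
 have "s <= r" using seg(2)[OF step1_to_step2(4)] by blast
 moreover have "covered r" by (rule covered_extend[OF s(3,1)]) (rule seg(3), simp_all add: step1_to_step2(4))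
 ultimately show ?case using step1_to_step2 s by auto
next
 case (step2_to_step1 s r)
 hence s: "0 <= s" "covered s" by auto
 note seg = step2_segment[OF step2_to_step1(1) s(1)]
 have r: "s < r" "enters_step1 \<delta> b \<xi> r b" using seg(1)[OF step2_to_step1(3)] by auto
 obtain A where "refracted_solution \<delta> b \<xi> r b A" by (rule step1_exists[OF r(2)])
 hence vr: "v r = b" using step1_segment(1)[OF r(2)] r s b_pos by auto
 have "covered r"
 proof (rule covered_extend[OF s(2,1)])
  fix s' u assume *: "s <= s'" "s' <= u" "u <= r"
  show "rr_between \<delta> b \<xi> v s' u"
  proof (cases "u = r")
   case True
   thus ?thesis using seg(3)[OF step2_to_step1(3) vr] * by simp
  next
   case False
   thus ?thesis using * by (intro seg(2)) (simp_all add: step2_to_step1(3))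
  qed
 qed
 thus ?case using step2_to_step1 r s b_pos by auto
qed

lemma start_value: "v 0 = max (\<xi> 0) 0"
proof (cases "0 <= \<xi> 0")
 case True
 hence "enters_step1 \<delta> b \<xi> 0 (\<xi> 0)" by (rule start_step1)
 thus ?thesis using enters_covers(1) by blast
next
 case False
 hence "\<xi> 0 < 0" by simp
 thus ?thesis using enters_covers(2)[OF start_step2] by blast
qed

text \<open>If the step lasted beyond \<open>t\<close>, its segment would cover the time up to
  \<open>t\<close>; hence its end is finite and at most \<open>t\<close>.\<close>

lemma step2_next:
 assumes "enters_step2 \<delta> b \<xi> s" "\<not> covered t"
 obtains r where "s < r" "r <= t" "enters_step1 \<delta> b \<xi> r b"
proof -
 have s: "0 <= s" "covered s" using enters_covers(2)[OF assms(1)] by auto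
 note seg = step2_segment[OF assms(1) s(1)]
 let ?F = "first_time_after s (\<lambda>t. b < reflected_path \<xi> s t)"
 have "\<not> ereal t < ?F"
 proof
  assume *: "ereal t < ?F"
  have "covered t"
  proof (rule covered_extend[OF s(2,1)])
   fix s' u assume **: "s <= s'" "s' <= u" "u <= t"
   hence "ereal u < ?F" using * by (metis ereal_less_eq(3) le_less_trans)
   with ** show "rr_between \<delta> b \<xi> v s' u" by (intro seg(2))
  qed
  thus False using assms by blast
 qed
 moreover have "ereal s <= ?F" by (rule first_time_after_ge)
 ultimately obtain r where r: "?F = ereal r" "r <= t" by (cases ?F) simp_all
 show ?thesis using that seg(1)[OF r(1)] r(2) by blast
qed

lemma step1_next:
 assumes "enters_step1 \<delta> b \<xi> s y" "\<not> covered t"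
 obtains r where "s <= r" "r <= t" "enters_step2 \<delta> b \<xi> r" "\<xi> r - \<xi> s <= - y + \<delta> * (r - s)"
  "0 < y ==> s < r"
proof -
 have s: "0 <= s" "0 <= y" "covered s" using enters_covers(1)[OF assms(1)] by auto
 obtain A where A: "refracted_solution \<delta> b \<xi> s y A" by (rule step1_exists[OF assms(1)])
 note seg = step1_segment[OF assms(1) s(1,2) A]
 let ?F = "first_time_after s (\<lambda>t. A t < 0)"
 have "\<not> ereal t < ?F"
 proof
  assume *: "ereal t < ?F"
  have "covered t"
  proof (rule covered_extend[OF s(3,1)])
   fix s' u assume **: "s <= s'" "s' <= u" "u <= t"
   hence "ereal u <= ?F" using * by (metis ereal_less_eq(3) le_less_trans less_imp_le)
   with ** show "rr_between \<delta> b \<xi> v s' u" by (intro seg(3))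
  qed
  thus False using assms by blast
 qed
 moreover have "ereal s <= ?F" by (rule first_time_after_ge)
 ultimately obtain r where r: "?F = ereal r" "r <= t" by (cases ?F) simp_all
 have "s < r" if "0 < y" using seg(4)[OF that] r(1) by simp
 thus ?thesis using that seg(2)[OF r(1)] r(2) by blast
qed

text \<open>There are finitely many cycles in bounded time: along an infinite sequence of cycles the
 path would drop by about `b` infinitely often to the left of the limit of the cycle times.\<close>

lemma covered_all: "covered t"
proof (rule ccontr)
 assume neg: "\<not> covered t"
 \<comment> \<open>An entry at level exactly \<open>b\<close> is needed, since a start at level 0
   gives no drop; after the first return from Step 2 the entry level is \<open>b\<close>.\<close>
 have ex: "\<exists>s0. enters_step1 \<delta> b \<xi> s0 b"
 proof (cases "0 <= \<xi> 0")
  case True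
  hence "enters_step1 \<delta> b \<xi> 0 (\<xi> 0)" by (rule start_step1)
  then obtain r where "enters_step2 \<delta> b \<xi> r" using step1_next[OF _ neg] by blast
  thus ?thesis using step2_next[OF _ neg] by blast
 next
  case False
  thus ?thesis using step2_next[OF start_step2 neg] by (metis not_le)
 qed
 \<comment> \<open>One cycle: refraction from \<open>s\<close> to \<open>r\<close>, then reflection
   from \<open>r\<close> to \<open>s'\<close>. The last conjunct is the drop during the
   refraction.\<close>
 define P where "P = (\<lambda>s r s'. s < r \<and> r < s' \<and> s' <= t \<and> \<xi> r - \<xi> s <= - b + \<delta> * (r - s))"
 have step: "\<exists>s'. enters_step1 \<delta> b \<xi> s' b \<and> (\<exists>r. P s r s')" if en: "enters_step1 \<delta> b \<xi> s b" for s
 proof -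
  obtain r where r: "s <= r" "r <= t" "enters_step2 \<delta> b \<xi> r" "\<xi> r - \<xi> s <= - b + \<delta> * (r - s)" "s < r" using step1_next[OF en neg] b_pos by metis
  obtain s' where "r < s'" "s' <= t" "enters_step1 \<delta> b \<xi> s' b" using step2_next[OF r(3) neg] by blast
  thus ?thesis using r unfolding P_def by blast
 qed
 obtain S where S: "\<And>n. enters_step1 \<delta> b \<xi> (S n) b" "\<And>n. \<exists>r. P (S n) r (S (Suc n))"
  using dependent_nat_choice[of "\<lambda>_ s. enters_step1 \<delta> b \<xi> s b" "\<lambda>_ s s'. \<exists>r. P s r s'"] ex step by auto
 obtain R where R: "\<And>n. P (S n) (R n) (S (Suc n))" using S(2) by metis
 have inc: "strict_mono S" using R unfolding strict_mono_Suc_iff P_def by (metis less_trans)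
 hence "incseq S" by (rule strict_mono_mono)
 have bd: "S n <= t" for n using R[of n] unfolding P_def by linarith
 obtain L where L: "S \<longlonglongrightarrow> L" "\<And>n. S n <= L" using incseq_convergent[OF `incseq S`, of t] bd by blast
 have SL: "S n < L" for n using L(2)[of "Suc n"] inc by (meson less_le_trans lessI strict_monoD)
 have RL: "R n < L" for n using R[of n] L(2)[of "Suc n"] unfolding P_def by linarith
 have "R \<longlonglongrightarrow> L" by (rule tendsto_sandwich[OF _ _ L(1) LIMSEQ_Suc[OF L(1)]])
   (use R in "auto simp: P_def less_imp_le")
 have "0 <= S 0" using enters_covers(1)[OF S(1)] by blast
 hence "0 < L" using SL[of 0] by linarith
 then obtain l where l: "(\<xi> \<longlongrightarrow> l) (at_left L)" using cad by (auto simp: cadlag_def)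
 have "(\<lambda>n. \<xi> (S n)) \<longlonglongrightarrow> l" by (rule filterlim_compose[OF l]) (intro tendsto_imp_filterlim_at_left L(1) always_eventually allI SL)
 moreover have "(\<lambda>n. \<xi> (R n)) \<longlonglongrightarrow> l" by (rule filterlim_compose[OF l]) (intro tendsto_imp_filterlim_at_left `R \<longlonglongrightarrow> L` always_eventually allI RL)
 ultimately have 1: "(\<lambda>n. \<xi> (R n) - \<xi> (S n)) \<longlonglongrightarrow> l - l" by (intro tendsto_diff)
 have 2: "(\<lambda>n. - b + \<delta> * (R n - S n)) \<longlonglongrightarrow> - b + \<delta> * (L - L)" by (intro tendsto_intros `R \<longlonglongrightarrow> L` L(1))
 have "l - l <= - b + \<delta> * (L - L)" by (rule LIMSEQ_le[OF 1 2]) (use R in "auto simp: P_def")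
 thus False using b_pos by simp
qed

lemma between:
 assumes "0 <= s" "s <= u"
 shows "rr_between \<delta> b \<xi> v s u" using covered_all[of u] assms unfolding covered_def by blast

end

subsection \<open>The Euler chain along a path\<close>

text \<open>The jump size is cut at 1 so that functions of exponential growth stay bounded on one step; as X has no
 positive jumps, the cut is inactive on a fine mesh.\<close>

definition euler_step :: "real => real => real => real => real => real" where
 "euler_step \<delta> b h u z = max 0 (u + min z 1 - (if b < u then \<delta> * h else 0))"

primrec euler :: "(real => real => real) => real => (nat => real) => nat => real" where
 "euler \<phi> x \<zeta> 0 = x"
| "euler \<phi> x \<zeta> (Suc i) = \<phi> (euler \<phi> x \<zeta> i) (\<zeta> i)"

definition increments :: "nat => (real => real) => nat => real" where
 "increments n f i = f (real (Suc i) / real n) - f (real i / real n)"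

text \<open>\<open>u\<close> is the chain, \<open>V\<close> and \<open>V'\<close> are the path at
  both ends of a step, \<open>D\<close> is the time the path spends above \<open>b\<close>. The
  excess of the chain does not accumulate. If \<open>V + e <= b\<close> the path has no drift.
  Otherwise either the chain has the full drift, at least that of the path, or
  \<open>u <= b < V + e\<close> leaves a margin for the drift of the path, which is at most
  \<open>e / 2\<close>.\<close>

lemma euler_step_upper:
 assumes "0 <= V'" "V + \<zeta> - \<delta> * D <= V'" "0 <= D" "D <= h" "\<zeta> <= 1" "V + e <= b --> D = 0"
  "u - V <= 2 * e" "\<delta> * h <= e / 2" "0 <= \<delta>" "0 <= e"
 shows "euler_step \<delta> b h u \<zeta> - V' <= 2 * e"
proof -
 have "\<delta> * D <= \<delta> * h" using assms by (intro mult_left_mono)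
 moreover have "0 <= \<delta> * D" "0 <= \<delta> * h" using assms by simp_all
 moreover have "min \<zeta> 1 = \<zeta>" using assms by simp
 moreover have "\<delta> * D = 0" if "V + e <= b" using assms(6) that by simp
 ultimately have d: "\<delta> * D <= \<delta> * h" "0 <= \<delta> * D" "0 <= \<delta> * h" "min \<zeta> 1 = \<zeta>" "V + e <= b --> \<delta> * D = 0" by blast+
 have "u + \<zeta> - (if b < u then \<delta> * h else 0) <= V' + 2 * e"
 proof (cases "V + e <= b")
  case True
  hence "\<delta> * D = 0" using d by blast
  thus ?thesis using assms(2,7) d(3) by (auto split: if_splits)
 next
  case False
  thus ?thesis using assms(2,7,8,10) d(1-3) by (auto split: if_splits)
 qed
 thus ?thesis using assms(1,10) unfolding euler_step_def d(4) by simp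
qed

text \<open>The deficit of the chain can grow only through drift that the path does not have. On a
  step without a large jump this needs \<open>b < u\<close> with \<open>V\<close> not far above
  \<open>b\<close>, and then the deficit is small enough to absorb \<open>\<delta> * h\<close>. Only
  bad steps cost \<open>\<delta> * h\<close>, and \<open>B\<close> counts the earlier ones.\<close>

lemma euler_step_lower:
 assumes "V' <= max (V + \<zeta> - \<delta> * D) e" "0 <= D" "D <= h" "\<zeta> <= 1"
  "\<not> bad \<and> b + e + \<delta> * h < V --> D = h"
  "V - u <= 2 * e + \<delta> * h * B" "\<delta> * h <= e / 2" "0 <= \<delta>" "0 <= e" "0 <= h" "0 <= B"
 shows "V' - euler_step \<delta> b h u \<zeta> <= 2 * e + \<delta> * h * (B + (if bad then 1 else 0))"
proof -
 have 1: "0 <= \<delta> * h" "0 <= \<delta> * h * B" using assms by auto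
 have 2: "\<delta> * D = \<delta> * h" if "\<not> bad" "b + e + \<delta> * h < V" using assms(5) that by simp
 have 3: "0 <= \<delta> * D" using assms by simp
 have 4: "min \<zeta> 1 = \<zeta>" using assms by simp
 have 5: "\<delta> * h * (B + (if bad then 1 else 0)) = \<delta> * h * B + (if bad then \<delta> * h else 0)" by (simp add: algebra_simps)
 have 6: "u + \<zeta> - (if b < u then \<delta> * h else 0) <= euler_step \<delta> b h u \<zeta>" "0 <= euler_step \<delta> b h u \<zeta>" unfolding euler_step_def 4 by auto
 show ?thesis
 proof (cases "V' <= e")
  case True
  thus ?thesis using 6(2) 1 5 assms(9) by (auto split: if_splits)
 next
  case False
  hence V': "V' <= V + \<zeta> - \<delta> * D" using assms(1) by (auto simp: max_def split: if_splits)
  show ?thesis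
  proof (cases "b < u \<and> \<not> bad \<and> V - u > 2 * e + \<delta> * h * B - \<delta> * h")
   case True
   hence "b + e + \<delta> * h < V" using assms(7) 1 by linarith
   with True have "\<delta> * D = \<delta> * h" using 2 by blast
   thus ?thesis using V' 6(1) True 5 assms(6) by auto
  next
   case False
   thus ?thesis using V' 6(1) 1 3 5 assms(6) by (auto split: if_splits)
  qed
 qed
qed

text \<open>The half-open cells are disjoint, so points of \<open>C\<close> chosen in them are
  distinct. Thus the number of steps with a large jump is bounded independently of \<open>n\<close>,
  and their total drift error is of order 1/n.\<close>

lemma card_cells_le:
 assumes "finite C"
 shows "card {j. j < i \<and> {real j / real n<..real (Suc j) / real n} \<inter> C \<noteq> {}} <= card C"
proof -
 let ?J = "{j. j < i \<and> {real j / real n<..real (Suc j) / real n} \<inter> C \<noteq> {}}"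
 have "\<forall>j\<in>?J. \<exists>c. c \<in> C \<and> real j / real n < c \<and> c <= real (Suc j) / real n" by auto
 from bchoice[OF this] obtain f where
  f: "\<forall>j\<in>?J. f j \<in> C \<and> real j / real n < f j \<and> f j <= real (Suc j) / real n" by blast
 have "inj_on f ?J"
 proof (rule linorder_inj_onI)
  fix j k assume jk: "j < k" "j \<in> ?J" "k \<in> ?J"
  hence "real (Suc j) / real n <= real k / real n" by (intro divide_right_mono) auto
  thus "f j \<noteq> f k" using bspec[OF f jk(2)] bspec[OF f jk(3)] by linarith
 qed auto
 moreover have "f ` ?J \<subseteq> C" using f by blast
 ultimately show ?thesis using assms by (rule card_inj_on_le)
qed

context rr_path
begin

abbreviation "E n \<equiv> euler (euler_step \<delta> b (1 / real n)) (v 0) (increments n \<xi>)"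

lemma nonneg: "0 <= s ==> 0 <= v s" using between[of s s] by (auto simp: rr_between_def)

lemma betweenD:
 assumes "0 <= s" "s <= u"
 shows "v s + (\<xi> u - \<xi> s) - \<delta> * time_above b v s u <= v u"
  and "\<And>C. \<forall>w\<in>{s..u}. \<xi> u - \<xi> w <= C ==> v u <= max (v s + (\<xi> u - \<xi> s) - \<delta> * time_above b v s u) C"
 using between[OF assms] by (auto simp: rr_between_def)

lemma \<delta>_time_above:
 assumes "s <= u"
 shows "0 <= \<delta> * time_above b v s u" "\<delta> * time_above b v s u <= \<delta> * (u - s)"
 using \<delta>_nonneg time_above_nonneg time_above_le[OF assms] by (auto intro: mult_left_mono)

lemma path_diff:
 assumes "0 <= s" "s <= u" "\<forall>w\<in>{s..u}. \<bar>\<xi> u - \<xi> w\<bar> <= e"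
 shows "\<bar>v u - v s\<bar> <= e + \<delta> * (u - s)"
proof -
 have "\<forall>w\<in>{s..u}. \<xi> u - \<xi> w <= e" using assms(3) by (auto simp: abs_le_iff)
 note 1 = betweenD(2)[OF assms(1,2) this] betweenD(1)[OF assms(1,2)] \<delta>_time_above[OF assms(2)]
 have 2: "\<bar>\<xi> u - \<xi> s\<bar> <= e" using assms by auto
 have 3: "0 <= v s" by (rule nonneg[OF assms(1)])
 show ?thesis using 1 2 3 unfolding abs_le_iff max_def by (auto split: if_splits)
qed

text \<open>The drift jumps at \<open>b\<close>, so no Lipschitz estimate for the recursion is
  available. The induction keeps the excess below \<open>2 * e\<close> throughout and lets the
  deficit grow by \<open>\<delta> * h\<close> per bad cell, that is, per cell with a point of the
  set \<open>C\<close> of possible large jumps.\<close>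

lemma euler_close:
 assumes "0 < \<eta>"
 shows "EV n. \<forall>i. real i / real n <= t -->
  \<bar>E n i - v (real i / real n)\<bar> <= \<eta>"
proof -
 define e where "e = min (\<eta> / 3) 1"
 have e: "0 < e" "e <= 1" "3 * e <= \<eta>" using assms by (auto simp: e_def)
 show ?thesis
 proof (rule cadlag_modulus[OF cad no_up e(1), of t])
  fix g C
  assume g: "0 < g" and C: "finite C"
   and up: "\<And>s u. 0 <= s ==> s <= u ==> u <= t ==> u - s < g ==> \<xi> u - \<xi> s < e"
   and osc: "\<And>s u. 0 <= s ==> s <= u ==> u <= t ==> u - s < g ==> {s<..u} \<inter> C = {} ==> \<bar>\<xi> u - \<xi> s\<bar> < e"
  have "(\<lambda>n. 1 / real n) \<longlonglongrightarrow> 0" by (rule lim_1_over_n)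
  hence "(\<lambda>n. \<delta> * (1 / real n)) \<longlonglongrightarrow> \<delta> * 0" "(\<lambda>n. \<delta> * (1 / real n) * real (card C)) \<longlonglongrightarrow> \<delta> * 0 * real (card C)" by (intro tendsto_intros)+
  hence "EV n. 1 / real n < g" "EV n. \<delta> * (1 / real n) < e / 2"
   "EV n. \<delta> * (1 / real n) * real (card C) < e" using order_tendstoD(2)[OF `(\<lambda>n. 1 / real n) \<longlonglongrightarrow> 0` g]
    order_tendstoD(2)[of "\<lambda>n. \<delta> * (1 / real n)" 0 sequentially "e/2"]
    order_tendstoD(2)[of "\<lambda>n. \<delta> * (1 / real n) * real (card C)" 0 sequentially "e"] e by auto
  moreover have "EV n. 0 < n" by (rule eventually_gt_at_top)
  ultimately show ?thesis
  proof eventually_elim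
   case (elim n)
   define h where "h = 1 / real n"
   define E where "E = euler (euler_step \<delta> b h) (v 0) (increments n \<xi>)"
   define bad where "bad j \<longleftrightarrow> {real j / real n<..real (Suc j) / real n} \<inter> C \<noteq> {}" for j
   have h: "0 < h" "h < g" "\<delta> * h <= e / 2" "\<delta> * h * real (card C) <= e" using elim by (auto simp: h_def)
   have "E i - v (real i / real n) <= 2 * e \<and>
     v (real i / real n) - E i <= 2 * e + \<delta> * h * real (card {j. j < i \<and> bad j})"
    if "real i / real n <= t" for i using that
   proof (induction i)
    case 0
    thus ?case using e by (simp add: E_def)
   next
    case (Suc i)
    define s u where "s = real i / real n" and "u = real (Suc i) / real n"
    have su: "0 <= s" "s <= u" "u - s = h" "u <= t" using Suc.prems by (simp_all add: s_def u_def h_def divide_right_mono add_divide_distrib)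
    have IH: "E i - v s <= 2 * e" "v s - E i <= 2 * e + \<delta> * h * real (card {j. j < i \<and> bad j})" using Suc.IH su unfolding s_def by auto
    define D where "D = time_above b v s u"
    have D: "0 <= D" "D <= h" using time_above_nonneg time_above_le[OF su(2)] su by (auto simp: D_def)
    have ups: "\<forall>w\<in>{s..r}. \<xi> r - \<xi> w <= e" if "r \<in> {s..u}" for r
    proof
     fix w assume w: "w \<in> {s..r}"
     have "\<xi> r - \<xi> w < e"
     proof (rule up)
      show "0 <= w" "w <= r" "r <= t" "r - w < g" using w that su h unfolding atLeastAtMost_iff by linarith+
     qed
     thus "\<xi> r - \<xi> w <= e" by simp
    qed
    have \<zeta>: "increments n \<xi> i = \<xi> u - \<xi> s" by (simp add: increments_def s_def u_def)
    have \<zeta>1: "\<xi> u - \<xi> s <= 1" using bspec[OF ups[of u], of s] su e by simp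
    \<comment> \<open>Upward moves within the cell are below \<open>e\<close>, so a path that starts
      at or below \<open>b - e\<close> does not exceed \<open>b\<close> during the step; values
      produced by the reflection are at most \<open>e\<close>, which is at most \<open>b\<close>
      here because \<open>v s\<close> is nonnegative.\<close>
    have z: "D = 0" if "v s + e <= b" unfolding D_def
    proof (rule time_above_eq_0(1))
     fix w assume w: "s <= w" "w < u"
     have "v w <= max (v s + (\<xi> w - \<xi> s) - \<delta> * time_above b v s w) e" by (rule betweenD(2)[OF su(1) w(1)]) (rule ups, use w in simp)
     moreover have "\<xi> w - \<xi> s <= e" using bspec[OF ups[of w], of s] w by simp
     ultimately show "v w <= b" using \<delta>_time_above[OF w(1)] nonneg[OF su(1)] that by linarith
    qed
    have l: "D = h" if "\<not> bad i" "b + e + \<delta> * h < v s" unfolding D_def su(3)[symmetric]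
    proof (rule time_above_eq_length[OF su(2)])
     fix w assume w: "s <= w" "w < u"
     have "\<bar>\<xi> w - \<xi> s\<bar> < e"
     proof (rule osc)
      have "{s<..w} \<subseteq> {s<..u}" using w by auto
      thus "{s<..w} \<inter> C = {}" using that(1) unfolding bad_def s_def[symmetric] u_def[symmetric] by blast
     qed (use w su h in linarith)+
     moreover have "\<delta> * (w - s) <= \<delta> * h" using w su \<delta>_nonneg by (intro mult_left_mono) auto
     ultimately show "b < v w" using betweenD(1)[OF su(1) w(1)] \<delta>_time_above[OF w(1)] that by linarith
    qed
    have E: "E (Suc i) = euler_step \<delta> b h (E i) (\<xi> u - \<xi> s)" by (simp add: E_def \<zeta>)
    have b: "0 <= v u" "v s + (\<xi> u - \<xi> s) - \<delta> * D <= v u" "v u <= max (v s + (\<xi> u - \<xi> s) - \<delta> * D) e"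
     using nonneg[of u] su betweenD(1)[OF su(1,2)] betweenD(2)[OF su(1,2) ups] by (simp_all add: D_def)
    have z': "v s + e <= b --> D = 0" and l': "\<not> bad i \<and> b + e + \<delta> * h < v s --> D = h" using z l by blast+
    have up': "E (Suc i) - v u <= 2 * e" unfolding E by (rule euler_step_upper[OF b(1,2) D \<zeta>1 z' IH(1) h(3) \<delta>_nonneg less_imp_le[OF e(1)]])
    have "v u - E (Suc i) <= 2 * e + \<delta> * h * (real (card {j. j < i \<and> bad j}) + (if bad i then 1 else 0))" unfolding E
     by (rule euler_step_lower[OF b(3) D \<zeta>1 l' IH(2) h(3) \<delta>_nonneg less_imp_le[OF e(1)] less_imp_le[OF h(1)]]) simp
    also have "real (card {j. j < i \<and> bad j}) + (if bad i then 1 else 0) = real (card {j. j < Suc i \<and> bad j})"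
    proof -
     have "{j. j < Suc i \<and> bad j} = (if bad i then insert i {j. j < i \<and> bad j} else {j. j < i \<and> bad j})" by (auto simp: less_Suc_eq)
     thus ?thesis by simp
    qed
    finally show ?case using up' by (simp add: u_def)
   qed
   moreover have "\<delta> * h * real (card {j. j < i \<and> bad j}) <= e" for i
   proof -
    have "\<delta> * h * real (card {j. j < i \<and> bad j}) <= \<delta> * h * real (card C)"
     using card_cells_le[OF C, of i n] \<delta>_nonneg h unfolding bad_def by (intro mult_left_mono) auto
    thus ?thesis using h by simp
   qed
   ultimately have "\<bar>E i - v (real i / real n)\<bar> <= \<eta>" if "real i / real n <= t" for i using e that by (smt (verit))
   thus ?case unfolding E_def h_def by blast
  qed
 qed
qed

end

text \<open>The chain stops once it has exceeded a; the second component accumulates the discount factors \<kappa>.\<close>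

primrec frozen :: "(real => real => real) => (real => real) => real => real => (nat => real) => nat => real \<times> real" where
 "frozen \<phi> \<kappa> a x \<zeta> 0 = (x, 1)"
| "frozen \<phi> \<kappa> a x \<zeta> (Suc i) =
   (let (u, k) = frozen \<phi> \<kappa> a x \<zeta> i in if a < u then (u, k) else (\<phi> u (\<zeta> i), k * \<kappa> u))"

definition alive :: "(real => real => real) => real => real => (nat => real) => nat => bool" where
 "alive \<phi> a x \<zeta> j \<longleftrightarrow> (\<forall>k\<le>j. euler \<phi> x \<zeta> k <= a)"

lemma alive_Suc: "alive \<phi> a x \<zeta> (Suc j) \<longleftrightarrow> alive \<phi> a x \<zeta> j \<and> euler \<phi> x \<zeta> (Suc j) <= a" unfolding alive_def by (auto simp: le_Suc_eq)

text \<open>Connects two descriptions of the stopped chain: the recursive pair suits conditioning on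
  the past, the free chain with the predicate \<open>alive\<close> suits convergence along a
  path.\<close>

lemma frozen_alive:
 "(alive \<phi> a x \<zeta> j --> fst (frozen \<phi> \<kappa> a x \<zeta> j) = euler \<phi> x \<zeta> j) \<and>
  (fst (frozen \<phi> \<kappa> a x \<zeta> j) <= a \<longleftrightarrow> alive \<phi> a x \<zeta> j) \<and>
  snd (frozen \<phi> \<kappa> a x \<zeta> j) = (\<Prod>i<j. if alive \<phi> a x \<zeta> i then \<kappa> (euler \<phi> x \<zeta> i) else 1)"
proof (induction j)
 case 0
 thus ?case by (auto simp: alive_def)
next
 case (Suc j)
 obtain u k where uk: "frozen \<phi> \<kappa> a x \<zeta> j = (u, k)" by fastforce
 show ?case
 proof (cases "alive \<phi> a x \<zeta> j")
  case True
  hence "u = euler \<phi> x \<zeta> j" "u <= a" using Suc uk by auto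
  thus ?thesis using Suc uk True by (auto simp: alive_Suc)
 next
  case False
  hence "a < u" using Suc uk by auto
  thus ?thesis using Suc uk False by (auto simp: alive_Suc)
 qed
qed

section \<open>Sums over a time grid as Lebesgue integrals\<close>

definition grid_index :: "nat => real => nat" where
 "grid_index n s = nat \<lfloor>s * real n\<rfloor>"

lemma measurable_grid_index [measurable]: "grid_index n \<in> borel \<rightarrow>\<^sub>M count_space UNIV" unfolding grid_index_def by measurable

lemma grid_index_le: "0 <= s ==> 0 < n ==> real (grid_index n s) / real n <= s" unfolding grid_index_def by (simp add: divide_le_eq)

lemma grid_index_gt: "0 <= s ==> 0 < n ==> s < real (grid_index n s) / real n + 1 / real n"
proof -
 assume "0 <= s" "0 < n"
 hence "s * real n < real (grid_index n s) + 1" unfolding grid_index_def by (simp add: floor_less_iff[symmetric])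
 thus ?thesis using `0 < n` by (simp add: add_divide_distrib[symmetric] less_divide_eq)
qed

lemma grid_index_iff:
 assumes "0 < n" "0 <= s"
 shows "grid_index n s = j \<longleftrightarrow> real j / real n <= s \<and> s < real (Suc j) / real n"
proof -
 have "grid_index n s = j \<longleftrightarrow> \<lfloor>s * real n\<rfloor> = int j"
  using assms unfolding grid_index_def by (metis int_nat_eq mult_nonneg_nonneg nat_int of_nat_0_le_iff zero_le_floor)
 also have "\<dots> \<longleftrightarrow> real j <= s * real n \<and> s * real n < real j + 1" by (simp add: floor_eq_iff)
 finally show ?thesis using assms by (simp add: divide_le_eq less_divide_eq add.commute)
qed

lemma grid_integral:
 fixes g :: "nat => real"
 assumes "0 < n"
 shows "(LINT s|lborel. indicator {0..<real m} s * g (grid_index n s)) = (\<Sum>j<m * n. g j) / real n"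
proof -
 have eq: "indicator {0..<real m} s * g (grid_index n s) =
   (\<Sum>j<m * n. g j * indicator {real j / real n..<real (Suc j) / real n} s)" for s
 proof (cases "0 <= s")
  case True
  have i: "indicator {real j / real n..<real (Suc j) / real n} s = (if grid_index n s = j then 1 else 0 :: real)" for j
   using grid_index_iff[OF assms True, of j] by (auto simp: indicator_def)
  have "grid_index n s < m * n \<longleftrightarrow> s < real m"
  proof
   assume "grid_index n s < m * n"
   hence "real (Suc (grid_index n s)) <= real m * real n" by (metis Suc_leI of_nat_le_iff of_nat_mult)
   hence "real (Suc (grid_index n s)) / real n <= real m" using assms by (simp add: divide_le_eq)
   thus "s < real m" using grid_index_iff[OF assms True, of "grid_index n s"] by linarith
  next
   assume "s < real m"
   hence "real (grid_index n s) / real n < real m" using grid_index_le[OF True assms] by linarith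
   hence "real (grid_index n s) < real (m * n)" using assms by (simp add: divide_less_eq)
   thus "grid_index n s < m * n" by (simp only: of_nat_less_iff)
  qed
  moreover have "(\<Sum>j<m * n. g j * (if grid_index n s = j then 1 else 0)) =
    (if grid_index n s < m * n then g (grid_index n s) else 0)" by (simp add: if_distrib[of "(*) _"] cong: if_cong)
  ultimately show ?thesis using True unfolding i by (auto simp: indicator_def)
 next
  case False
  hence "indicator {real j / real n..<real (Suc j) / real n} s = (0::real)" for j
   using assms by (auto simp: indicator_def not_le intro: less_le_trans)
  thus ?thesis using False by simp
 qed
 have "(LINT s|lborel. (\<Sum>j<m * n. g j * indicator {real j / real n..<real (Suc j) / real n} s))
   = (\<Sum>j<m * n. g j * (LINT s|lborel. indicator {real j / real n..<real (Suc j) / real n} s))" by (subst Bochner_Integration.integral_sum)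
   (auto intro!: integrable_mult_right integrable_real_indicator simp: emeasure_lborel_Ico divide_right_mono)
 also have "\<dots> = (\<Sum>j<m * n. g j * (1 / real n))" using assms by (intro sum.cong refl) (auto simp: field_simps)
 finally show ?thesis unfolding eq by (simp add: sum_divide_distrib)
qed

text \<open>One-sided dominated convergence: \<open>min (H s) (g n (grid_index n s))\<close> is
  dominated by \<open>R\<close> and tends to \<open>H s\<close>. This gives a convergent lower bound
  for the sums even when the sums themselves do not converge.\<close>

lemma grid_limit_lower:
 fixes g :: "nat => nat => real" and H :: "real => real"
 assumes g: "\<And>n j. 0 <= g n j" and H[measurable]: "H \<in> borel_measurable borel" and HR: "\<And>s. 0 <= H s" "\<And>s. H s <= R"
  and ev: "AE s in lborel. 0 < s --> s < real m --> (EV n. H s <= g n (grid_index n s))"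
 shows "\<exists>lo. lo \<longlonglongrightarrow> (LINT s|lborel. indicator {0..<real m} s * H s) \<and>
  (\<forall>n>0. lo n <= (\<Sum>j<m * n. g n j) / real n)"
proof (intro exI conjI allI impI)
 let ?f = "\<lambda>n s. indicator {0..<real m} s * min (H s) (g n (grid_index n s))"
 have mg[measurable]: "(\<lambda>s. g n (grid_index n s)) \<in> borel_measurable borel" for n by measurable
 have ib: "integrable lborel (\<lambda>s. indicator {0..<real m} s * R)"
  by (intro integrable_mult_left integrable_real_indicator) (auto simp: emeasure_lborel_Ico divide_right_mono)
 show "(\<lambda>n. LINT s|lborel. ?f n s) \<longlonglongrightarrow> (LINT s|lborel. indicator {0..<real m} s * H s)"
 proof (rule integral_dominated_convergence[where w="\<lambda>s. indicator {0..<real m} s * R"])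
  have "AE s in lborel. s \<noteq> (0::real)" by (rule AE_lborel_singleton)
  with ev show "AE s in lborel. (\<lambda>n. ?f n s) \<longlonglongrightarrow> indicator {0..<real m} s * H s"
  proof eventually_elim
   case (elim s)
   show ?case
   proof (cases "0 < s \<and> s < real m")
    case True
    hence "EV n. min (H s) (g n (grid_index n s)) = H s" using elim by (auto elim!: eventually_mono)
    hence "(\<lambda>n. min (H s) (g n (grid_index n s))) \<longlonglongrightarrow> H s" by (rule tendsto_eventually)
    thus ?thesis by (intro tendsto_intros)
   next
    case False
    hence "indicator {0..<real m} s = (0::real)" using elim by (auto simp: indicator_def)
    thus ?thesis by simp
   qed
  qed
  show "AE s in lborel. norm (?f n s) <= indicator {0..<real m} s * R" for n
  proof (rule AE_I2)
   fix s
   show "norm (?f n s) <= indicator {0..<real m} s * R" using HR(1)[of s] HR(2)[of s] g[of n "grid_index n s"] by (auto simp: indicator_def min_def)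
  qed
 qed (use ib in auto)
 fix n :: nat assume "0 < n"
 \<comment> \<open>The weights may be unbounded in \<open>j\<close>; on \<open>{0..<real m}\<close>
   only indices up to \<open>m * n\<close> occur, and a finite sum bounds these.\<close>
 have fin: "g n j <= (\<Sum>j\<le>m * n. \<bar>g n j\<bar>)" if "j <= m * n" for j using member_le_sum[of j "{..m * n}" "\<lambda>j. \<bar>g n j\<bar>"] that abs_ge_self[of "g n j"] by auto
 have gi: "integrable lborel (\<lambda>s. indicator {0..<real m} s * g n (grid_index n s))"
 proof (rule Bochner_Integration.integrable_bound)
  show "integrable lborel (\<lambda>s. indicator {0..<real m} s * (\<Sum>j\<le>m * n. \<bar>g n j\<bar>))"
   by (intro integrable_mult_left integrable_real_indicator) (auto simp: emeasure_lborel_Ico divide_right_mono)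
  have "g n (grid_index n s) <= (\<Sum>j\<le>m * n. \<bar>g n j\<bar>)" if "0 <= s" "s < real m" for s
  proof (rule fin)
   have "s * real n <= real (m * n)" using that by (simp add: mult_right_mono)
   thus "grid_index n s <= m * n" unfolding grid_index_def by (metis floor_mono floor_of_nat nat_le_iff)
  qed
  thus "AE s in lborel. norm (indicator {0..<real m} s * g n (grid_index n s)) <=
    norm (indicator {0..<real m} s * (\<Sum>j\<le>m * n. \<bar>g n j\<bar>))"
   using g by (intro AE_I2) (auto simp: indicator_def abs_mult intro: order.trans[OF _ abs_ge_self])
 qed auto
 have "(LINT s|lborel. ?f n s) <= (LINT s|lborel. indicator {0..<real m} s * g n (grid_index n s))"
  by (rule integral_mono'[OF gi]) (use g HR in "auto simp: indicator_def")
 thus "(LINT s|lborel. ?f n s) <= (\<Sum>j<m * n. g n j) / real n" unfolding grid_integral[OF `0 < n`] .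
qed

text \<open>The lower estimate for \<open>R - g\<close> and \<open>R - H\<close>.\<close>

lemma grid_limit_upper:
 fixes g :: "nat => nat => real" and H :: "real => real"
 assumes g: "\<And>n j. 0 <= g n j" "\<And>n j. g n j <= R" and H[measurable]: "H \<in> borel_measurable borel"
  and HR: "\<And>s. 0 <= H s" "\<And>s. H s <= R"
  and ev: "AE s in lborel. 0 < s --> s < real m --> (EV n. g n (grid_index n s) <= H s)"
 shows "\<exists>hi. hi \<longlonglongrightarrow> (LINT s|lborel. indicator {0..<real m} s * H s) \<and>
  (\<forall>n>0. (\<Sum>j<m * n. g n j) / real n <= hi n)"
proof -
 have "AE s in lborel. 0 < s --> s < real m --> (EV n. R - H s <= R - g n (grid_index n s))"
  using ev by eventually_elim (auto elim!: eventually_mono)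
 then obtain lo where lo: "lo \<longlonglongrightarrow> (LINT s|lborel. indicator {0..<real m} s * (R - H s))"
  "\<And>n. n > 0 ==> lo n <= (\<Sum>j<m * n. R - g n j) / real n" using grid_limit_lower[of "\<lambda>n j. R - g n j" "\<lambda>s. R - H s" R m] g HR by auto
 have ib: "integrable lborel (\<lambda>s. indicator {0..<real m} s * R)"
  by (intro integrable_mult_left integrable_real_indicator) (auto simp: emeasure_lborel_Ico divide_right_mono)
 have iH: "integrable lborel (\<lambda>s. indicator {0..<real m} s * H s)"
  by (rule Bochner_Integration.integrable_bound[OF ib]) (use HR in "auto simp: indicator_def intro!: AE_I2 order.trans[OF _ abs_ge_self]")
 have "(LINT s|lborel. indicator {0..<real m} s * (R - H s)) = real m * R - (LINT s|lborel. indicator {0..<real m} s * H s)"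
  unfolding right_diff_distrib by (subst Bochner_Integration.integral_diff[OF ib iH]) simp
 hence "(\<lambda>n. real m * R - lo n) \<longlonglongrightarrow> real m * R - (real m * R - (LINT s|lborel. indicator {0..<real m} s * H s))"
  using lo(1) by (intro tendsto_intros) simp
 moreover have "(\<Sum>j<m * n. g n j) / real n <= real m * R - lo n" if "n > 0" for n
  using lo(2)[OF that] that by (simp add: sum_subtractf diff_divide_distrib)
 ultimately show ?thesis by (intro exI[of _ "\<lambda>n. real m * R - lo n"]) auto
qed

section \<open>Limits of chain sums along one path\<close>

context rr_path
begin

abbreviation "live c n \<equiv> alive (euler_step \<delta> b (1 / real n)) c (v 0) (increments n \<xi>)"

text \<open>For each horizon \<open>m\<close> and each size \<open>1 / real (Suc k)\<close> the
  modulus leaves a finite set of possible jump times; their union is countable.\<close>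

lemma left_continuous_ae:
 obtains D where "countable D"
  "\<And>s e. 0 < s ==> s \<notin> D ==> 0 < e ==> \<exists>d>0. \<forall>u. 0 <= u --> s - d < u --> u <= s --> \<bar>\<xi> s - \<xi> u\<bar> < e"
proof -
 have "\<exists>C. finite C \<and> (\<exists>h>0. \<forall>s u. 0 <= s --> s <= u --> u <= real m --> u - s < h -->
   {s<..u} \<inter> C = {} --> \<bar>\<xi> u - \<xi> s\<bar> < 1 / real (Suc k))" for m k by (rule cadlag_modulus[OF cad no_up, of "1 / real (Suc k)" "real m"]) (simp, blast)
 then obtain C where C: "\<And>m k. finite (C m k)"
  "\<And>m k. \<exists>h>0. \<forall>s u. 0 <= s --> s <= u --> u <= real m --> u - s < h -->
   {s<..u} \<inter> C m k = {} --> \<bar>\<xi> u - \<xi> s\<bar> < 1 / real (Suc k)" by metis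
 have "\<exists>d>0. \<forall>u. 0 <= u --> s - d < u --> u <= s --> \<bar>\<xi> s - \<xi> u\<bar> < e"
  if s: "0 < s" "s \<notin> (\<Union>m k. C m k)" and e: "0 < e" for s e
 proof -
  obtain k where k: "1 / real (Suc k) < e" using e nat_approx_posE by blast
  obtain m where m: "s <= real m" using real_arch_simple by blast
  obtain h where h: "0 < h" "\<And>s u. 0 <= s ==> s <= u ==> u <= real m ==> u - s < h ==>
   {s<..u} \<inter> C m k = {} ==> \<bar>\<xi> u - \<xi> s\<bar> < 1 / real (Suc k)" using C(2)[of m k] by metis
  obtain r where r: "0 < r" "\<And>c. c \<in> C m k ==> c \<noteq> s ==> r <= dist s c" using finite_set_avoid[OF C(1)[of m k], of s] by blast
  show ?thesis
  proof (intro exI[of _ "min h r"] conjI allI impI)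
   show "0 < min h r" using h r by simp
   fix u assume u: "0 <= u" "s - min h r < u" "u <= s"
   have "c \<notin> {u<..s}" if "c \<in> C m k" for c using r(2)[OF that] s that u by (cases "c = s") (auto simp: dist_real_def)
   hence "{u<..s} \<inter> C m k = {}" by blast
   hence "\<bar>\<xi> s - \<xi> u\<bar> < 1 / real (Suc k)" using u m by (intro h(2)) auto
   thus "\<bar>\<xi> s - \<xi> u\<bar> < e" using k by simp
  qed
 qed
 moreover have "countable (\<Union>m k. C m k)" using C(1) by (intro countable_UN) (auto intro: countable_finite)
 ultimately show ?thesis using that by blast
qed

lemma path_left_continuous_ae:
 obtains D where "countable D"
  "\<And>s e. 0 < s ==> s \<notin> D ==> 0 < e ==> \<exists>d>0. \<forall>u. 0 <= u --> s - d < u --> u <= s --> \<bar>v s - v u\<bar> < e"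
proof (rule left_continuous_ae)
 fix D assume D: "countable D"
  "\<And>s e. 0 < s ==> s \<notin> D ==> 0 < e ==> \<exists>d>0. \<forall>u. 0 <= u --> s - d < u --> u <= s --> \<bar>\<xi> s - \<xi> u\<bar> < e"
 have "\<exists>d>0. \<forall>u. 0 <= u --> s - d < u --> u <= s --> \<bar>v s - v u\<bar> < e"
  if s: "0 < s" "s \<notin> D" "0 < e" for s e
 proof -
  obtain d where d: "0 < d" "\<And>u. 0 <= u ==> s - d < u ==> u <= s ==> \<bar>\<xi> s - \<xi> u\<bar> < e / 2" using D(2)[OF s(1,2), of "e/2"] s(3) by auto
  show ?thesis
  proof (intro exI[of _ "min d (e / (2 * (\<delta> + 1)))"] conjI allI impI)
   show "0 < min d (e / (2 * (\<delta> + 1)))" using d(1) s(3) \<delta>_nonneg by simp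
   fix u assume u: "0 <= u" "s - min d (e / (2 * (\<delta> + 1))) < u" "u <= s"
   have "\<forall>w\<in>{u..s}. \<bar>\<xi> s - \<xi> w\<bar> <= e / 2"
   proof
    fix w assume "w \<in> {u..s}"
    hence "\<bar>\<xi> s - \<xi> w\<bar> < e / 2" using u by (intro d(2)) auto
    thus "\<bar>\<xi> s - \<xi> w\<bar> <= e / 2" by simp
   qed
   hence "\<bar>v s - v u\<bar> <= e / 2 + \<delta> * (s - u)" using path_diff u by blast
   moreover have "\<delta> * (s - u) < e / 2"
   proof -
    have "\<delta> * (s - u) <= (\<delta> + 1) * (s - u)" using u by (simp add: algebra_simps)
    also have "\<dots> < (\<delta> + 1) * (e / (2 * (\<delta> + 1)))" using u \<delta>_nonneg by (intro mult_strict_left_mono) auto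
    also have "\<dots> = e / 2" using \<delta>_nonneg by (simp add: field_simps)
    finally show ?thesis .
   qed
   ultimately show "\<bar>v s - v u\<bar> < e" by linarith
  qed
 qed
 thus thesis using that[OF D(1)] by blast
qed

lemma path_right_continuous:
 assumes "0 <= s" "0 < e"
 obtains d where "0 < d" "\<And>u. s <= u ==> u < s + d ==> \<bar>v u - v s\<bar> < e"
proof -
 obtain d where d: "0 < d" "\<And>u. s <= u ==> u < s + d ==> \<bar>\<xi> u - \<xi> s\<bar> < e / 4" using cadlag_right[OF cad `0 <= s`, of "e/4"] assms by auto
 show ?thesis
 proof (rule that[of "min d (e / (2 * (\<delta> + 1)))"])
  show "0 < min d (e / (2 * (\<delta> + 1)))" using d(1) assms \<delta>_nonneg by simp
  fix u assume u: "s <= u" "u < s + min d (e / (2 * (\<delta> + 1)))"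
  have "\<forall>w\<in>{s..u}. \<bar>\<xi> u - \<xi> w\<bar> <= e / 2"
  proof
   fix w assume "w \<in> {s..u}"
   hence "\<bar>\<xi> w - \<xi> s\<bar> < e / 4" "\<bar>\<xi> u - \<xi> s\<bar> < e / 4" using u by (intro d(2); auto)+
   thus "\<bar>\<xi> u - \<xi> w\<bar> <= e / 2" by linarith
  qed
  hence "\<bar>v u - v s\<bar> <= e / 2 + \<delta> * (u - s)" using path_diff u assms by blast
  moreover have "\<delta> * (u - s) < e / 2"
  proof -
   have "\<delta> * (u - s) <= (\<delta> + 1) * (u - s)" using u by (simp add: algebra_simps)
   also have "\<dots> < (\<delta> + 1) * (e / (2 * (\<delta> + 1)))" using u \<delta>_nonneg by (intro mult_strict_left_mono) auto
   also have "\<dots> = e / 2" using \<delta>_nonneg by (simp add: field_simps)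
   finally show ?thesis .
  qed
  ultimately show "\<bar>v u - v s\<bar> < e" by linarith
 qed
qed

text \<open>Measurability in time comes from continuity off a countable set. The argument is cut at
  0 because \<open>v\<close> is arbitrary at negative times.\<close>

lemma path_measurable: "(\<lambda>s. v (max 0 s)) \<in> borel_measurable borel"
proof (rule path_left_continuous_ae)
 fix D assume D: "countable D"
  "\<And>s e. 0 < s ==> s \<notin> D ==> 0 < e ==> \<exists>d>0. \<forall>u. 0 <= u --> s - d < u --> u <= s --> \<bar>v s - v u\<bar> < e"
 have "continuous (at s) (\<lambda>s. v (max 0 s))" if "s \<notin> D" for s unfolding continuous_at_eps_delta
 proof (intro allI impI)
  fix e :: real assume e: "0 < e"
  obtain d1 where d1: "0 < d1" "\<And>u. max 0 s <= u ==> u < max 0 s + d1 ==> \<bar>v u - v (max 0 s)\<bar> < e"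
   using path_right_continuous[of "max 0 s" e] e by auto
  obtain d2 where d2: "0 < d2" "\<And>u. 0 <= u ==> s - d2 < u ==> u <= s ==> \<bar>v s - v u\<bar> < e \<or> s <= 0"
  proof (cases "0 < s")
   case True
   thus ?thesis using D(2)[OF True `s \<notin> D` e] that by blast
  next
   case False
   thus ?thesis using that[of 1] by simp
  qed
  show "\<exists>d>0. \<forall>x'. dist x' s < d --> dist (v (max 0 x')) (v (max 0 s)) < e"
  proof (intro exI[of _ "min d1 d2"] conjI allI impI)
   show "0 < min d1 d2" using d1 d2 by simp
   fix x' assume x: "dist x' s < min d1 d2"
   show "dist (v (max 0 x')) (v (max 0 s)) < e"
   proof (cases "max 0 s <= max 0 x'")
    case True
    have "max 0 x' < max 0 s + d1" using x d1(1) by (auto simp: dist_real_def max_def abs_if split: if_splits)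
    thus ?thesis using d1(2)[OF True] by (simp add: dist_real_def)
   next
    case False
    hence "0 < s" "max 0 x' <= s" by auto
    thus ?thesis using d2(2)[of "max 0 x'"] x by (auto simp: dist_real_def abs_minus_commute)
   qed
  qed
 qed
 hence "continuous_on (- D) (\<lambda>s. v (max 0 s))" by (auto intro: continuous_at_imp_continuous_on)
 thus ?thesis by (rule borel_measurable_continuous_countable_exceptions[OF D(1)])
qed

text \<open>The grid point below \<open>s\<close> may sample the path just before \<open>s\<close>,
  so the jump times of the path have to be left out; they form a countable set.\<close>

lemma euler_tendsto:
 obtains D where "countable D" "\<And>s. 0 < s ==> s \<notin> D ==> (\<lambda>n. E n (grid_index n s)) \<longlonglongrightarrow> v s"
proof (rule path_left_continuous_ae)
 fix D assume D: "countable D"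
  "\<And>s e. 0 < s ==> s \<notin> D ==> 0 < e ==> \<exists>d>0. \<forall>u. 0 <= u --> s - d < u --> u <= s --> \<bar>v s - v u\<bar> < e"
 have "(\<lambda>n. E n (grid_index n s)) \<longlonglongrightarrow> v s" if s: "0 < s" "s \<notin> D" for s
 proof (rule tendstoI)
  fix e :: real assume e: "0 < e"
  hence "0 < e / 2" by simp
  obtain d where d: "0 < d" "\<And>u. 0 <= u ==> s - d < u ==> u <= s ==> \<bar>v s - v u\<bar> < e / 2" using D(2)[OF s `0 < e / 2`] by blast
  have "EV n. 1 / real n < d" using order_tendstoD(2)[OF lim_1_over_n d(1)] .
  with euler_close[OF `0 < e / 2`, of s] eventually_gt_at_top[of 0]
  show "EV n. dist (E n (grid_index n s)) (v s) < e"
  proof eventually_elim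
   case (elim n)
   have le: "real (grid_index n s) / real n <= s" "s < real (grid_index n s) / real n + 1 / real n" using grid_index_le grid_index_gt s elim by auto
   have "\<bar>v s - v (real (grid_index n s) / real n)\<bar> < e / 2" using le elim by (intro d(2)) auto
   moreover have "\<bar>E n (grid_index n s) - v (real (grid_index n s) / real n)\<bar> <= e / 2" using elim(1) le(1) by blast
   ultimately show ?case by (simp add: dist_real_def abs_if split: if_splits)
  qed
 qed
 thus thesis using that[OF D(1)] by blast
qed

text \<open>The chain is stopped at \<open>a + \<eta>\<close> and its error is at most \<eta>.
  Asymptotically its exit therefore comes no earlier than the passage of V above \<open>a\<close>
  and, by \<open>not_alive_eventually\<close>, no later than the passage above
  \<open>a + 2 * \<eta>\<close>.\<close>

lemma alive_eventually:
 assumes "0 < \<eta>" "v 0 <= a" "0 <= s" "ereal s < passage_above a v"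
 shows "EV n. live (a + \<eta>) n (grid_index n s)"
 using euler_close[OF `0 < \<eta>`, of s] eventually_gt_at_top[of 0]
proof eventually_elim
 case (elim n)
 have le: "real (grid_index n s) / real n <= s" using grid_index_le assms elim by auto
 show ?case unfolding alive_def
 proof (intro allI impI)
  fix k assume "k <= grid_index n s"
  hence "real k / real n <= real (grid_index n s) / real n" by (intro divide_right_mono) auto
  hence ks: "real k / real n <= s" using le by simp
  have "v (real k / real n) <= a"
  proof (cases "k = 0")
   case False
   hence "0 < real k / real n" using elim by simp
   moreover have "ereal (real k / real n) < passage_above a v" using assms(4) ks by (metis ereal_less_eq(3) le_less_trans)
   ultimately show ?thesis using not_before_first_time_after[of 0 "real k / real n" "\<lambda>t. a < v t"] unfolding passage_above_def by simp
  qed (use assms in simp)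
  moreover have "\<bar>E n k - v (real k / real n)\<bar> <= \<eta>" using elim ks by blast
  ultimately show "E n k <= a + \<eta>" by linarith
 qed
qed

lemma not_alive_eventually:
 assumes "0 < \<eta>" "passage_above (a + 2 * \<eta>) v < ereal s"
 shows "EV n. \<not> live (a + \<eta>) n (grid_index n s)"
proof -
 obtain t where t: "0 < t" "a + 2 * \<eta> < v t" "t < s"
  using first_time_after_approx[of 0 "\<lambda>t. a + 2 * \<eta> < v t" "ereal s"] assms unfolding passage_above_def by auto
 define e where "e = v t - (a + 2 * \<eta>)"
 have "0 < e" using t by (simp add: e_def)
 obtain d where d: "0 < d" "\<And>u. t <= u ==> u < t + d ==> \<bar>v u - v t\<bar> < e" using path_right_continuous[of t e] t `0 < e` by auto
 have "0 < min d (s - t)" using t d by simp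
 hence "EV n. 1 / real n < min d (s - t)" using order_tendstoD(2)[OF lim_1_over_n] by blast
 with euler_close[OF `0 < \<eta>`, of s] eventually_gt_at_top[of 0]
 show ?thesis
 proof eventually_elim
  case (elim n)
  define k where "k = Suc (grid_index n t)"
  have k: "real k / real n = real (grid_index n t) / real n + 1 / real n" by (simp add: k_def add_divide_distrib)
  have tk: "t < real k / real n" "real k / real n <= t + 1 / real n" unfolding k using grid_index_le[of t n] grid_index_gt[of t n] t elim by auto
  have ks: "real k / real n < s" using tk elim by auto
  have "k <= grid_index n s"
  proof -
   have "real k <= s * real n" using ks elim by (simp add: divide_less_eq)
   thus ?thesis unfolding grid_index_def by (metis le_nat_floor)
  qed
  moreover have "\<bar>v (real k / real n) - v t\<bar> < e" using tk elim by (intro d(2)) auto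
  moreover have "\<bar>E n k - v (real k / real n)\<bar> <= \<eta>" using elim ks by auto
  ultimately have "\<not> E n k <= a + \<eta>" by (auto simp: e_def)
  thus ?case using `k <= grid_index n s` unfolding alive_def by blast
 qed
qed

lemma AE_not_in_countable:
 fixes D :: "real set"
 assumes "countable D"
 shows "AE s in lborel. s \<notin> D" using countable_imp_null_set_lborel[OF assms] by (rule AE_not_in)

text \<open>Off \<open>b\<close> the weight is locally constant, so convergence of the chain makes
  the weights eventually equal; \<open>null\<close> removes the times at which V sits at
  \<open>b\<close>, where the weight may jump.\<close>

lemma weight_limit_lower:
 assumes "0 < \<eta>" "v 0 <= a" and rate[measurable]: "rate \<in> borel_measurable borel"
  and R: "\<And>u. 0 <= rate u" "\<And>u. rate u <= R"
  and loc: "\<And>u. u \<noteq> b ==> \<forall>\<^sub>F w in nhds u. rate w = rate u"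
  and null: "AE s in lborel. 0 < s --> ereal s < passage_above a v --> v s \<noteq> b"
 shows "\<exists>lo. lo \<longlonglongrightarrow> (LINT s|lborel. indicator {0..<real m} s *
    (if ereal s < passage_above a v then rate (v (max 0 s)) else 0)) \<and>
  (\<forall>n>0. lo n <= (\<Sum>j<m * n. if live (a + \<eta>) n j
    then rate (E n j) else 0) / real n)"
proof (rule grid_limit_lower[where R=R])
 note path_measurable[measurable]
 show "(\<lambda>s. if ereal s < passage_above a v then rate (v (max 0 s)) else 0) \<in> borel_measurable borel" by measurable
 obtain D where D: "countable D" "\<And>s. 0 < s ==> s \<notin> D ==> (\<lambda>n. E n (grid_index n s)) \<longlonglongrightarrow> v s" using euler_tendsto by blast
 show "AE s in lborel. 0 < s --> s < real m --> (EV n.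
   (if ereal s < passage_above a v then rate (v (max 0 s)) else 0)
   <= (if live (a + \<eta>) n (grid_index n s)
    then rate (E n (grid_index n s)) else 0))" using null AE_not_in_countable[OF D(1)]
 proof eventually_elim
  case (elim s)
  show ?case
  proof (intro impI)
   assume s: "0 < s"
   show "EV n.
    (if ereal s < passage_above a v then rate (v (max 0 s)) else 0)
    <= (if live (a + \<eta>) n (grid_index n s)
     then rate (E n (grid_index n s)) else 0)"
   proof (cases "ereal s < passage_above a v")
    case True
    have "EV n. rate (E n (grid_index n s)) = rate (v s)"
     using loc[of "v s"] D(2)[OF s elim(2)] elim(1) s True unfolding filterlim_def le_filter_def eventually_filtermap by blast
    with alive_eventually[OF assms(1,2) less_imp_le[OF s] True] show ?thesis by eventually_elim (use s R in auto)
   qed (auto simp: R)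
  qed
 qed
 have "0 <= R" using R(1)[of 0] R(2)[of 0] by linarith
 thus "(if ereal s < passage_above a v then rate (v (max 0 s)) else 0) <= R" for s using R by auto
qed (use R in auto)

lemma weight_limit_upper:
 assumes "0 < \<eta>" and rate[measurable]: "rate \<in> borel_measurable borel"
  and R: "\<And>u. 0 <= rate u" "\<And>u. rate u <= R"
  and loc: "\<And>u. u \<noteq> b ==> \<forall>\<^sub>F w in nhds u. rate w = rate u"
  and null: "AE s in lborel. 0 < s --> ereal s <= passage_above (a + 2 * \<eta>) v --> v s \<noteq> b"
 shows "\<exists>hi. hi \<longlonglongrightarrow> (LINT s|lborel. indicator {0..<real m} s *
    (if ereal s <= passage_above (a + 2 * \<eta>) v then rate (v (max 0 s)) else 0)) \<and>
  (\<forall>n>0. (\<Sum>j<m * n. if live (a + \<eta>) n j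
    then rate (E n j) else 0) / real n <= hi n)"
proof (rule grid_limit_upper[where R=R])
 note path_measurable[measurable]
 show "(\<lambda>s. if ereal s <= passage_above (a + 2 * \<eta>) v then rate (v (max 0 s)) else 0) \<in> borel_measurable borel" by measurable
 obtain D where D: "countable D" "\<And>s. 0 < s ==> s \<notin> D ==> (\<lambda>n. E n (grid_index n s)) \<longlonglongrightarrow> v s" using euler_tendsto by blast
 show "AE s in lborel. 0 < s --> s < real m --> (EV n.
   (if live (a + \<eta>) n (grid_index n s)
    then rate (E n (grid_index n s)) else 0)
   <= (if ereal s <= passage_above (a + 2 * \<eta>) v then rate (v (max 0 s)) else 0))" using null AE_not_in_countable[OF D(1)]
 proof eventually_elim
  case (elim s)
  show ?case
  proof (intro impI)
   assume s: "0 < s"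
   show "EV n.
    (if live (a + \<eta>) n (grid_index n s)
     then rate (E n (grid_index n s)) else 0)
    <= (if ereal s <= passage_above (a + 2 * \<eta>) v then rate (v (max 0 s)) else 0)"
   proof (cases "ereal s <= passage_above (a + 2 * \<eta>) v")
    case True
    have "EV n. rate (E n (grid_index n s)) = rate (v s)"
     using loc[of "v s"] D(2)[OF s elim(2)] elim(1) s True unfolding filterlim_def le_filter_def eventually_filtermap by blast
    thus ?thesis by eventually_elim (use s True R in auto)
   next
    case False
    hence "passage_above (a + 2 * \<eta>) v < ereal s" by simp
    from not_alive_eventually[OF assms(1) this] show ?thesis by eventually_elim (use False in auto)
   qed
  qed
 qed
 have "0 <= R" using R(1)[of 0] R(2)[of 0] by linarith
 thus "(if ereal s <= passage_above (a + 2 * \<eta>) v then rate (v (max 0 s)) else 0) <= R"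
  and "(if live (a + \<eta>) n j
    then rate (E n j) else 0) <= R" for s n j using R by auto
qed (use R in auto)

text \<open>Bounds the time V spends exactly at \<open>b\<close> by the time of the chain in any
  window around \<open>b\<close>. From this the assumption \<open>null\<close> of the two preceding
  lemmas will be derived.\<close>

lemma occupation_limit_lower:
 assumes "0 < \<eta>" "v 0 <= a" "0 < r"
 shows "\<exists>lo. lo \<longlonglongrightarrow> (LINT s|lborel. indicator {0..<real m} s *
    (if ereal s < passage_above a v \<and> v (max 0 s) = b then 1 else 0)) \<and>
  (\<forall>n>0. lo n <= (\<Sum>j<m * n. if live (a + \<eta>) n j
    \<and> \<bar>E n j - b\<bar> <= r then 1 else 0) / real n)"
proof (rule grid_limit_lower[where R=1])
 note path_measurable[measurable]
 show "(\<lambda>s. if ereal s < passage_above a v \<and> v (max 0 s) = b then 1 else 0 :: real) \<in> borel_measurable borel" by measurable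
 obtain D where D: "countable D" "\<And>s. 0 < s ==> s \<notin> D ==> (\<lambda>n. E n (grid_index n s)) \<longlonglongrightarrow> v s" using euler_tendsto by blast
 show "AE s in lborel. 0 < s --> s < real m --> (EV n.
   (if ereal s < passage_above a v \<and> v (max 0 s) = b then 1 else 0 :: real)
   <= (if live (a + \<eta>) n (grid_index n s)
    \<and> \<bar>E n (grid_index n s) - b\<bar> <= r then 1 else 0))" using AE_not_in_countable[OF D(1)]
 proof eventually_elim
  case (elim s)
  show ?case
  proof (intro impI)
   assume s: "0 < s"
   show "EV n.
    (if ereal s < passage_above a v \<and> v (max 0 s) = b then 1 else 0 :: real)
    <= (if live (a + \<eta>) n (grid_index n s)
     \<and> \<bar>E n (grid_index n s) - b\<bar> <= r then 1 else 0)"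
   proof (cases "ereal s < passage_above a v \<and> v s = b")
    case True
    hence T: "ereal s < passage_above a v" by simp
    have "EV n. dist (E n (grid_index n s)) b < r" using tendstoD[OF D(2)[OF s elim] `0 < r`] True by simp
    with alive_eventually[OF assms(1,2) less_imp_le[OF s] T] show ?thesis by eventually_elim (auto simp: dist_real_def)
   qed (use s in auto)
  qed
 qed
qed auto

end

section \<open>Independence: integrating out the next step of the chain\<close>

lemma (in prob_space) indep_var_expectation:
 fixes f :: "_ => real"
 assumes ind: "indep_var N1 A N2 Z" and f[measurable]: "f \<in> borel_measurable (N1 \<Otimes>\<^sub>M N2)"
  and int: "integrable M (\<lambda>w. f (A w, Z w))"
 shows "(EE w. f (A w, Z w)) = (EE w. (EE w'. f (A w, Z w')))"
proof -
 have A[measurable]: "A \<in> measurable M N1" and Z[measurable]: "Z \<in> measurable M N2" using ind indep_var_rv1 indep_var_rv2 by auto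
 have eq: "distr M N1 A \<Otimes>\<^sub>M distr M N2 Z = distr M (N1 \<Otimes>\<^sub>M N2) (\<lambda>w. (A w, Z w))" using ind unfolding indep_var_distribution_eq by auto
 interpret D1: prob_space "distr M N1 A" by (rule prob_space_distr) measurable
 interpret D2: prob_space "distr M N2 Z" by (rule prob_space_distr) measurable
 interpret P: pair_prob_space "distr M N1 A" "distr M N2 Z" ..
 have "integrable (distr M (N1 \<Otimes>\<^sub>M N2) (\<lambda>w. (A w, Z w))) f" by (subst integrable_distr_eq) (use int in auto)
 hence i: "integrable (distr M N1 A \<Otimes>\<^sub>M distr M N2 Z) f" unfolding eq .
 have "(EE w. f (A w, Z w)) = (\<integral>p. f p \<partial>distr M (N1 \<Otimes>\<^sub>M N2) (\<lambda>w. (A w, Z w)))" by (subst integral_distr) auto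
 also have "\<dots> = (\<integral>y. (\<integral>z. f (y, z) \<partial>distr M N2 Z) \<partial>distr M N1 A)" unfolding eq[symmetric] by (rule P.integral_fst'[OF i, symmetric])
 also have "\<dots> = (\<integral>y. (\<integral>w'. f (y, Z w') \<partial>M) \<partial>distr M N1 A)"
  by (intro Bochner_Integration.integral_cong refl integral_distr) (auto simp: space_pair_measure)
 also have "\<dots> = (\<integral>w. (\<integral>w'. f (A w, Z w') \<partial>M) \<partial>M)" by (subst integral_distr) auto
 finally show ?thesis .
qed

lemma (in prob_space) abs_expectation_le:
 fixes f :: "_ => real"
 assumes "\<And>w. \<bar>f w\<bar> <= B"
 shows "\<bar>expectation f\<bar> <= B"
proof -
 have "0 <= B" using assms[of undefined] by linarith
 have "norm (expectation f) <= (EE w. norm (f w))" by (rule integral_norm_bound)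
 also have "\<dots> <= (EE _. B)" by (rule integral_mono') (use assms `0 <= B` in auto)
 finally show ?thesis by (simp add: prob_space)
qed

lemma measurable_frozen:
 assumes [measurable]: "(\<lambda>p. \<phi> (fst p) (snd p)) \<in> borel_measurable (borel \<Otimes>\<^sub>M borel)" "\<kappa> \<in> borel_measurable borel"
  and \<zeta>: "\<And>j. j < i ==> (\<lambda>w. \<zeta> w j) \<in> borel_measurable N"
 shows "(\<lambda>w. frozen \<phi> \<kappa> a x (\<zeta> w) i) \<in> N \<rightarrow>\<^sub>M borel \<Otimes>\<^sub>M borel" using \<zeta>
proof (induction i)
 case (Suc i)
 hence [measurable]: "(\<lambda>w. frozen \<phi> \<kappa> a x (\<zeta> w) i) \<in> N \<rightarrow>\<^sub>M borel \<Otimes>\<^sub>M borel"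
  "(\<lambda>w. \<zeta> w i) \<in> borel_measurable N" by auto
 have "(\<lambda>w. \<phi> (fst (frozen \<phi> \<kappa> a x (\<zeta> w) i)) (\<zeta> w i)) \<in> borel_measurable N"
  by (rule measurable_compose[OF _ assms(1), of "\<lambda>w. (fst (frozen \<phi> \<kappa> a x (\<zeta> w) i), \<zeta> w i)", simplified]) measurable
 note [measurable] = this
 show ?case unfolding frozen.simps case_prod_unfold Let_def by measurable
qed simp

lemma frozen_cong:
 assumes "\<And>j. j < i ==> \<zeta> j = \<zeta>' j"
 shows "frozen \<phi> \<kappa> a x \<zeta> i = frozen \<phi> \<kappa> a x \<zeta>' i" using assms
proof (induction i)
 case (Suc i)
 hence "frozen \<phi> \<kappa> a x \<zeta> i = frozen \<phi> \<kappa> a x \<zeta>' i" "\<zeta> i = \<zeta>' i" by simp_all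
 thus ?case by (simp add: case_prod_unfold Let_def)
qed simp

lemma frozen_bounds:
 assumes "\<forall>u z. u <= a --> \<phi> u z <= a + 1" "x <= a + 1" "\<And>u. 0 <= \<kappa> u" "\<And>u. \<kappa> u <= 1"
 shows "fst (frozen \<phi> \<kappa> a x \<zeta> i) <= a + 1" "0 <= snd (frozen \<phi> \<kappa> a x \<zeta> i)" "snd (frozen \<phi> \<kappa> a x \<zeta> i) <= 1"
proof -
 have "fst (frozen \<phi> \<kappa> a x \<zeta> i) <= a + 1 \<and> 0 <= snd (frozen \<phi> \<kappa> a x \<zeta> i) \<and> snd (frozen \<phi> \<kappa> a x \<zeta> i) <= 1"
 proof (induction i)
  case 0
  thus ?case using assms by simp
 next
  case (Suc i)
  obtain u k where uk: "frozen \<phi> \<kappa> a x \<zeta> i = (u, k)" by fastforce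
  show ?case
  proof (cases "a < u")
   case True
   thus ?thesis using Suc uk by simp
  next
   case False
   have "\<phi> u (\<zeta> i) <= a + 1" using assms(1) False by simp
   thus ?thesis using Suc uk False assms(3,4)[of u] by (simp add: mult_le_one)
  qed
 qed
 thus "fst (frozen \<phi> \<kappa> a x \<zeta> i) <= a + 1" "0 <= snd (frozen \<phi> \<kappa> a x \<zeta> i)" "snd (frozen \<phi> \<kappa> a x \<zeta> i) <= 1" by auto
qed

context levy_process
begin

abbreviation incs :: "nat => 'w => nat => real" where
 "incs n w \<equiv> increments n (\<lambda>t. X t w)"

lemma measurable_incs [measurable]: "(\<lambda>w. incs n w i) \<in> borel_measurable M" unfolding increments_def
 by (intro borel_measurable_diff random_variable_X divide_nonneg_nonneg) auto

lemma indep_incs: "indep_vars (\<lambda>_. borel) (\<lambda>i w. incs n w i) {..<N}" using independent_increments[of "\<lambda>k. real k / real n" N]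
 unfolding increments_def by (simp add: mono_def divide_right_mono)

lemma distr_incs: "distr M borel (\<lambda>w. incs n w i) = distr M borel (X (1 / real n))"
proof -
 have "real (Suc i) / real n - real i / real n = 1 / real n" by (simp add: add_divide_distrib)
 thus ?thesis using stationary_increments[of "real i / real n" "real (Suc i) / real n"] unfolding increments_def by (simp add: divide_right_mono)
qed

lemma expectation_incs:
 fixes f :: "real => real"
 assumes [measurable]: "f \<in> borel_measurable borel"
 shows "(EE w. f (incs n w i)) = (EE w. f (X (1 / real n) w))"
proof -
 have [measurable]: "X (1 / real n) \<in> borel_measurable M" by (rule random_variable_X) simp
 have "(EE w. f (incs n w i)) = (\<integral>z. f z \<partial>distr M borel (\<lambda>w. incs n w i))" by (subst integral_distr) auto
 also have "\<dots> = (EE w. f (X (1 / real n) w))" unfolding distr_incs by (subst integral_distr) auto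
 finally show ?thesis .
qed

text \<open>The state after \<open>i\<close> steps is a function of the increments below
  \<open>i\<close>, hence independent of increment \<open>i\<close>. Both are written through
  restrictions to disjoint index sets so that independence of blocks applies.\<close>

lemma frozen_incs_expectation:
 fixes H :: "(real \<times> real) \<times> real => real"
 assumes \<phi>[measurable]: "(\<lambda>p. \<phi> (fst p) (snd p)) \<in> borel_measurable (borel \<Otimes>\<^sub>M borel)" "\<kappa> \<in> borel_measurable borel"
  and H[measurable]: "H \<in> borel_measurable ((borel \<Otimes>\<^sub>M borel) \<Otimes>\<^sub>M borel)"
  and int: "integrable M (\<lambda>w. H (frozen \<phi> \<kappa> a x (incs n w) i, incs n w i))"
 shows "(EE w. H (frozen \<phi> \<kappa> a x (incs n w) i, incs n w i)) =
  (EE w. (EE w'. H (frozen \<phi> \<kappa> a x (incs n w) i, incs n w' i)))"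
proof -
 have ind: "indep_var (PiM {..<i} (\<lambda>_. borel)) (\<lambda>w. restrict (\<lambda>j. incs n w j) {..<i})
   (PiM {i} (\<lambda>_. borel)) (\<lambda>w. restrict (\<lambda>j. incs n w j) {i})" by (rule indep_var_restrict[OF indep_incs[of n "Suc i"]]) auto
 have m1[measurable]: "(\<lambda>\<zeta>. frozen \<phi> \<kappa> a x \<zeta> i) \<in> PiM {..<i} (\<lambda>_. borel) \<rightarrow>\<^sub>M borel \<Otimes>\<^sub>M borel" by (rule measurable_frozen) (use \<phi> in auto)
 have m2[measurable]: "(\<lambda>\<zeta>. \<zeta> i) \<in> PiM {i} (\<lambda>_. borel) \<rightarrow>\<^sub>M (borel :: real measure)" by measurable
 define f where "f = (\<lambda>p :: (nat => real) \<times> (nat => real). H (frozen \<phi> \<kappa> a x (fst p) i, snd p i))"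
 have f: "f \<in> borel_measurable (PiM {..<i} (\<lambda>_. borel) \<Otimes>\<^sub>M PiM {i} (\<lambda>_. borel))" unfolding f_def by measurable
 have e: "frozen \<phi> \<kappa> a x (restrict (incs n w) {..<i}) i = frozen \<phi> \<kappa> a x (incs n w) i" for w by (rule frozen_cong) auto
 have fe: "f (restrict (incs n w) {..<i}, restrict (incs n w') {i}) = H (frozen \<phi> \<kappa> a x (incs n w) i, incs n w' i)" for w w' by (simp add: f_def e)
 show ?thesis using indep_var_expectation[OF ind f] int by (simp add: fe)
qed

text \<open>The discrete Dynkin formula for one step of the stopped and discounted chain; above
  \<open>a\<close> nothing moves. A bound on \<open>F\<close> up to \<open>a + 1\<close> suffices,
  since a step from below \<open>a\<close> ends there.\<close>

lemma frozen_increment: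
 fixes F :: "real => real" and n :: nat
 assumes \<phi>[measurable]: "(\<lambda>p. \<phi> (fst p) (snd p)) \<in> borel_measurable (borel \<Otimes>\<^sub>M borel)"
  and \<kappa>[measurable]: "\<kappa> \<in> borel_measurable borel" and F[measurable]: "F \<in> borel_measurable borel"
  and b: "\<forall>u z. u <= a --> \<phi> u z <= a + 1" "x <= a + 1" "\<And>u. 0 <= \<kappa> u" "\<And>u. \<kappa> u <= 1"
  and B_all: "\<forall>u\<le>a + 1. \<bar>F u\<bar> <= B"
 defines "V \<equiv> \<lambda>i w. fst (frozen \<phi> \<kappa> a x (incs n w) i)" and "K \<equiv> \<lambda>i w. snd (frozen \<phi> \<kappa> a x (incs n w) i)"
 defines "Q \<equiv> \<lambda>u. (EE w. F (\<phi> u (X (1 / real n) w)))"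
 shows "integrable M (\<lambda>w. K i w * F (V i w))"
  and "integrable M (\<lambda>w. indicator {..a} (V i w) * K i w * (\<kappa> (V i w) * Q (V i w) - F (V i w)))"
  and "(EE w. K (Suc i) w * F (V (Suc i) w)) = (EE w. K i w * F (V i w)) +
   (EE w. indicator {..a} (V i w) * K i w * (\<kappa> (V i w) * Q (V i w) - F (V i w)))"
proof -
 note B = B_all[rule_format]
 have S[measurable]: "(\<lambda>w. frozen \<phi> \<kappa> a x (incs n w) i) \<in> M \<rightarrow>\<^sub>M borel \<Otimes>\<^sub>M borel" for i by (rule measurable_frozen) measurable
 have [measurable]: "X (1 / real n) \<in> borel_measurable M" by (rule random_variable_X) simp
 have [measurable]: "V i \<in> borel_measurable M" "K i \<in> borel_measurable M" for i unfolding V_def K_def by measurable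
 have bd: "V i w <= a + 1" "0 <= K i w" "K i w <= 1" for i w unfolding V_def K_def using frozen_bounds[OF b(1,2), where \<kappa>=\<kappa>] b(3,4) by auto
 have B0: "0 <= B" using B[of "a + 1"] by linarith
 have KF: "\<bar>K i w * y\<bar> <= B" if "\<bar>y\<bar> <= B" for i w y using bd(2)[of i w] bd(3)[of i w] that B0 mult_mono[of "K i w" 1 "\<bar>y\<bar>" B] by (simp add: abs_mult)
 show i1: "integrable M (\<lambda>w. K i w * F (V i w))" for i by (rule integrable_const_bound[where B=B]) (use KF B bd in auto)
 have m\<phi>: "(\<lambda>p :: (real \<times> real) \<times> real. \<phi> (fst (fst p)) (snd p)) \<in> borel_measurable ((borel \<Otimes>\<^sub>M borel) \<Otimes>\<^sub>M borel)"
 proof -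
  have "(\<lambda>p :: (real \<times> real) \<times> real. (fst (fst p), snd p)) \<in> (borel \<Otimes>\<^sub>M borel) \<Otimes>\<^sub>M borel \<rightarrow>\<^sub>M borel \<Otimes>\<^sub>M borel" by measurable
  from measurable_compose[OF this \<phi>] show ?thesis by simp
 qed
 note [measurable] = m\<phi>
 define H where "H = (\<lambda>p :: (real \<times> real) \<times> real. if a < fst (fst p) then snd (fst p) * F (fst (fst p))
  else snd (fst p) * \<kappa> (fst (fst p)) * F (\<phi> (fst (fst p)) (snd p)))"
 have H[measurable]: "H \<in> borel_measurable ((borel \<Otimes>\<^sub>M borel) \<Otimes>\<^sub>M borel)" unfolding H_def by measurable
 have KS: "K (Suc i) w * F (V (Suc i) w) = H (frozen \<phi> \<kappa> a x (incs n w) i, incs n w i)" for w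
  unfolding H_def V_def K_def frozen.simps by (simp add: case_prod_unfold Let_def)
 have \<phi>2: "(\<lambda>w'. \<phi> u (Z w')) \<in> borel_measurable M" if [measurable]: "Z \<in> borel_measurable M" for u Z
  using measurable_compose[OF _ \<phi>, of "\<lambda>w. (u, Z w)" M] by simp
 have Q: "\<bar>Q u\<bar> <= B" if "u <= a" for u
 proof -
  have "\<bar>F (\<phi> u z)\<bar> <= B" for z using b(1) that by (intro B) simp
  thus ?thesis unfolding Q_def by (rule abs_expectation_le)
 qed

 have HQ: "(EE w'. H (frozen \<phi> \<kappa> a x (incs n w) i, incs n w' i)) =
   K i w * F (V i w) + indicator {..a} (V i w) * K i w * (\<kappa> (V i w) * Q (V i w) - F (V i w))" for w
 proof (cases "a < V i w")
  case True
  thus ?thesis by (simp add: H_def V_def K_def prob_space)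
 next
  case False
  have [measurable]: "(\<lambda>z. F (\<phi> (V i w) z)) \<in> borel_measurable borel" using measurable_compose[OF _ \<phi>, of "\<lambda>z. (V i w, z)" borel] by simp
  have "(EE w'. H (frozen \<phi> \<kappa> a x (incs n w) i, incs n w' i)) =
    (EE w'. K i w * \<kappa> (V i w) * F (\<phi> (V i w) (incs n w' i)))"
   using False by (intro Bochner_Integration.integral_cong refl) (simp add: H_def V_def K_def)
  also have "\<dots> = K i w * \<kappa> (V i w) * Q (V i w)" unfolding Q_def by (simp add: expectation_incs[of "\<lambda>z. F (\<phi> (V i w) z)"])
  finally show ?thesis using False by (simp add: algebra_simps)
 qed
 have "(\<lambda>p. F (\<phi> (fst p) (X (1 / real n) (snd p)))) \<in> borel_measurable (borel \<Otimes>\<^sub>M M)"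
  using measurable_compose[OF _ \<phi>, of "\<lambda>p. (fst p, X (1 / real n) (snd p))" "borel \<Otimes>\<^sub>M M"] by simp
 hence [measurable]: "Q \<in> borel_measurable borel" unfolding Q_def by (intro borel_measurable_lebesgue_integral) (simp add: case_prod_unfold)
 show i2: "integrable M (\<lambda>w. indicator {..a} (V i w) * K i w * (\<kappa> (V i w) * Q (V i w) - F (V i w)))"
 proof (rule integrable_const_bound[where B="2 * B"], rule AE_I2)
  fix w
  show "norm (indicator {..a} (V i w) * K i w * (\<kappa> (V i w) * Q (V i w) - F (V i w))) <= 2 * B"
  proof (cases "V i w <= a")
   case True
   have "\<bar>\<kappa> (V i w) * Q (V i w)\<bar> <= B" using Q[OF True] b(3,4)[of "V i w"] B0 mult_mono[of "\<kappa> (V i w)" 1 "\<bar>Q (V i w)\<bar>" B] by (simp add: abs_mult)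
   moreover have "\<bar>F (V i w)\<bar> <= B" using B[of "V i w"] True by simp
   ultimately have "\<bar>\<kappa> (V i w) * Q (V i w) - F (V i w)\<bar> <= 2 * B" by linarith
   thus ?thesis using True bd(2,3)[of i w] B0 mult_mono[of "K i w" 1 "\<bar>\<kappa> (V i w) * Q (V i w) - F (V i w)\<bar>" "2 * B"] by (simp add: abs_mult)
  qed (use B0 in simp)
 qed measurable
 have iH: "integrable M (\<lambda>w. H (frozen \<phi> \<kappa> a x (incs n w) i, incs n w i))" using i1[of "Suc i"] unfolding KS .
 have "(EE w. K (Suc i) w * F (V (Suc i) w)) =
   (EE w. (EE w'. H (frozen \<phi> \<kappa> a x (incs n w) i, incs n w' i)))" unfolding KS by (rule frozen_incs_expectation[OF \<phi> \<kappa> H iH])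
 also have "\<dots> = (EE w. K i w * F (V i w)) +
   (EE w. indicator {..a} (V i w) * K i w * (\<kappa> (V i w) * Q (V i w) - F (V i w)))"
  unfolding HQ by (rule Bochner_Integration.integral_add[OF i1 i2])
 finally show "(EE w. K (Suc i) w * F (V (Suc i) w)) = (EE w. K i w * F (V i w)) +
   (EE w. indicator {..a} (V i w) * K i w * (\<kappa> (V i w) * Q (V i w) - F (V i w)))" .
qed

end

section \<open>Exponential moments\<close>

context levy_process
begin

text \<open>The event is defined through rational times, which makes it measurable and includes all
  grid times; its probability tends to 1 by right-continuity at 0.\<close>

lemma AE_small_near_0:
 assumes "0 < e" "0 < g"
 obtains k A where "0 < (k::nat)" "A \<in> sets M" "prob A \<ge> 1 - g"
  "\<And>z n j. z \<in> A ==> real j / real n <= 1 / real k ==> \<bar>X (real j / real n) z\<bar> <= e"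
proof -
 define A where "A k = {z \<in> space M. \<forall>q::rat. 0 <= q --> real_of_rat q <= 1 / real (Suc k) --> \<bar>X (real_of_rat q) z\<bar> <= e}" for k
 have A[measurable]: "A k \<in> sets M" for k
 proof -
  have "{z \<in> space M. 0 <= q --> real_of_rat q <= 1 / real (Suc k) --> \<bar>X (real_of_rat q) z\<bar> <= e} \<in> sets M" for q
  proof (cases "0 <= q")
   case True
   hence [measurable]: "X (real_of_rat q) \<in> borel_measurable M" by (intro random_variable_X) simp
   show ?thesis by measurable
  qed simp
  thus ?thesis unfolding A_def by (rule sets.sets_Collect_countable_All)
 qed
 have "(\<lambda>k. \<integral>z. indicator (A k) z \<partial>M) \<longlonglongrightarrow> (\<integral>z. (1::real) \<partial>M)"
 proof (rule integral_dominated_convergence[where w="\<lambda>_. 1"])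
  show "AE z in M. (\<lambda>k. indicator (A k) z) \<longlonglongrightarrow> (1::real)" using starts_at_0 cadlag_paths AE_space
  proof eventually_elim
   case (elim z)
   obtain h where h: "0 < h" "\<And>t. 0 <= t ==> t < 0 + h ==> \<bar>X t z - X 0 z\<bar> < e" using cadlag_right[OF elim(2) order_refl `0 < e`] by auto
   have "EV k. 1 / real (Suc k) < h" using order_tendstoD(2)[OF LIMSEQ_Suc[OF lim_1_over_n] h(1)] .
   hence "EV k. indicator (A k) z = (1::real)"
   proof eventually_elim
    case (elim k)
    have "\<bar>X (real_of_rat q) z\<bar> <= e" if "0 <= q" "real_of_rat q <= 1 / real (Suc k)" for q :: rat
    proof -
     have "\<bar>X (real_of_rat q) z - X 0 z\<bar> < e" using that elim by (intro h(2)) auto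
     thus ?thesis using `X 0 z = 0` by simp
    qed
    thus ?case using `z \<in> space M` by (simp add: A_def)
   qed
   thus ?case by (rule tendsto_eventually)
  qed
 qed auto
 hence "(\<lambda>k. prob (A k)) \<longlonglongrightarrow> 1" by (simp add: prob_space)
 from order_tendstoD(1)[OF this, of "1 - g"] `0 < g`
 obtain k where k: "1 - g < prob (A k)" by (auto dest: eventually_happens)
 show ?thesis
 proof (rule that[of "Suc k" "A k"])
  fix z n j assume "z \<in> A k" "real j / real n <= 1 / real (Suc k)"
  moreover have "real_of_rat (of_nat j / of_nat n) = real j / real n" by (simp add: of_rat_divide)
  moreover have "(0::rat) <= of_nat j / of_nat n" by simp
  ultimately show "\<bar>X (real j / real n) z\<bar> <= e" unfolding A_def by (metis (mono_tags, lifting) mem_Collect_eq)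
 qed (use k in auto)
qed

text \<open>Let \<open>m\<close> be the truncated moment of one step. If \<open>m > 1\<close>,
  discounting every step by \<open>1 / m\<close> turns \<open>exp (\<theta> * u)\<close> along the
  chain stopped above 1 into a martingale of mean 1, and the undiscounted value is at most
  \<open>exp (2 * \<theta>)\<close>. With probability close to 1 the chain stays below 1 for
  \<open>l\<close> steps, that is up to time \<open>1 / k\<close>, and is then discounted by
  \<open>(1 / m) ^ l\<close>. This bounds \<open>m ^ l\<close>, and the \<open>k\<close>-th power of
  the bound serves all \<open>l\<close>.\<close>

lemma truncated_mgf_bound:
 assumes "0 < \<theta>"
 obtains k C where "0 < (k::nat)" "0 < C"
  "\<forall>l>0. (EE w. exp (\<theta> * min (X (1 / real (k * l)) w) 1)) ^ (k * l) <= C"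
proof -
 \<comment> \<open>Chosen so that the exceptional event contributes at most 1/2 after multiplication
   with \<open>exp (2 * \<theta>)\<close>.\<close>
 have "0 < exp (- (2 * \<theta>)) / 2" by simp
 then obtain k A where k: "0 < (k::nat)" "A \<in> sets M" "prob A \<ge> 1 - exp (- (2 * \<theta>)) / 2"
  "\<And>w n j. w \<in> A ==> real j / real n <= 1 / real k ==> \<bar>X (real j / real n) w\<bar> <= 1/2"
  using AE_small_near_0[of "1/2" "exp (- (2 * \<theta>)) / 2"] by (metis zero_less_divide_1_iff zero_less_numeral)
 have "(EE w. exp (\<theta> * min (X (1 / real (k * l)) w) 1)) ^ (k * l) <= (max 1 (2 * exp (2 * \<theta>))) ^ k"
  if l: "0 < l" for l
 proof -
  define n where "n = k * l"
  have n: "0 < n" using k l by (simp add: n_def)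
  define m where "m = (EE w. exp (\<theta> * min (X (1 / real n) w) 1))"
  show ?thesis
  proof (cases "m <= 1")
   case True
   have "0 <= m" unfolding m_def by (intro Bochner_Integration.integral_nonneg) simp
   hence "m ^ n <= 1" using True by (rule power_le_one)
   also have "1 <= (max 1 (2 * exp (2 * \<theta>))) ^ k" by (rule one_le_power) simp
   finally show ?thesis unfolding m_def n_def .
  next
   case False
   define \<phi> where "\<phi> = (\<lambda>u z :: real. u + min z 1)"
   define \<kappa> where "\<kappa> = (\<lambda>u :: real. 1 / m)"
   define F where "F = (\<lambda>u. exp (\<theta> * u))"
   have \<phi>[measurable]: "(\<lambda>p. \<phi> (fst p) (snd p)) \<in> borel_measurable (borel \<Otimes>\<^sub>M borel)" unfolding \<phi>_def by measurable
   have mX[measurable]: "X (1 / real n) \<in> borel_measurable M" by (rule random_variable_X) simp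
   have mm[measurable]: "\<kappa> \<in> borel_measurable borel" "F \<in> borel_measurable borel" unfolding \<kappa>_def F_def by measurable
   have b1: "\<forall>u z. u <= 1 --> \<phi> u z <= 1 + 1" by (auto simp: \<phi>_def)
   have b: "(0::real) <= 1 + 1" "0 <= \<kappa> u" "\<kappa> u <= 1" for u z using False by (auto simp: \<phi>_def \<kappa>_def)
   have B: "\<forall>u\<le>1 + 1. \<bar>F u\<bar> <= exp (2 * \<theta>)" using assms by (simp add: F_def)
   define V where "V i w = fst (frozen \<phi> \<kappa> 1 0 (incs n w) i)" for i w
   define K where "K i w = snd (frozen \<phi> \<kappa> 1 0 (incs n w) i)" for i w
   note inc = frozen_increment[where x=0 and a=1 and B="exp (2 * \<theta>)" and \<phi>=\<phi> and \<kappa>=\<kappa> and F=F and n=n,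
     OF \<phi> mm b1 b(1,2,3) B, folded V_def K_def]
   have Q: "(EE w. F (\<phi> u (X (1 / real n) w))) = F u * m" for u by (simp add: F_def \<phi>_def m_def distrib_left exp_add)
   have E1: "(EE w. K i w * F (V i w)) = 1" for i
   proof (induction i)
    case 0
    thus ?case by (simp add: K_def V_def F_def prob_space)
   next
    case (Suc i)
    thus ?case using inc(3)[of i] False by (simp add: Q \<kappa>_def)
   qed
   have bd: "V i w <= 1 + 1" "0 <= K i w" "K i w <= 1" for i w unfolding V_def K_def using frozen_bounds[OF b1 b(1), of \<kappa>] b(2,3) by auto
   have KA: "K l w <= (1 / m) ^ l" if "w \<in> A" "X 0 w = 0" for w
   proof -
    have small: "\<bar>X (real j / real n) w\<bar> <= 1/2" if "j <= l" for j
    proof (rule k(4)[OF `w \<in> A`])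
     have "real j / real n <= real l / real n" using that by (intro divide_right_mono) auto
     also have "\<dots> = 1 / real k" using l by (simp add: n_def)
     finally show "real j / real n <= 1 / real k" .
    qed
    have e: "euler \<phi> 0 (incs n w) j = X (real j / real n) w" if "j <= l" for j using that
    proof (induction j)
     case 0
     thus ?case using `X 0 w = 0` by simp
    next
     case (Suc j)
     have "incs n w j <= 1" using small[of j] small[of "Suc j"] Suc.prems unfolding increments_def by linarith
     thus ?case using Suc unfolding \<phi>_def by (simp add: increments_def)
    qed
    have "alive \<phi> 1 0 (incs n w) j" if "j < l" for j unfolding alive_def
    proof (intro allI impI)
     fix i assume "i <= j"
     hence "i <= l" using that by simp
     from small[OF this] e[OF this] show "euler \<phi> 0 (incs n w) i <= 1" by linarith
    qed
    hence "K l w = (\<Prod>i<l. 1 / m)" unfolding K_def using frozen_alive[of \<phi> 1 0 "incs n w" l \<kappa>] by (simp add: \<kappa>_def)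
    thus ?thesis by simp
   qed
   have "(EE w. K l w * F (V l w)) <=
     (EE w. exp (2 * \<theta>) * ((1 / m) ^ l + indicator (space M - A) w))"
   proof (rule integral_mono_AE[OF inc(1)])
    show "integrable M (\<lambda>w. exp (2 * \<theta>) * ((1 / m) ^ l + indicator (space M - A) w))"
     using k(2) by (intro integrable_mult_right Bochner_Integration.integrable_add integrable_real_indicator)
      (auto simp: emeasure_eq_measure)
    show "AE w in M. K l w * F (V l w) <= exp (2 * \<theta>) * ((1 / m) ^ l + indicator (space M - A) w)" using starts_at_0 AE_space
    proof eventually_elim
     case (elim w)
     have "K l w <= (1 / m) ^ l + indicator (space M - A) w"
     proof (cases "w \<in> A")
      case True
      thus ?thesis using KA[OF True elim(1)] by simp
     next
      case False
      moreover have "0 <= (1 / m) ^ l" using `\<not> m <= 1` by simp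
      ultimately show ?thesis using bd(3)[of l w] elim(2) by simp
     qed
     hence "K l w * F (V l w) <= ((1 / m) ^ l + indicator (space M - A) w) * exp (2 * \<theta>)"
      using bd[of l w] B[rule_format, of "V l w"] by (intro mult_mono) (auto simp: F_def)
     thus ?case by (simp add: mult.commute)
    qed
   qed measurable
   also have "\<dots> = exp (2 * \<theta>) * ((1 / m) ^ l + (1 - prob A))" using k(2) by (subst integral_mult_right_zero, subst Bochner_Integration.integral_add)
     (auto simp: prob_space prob_compl emeasure_eq_measure intro!: integrable_real_indicator)
   also have "\<dots> <= exp (2 * \<theta>) * ((1 / m) ^ l + exp (- (2 * \<theta>)) / 2)" using k(3) by (intro mult_left_mono) auto
   also have "\<dots> = exp (2 * \<theta>) * (1 / m) ^ l + 1/2" by (simp add: distrib_left exp_minus)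
   finally have "m ^ l <= 2 * exp (2 * \<theta>)" using False unfolding E1 by (simp add: power_one_over field_simps)
   also have "\<dots> <= max 1 (2 * exp (2 * \<theta>))" by simp
   finally have "(m ^ l) ^ k <= (max 1 (2 * exp (2 * \<theta>))) ^ k" using False by (intro power_mono) auto
   thus ?thesis unfolding m_def n_def by (simp add: power_mult[symmetric] mult.commute)
  qed
 qed
 thus ?thesis using that[of k "(max 1 (2 * exp (2 * \<theta>))) ^ k"] k(1) by (auto intro!: zero_less_power)
qed

lemma nn_integral_two_increments:
 fixes f :: "real => ennreal"
 assumes "0 <= s" "0 <= t" and f[measurable]: "f \<in> borel_measurable borel"
 shows "(\<integral>\<^sup>+w. f (X s w) * f (X (s + t) w - X s w) \<partial>M) = (\<integral>\<^sup>+w. f (X s w) \<partial>M) * (\<integral>\<^sup>+w. f (X t w) \<partial>M)"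
proof -
 define u :: "nat => real" where "u k = (if k = 0 then 0 else if k = 1 then s else s + t)" for k
 have [measurable]: "X s \<in> borel_measurable M" "X t \<in> borel_measurable M" "X (s + t) \<in> borel_measurable M" "X 0 \<in> borel_measurable M"
  using assms by (auto intro: random_variable_X)
 have "mono u" using assms by (auto simp: mono_def u_def)
 hence "indep_vars (\<lambda>_. borel) (\<lambda>i w. X (u (Suc i)) w - X (u i) w) {..<2}" by (intro independent_increments[OF _ `mono u`]) (simp add: u_def)
 hence ind: "indep_vars (\<lambda>_. borel) (\<lambda>i w. f (X (u (Suc i)) w - X (u i) w)) {..<2}" by (rule indep_vars_compose2) simp
 have "(\<integral>\<^sup>+w. f (X s w) * f (X (s + t) w - X s w) \<partial>M) =
   (\<integral>\<^sup>+w. (\<Prod>i<2. f (X (u (Suc i)) w - X (u i) w)) \<partial>M)" by (intro nn_integral_cong_AE)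
   (use starts_at_0 in "eventually_elim, simp add: numeral_2_eq_2 lessThan_Suc u_def mult.commute")
 also have "\<dots> = (\<Prod>i<2. \<integral>\<^sup>+w. f (X (u (Suc i)) w - X (u i) w) \<partial>M)" by (rule indep_vars_nn_integral[OF _ ind]) auto
 also have "\<dots> = (\<integral>\<^sup>+w. f (X s w - X 0 w) \<partial>M) * (\<integral>\<^sup>+w. f (X (s + t) w - X s w) \<partial>M)" by (simp add: numeral_2_eq_2 lessThan_Suc u_def mult.commute)
 also have "(\<integral>\<^sup>+w. f (X s w - X 0 w) \<partial>M) = (\<integral>\<^sup>+w. f (X s w) \<partial>M)" by (intro nn_integral_cong_AE) (use starts_at_0 in "eventually_elim, simp")
 also have "(\<integral>\<^sup>+w. f (X (s + t) w - X s w) \<partial>M) = (\<integral>\<^sup>+z. f z \<partial>distr M borel (\<lambda>w. X (s + t) w - X s w))" by (subst nn_integral_distr) auto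
 also have "distr M borel (\<lambda>w. X (s + t) w - X s w) = distr M borel (X t)" using stationary_increments[of s "s + t"] assms by simp
 also have "(\<integral>\<^sup>+z. f z \<partial>distr M borel (X t)) = (\<integral>\<^sup>+w. f (X t w) \<partial>M)" by (subst nn_integral_distr) auto
 finally show ?thesis .
qed

text \<open>The moment generating function is not assumed to be finite for positive arguments: this follows from the
 absence of positive jumps.\<close>

definition nn_mgf :: "real => real => ennreal" where
 "nn_mgf l t = (\<integral>\<^sup>+w. ennreal (exp (l * X t w)) \<partial>M)"

lemma nn_mgf_add:
 assumes "0 <= s" "0 <= t"
 shows "nn_mgf l (s + t) = nn_mgf l s * nn_mgf l t"
proof -
 have "nn_mgf l (s + t) = (\<integral>\<^sup>+w. ennreal (exp (l * X s w)) * ennreal (exp (l * (X (s + t) w - X s w))) \<partial>M)"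
  unfolding nn_mgf_def by (simp add: ennreal_mult[symmetric] exp_add[symmetric] algebra_simps)
 also have "\<dots> = nn_mgf l s * nn_mgf l t" unfolding nn_mgf_def by (rule nn_integral_two_increments[OF assms, of "\<lambda>z. ennreal (exp (l * z))"]) simp
 finally show ?thesis .
qed

lemma nn_mgf_0: "nn_mgf l 0 = 1"
proof -
 have "nn_mgf l 0 = (\<integral>\<^sup>+w. 1 \<partial>M)" unfolding nn_mgf_def by (intro nn_integral_cong_AE) (use starts_at_0 in "eventually_elim, simp")
 thus ?thesis by (simp add: emeasure_space_1)
qed

lemma nn_mgf_mult:
 assumes "0 <= t"
 shows "nn_mgf l (real k * t) = nn_mgf l t ^ k"
proof (induction k)
 case (Suc k)
 thus ?case using nn_mgf_add[of "real k * t" t l] assms by (simp add: algebra_simps)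
qed (simp add: nn_mgf_0)

lemma nn_mgf_pos: "0 <= t ==> 0 < nn_mgf l t"
proof (rule ccontr)
 assume "0 <= t" and n: "\<not> 0 < nn_mgf l t"
 hence [measurable]: "X t \<in> borel_measurable M" by (intro random_variable_X)
 have "AE w in M. ennreal (exp (l * X t w)) = 0" using n unfolding nn_mgf_def by (subst (asm) not_gr_zero, subst (asm) nn_integral_0_iff_AE) auto
 hence "AE w in M. False" by eventually_elim simp
 thus False by simp
qed

end

text \<open>On a fine mesh no increment exceeds 1, so the truncation is inactive and the product of
  the truncated exponentials equals \<open>exp (j * X 1 w)\<close>. The products have means at most
  \<open>C\<close>, and Fatou's lemma carries the bound over.\<close>

lemma (in spectrally_negative_levy_process) nn_mgf_finite_1:
 assumes "0 < j"
 shows "nn_mgf j 1 < \<infinity>" unfolding nn_mgf_def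
proof -
 obtain k C where k: "0 < (k::nat)" "0 < C"
  and C: "\<forall>l>0. (EE w. exp (j * min (X (1 / real (k * l)) w) 1)) ^ (k * l) <= C" by (rule truncated_mgf_bound[OF assms])
 define u where "u l w = (\<Prod>i<k * Suc l. exp (j * min (incs (k * Suc l) w i) 1))" for l w
 have [measurable]: "u l \<in> borel_measurable M" for l unfolding u_def by measurable
 have eu: "(\<integral>\<^sup>+w. ennreal (u l w) \<partial>M) <= ennreal C" for l
 proof -
  define n where "n = k * Suc l"
  have mX[measurable]: "X (1 / real n) \<in> borel_measurable M" by (rule random_variable_X) simp
  have ind: "indep_vars (\<lambda>_. borel) (\<lambda>i w. exp (j * min (incs n w i) 1)) {..<n}"
   using indep_vars_compose2[OF indep_incs[of n n], of "\<lambda>_ z. exp (j * min z 1)" "\<lambda>_. borel"] by simp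
  have int: "integrable M (\<lambda>w. exp (j * min (incs n w i) 1))" for i
   by (rule integrable_const_bound[where B="exp j"]) (use assms in "auto simp: mult_left_le")
  have "expectation (u l) = (\<Prod>i<n. (EE w. exp (j * min (incs n w i) 1)))"
   unfolding u_def n_def[symmetric] by (rule indep_vars_lebesgue_integral[OF _ ind int]) simp_all
  also have "\<dots> = (EE w. exp (j * min (X (1 / real n) w) 1)) ^ n" by (simp add: expectation_incs[of "\<lambda>z. exp (j * min z 1)"])
  also have "\<dots> <= C" unfolding n_def by (rule C[rule_format]) simp
  finally have "expectation (u l) <= C" .
  moreover have "integrable M (u l)" unfolding u_def n_def[symmetric] by (rule indep_vars_integrable[OF _ ind int]) simp_all
  ultimately show ?thesis by (subst nn_integral_eq_integral) (auto simp: u_def prod_nonneg intro!: ennreal_leI)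
 qed
 have "(\<integral>\<^sup>+w. ennreal (exp (j * X 1 w)) \<partial>M) <= (\<integral>\<^sup>+w. liminf (\<lambda>l. ennreal (u l w)) \<partial>M)"
 proof (rule nn_integral_mono_AE)
  show "AE w in M. ennreal (exp (j * X 1 w)) <= liminf (\<lambda>l. ennreal (u l w))" using starts_at_0 cadlag_paths no_positive_jumps_paths
  proof eventually_elim
   case (elim w)
   obtain h where h: "0 < h" "\<forall>s u. 0 <= s \<and> s <= u \<and> u <= 1 \<and> u - s < h --> X u w - X s w < 1" using cadlag_up_modulus[OF elim(2,3), of 1 1] by auto
   have "EV l. 1 / real (Suc l) < h" using order_tendstoD(2)[OF LIMSEQ_Suc[OF lim_1_over_n] h(1)] .
   hence "EV l. ennreal (u l w) = ennreal (exp (j * X 1 w))"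
   proof eventually_elim
    case (elim l)
    define n where "n = k * Suc l"
    have n: "0 < n" using k by (simp add: n_def)
    have "1 * Suc l <= k * Suc l" using k(1) by (intro mult_le_mono1) simp
    hence "Suc l <= n" by (simp add: n_def)
    hence "1 / real n <= 1 / real (Suc l)" by (intro frac_le) auto
    hence n\<rho>: "1 / real n < h" using elim by simp
    have inc1: "incs n w i <= 1" if "i < n" for i
    proof -
     have "real (Suc i) <= real n" using that by simp
     hence "real (Suc i) / real n <= 1" using n by (simp add: divide_le_eq)
     moreover have "real (Suc i) / real n - real i / real n = 1 / real n" by (simp add: add_divide_distrib)
     ultimately have "X (real (Suc i) / real n) w - X (real i / real n) w < 1"
      using n\<rho> by (intro h(2)[rule_format] conjI) (auto intro: divide_right_mono)
     thus ?thesis by (simp add: increments_def)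
    qed
    have "(\<Prod>i<n. exp (j * min (incs n w i) 1)) = (\<Prod>i<n. exp (j * incs n w i))" using inc1 by (intro prod.cong refl) auto
    also have "\<dots> = exp (j * (\<Sum>i<n. incs n w i))" by (simp add: exp_sum sum_distrib_left)
    also have "(\<Sum>i<n. incs n w i) = X (real n / real n) w - X (real 0 / real n) w" unfolding increments_def by (rule sum_lessThan_telescope)
    finally show ?case using n `X 0 w = 0` unfolding u_def n_def[symmetric] by simp
   qed
   hence "(\<lambda>l. ennreal (u l w)) \<longlonglongrightarrow> ennreal (exp (j * X 1 w))" by (rule tendsto_eventually)
   thus ?case by (simp add: lim_imp_Liminf)
  qed
 qed
 also have "\<dots> <= liminf (\<lambda>l. \<integral>\<^sup>+w. ennreal (u l w) \<partial>M)" by (rule nn_integral_liminf) measurable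
 also have "\<dots> <= ennreal C" using eu by (intro Liminf_le always_eventually allI) auto
 also have "\<dots> < \<infinity>" by simp
 finally show "(\<integral>\<^sup>+w. ennreal (exp (j * X 1 w)) \<partial>M) < \<infinity>" .
qed

context spectrally_negative_levy_process
begin

abbreviation "\<psi> \<equiv> laplace_exponent M X"

lemma nn_mgf_grid:
 assumes "0 <= l" "0 < n"
 shows "nn_mgf l (real k / real n) = ennreal (exp (real k / real n * \<psi> l))"
proof -
 have fin: "nn_mgf l 1 < \<infinity>"
 proof (cases "l = 0")
  case True
  thus ?thesis by (simp add: nn_mgf_def emeasure_space_1)
 qed (use assms nn_mgf_finite_1 in auto)
 define g where "g = nn_mgf l (1 / real n)"
 have "g ^ n = nn_mgf l 1" using nn_mgf_mult[of "1 / real n" l n] assms by (simp add: g_def)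
 hence "g < \<infinity>" using fin assms(2) by (metis ennreal_top_eq_mult_iff infinity_ennreal_def less_top not_gr_zero power_eq_top_ennreal)
 then obtain r where r: "g = ennreal r" "0 <= r" by (cases g) auto
 have "0 < g" unfolding g_def by (rule nn_mgf_pos) simp
 hence "0 < r" using r by simp
 have [measurable]: "X 1 \<in> borel_measurable M" by (rule random_variable_X) simp
 have "nn_mgf l 1 = ennreal (r ^ n)" using `g ^ n = nn_mgf l 1` r by (simp add: ennreal_power)
 hence "(EE w. exp (l * X 1 w)) = r ^ n" unfolding nn_mgf_def using `0 < r` by (intro integral_eq_nn_integral[THEN trans]) auto
 hence \<psi>: "\<psi> l = real n * ln r" unfolding laplace_exponent_def using `0 < r` by (simp add: ln_realpow)
 have "nn_mgf l (real k / real n) = ennreal (r ^ k)" using nn_mgf_mult[of "1 / real n" l k] r by (simp add: g_def[symmetric] ennreal_power)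
 also have "r ^ k = exp (real k / real n * \<psi> l)" using assms(2) `0 < r` by (simp add: \<psi> exp_of_nat_mult)
 finally show ?thesis .
qed

lemma nn_mgf_le:
 assumes "0 <= l" "0 <= t"
 shows "nn_mgf l t <= ennreal (exp (t * \<psi> l))"
proof -
 define s where "s n = real (Suc (grid_index (Suc n) t)) / real (Suc n)" for n
 have s: "t < s n" "s n <= t + 1 / real (Suc n)" for n using grid_index_le[OF assms(2), of "Suc n"] grid_index_gt[OF assms(2), of "Suc n"]
  by (auto simp: s_def add_divide_distrib)
 have lim: "s \<longlonglongrightarrow> t"
 proof (rule tendsto_sandwich[OF _ _ tendsto_const])
  show "(\<lambda>n. t + 1 / real (Suc n)) \<longlonglongrightarrow> t" using tendsto_add[OF tendsto_const LIMSEQ_Suc[OF lim_1_over_n], of t] by simp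
 qed (use s in "auto intro!: always_eventually less_imp_le")
 have [measurable]: "X t \<in> borel_measurable M" "X (s n) \<in> borel_measurable M" for n using assms s(1)[of n] by (auto intro: random_variable_X)
 have "nn_mgf l t <= (\<integral>\<^sup>+w. liminf (\<lambda>n. ennreal (exp (l * X (s n) w))) \<partial>M)" unfolding nn_mgf_def
 proof (rule nn_integral_mono_AE)
  show "AE w in M. ennreal (exp (l * X t w)) <= liminf (\<lambda>n. ennreal (exp (l * X (s n) w)))" using cadlag_paths
  proof eventually_elim
   case (elim w)
   hence "((\<lambda>t. X t w) \<longlongrightarrow> X t w) (at_right t)" using assms by (auto simp: cadlag_def)
   hence "(\<lambda>n. X (s n) w) \<longlonglongrightarrow> X t w" by (rule filterlim_compose) (intro tendsto_imp_filterlim_at_right lim always_eventually allI s)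
   hence "(\<lambda>n. ennreal (exp (l * X (s n) w))) \<longlonglongrightarrow> ennreal (exp (l * X t w))" by (intro tendsto_intros)
   from lim_imp_Liminf[OF sequentially_bot this] show ?case by simp
  qed
 qed
 also have "\<dots> <= liminf (\<lambda>n. nn_mgf l (s n))" unfolding nn_mgf_def by (rule nn_integral_liminf) measurable
 also have "\<dots> = liminf (\<lambda>n. ennreal (exp (s n * \<psi> l)))" unfolding s_def by (subst nn_mgf_grid[OF assms(1)]) auto
 also have "\<dots> = ennreal (exp (t * \<psi> l))" by (intro lim_imp_Liminf tendsto_intros lim) simp
 finally show ?thesis .
qed

text \<open>Right-continuity and Fatou's lemma give only \<open><=\<close>. Multiplicativity turns
  this into equality: the factors at \<open>t\<close> and at \<open>real N - t\<close> are bounded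
  by their exponentials, and their product is exact at the integer time.\<close>

lemma nn_mgf_eq:
 assumes "0 <= l" "0 <= t"
 shows "nn_mgf l t = ennreal (exp (t * \<psi> l))"
proof (rule antisym)
 show "nn_mgf l t <= ennreal (exp (t * \<psi> l))" by (rule nn_mgf_le[OF assms])
 obtain N where N: "t <= real N" using real_arch_simple by blast
 have "ennreal (exp (t * \<psi> l)) * ennreal (exp ((real N - t) * \<psi> l)) = nn_mgf l (real N / real 1)"
  by (subst nn_mgf_grid[OF assms(1)]) (auto simp: ennreal_mult[symmetric] exp_add[symmetric] algebra_simps)
 also have "\<dots> = nn_mgf l t * nn_mgf l (real N - t)" using nn_mgf_add[of t "real N - t" l] assms N by simp
 also have "\<dots> <= nn_mgf l t * ennreal (exp ((real N - t) * \<psi> l))" using nn_mgf_le[OF assms(1), of "real N - t"] N by (intro mult_left_mono) auto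
 finally show "ennreal (exp (t * \<psi> l)) <= nn_mgf l t"
  using ennreal_mult_le_mult_iff[of "ennreal (exp ((real N - t) * \<psi> l))" "ennreal (exp (t * \<psi> l))" "nn_mgf l t"] by (simp add: mult.commute)
qed

lemma mgf:
 assumes "0 <= l" "0 <= t"
 shows "has_bochner_integral M (\<lambda>w. exp (l * X t w)) (exp (t * \<psi> l))"
proof -
 have [measurable]: "X t \<in> borel_measurable M" using assms by (intro random_variable_X)
 show ?thesis using nn_mgf_eq[OF assms] unfolding nn_mgf_def by (intro has_bochner_integral_nn_integral) auto
qed

end

section \<open>The Laplace exponent: growth and the drift condition\<close>

lemma has_bochner_integral_mono:
 fixes f g :: "_ => real"
 assumes "has_bochner_integral M f x" "has_bochner_integral M g y" "\<And>w. f w <= g w"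
 shows "x <= y" using integral_mono[of M f g] assms by (auto simp: has_bochner_integral_iff)

lemma exp_minus_le_quadratic:
 fixes v :: real
 assumes "0 <= v"
 shows "exp (- v) <= 1 - v + v\<^sup>2"
proof -
 have "1 + v <= exp v" by (rule exp_ge_add_one_self)
 hence "exp (- v) <= 1 / (1 + v)" using assms by (simp add: exp_minus field_simps)
 also have "\<dots> <= 1 - v + v\<^sup>2"
 proof -
  have "(1 - v + v\<^sup>2) * (1 + v) = 1 + v ^ 3" by (simp add: power2_eq_square power3_eq_cube algebra_simps)
  also have "\<dots> \<ge> 1" using assms by simp
  finally show ?thesis using assms by (simp add: divide_le_eq)
 qed
 finally show ?thesis .
qed

definition lk_integrand :: "real => real => real" where
 "lk_integrand l x = exp (l * x) - 1 - l * x * indicator {-1<..} x"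

lemma lk_integrand_bounds:
 assumes "0 <= l" "x < 0"
 shows "lk_integrand l x <= l\<^sup>2 * min 1 (x\<^sup>2)" "- min 1 (x\<^sup>2) <= lk_integrand l x"
  "-1 < x ==> 0 <= lk_integrand l x"
proof -
 have p: "0 <= lk_integrand l x" if "-1 < x"
 proof -
  have "lk_integrand l x = exp (l * x) - 1 - l * x" using that by (simp add: lk_integrand_def)
  thus ?thesis using exp_ge_add_one_self[of "l * x"] by linarith
 qed
 thus "-1 < x ==> 0 <= lk_integrand l x" .
 show "lk_integrand l x <= l\<^sup>2 * min 1 (x\<^sup>2)"
 proof (cases "-1 < x")
  case True
  have "x\<^sup>2 <= 1" using True assms by (simp add: abs_square_le_1)
  hence "min 1 (x\<^sup>2) = x\<^sup>2" by simp
  thus ?thesis using exp_minus_le_quadratic[of "- (l * x)"] assms True by (simp add: lk_integrand_def power_mult_distrib mult_nonneg_nonpos)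
 next
  case False
  hence "exp (l * x) <= 1" using assms by (simp add: mult_nonneg_nonpos)
  hence "lk_integrand l x <= 0" using False by (simp add: lk_integrand_def)
  moreover have "0 <= l\<^sup>2 * min 1 (x\<^sup>2)" by simp
  ultimately show ?thesis by linarith
 qed
 show "- min 1 (x\<^sup>2) <= lk_integrand l x"
 proof (cases "-1 < x")
  case True
  moreover have "0 <= min 1 (x\<^sup>2)" by simp
  ultimately show ?thesis using p by linarith
 next
  case False
  hence "1 <= x\<^sup>2" using power_mono[of 1 "- x" 2] by simp
  thus ?thesis using False by (simp add: lk_integrand_def)
 qed
qed

lemma negative_levy_measure_facts:
 assumes "negative_levy_measure \<nu>"
 shows "sets \<nu> = sets borel" "AE x in \<nu>. x < 0" "integrable \<nu> (\<lambda>x. min 1 (x\<^sup>2))"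
  "0 <= l ==> integrable \<nu> (lk_integrand l)"
proof -
 show s[measurable_cong]: "sets \<nu> = sets borel" using assms by (simp add: negative_levy_measure_def)
 have "{0..} \<in> null_sets \<nu>" using assms s by (auto simp: negative_levy_measure_def null_sets_def)
 hence "AE x in \<nu>. x \<notin> {0..}" by (rule AE_not_in)
 thus n: "AE x in \<nu>. x < 0" by eventually_elim auto
 have m: "(\<lambda>x::real. min 1 (x\<^sup>2)) \<in> borel_measurable \<nu>" by measurable
 show i: "integrable \<nu> (\<lambda>x. min 1 (x\<^sup>2))" using assms m by (intro integrableI_nonneg) (auto simp: negative_levy_measure_def)
 show "integrable \<nu> (lk_integrand l)" if "0 <= l"
 proof (rule Bochner_Integration.integrable_bound)
  show "integrable \<nu> (\<lambda>x. (l\<^sup>2 + 1) * min 1 (x\<^sup>2))" using i by (rule integrable_mult_right)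
  show "lk_integrand l \<in> borel_measurable \<nu>" unfolding lk_integrand_def by measurable
  show "AE x in \<nu>. norm (lk_integrand l x) <= norm ((l\<^sup>2 + 1) * min 1 (x\<^sup>2))" using n
  proof eventually_elim
   case (elim x)
   have "0 <= l\<^sup>2 * min 1 (x\<^sup>2)" "0 <= min 1 (x\<^sup>2)" by simp_all
   hence "\<bar>lk_integrand l x\<bar> <= (l\<^sup>2 + 1) * min 1 (x\<^sup>2)" using lk_integrand_bounds(1,2)[OF that elim] unfolding distrib_right by linarith
   thus ?case by simp
  qed
 qed
qed

locale sn_levy_triplet = spectrally_negative_levy_process M X
 for M :: "'w measure" and X :: "real => 'w => real" +
 fixes \<gamma> \<sigma> :: real and \<nu> :: "real measure" and \<delta> :: real
 assumes triplet: "has_levy_triplet M X \<gamma> \<sigma> \<nu>"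
  and \<delta>_nonneg: "0 <= \<delta>"
  and bv: "bounded_variation_paths M X ==> \<delta> < bv_drift \<gamma> \<nu>"
begin

lemma \<psi>_lk: "0 <= l ==> \<psi> l = \<gamma> * l + \<sigma>\<^sup>2 / 2 * l\<^sup>2 + (LINT x|\<nu>. lk_integrand l x)"
 using triplet unfolding has_levy_triplet_def levy_khintchine_exponent_def lk_integrand_def by auto

lemma levy_measure: "negative_levy_measure \<nu>" using triplet by (auto simp: has_levy_triplet_def)

lemma \<psi>_quadratic:
 obtains C where "0 <= C" "\<forall>l\<ge>0. \<psi> l <= C * (1 + l\<^sup>2)"
proof -
 define I where "I = (LINT x|\<nu>. min 1 (x\<^sup>2))"
 have I: "0 <= I" unfolding I_def by (intro Bochner_Integration.integral_nonneg) simp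
 have "\<psi> l <= (\<bar>\<gamma>\<bar> + \<sigma>\<^sup>2 / 2 + I) * (1 + l\<^sup>2)" if "0 <= l" for l
 proof -
  have "(LINT x|\<nu>. lk_integrand l x) <= (LINT x|\<nu>. l\<^sup>2 * min 1 (x\<^sup>2))"
  proof (rule integral_mono_AE')
   show "AE x in \<nu>. lk_integrand l x <= l\<^sup>2 * min 1 (x\<^sup>2)"
    using negative_levy_measure_facts(2)[OF levy_measure] by eventually_elim (rule lk_integrand_bounds(1)[OF that])
  qed (use negative_levy_measure_facts(3)[OF levy_measure] in auto)
  also have "\<dots> = l\<^sup>2 * I" by (simp add: I_def)
  finally have 1: "(LINT x|\<nu>. lk_integrand l x) <= l\<^sup>2 * I" .
  have "2 * l <= 1 + l\<^sup>2" using sum_squares_bound[of 1 l] by simp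
  hence "l <= 1 + l\<^sup>2" using that by linarith
  hence "\<gamma> * l <= \<bar>\<gamma>\<bar> * (1 + l\<^sup>2)" using that by (intro mult_mono) auto
  moreover have "\<sigma>\<^sup>2 / 2 * l\<^sup>2 <= \<sigma>\<^sup>2 / 2 * (1 + l\<^sup>2)" by (intro mult_left_mono) auto
  moreover have "l\<^sup>2 * I <= I * (1 + l\<^sup>2)" using I by (simp add: algebra_simps)
  ultimately show ?thesis unfolding \<psi>_lk[OF that] using 1 by (simp add: distrib_right)
 qed
 thus ?thesis using that[of "\<bar>\<gamma>\<bar> + \<sigma>\<^sup>2 / 2 + I"] I by auto
qed

text \<open>Convexity of \<psi> together with \<psi>(0) = 0. It is Jensen's inequality for the power
  \<open>r\<close>, in the pointwise form \<open>conv\<close>, applied to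
  \<open>exp (l * X 1 w - \<psi> l)\<close>, which has mean 1.\<close>

lemma \<psi>_superlinear:
 assumes "0 <= l" "1 <= r"
 shows "r * \<psi> l <= \<psi> (r * l)"
proof -
 have m: "has_bochner_integral M (\<lambda>w. exp (c * X 1 w)) (exp (\<psi> c))" if "0 <= c" for c using mgf[OF that, of 1] by simp
 have conv: "exp u <= 1 / r * exp (r * u) + (1 - 1 / r)" for u :: real
  using convex_onD[OF exp_convex, of "1 / r" 0 "r * u"] assms by (simp add: add.commute)
 have 1: "has_bochner_integral M (\<lambda>w. exp (l * X 1 w - \<psi> l)) 1" using has_bochner_integral_mult_left[OF m[OF assms(1)], of "exp (- \<psi> l)"]
  by (simp add: exp_diff exp_minus field_simps)
 have 2: "has_bochner_integral M (\<lambda>w. exp (r * (l * X 1 w - \<psi> l))) (exp (\<psi> (r * l) - r * \<psi> l))"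
  using has_bochner_integral_mult_left[OF m[of "r * l"], of "exp (- r * \<psi> l)"] assms by (simp add: exp_diff exp_minus field_simps)
 have "1 <= 1 / r * exp (\<psi> (r * l) - r * \<psi> l) + (1 - 1 / r)"
 proof (rule has_bochner_integral_mono[OF 1])
  show "has_bochner_integral M (\<lambda>w. 1 / r * exp (r * (l * X 1 w - \<psi> l)) + (1 - 1 / r))
   (1 / r * exp (\<psi> (r * l) - r * \<psi> l) + (1 - 1 / r))" by (intro has_bochner_integral_add has_bochner_integral_mult_right 2)
    (auto simp: has_bochner_integral_iff prob_space)
 qed (rule conv)
 hence "1 <= exp (\<psi> (r * l) - r * \<psi> l)" using assms by (simp add: field_simps)
 thus ?thesis by simp
qed

text \<open>Chernoff's bound with the exponent sent to infinity: for every \<open>l\<close> the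
  probability of exceeding the bound by more than \<open>e\<close> is at most
  \<open>exp (- l * e)\<close>.\<close>

lemma AE_increment_le:
 assumes le: "\<forall>l>0. \<psi> l <= \<delta> * l" and st: "0 <= s" "s <= t"
 shows "AE w in M. X t w - X s w <= \<delta> * (t - s)"
proof -
 have [measurable]: "X s \<in> borel_measurable M" "X t \<in> borel_measurable M" "X (t - s) \<in> borel_measurable M" using st by (auto intro: random_variable_X)
 define h where "h = t - s"
 have h: "0 <= h" using st by (simp add: h_def)
 have "prob {w \<in> space M. e < X h w - \<delta> * h} = 0" if "0 < e" for e
 proof (rule ccontr)
  assume n: "prob {w \<in> space M. e < X h w - \<delta> * h} \<noteq> 0"
  define P where "P = prob {w \<in> space M. e < X h w - \<delta> * h}"
  have P: "0 < P" using n by (simp add: P_def zero_less_measure_iff)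
  have *: "exp (l * e) * P <= 1" if "0 < l" for l
  proof -
   have 1: "has_bochner_integral M (\<lambda>w. exp (l * e) * indicator {w \<in> space M. e < X h w - \<delta> * h} w) (exp (l * e) * P)"
    unfolding P_def h_def by (intro has_bochner_integral_mult_right has_bochner_integral_real_indicator) (auto simp: emeasure_eq_measure)
   have 2: "has_bochner_integral M (\<lambda>w. exp (- (l * \<delta> * h)) * exp (l * X h w)) (exp (- (l * \<delta> * h)) * exp (h * \<psi> l))"
    using mgf[of l h] that h by (intro has_bochner_integral_mult_right) auto
   have "exp (l * e) * P <= exp (- (l * \<delta> * h)) * exp (h * \<psi> l)"
   proof (rule has_bochner_integral_mono[OF 1 2])
    fix w
    show "exp (l * e) * indicator {w \<in> space M. e < X h w - \<delta> * h} w <= exp (- (l * \<delta> * h)) * exp (l * X h w)"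
    proof (cases "e < X h w - \<delta> * h")
     case True
     hence "l * e <= l * (X h w - \<delta> * h)" using that by (intro mult_left_mono) auto
     thus ?thesis by (auto simp: indicator_def exp_add[symmetric] algebra_simps)
    qed (auto simp: indicator_def)
   qed
   also have "\<dots> = exp (h * (\<psi> l - \<delta> * l))" by (simp add: exp_add[symmetric] algebra_simps)
   also have "\<dots> <= 1" using le that h by (simp add: mult_nonneg_nonpos)
   finally show ?thesis .
  qed
  \<comment> \<open>Large enough for \<open>exp (l * e) * P\<close> to reach 2, against the bound
    1.\<close>
  define l where "l = max 1 (ln (2 / P) / e)"
  have "ln (2 / P) / e <= l" by (simp add: l_def)
  hence "ln (2 / P) <= l * e" using that by (simp add: pos_divide_le_eq)
  hence "exp (ln (2 / P)) <= exp (l * e)" by simp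
  hence "2 <= exp (l * e) * P" using P by (simp add: pos_divide_le_eq)
  moreover have "0 < l" by (simp add: l_def)
  ultimately show False using *[of l] by linarith
 qed
 hence "AE w in M. \<not> 1 / real (Suc k) < X h w - \<delta> * h" for k by (subst AE_iff_measurable[OF _ refl]) (auto simp: emeasure_eq_measure h_def)
 hence "AE w in M. \<forall>k. \<not> 1 / real (Suc k) < X h w - \<delta> * h" by (simp add: AE_all_countable)
 hence "AE w in M. X h w <= \<delta> * h"
 proof eventually_elim
  case (elim w)
  show ?case
  proof (rule ccontr)
   assume "\<not> ?thesis"
   then obtain k where "1 / real (Suc k) < X h w - \<delta> * h" using nat_approx_posE[of "X h w - \<delta> * h"] by auto
   thus False using elim by blast
  qed
 qed
 hence "AE z in distr M borel (X (t - s)). z <= \<delta> * h" unfolding h_def by (subst AE_distr_iff) auto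
 hence "AE z in distr M borel (\<lambda>w. X t w - X s w). z <= \<delta> * h" by (simp only: stationary_increments[OF st])
 thus ?thesis unfolding h_def by (subst (asm) AE_distr_iff) auto
qed

text \<open>The increments are bounded at rational times off one null set, then at all times by
  right-continuity. Hence \<open>\<delta> * r - X r w\<close> is nondecreasing in \<open>r\<close>,
  and the path is a difference of monotone functions.\<close>

lemma bounded_variation_if_increment_le:
 assumes le: "\<forall>l>0. \<psi> l <= \<delta> * l"
 shows "bounded_variation_paths M X"
proof -
 have "AE w in M. \<forall>s t :: rat. 0 <= s --> s <= t --> X (of_rat t) w - X (of_rat s) w <= \<delta> * (of_rat t - of_rat s)"
 proof (intro AE_all_countable[THEN iffD2] allI)
  fix s t :: rat
  show "AE w in M. 0 <= s --> s <= t --> X (of_rat t) w - X (of_rat s) w <= \<delta> * (of_rat t - of_rat s)"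
  proof (cases "0 <= s \<and> s <= t")
   case True
   thus ?thesis using AE_increment_le[OF le, of "of_rat s" "of_rat t"] by (simp add: of_rat_less_eq)
  qed auto
 qed
 thus ?thesis unfolding bounded_variation_paths_def using cadlag_paths
 proof eventually_elim
  case (elim w)
  have inc: "X t w - X s w <= \<delta> * (t - s)" if st: "0 <= s" "s < t" for s t
  proof (rule ccontr)
   assume "\<not> ?thesis"
   define e where "e = X t w - X s w - \<delta> * (t - s)"
   have e: "0 < e" "0 < e / (4 * (\<delta> + 1))" "0 < e/4" using `\<not> _` \<delta>_nonneg by (simp_all add: e_def)
   obtain r1 where r1: "0 < r1" "\<And>u. s <= u ==> u < s + r1 ==> \<bar>X u w - X s w\<bar> < e / 4" using cadlag_right[OF elim(2) st(1) e(3)] by blast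
   obtain r2 where r2: "0 < r2" "\<And>u. t <= u ==> u < t + r2 ==> \<bar>X u w - X t w\<bar> < e / 4" using cadlag_right[OF elim(2) _ e(3), of t] st by auto
   obtain p :: rat where p: "s < of_rat p" "of_rat p < s + min r1 (t - s)" using of_rat_dense[of s "s + min r1 (t - s)"] r1 st by auto
   obtain q :: rat where q: "t < of_rat q" "of_rat q < t + min r2 (e / (4 * (\<delta> + 1)))"
    using of_rat_dense[of t "t + min r2 (e / (4 * (\<delta> + 1)))"] r2 e by auto
   have "min r1 (t - s) <= t - s" by simp
   hence "0 < (of_rat p :: real)" "(of_rat p :: real) < of_rat q" using p q st by linarith+
   hence "0 <= p" "p <= q" by (simp_all add: of_rat_less)
   hence "X (of_rat q) w - X (of_rat p) w <= \<delta> * (of_rat q - of_rat p)" using elim(1) by blast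
   also have "\<dots> <= \<delta> * (t - s + e / (4 * (\<delta> + 1)))" using p q \<delta>_nonneg by (intro mult_left_mono) auto
   also have "\<dots> <= \<delta> * (t - s) + e / 4"
   proof -
    have "\<delta> * (e / (4 * (\<delta> + 1))) <= (\<delta> + 1) * (e / (4 * (\<delta> + 1)))" using e by (intro mult_right_mono) auto
    also have "\<dots> = e / 4" using \<delta>_nonneg by (simp add: field_simps)
    finally show ?thesis by (simp add: distrib_left)
   qed
   finally have "X (of_rat q) w - X (of_rat p) w <= \<delta> * (t - s) + e / 4" .
   moreover have "\<bar>X (of_rat p) w - X s w\<bar> < e / 4" using p by (intro r1) auto
   moreover have "\<bar>X (of_rat q) w - X t w\<bar> < e / 4" using q by (intro r2) auto
   moreover have "X t w - X s w = e + \<delta> * (t - s)" by (simp add: e_def)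
   ultimately show False using e(1) by linarith
  qed
  show ?case
  proof (intro allI impI)
   fix t :: real assume "0 <= t"
   define S where "S = (\<lambda>r. \<delta> * r - X r w)"
   have inc': "X s w - X r w <= \<delta> * (s - r)" if "0 <= r" "r <= s" for r s using inc[of r s] that by (cases "r = s") auto
   have S: "S r <= S s" if "0 <= r" "r <= s" for r s using inc'[OF that] by (simp add: S_def algebra_simps)
   show "bounded_variation_on (\<lambda>s. X s w) 0 t" unfolding bounded_variation_on_def
   proof (intro exI[of _ "\<delta> * t + (S t - S 0)"] allI impI)
    fix n :: nat and u :: "nat => real" assume u: "mono u" "range u \<subseteq> {0..t}"
    have r: "0 <= u i" "u i <= t" for i using subsetD[OF u(2), of "u i"] by simp_all
    have "\<bar>X (u (Suc i)) w - X (u i) w\<bar> <= \<delta> * (u (Suc i) - u i) + (S (u (Suc i)) - S (u i))" for i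
    proof -
     have m: "u i <= u (Suc i)" using u(1) by (simp add: mono_def)
     have "0 <= \<delta> * (u (Suc i) - u i)" using m \<delta>_nonneg by simp
     moreover have "X (u (Suc i)) w - X (u i) w = \<delta> * (u (Suc i) - u i) - (S (u (Suc i)) - S (u i))" by (simp add: S_def algebra_simps)
     ultimately show ?thesis using S[OF r(1) m] by linarith
    qed
    hence "(\<Sum>i<n. \<bar>X (u (Suc i)) w - X (u i) w\<bar>) <= (\<Sum>i<n. \<delta> * (u (Suc i) - u i) + (S (u (Suc i)) - S (u i)))" by (intro sum_mono)
    also have "\<dots> = \<delta> * (u n - u 0) + (S (u n) - S (u 0))" unfolding sum.distrib sum_distrib_left[of \<delta> "\<lambda>i. u (Suc i) - u i" "{..<n}", symmetric]
      sum_lessThan_telescope[of u n] sum_lessThan_telescope[of "\<lambda>i. S (u i)" n] ..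
    also have "\<dots> <= \<delta> * t + (S t - S 0)"
    proof -
     have "\<delta> * (u n - u 0) <= \<delta> * t" using r[of n] r[of 0] \<delta>_nonneg by (intro mult_left_mono) auto
     moreover have "S (u n) <= S t" by (rule S[OF r])
     moreover have "S 0 <= S (u 0)" by (rule S[OF order_refl r(1)])
     ultimately show ?thesis by linarith
    qed
    finally show "(\<Sum>i<n. \<bar>X (u (Suc i)) w - X (u i) w\<bar>) <= \<delta> * t + (S t - S 0)" .
   qed
  qed
 qed
qed

text \<open>The drift is the limit of \<open>\<psi> l / l\<close>, of which one inequality is
  needed. Along \<open>l = real (Suc n)\<close> Fatou's lemma yields the integrability of the
  identity over the small jumps together with the bound; jumps of size at least 1 contribute at most
  \<open>N / real (Suc n)\<close>.\<close>

lemma bv_drift_le: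
 assumes le: "\<forall>l>0. \<psi> l <= \<delta> * l"
 shows "bv_drift \<gamma> \<nu> <= \<delta>"
proof -
 note nlf = negative_levy_measure_facts[OF levy_measure]
 note [measurable_cong] = nlf(1)
 let ?J = "{-1<..<0::real}"
 have fin: "integrable \<nu> (indicator {..-1} :: real => real)"
 proof (rule Bochner_Integration.integrable_bound[OF nlf(3)])
  show "AE x in \<nu>. norm (indicator {..-1} x :: real) <= norm (min 1 (x\<^sup>2))"
  proof (rule AE_I2)
   fix x :: real
   show "norm (indicator {..-1} x :: real) <= norm (min 1 (x\<^sup>2))" using power_mono[of 1 "- x" 2] by (auto simp: indicator_def)
  qed
 qed measurable
 define N where "N = (LINT x|\<nu>. indicator {..-1} x :: real)"
 define f where "f n x = lk_integrand (real (Suc n)) x * indicator ?J x / real (Suc n)" for n x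
 have f_int: "integrable \<nu> (f n)" for n
 proof -
  have "?J \<in> sets \<nu>" by (simp add: nlf(1))
  thus ?thesis unfolding f_def by (intro integrable_divide integrable_real_mult_indicator nlf(4)) simp_all
 qed
 have f_le: "(LINT x|\<nu>. f n x) <= \<delta> - \<gamma> + N / real (Suc n)" for n
 proof -
  let ?n = "real (Suc n)"
  have "(LINT x|\<nu>. f n x) <= (LINT x|\<nu>. lk_integrand ?n x / ?n + indicator {..-1} x / ?n)"
  proof (rule integral_mono_AE[OF f_int])
   show "integrable \<nu> (\<lambda>x. lk_integrand ?n x / ?n + indicator {..-1} x / ?n)"
    using nlf(4)[of ?n] fin by (intro Bochner_Integration.integrable_add integrable_divide) auto
   show "AE x in \<nu>. f n x <= lk_integrand ?n x / ?n + indicator {..-1} x / ?n" using nlf(2)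
   proof eventually_elim
    case (elim x)
    show ?case
    proof (cases "-1 < x")
     case True
     thus ?thesis using elim by (simp add: f_def)
    next
     case False
     hence "0 <= lk_integrand ?n x + 1" by (simp add: lk_integrand_def)
     hence "0 <= (lk_integrand ?n x + 1) / ?n" by simp
     thus ?thesis using False by (simp add: f_def add_divide_distrib)
    qed
   qed
  qed
  also have "\<dots> = (LINT x|\<nu>. lk_integrand ?n x) / ?n + N / ?n" using nlf(4)[of ?n] fin by (subst Bochner_Integration.integral_add) (auto simp: N_def)
  also have "(LINT x|\<nu>. lk_integrand ?n x) <= (\<delta> - \<gamma>) * ?n"
  proof -
   have "\<psi> ?n <= \<delta> * ?n" using le by simp
   moreover have "0 <= \<sigma>\<^sup>2 / 2 * ?n\<^sup>2" by simp
   ultimately show ?thesis using \<psi>_lk[of ?n] unfolding left_diff_distrib by linarith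
  qed
  hence "(LINT x|\<nu>. lk_integrand ?n x) / ?n <= \<delta> - \<gamma>" by (simp add: divide_le_eq)
  finally show ?thesis by simp
 qed
 have lim: "(\<lambda>n. f n x) \<longlonglongrightarrow> indicator ?J x * - x" for x
 proof (cases "x \<in> ?J")
  case True
  have "(\<lambda>n. (exp (real (Suc n) * x) - 1) / real (Suc n) - x) \<longlonglongrightarrow> 0 - x"
  proof (intro tendsto_diff tendsto_const)
   have "\<bar>(exp (real (Suc n) * x) - 1) / real (Suc n)\<bar> <= 1 / real (Suc n)" for n
   proof -
    have "real (Suc n) * x <= 0" using True by (intro mult_nonneg_nonpos) auto
    hence "\<bar>exp (real (Suc n) * x) - 1\<bar> <= 1" by (simp add: abs_le_iff)
    thus ?thesis by (simp add: divide_right_mono)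
   qed
   thus "(\<lambda>n. (exp (real (Suc n) * x) - 1) / real (Suc n)) \<longlonglongrightarrow> 0"
    by (intro Lim_null_comparison[OF _ LIMSEQ_Suc[OF lim_1_over_n]]) (auto intro!: always_eventually)
  qed
  moreover have "f n x = (exp (real (Suc n) * x) - 1) / real (Suc n) - x" for n using True by (simp add: f_def lk_integrand_def diff_divide_distrib)
  ultimately show ?thesis using True by simp
 qed (simp add: f_def)
 have fpos: "0 <= f n x" for n x using lk_integrand_bounds(3)[of "real (Suc n)" x] by (auto simp: f_def indicator_def)
 have nn: "(\<integral>\<^sup>+x. ennreal (indicator ?J x * - x) \<partial>\<nu>) <= ennreal (\<delta> - \<gamma>)"
 proof -
  have "(\<integral>\<^sup>+x. ennreal (indicator ?J x * - x) \<partial>\<nu>) = (\<integral>\<^sup>+x. liminf (\<lambda>n. ennreal (f n x)) \<partial>\<nu>)"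
   using lim_imp_Liminf[OF sequentially_bot tendsto_ennrealI[OF lim]] by (intro nn_integral_cong) simp
  also have "\<dots> <= liminf (\<lambda>n. \<integral>\<^sup>+x. ennreal (f n x) \<partial>\<nu>)" using f_int by (intro nn_integral_liminf) auto
  also have "\<dots> <= liminf (\<lambda>n. ennreal (\<delta> - \<gamma> + N / real (Suc n)))"
   using f_int fpos f_le by (intro Liminf_mono always_eventually allI) (simp add: nn_integral_eq_integral ennreal_leI)
  also have "\<dots> = ennreal (\<delta> - \<gamma>)"
  proof (intro lim_imp_Liminf tendsto_ennrealI)
   have "(\<lambda>n. \<delta> - \<gamma> + N * (1 / real (Suc n))) \<longlonglongrightarrow> \<delta> - \<gamma> + N * 0" by (intro tendsto_intros LIMSEQ_Suc[OF lim_1_over_n])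
   thus "(\<lambda>n. \<delta> - \<gamma> + N / real (Suc n)) \<longlonglongrightarrow> \<delta> - \<gamma>" by simp
  qed simp
  finally show ?thesis .
 qed
 have int: "integrable \<nu> (\<lambda>x. indicator ?J x * - x)" using nn by (intro integrableI_nonneg) (auto simp: indicator_def intro: le_less_trans)
 have "0 <= \<delta> - \<gamma>"
 proof -
  have fi: "0 <= (LINT x|\<nu>. f n x)" for n using fpos by (intro Bochner_Integration.integral_nonneg)
  have "0 <= \<delta> - \<gamma> + N * (1 / real (Suc n))" for n using order.trans[OF fi f_le, of n] by simp
  moreover have "(\<lambda>n. \<delta> - \<gamma> + N * (1 / real (Suc n))) \<longlonglongrightarrow> \<delta> - \<gamma> + N * 0" by (intro tendsto_intros LIMSEQ_Suc[OF lim_1_over_n])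
  ultimately have "0 <= \<delta> - \<gamma> + N * 0" by (intro LIMSEQ_le_const) auto
  thus ?thesis by simp
 qed
 hence "(LINT x|\<nu>. indicator ?J x * - x) <= \<delta> - \<gamma>" using nn int by (subst (asm) nn_integral_eq_integral) (auto simp: indicator_def)
 moreover have "(LINT x|\<nu>. indicator ?J x * - x) = - (LINT x:?J|\<nu>. x)"
  unfolding set_lebesgue_integral_def by (subst Bochner_Integration.integral_minus[symmetric]) simp
 ultimately show ?thesis unfolding bv_drift_def by simp
qed

text \<open>Here the condition \<delta> < c enters: if \<open>\<psi> l <= \<delta> * l\<close> held
  for all \<open>l > 0\<close>, the paths would have bounded variation and drift at most \<delta>.
  One point of strict inequality extends to all larger arguments by superlinearity.\<close>

lemma \<psi>_linear_growth:
 obtains e l0 where "0 < e" "0 < l0" "\<forall>l\<ge>l0. (\<delta> + e) * l <= \<psi> l"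
proof -
 have "\<not> (\<forall>l>0. \<psi> l <= \<delta> * l)" using bv_drift_le bv[OF bounded_variation_if_increment_le] by fastforce
 then obtain l0 where l0: "0 < l0" "\<delta> * l0 < \<psi> l0" by (auto simp: not_le)
 have "(\<delta> + (\<psi> l0 / l0 - \<delta>)) * l <= \<psi> l" if "l0 <= l" for l using \<psi>_superlinear[of l0 "l / l0"] l0 that by (simp add: field_simps)
 moreover have "0 < \<psi> l0 / l0 - \<delta>" using l0 by (simp add: field_simps)
 ultimately show ?thesis using that[of "\<psi> l0 / l0 - \<delta>" l0] l0 by blast
qed

end

section \<open>Small-time tails\<close>

context sn_levy_triplet
begin

lemma tail_bound:
 assumes "0 <= l" "0 <= \<kappa>" "0 <= s"
 shows "integrable M (\<lambda>w. exp (l * X s w) * indicator {\<eta><..} (X s w))"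
  and "(EE w. exp (l * X s w) * indicator {\<eta><..} (X s w)) <= exp (- \<kappa> * \<eta> + s * \<psi> (l + \<kappa>))"
proof -
 have [measurable]: "X s \<in> borel_measurable M" using assms by (intro random_variable_X)
 show i: "integrable M (\<lambda>w. exp (l * X s w) * indicator {\<eta><..} (X s w))"
 proof (rule Bochner_Integration.integrable_bound)
  show "integrable M (\<lambda>w. exp (l * X s w))" using mgf[OF assms(1,3)] by (simp add: has_bochner_integral_iff)
 qed (auto simp: indicator_def)
 have m: "has_bochner_integral M (\<lambda>w. exp (- \<kappa> * \<eta>) * exp ((l + \<kappa>) * X s w)) (exp (- \<kappa> * \<eta>) * exp (s * \<psi> (l + \<kappa>)))"
  using mgf[of "l + \<kappa>" s] assms by (intro has_bochner_integral_mult_right) auto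
 have "(EE w. exp (l * X s w) * indicator {\<eta><..} (X s w)) <= exp (- \<kappa> * \<eta>) * exp (s * \<psi> (l + \<kappa>))"
 proof (rule has_bochner_integral_mono[OF _ m])
  show "has_bochner_integral M (\<lambda>w. exp (l * X s w) * indicator {\<eta><..} (X s w))
   ((EE w. exp (l * X s w) * indicator {\<eta><..} (X s w)))" using i by (rule has_bochner_integral_integrable)
  fix w
  have "\<kappa> * \<eta> <= \<kappa> * X s w" if "\<eta> < X s w" using assms that by (intro mult_left_mono) auto
  thus "exp (l * X s w) * indicator {\<eta><..} (X s w) <= exp (- \<kappa> * \<eta>) * exp ((l + \<kappa>) * X s w)"
   by (auto simp: indicator_def exp_add[symmetric] algebra_simps)
 qed
 thus "(EE w. exp (l * X s w) * indicator {\<eta><..} (X s w)) <= exp (- \<kappa> * \<eta> + s * \<psi> (l + \<kappa>))" by (simp only: exp_add)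
qed

text \<open>Exponential tilting by \<open>sqrt (real n)\<close>: as \<psi> grows at most
  quadratically, \<open>\<psi> (l + sqrt (real n)) / real n\<close> stays bounded, while
  \<open>exp (- sqrt (real n) * \<eta>)\<close> beats the factor \<open>real n\<close>. The absence
  of upward jumps thus becomes an upper tail of order o(1/n).\<close>

lemma tail_o:
 assumes "0 <= l" "0 < \<eta>"
 shows "(\<lambda>n. real n * (EE w. exp (l * X (1 / real n) w) * indicator {\<eta><..} (X (1 / real n) w))) \<longlonglongrightarrow> 0"
proof -
 obtain C where C: "0 <= C" "\<forall>l\<ge>0. \<psi> l <= C * (1 + l\<^sup>2)" by (rule \<psi>_quadratic)
 define D where "D = exp (C * (3 + 2 * l\<^sup>2))"
 have bound: "real n * (EE w. exp (l * X (1 / real n) w) * indicator {\<eta><..} (X (1 / real n) w))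
   <= D * (real n * exp (- sqrt (real n) * \<eta>))" if "0 < n" for n
 proof -
  have "(l + sqrt (real n))\<^sup>2 <= 2 * l\<^sup>2 + 2 * real n" using sum_squares_bound[of l "sqrt (real n)"] by (simp add: power2_sum)
  hence "1 + (l + sqrt (real n))\<^sup>2 <= (3 + 2 * l\<^sup>2) * real n"
  proof -
   assume *: "(l + sqrt (real n))\<^sup>2 <= 2 * l\<^sup>2 + 2 * real n"
   have "1 <= real n" using that by simp
   moreover have "2 * l\<^sup>2 * 1 <= 2 * l\<^sup>2 * real n" using that by (intro mult_left_mono) auto
   ultimately show ?thesis using * by (simp add: distrib_right)
  qed
  hence "1 / real n * (1 + (l + sqrt (real n))\<^sup>2) <= 3 + 2 * l\<^sup>2" using that by (simp add: field_simps)
  hence "C * (1 / real n * (1 + (l + sqrt (real n))\<^sup>2)) <= C * (3 + 2 * l\<^sup>2)" using C(1) by (intro mult_left_mono)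
  moreover have "1 / real n * \<psi> (l + sqrt (real n)) <= 1 / real n * (C * (1 + (l + sqrt (real n))\<^sup>2))" using C(2) assms by (intro mult_left_mono) auto
  ultimately have "1 / real n * \<psi> (l + sqrt (real n)) <= C * (3 + 2 * l\<^sup>2)" by (simp add: algebra_simps)
  hence "exp (- sqrt (real n) * \<eta> + 1 / real n * \<psi> (l + sqrt (real n))) <= D * exp (- sqrt (real n) * \<eta>)" unfolding D_def exp_add[symmetric] by simp
  hence "(EE w. exp (l * X (1 / real n) w) * indicator {\<eta><..} (X (1 / real n) w)) <= D * exp (- sqrt (real n) * \<eta>)"
   using tail_bound(2)[of l "sqrt (real n)" "1 / real n" \<eta>] assms by simp
  thus ?thesis using that by (simp add: mult_left_mono mult.left_commute)
 qed
 have "((\<lambda>x. x * exp (- sqrt x * \<eta>)) \<longlongrightarrow> 0) at_top" using assms(2) by real_asymp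
 hence "(\<lambda>n. real n * exp (- sqrt (real n) * \<eta>)) \<longlonglongrightarrow> 0" by (rule filterlim_compose[OF _ filterlim_real_sequentially])
 hence lim: "(\<lambda>n. D * (real n * exp (- sqrt (real n) * \<eta>))) \<longlonglongrightarrow> 0" by (rule tendsto_mult_right_zero)
 show ?thesis
 proof (rule tendsto_sandwich[OF _ _ tendsto_const lim])
  show "EV n. 0 <= real n * (EE w. exp (l * X (1 / real n) w) * indicator {\<eta><..} (X (1 / real n) w))"
   by (intro always_eventually allI mult_nonneg_nonneg Bochner_Integration.integral_nonneg) auto
  show "EV n. real n * (EE w. exp (l * X (1 / real n) w) * indicator {\<eta><..} (X (1 / real n) w))
   <= D * (real n * exp (- sqrt (real n) * \<eta>))" using eventually_gt_at_top[of 0] by eventually_elim (rule bound)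
 qed
qed

lemma prob_large_at_right_0:
 assumes "0 < \<eta>"
 shows "((\<lambda>s. (EE z. indicator {\<eta><..} \<bar>X s z\<bar> :: real)) \<longlongrightarrow> 0) (at_right 0)"
proof (rule tendsto_at_right_sequentially[OF zero_less_one])
 fix S :: "nat => real" assume S: "\<And>n. 0 < S n" "S \<longlonglongrightarrow> 0"
 have [measurable]: "X (S n) \<in> borel_measurable M" for n using S(1)[of n] by (intro random_variable_X) simp
 have "(\<lambda>n. (EE z. indicator {\<eta><..} \<bar>X (S n) z\<bar> :: real)) \<longlonglongrightarrow> (EE z. 0)"
 proof (rule integral_dominated_convergence[where w="\<lambda>_. 1"])
  show "AE z in M. (\<lambda>n. indicator {\<eta><..} \<bar>X (S n) z\<bar> :: real) \<longlonglongrightarrow> 0" using starts_at_0 cadlag_paths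
  proof eventually_elim
   case (elim z)
   have "((\<lambda>t. X t z) \<longlongrightarrow> X 0 z) (at_right 0)" using elim(2) by (auto simp: cadlag_def)
   hence "(\<lambda>n. X (S n) z) \<longlonglongrightarrow> X 0 z" by (rule filterlim_compose) (intro tendsto_imp_filterlim_at_right S always_eventually allI)
   hence "(\<lambda>n. \<bar>X (S n) z\<bar>) \<longlonglongrightarrow> \<bar>X 0 z\<bar>" by (intro tendsto_intros)
   from order_tendstoD(2)[OF this, of \<eta>] elim(1) assms
   have "EV n. \<bar>X (S n) z\<bar> < \<eta>" by simp
   hence "EV n. indicator {\<eta><..} \<bar>X (S n) z\<bar> = (0::real)" by eventually_elim (auto simp: indicator_def)
   thus ?case by (rule tendsto_eventually)
  qed
 qed auto
 thus "(\<lambda>n. (EE z. indicator {\<eta><..} \<bar>X (S n) z\<bar> :: real)) \<longlonglongrightarrow> 0" by simp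
qed

text \<open>For downward moves the exponential is at most 1 and a small probability suffices; upward
  moves are handled by tilting.\<close>

lemma small_time:
 assumes "0 <= l" "0 < \<eta>" "0 < e"
 obtains s0 where "0 < s0"
  "\<forall>s. 0 < s \<and> s < s0 --> integrable M (\<lambda>w. (1 + exp (l * X s w)) * indicator {\<eta><..} \<bar>X s w\<bar>) \<and>
   (EE w. (1 + exp (l * X s w)) * indicator {\<eta><..} \<bar>X s w\<bar>) <= e"
proof -
 have "\<forall>\<^sub>F s in at_right 0. (EE w. indicator {\<eta><..} \<bar>X s w\<bar> :: real) < e / 4"
  using order_tendstoD(2)[OF prob_large_at_right_0[OF assms(2)], of "e / 4"] assms by simp
 then obtain s1 where s1: "0 < s1" "\<And>s. 0 < s ==> s < s1 ==> (EE w. indicator {\<eta><..} \<bar>X s w\<bar> :: real) < e / 4"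
  unfolding eventually_at_right_field by auto
 \<comment> \<open>Makes the tilted tail at most \<open>e / 4\<close> in the limit of vanishing
   time; a small \<open>s\<close> then keeps it below \<open>e / 2\<close>.\<close>
 define \<kappa> where "\<kappa> = max 0 (ln (4 / e) / \<eta>)"
 have \<kappa>: "0 <= \<kappa>" "exp (- \<kappa> * \<eta>) <= e / 4"
 proof -
  show "0 <= \<kappa>" by (simp add: \<kappa>_def)
  have "ln (4 / e) / \<eta> <= \<kappa>" by (simp add: \<kappa>_def)
  hence "ln (4 / e) <= \<kappa> * \<eta>" using assms by (simp add: pos_divide_le_eq)
  hence "exp (- (\<kappa> * \<eta>)) <= exp (- ln (4 / e))" by simp
  also have "\<dots> = e / 4" using assms by (simp add: exp_minus)
  finally show "exp (- \<kappa> * \<eta>) <= e / 4" by simp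
 qed
 have "((\<lambda>s. exp (- \<kappa> * \<eta> + s * \<psi> (l + \<kappa>))) \<longlongrightarrow> exp (- \<kappa> * \<eta> + 0 * \<psi> (l + \<kappa>))) (at_right 0)" by (intro tendsto_intros)
 hence "\<forall>\<^sub>F s in at_right 0. exp (- \<kappa> * \<eta> + s * \<psi> (l + \<kappa>)) < e / 2" by (rule order_tendstoD(2)) (use \<kappa>(2) assms in auto)
 then obtain s2 where s2: "0 < s2" "\<And>s. 0 < s ==> s < s2 ==> exp (- \<kappa> * \<eta> + s * \<psi> (l + \<kappa>)) < e / 2" unfolding eventually_at_right_field by auto
 show ?thesis
 proof (rule that[of "min s1 s2"], goal_cases)
  case 1
  thus ?case using s1 s2 by simp
 next
  case 2
  show ?case
  proof (intro allI impI)
   fix s assume s: "0 < s \<and> s < min s1 s2"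
   hence [measurable]: "X s \<in> borel_measurable M" by (intro random_variable_X) simp
   note tb = tail_bound[OF assms(1) \<kappa>(1), of s \<eta>]
   have i1: "integrable M (\<lambda>w. exp (l * X s w) * indicator {\<eta><..} (X s w))" using tb(1) s by simp
   have i2: "integrable M (\<lambda>w. indicator {\<eta><..} \<bar>X s w\<bar> :: real)" by (rule integrable_const_bound[where B=1]) auto
   have i: "integrable M (\<lambda>w. 2 * indicator {\<eta><..} \<bar>X s w\<bar> + exp (l * X s w) * indicator {\<eta><..} (X s w))" using i1 i2 by auto
   have le: "(1 + exp (l * X s w)) * indicator {\<eta><..} \<bar>X s w\<bar> <=
     2 * indicator {\<eta><..} \<bar>X s w\<bar> + exp (l * X s w) * indicator {\<eta><..} (X s w)" for w
   proof (cases "\<eta> < X s w")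
    case True
    thus ?thesis using assms by (simp add: indicator_def)
   next
    case False
    have "exp (l * X s w) <= 1" if "\<eta> < \<bar>X s w\<bar>" using False that assms by (simp add: mult_nonneg_nonpos)
    thus ?thesis using False by (simp add: indicator_def)
   qed
   have j: "integrable M (\<lambda>w. (1 + exp (l * X s w)) * indicator {\<eta><..} \<bar>X s w\<bar>)"
   proof (rule Bochner_Integration.integrable_bound[OF i])
    show "AE w in M. norm ((1 + exp (l * X s w)) * indicator {\<eta><..} \<bar>X s w\<bar>) <=
      norm (2 * indicator {\<eta><..} \<bar>X s w\<bar> + exp (l * X s w) * indicator {\<eta><..} (X s w))"
    proof (rule AE_I2)
     fix w
     have "0 <= (1 + exp (l * X s w)) * indicator {\<eta><..} \<bar>X s w\<bar>" by simp
     thus "norm ((1 + exp (l * X s w)) * indicator {\<eta><..} \<bar>X s w\<bar>) <=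
      norm (2 * indicator {\<eta><..} \<bar>X s w\<bar> + exp (l * X s w) * indicator {\<eta><..} (X s w))" using le[of w] unfolding real_norm_def by linarith
    qed
   qed measurable
   have "(EE w. (1 + exp (l * X s w)) * indicator {\<eta><..} \<bar>X s w\<bar>) <=
     (EE w. 2 * indicator {\<eta><..} \<bar>X s w\<bar> + exp (l * X s w) * indicator {\<eta><..} (X s w))" by (rule integral_mono[OF j i le])
   also have "\<dots> = 2 * (EE w. indicator {\<eta><..} \<bar>X s w\<bar>) + (EE w. exp (l * X s w) * indicator {\<eta><..} (X s w))" using i1 i2 by simp
   also have "\<dots> <= e" using s1(2)[of s] s2(2)[of s] tb(2) s by simp
   finally show "integrable M (\<lambda>w. (1 + exp (l * X s w)) * indicator {\<eta><..} \<bar>X s w\<bar>) \<and>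
    (EE w. (1 + exp (l * X s w)) * indicator {\<eta><..} \<bar>X s w\<bar>) <= e" using j by blast
  qed
 qed
qed

end

subsection \<open>Uniqueness of Laplace transforms and the one-step formula\<close>

lemma abs_exp_minus_1_le:
 fixes u :: real
 shows "\<bar>exp u - 1\<bar> <= \<bar>u\<bar> * exp \<bar>u\<bar>"
proof (cases "0 <= u")
 case True
 have "exp u * (1 - exp (- u)) <= exp u * u" using exp_ge_add_one_self[of "- u"] by (intro mult_left_mono) auto
 thus ?thesis using True by (simp add: right_diff_distrib exp_minus mult.commute)
next
 case False
 have "1 - exp u <= - u" using exp_ge_add_one_self[of u] by linarith
 also have "\<dots> * 1 <= - u * exp (- u)" using False by (intro mult_left_mono) auto
 finally show ?thesis using False by simp
qed

lemma power_le_exp: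
 fixes y h :: real
 assumes "0 < h"
 shows "\<bar>y\<bar> ^ m <= (real m / h) ^ m * exp (h * \<bar>y\<bar>)"
proof (cases "m = 0")
 case False
 have "h * \<bar>y\<bar> / real m <= exp (h * \<bar>y\<bar> / real m)" using exp_ge_add_one_self[of "h * \<bar>y\<bar> / real m"] by linarith
 hence "(h * \<bar>y\<bar> / real m) ^ m <= exp (h * \<bar>y\<bar> / real m) ^ m" using assms by (intro power_mono) auto
 also have "\<dots> = exp (h * \<bar>y\<bar>)" using False by (simp add: exp_of_nat_mult[symmetric])
 finally have "(real m / h) ^ m * (h * \<bar>y\<bar> / real m) ^ m <= (real m / h) ^ m * exp (h * \<bar>y\<bar>)" using assms by (intro mult_left_mono) auto
 moreover have "(real m / h) ^ m * (h * \<bar>y\<bar> / real m) ^ m = \<bar>y\<bar> ^ m" unfolding power_mult_distrib[symmetric] using assms False by simp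
 ultimately show ?thesis by simp
qed (use assms in simp)

text \<open>Functions on the whole line, because the mean of a randomly shifted function need not
  vanish on a half-line even if the function does.\<close>

locale two_sided_laplace =
 fixes \<phi> :: "real => real" and l0 :: real
 assumes int: "\<And>l. l0 < l ==> integrable lborel (\<lambda>y. exp (- l * y) * \<phi> y)"
begin

lemma measurable_\<phi> [measurable]: "\<phi> \<in> borel_measurable borel"
proof -
 have "(\<lambda>y. exp (- (l0 + 1) * y) * \<phi> y) \<in> borel_measurable borel" using int[of "l0 + 1"] by (auto dest: borel_measurable_integrable)
 hence "(\<lambda>y. exp ((l0 + 1) * y) * (exp (- (l0 + 1) * y) * \<phi> y)) \<in> borel_measurable borel" by measurable
 moreover have e: "exp (a * y) * (exp (- a * y) * z) = z" for a y z :: real by (simp add: exp_minus)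
 ultimately show ?thesis unfolding e by simp
qed

lemma integrable_exp_abs:
 assumes "0 <= r" "l0 < l - r"
 shows "integrable lborel (\<lambda>y. exp (r * \<bar>y\<bar>) * (exp (- l * y) * \<phi> y))"
proof (rule Bochner_Integration.integrable_bound)
 show "integrable lborel (\<lambda>y. \<bar>exp (- (l - r) * y) * \<phi> y\<bar> + \<bar>exp (- (l + r) * y) * \<phi> y\<bar>)"
  using assms by (intro Bochner_Integration.integrable_add integrable_abs int) auto
 show "AE y in lborel. norm (exp (r * \<bar>y\<bar>) * (exp (- l * y) * \<phi> y))
   <= norm (\<bar>exp (- (l - r) * y) * \<phi> y\<bar> + \<bar>exp (- (l + r) * y) * \<phi> y\<bar>)"
 proof (rule AE_I2)
  fix y
  have "exp (r * \<bar>y\<bar>) * exp (- l * y) <= exp (- (l - r) * y) + exp (- (l + r) * y)" by (cases "0 <= y") (simp_all add: exp_add[symmetric] algebra_simps)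
  hence "exp (r * \<bar>y\<bar>) * exp (- l * y) * \<bar>\<phi> y\<bar> <= (exp (- (l - r) * y) + exp (- (l + r) * y)) * \<bar>\<phi> y\<bar>" by (intro mult_right_mono) auto
  thus "norm (exp (r * \<bar>y\<bar>) * (exp (- l * y) * \<phi> y))
   <= norm (\<bar>exp (- (l - r) * y) * \<phi> y\<bar> + \<bar>exp (- (l + r) * y) * \<phi> y\<bar>)" by (simp add: abs_mult distrib_right mult.assoc)
 qed
qed measurable

lemma integrable_power_exp_abs:
 assumes "0 <= r" "l0 < l - r"
 shows "integrable lborel (\<lambda>y. \<bar>y\<bar> ^ m * exp (r * \<bar>y\<bar>) * (exp (- l * y) * \<phi> y))"
proof (rule Bochner_Integration.integrable_bound)
 define h where "h = (l - r - l0) / 2"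
 have h: "0 < h" "l0 < l - (r + h)" using assms by (auto simp: h_def field_simps)
 show "integrable lborel (\<lambda>y. (real m / h) ^ m * (exp ((r + h) * \<bar>y\<bar>) * (exp (- l * y) * \<phi> y)))"
  using h assms by (intro integrable_mult_right integrable_exp_abs) auto
 show "AE y in lborel. norm (\<bar>y\<bar> ^ m * exp (r * \<bar>y\<bar>) * (exp (- l * y) * \<phi> y))
   <= norm ((real m / h) ^ m * (exp ((r + h) * \<bar>y\<bar>) * (exp (- l * y) * \<phi> y)))"
 proof (rule AE_I2)
  fix y
  have "\<bar>y\<bar> ^ m * exp (r * \<bar>y\<bar>) <= (real m / h) ^ m * exp (h * \<bar>y\<bar>) * exp (r * \<bar>y\<bar>)"
   using power_le_exp[OF h(1), of y m] by (intro mult_right_mono) auto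
  hence *: "\<bar>y\<bar> ^ m * exp (r * \<bar>y\<bar>) * \<bar>exp (- l * y) * \<phi> y\<bar> <=
    (real m / h) ^ m * exp (h * \<bar>y\<bar>) * exp (r * \<bar>y\<bar>) * \<bar>exp (- l * y) * \<phi> y\<bar>" by (intro mult_right_mono) auto
  show "norm (\<bar>y\<bar> ^ m * exp (r * \<bar>y\<bar>) * (exp (- l * y) * \<phi> y))
   <= norm ((real m / h) ^ m * (exp ((r + h) * \<bar>y\<bar>) * (exp (- l * y) * \<phi> y)))"
  proof -
   have "exp ((r + h) * \<bar>y\<bar>) = exp (h * \<bar>y\<bar>) * exp (r * \<bar>y\<bar>)" by (simp add: exp_add[symmetric] algebra_simps)
   thus ?thesis using * h(1) by (simp add: abs_mult mult.assoc)
  qed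
 qed
qed measurable

end

locale two_sided_laplace_zero = two_sided_laplace +
 assumes zero: "\<And>l. l0 < l ==> (LINT y|lborel. exp (- l * y) * \<phi> y) = 0"
begin

lemma integrable_moment:
 assumes "l0 < l"
 shows "integrable lborel (\<lambda>y. y ^ m * (exp (- l * y) * \<phi> y))"
proof (rule Bochner_Integration.integrable_bound)
 show "integrable lborel (\<lambda>y. \<bar>y\<bar> ^ m * exp (0 * \<bar>y\<bar>) * (exp (- l * y) * \<phi> y))" using assms by (intro integrable_power_exp_abs) auto
qed (auto simp: abs_mult power_abs)

text \<open>Differentiation in \<open>l\<close>: the difference quotients of a vanishing transform
  vanish, and a smaller tilt by \<open>g k\<close> multiplies the integrand by at most
  \<open>exp (h * \<bar>y\<bar>)\<close>, which is still integrable against it.\<close>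

lemma moment_zero:
 assumes "l0 < l"
 shows "(LINT y|lborel. y ^ m * (exp (- l * y) * \<phi> y)) = 0" using assms
proof (induction m arbitrary: l)
 case 0
 thus ?case using zero by simp
next
 case (Suc m)
 define h where "h = (l - l0) / 2"
 have h: "0 < h" "l0 < l - h" using Suc.prems by (auto simp: h_def field_simps)
 define g where "g k = h * (1 / real (Suc k))" for k
 have g: "0 < g k" "g k <= h" for k using h(1) by (auto simp: g_def divide_le_eq mult_left_le)
 have "g \<longlonglongrightarrow> h * 0" unfolding g_def by (intro tendsto_intros LIMSEQ_Suc[OF lim_1_over_n])
 hence g0: "filterlim g (at 0) sequentially" using g(1) by (auto simp: filterlim_at intro!: always_eventually less_imp_neq[symmetric])
 define q where "q k y = (exp (g k * y) - 1) / g k * (y ^ m * (exp (- l * y) * \<phi> y))" for k y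
 have q: "(LINT y|lborel. q k y) = 0" for k
 proof -
  have "q k y = (y ^ m * (exp (- (l - g k) * y) * \<phi> y) - y ^ m * (exp (- l * y) * \<phi> y)) / g k" for y
   by (simp add: q_def algebra_simps exp_add[symmetric] diff_divide_distrib)
  thus ?thesis using Suc.IH[of "l - g k"] Suc.IH[of l] integrable_moment[of "l - g k" m] integrable_moment[of l m]
    g[of k] h Suc.prems by simp
 qed
 have "(\<lambda>k. LINT y|lborel. q k y) \<longlonglongrightarrow> (LINT y|lborel. y ^ Suc m * (exp (- l * y) * \<phi> y))"
 proof (rule integral_dominated_convergence[where w="\<lambda>y. norm (\<bar>y\<bar> ^ Suc m * exp (h * \<bar>y\<bar>) * (exp (- l * y) * \<phi> y))"])
  show "integrable lborel (\<lambda>y. norm (\<bar>y\<bar> ^ Suc m * exp (h * \<bar>y\<bar>) * (exp (- l * y) * \<phi> y)))"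
   using h by (intro integrable_norm integrable_power_exp_abs) auto
  show "AE y in lborel. (\<lambda>k. q k y) \<longlonglongrightarrow> y ^ Suc m * (exp (- l * y) * \<phi> y)"
  proof (rule AE_I2)
   fix y :: real
   have "((\<lambda>e. exp (e * y)) has_field_derivative y) (at 0)" by (auto intro!: derivative_eq_intros)
   hence "((\<lambda>e. (exp (e * y) - 1) / e) \<longlongrightarrow> y) (at 0)" by (simp add: DERIV_def)
   from filterlim_compose[OF this g0]
   have "(\<lambda>k. (exp (g k * y) - 1) / g k * (y ^ m * (exp (- l * y) * \<phi> y))) \<longlonglongrightarrow> y * (y ^ m * (exp (- l * y) * \<phi> y))" by (intro tendsto_intros)
   thus "(\<lambda>k. q k y) \<longlonglongrightarrow> y ^ Suc m * (exp (- l * y) * \<phi> y)" by (simp add: q_def[abs_def] mult.assoc)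
  qed
  show "AE y in lborel. norm (q k y) <= norm (\<bar>y\<bar> ^ Suc m * exp (h * \<bar>y\<bar>) * (exp (- l * y) * \<phi> y))" for k
  proof (rule AE_I2)
   fix y :: real
   have "\<bar>exp (g k * y) - 1\<bar> <= g k * \<bar>y\<bar> * exp (g k * \<bar>y\<bar>)" using abs_exp_minus_1_le[of "g k * y"] g(1)[of k] by (simp add: abs_mult)
   also have "\<dots> <= g k * \<bar>y\<bar> * exp (h * \<bar>y\<bar>)" using g[of k] by (intro mult_left_mono) (auto intro: mult_right_mono)
   finally have "\<bar>(exp (g k * y) - 1) / g k\<bar> <= \<bar>y\<bar> * exp (h * \<bar>y\<bar>)" using g(1)[of k] by (simp add: field_simps)
   hence "\<bar>(exp (g k * y) - 1) / g k\<bar> * \<bar>y ^ m * (exp (- l * y) * \<phi> y)\<bar> <=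
     \<bar>y\<bar> * exp (h * \<bar>y\<bar>) * \<bar>y ^ m * (exp (- l * y) * \<phi> y)\<bar>" by (intro mult_right_mono) auto
   thus "norm (q k y) <= norm (\<bar>y\<bar> ^ Suc m * exp (h * \<bar>y\<bar>) * (exp (- l * y) * \<phi> y))" by (simp add: q_def abs_mult power_abs mult_ac)
  qed
 qed (auto simp: q_def)
 thus ?case unfolding q using LIMSEQ_unique tendsto_const by blast
qed

text \<open>The exponential series in \<open>w\<close> is integrated term by term, and every term is
  a vanishing moment. This extends the zero transform from the real point \<open>c\<close> to a
  complex disc of radius \<open>c - l0\<close> around it.\<close>

lemma complex_zero:
 assumes "l0 < c - cmod w"
 shows "(LINT y|lborel. complex_of_real (exp (- c * y) * \<phi> y) * exp (w * of_real y)) = 0"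
proof -
 have c: "l0 < c" using assms norm_ge_zero[of w] by linarith
 define S where "S N y = complex_of_real (exp (- c * y) * \<phi> y) * (\<Sum>n<N. (w * of_real y) ^ n /\<^sub>R fact n)" for N y
 have im: "integrable lborel (\<lambda>y. complex_of_real (y ^ n * (exp (- c * y) * \<phi> y)) * (w ^ n /\<^sub>R fact n))" for n
  by (intro integrable_mult_left integrable_of_real integrable_moment c)
 have S: "S N y = (\<Sum>n<N. complex_of_real (y ^ n * (exp (- c * y) * \<phi> y)) * (w ^ n /\<^sub>R fact n))" for N y
  by (simp add: S_def sum_distrib_left power_mult_distrib scaleR_conv_of_real mult_ac)
 have S0: "(LINT y|lborel. S N y) = 0" for N
  unfolding S by (subst Bochner_Integration.integral_sum[OF im]) (use moment_zero[OF c] in "simp del: of_real_mult of_real_power")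
 have "(\<lambda>N. LINT y|lborel. S N y) \<longlonglongrightarrow>
   (LINT y|lborel. complex_of_real (exp (- c * y) * \<phi> y) * exp (w * of_real y))"
 proof (rule integral_dominated_convergence[where w="\<lambda>y. norm (exp (cmod w * \<bar>y\<bar>) * (exp (- c * y) * \<phi> y))"])
  show "integrable lborel (\<lambda>y. norm (exp (cmod w * \<bar>y\<bar>) * (exp (- c * y) * \<phi> y)))" using assms by (intro integrable_norm integrable_exp_abs) auto
  show "AE y in lborel. (\<lambda>N. S N y) \<longlonglongrightarrow> complex_of_real (exp (- c * y) * \<phi> y) * exp (w * of_real y)"
   unfolding S_def by (intro AE_I2 tendsto_intros) (use exp_converges[of "w * of_real _"] in "simp add: sums_def")
  show "AE y in lborel. norm (S N y) <= norm (exp (cmod w * \<bar>y\<bar>) * (exp (- c * y) * \<phi> y))" for N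
  proof (rule AE_I2)
   fix y :: real
   have "norm (\<Sum>n<N. (w * of_real y) ^ n /\<^sub>R fact n) <= (\<Sum>n<N. (cmod w * \<bar>y\<bar>) ^ n /\<^sub>R fact n)"
    by (rule order.trans[OF norm_sum]) (simp add: norm_mult norm_power power_mult_distrib)
   also have "\<dots> <= exp (cmod w * \<bar>y\<bar>)" using sum_le_suminf[of "\<lambda>n. (cmod w * \<bar>y\<bar>) ^ n /\<^sub>R fact n" "{..<N}"] summable_exp_generic[of "cmod w * \<bar>y\<bar>"]
    by (simp add: exp_def)
   finally show "norm (S N y) <= norm (exp (cmod w * \<bar>y\<bar>) * (exp (- c * y) * \<phi> y))"
    using mult_right_mono[of "cmod (\<Sum>n<N. (w * of_real y) ^ n /\<^sub>R fact n)" "exp (cmod w * \<bar>y\<bar>)" "\<bar>exp (- c * y) * \<phi> y\<bar>"]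
    by (simp add: S_def norm_mult abs_mult mult_ac)
  qed
 qed (auto simp: S_def)
 thus ?thesis unfolding S0 using LIMSEQ_unique tendsto_const by blast
qed

text \<open>A disc around a fixed centre misses large frequencies. From the centre
  \<open>l0 + 1 + t\<^sup>2\<close> the displacement \<open>w\<close> has modulus below
  \<open>t\<^sup>2 + 1\<close>, which is the radius of the disc there, and its real part cancels the
  shift of the centre.\<close>

lemma fourier_zero:
 "(LINT y|lborel. complex_of_real (exp (- (l0 + 1) * y) * \<phi> y) * iexp (t * y)) = 0"
proof -
 define w where "w = Complex (t\<^sup>2) t"
 have "(cmod w)\<^sup>2 = (t\<^sup>2)\<^sup>2 + t\<^sup>2" by (simp add: w_def cmod_power2)
 also have "\<dots> < (t\<^sup>2 + 1)\<^sup>2" by (simp add: power2_sum add_nonneg_pos)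
 finally have "cmod w < t\<^sup>2 + 1" by (rule power2_less_imp_less) simp
 hence "l0 < (l0 + 1 + t\<^sup>2) - cmod w" by linarith
 from complex_zero[OF this]
 have z: "(LINT y|lborel. complex_of_real (exp (- (l0 + 1 + t\<^sup>2) * y) * \<phi> y) * exp (w * of_real y)) = 0" .
 have e: "complex_of_real (exp (- (l0 + 1 + t\<^sup>2) * y) * \<phi> y) * exp (w * of_real y) =
   complex_of_real (exp (- (l0 + 1) * y) * \<phi> y) * iexp (t * y)" for y
 proof -
  have "w * of_real y = of_real (t\<^sup>2 * y) + \<i> * of_real (t * y)" by (simp add: w_def complex_eq_iff)
  hence "exp (w * of_real y) = complex_of_real (exp (t\<^sup>2 * y)) * iexp (t * y)" by (simp only: exp_add exp_of_real)
  moreover have "exp (- (l0 + 1 + t\<^sup>2) * y) * exp (t\<^sup>2 * y) = exp (- (l0 + 1) * y)" by (simp add: exp_add[symmetric] algebra_simps)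
  moreover have "complex_of_real (exp (- (l0 + 1 + t\<^sup>2) * y) * \<phi> y) * (complex_of_real (exp (t\<^sup>2 * y)) * iexp (t * y)) =
    complex_of_real (exp (- (l0 + 1 + t\<^sup>2) * y) * exp (t\<^sup>2 * y) * \<phi> y) * iexp (t * y)" unfolding of_real_mult by (simp only: mult_ac)
  ultimately show ?thesis by (simp only:)
 qed
 show ?thesis using z unfolding e .
qed

text \<open>Positive and negative part of the tilted function have the same Fourier transform, in
  particular (at \<open>t = 0\<close>) the same mass \<open>A\<close>. If \<open>A\<close> is
  positive, they are after normalisation densities of two distributions with equal characteristic
  functions, and Levy's uniqueness theorem applies.\<close>

lemma AE_zero: "AE y in lborel. \<phi> y = 0"
proof -
 define g where "g y = exp (- (l0 + 1) * y) * \<phi> y" for y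
 have g: "integrable lborel g" unfolding g_def using int[of "l0 + 1"] by simp
 have [measurable]: "g \<in> borel_measurable borel" unfolding g_def by measurable
 define p where "p y = max 0 (g y)" for y
 define m where "m y = max 0 (- g y)" for y
 have pm: "g y = p y - m y" "0 <= p y" "0 <= m y" "p y * m y = 0" for y by (auto simp: p_def m_def max_def)
 have [measurable]: "p \<in> borel_measurable borel" "m \<in> borel_measurable borel" unfolding p_def m_def by measurable
 have ip: "integrable lborel p" "integrable lborel m" unfolding p_def m_def using g by auto
 have F0: "(LINT y|lborel. complex_of_real (p y) * iexp (t * y)) = (LINT y|lborel. complex_of_real (m y) * iexp (t * y))" for t
 proof -
  have i: "integrable lborel (\<lambda>y. complex_of_real (f y) * iexp (t * y))" if "integrable lborel f" for f
   by (rule Bochner_Integration.integrable_bound[OF that]) (use borel_measurable_integrable[OF that] in "auto simp: norm_mult")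
  have "(LINT y|lborel. complex_of_real (p y) * iexp (t * y)) - (LINT y|lborel. complex_of_real (m y) * iexp (t * y))
    = (LINT y|lborel. complex_of_real (g y) * iexp (t * y))"
   by (subst Bochner_Integration.integral_diff[symmetric, OF i[OF ip(1)] i[OF ip(2)]]) (simp add: pm(1) left_diff_distrib)
  also have "\<dots> = 0" unfolding g_def by (rule fourier_zero)
  finally show ?thesis by simp
 qed
 define A where "A = (LINT y|lborel. p y)"
 have A': "(LINT y|lborel. m y) = A" using F0[of 0] by (simp add: A_def)
 have "AE y in lborel. p y = m y"
 proof (cases "A = 0")
  case True
  hence "AE y in lborel. p y = 0" "AE y in lborel. m y = 0"
   using integral_nonneg_eq_0_iff_AE[OF ip(1)] integral_nonneg_eq_0_iff_AE[OF ip(2)] pm(2,3) A' by (simp_all add: A_def)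
  thus ?thesis by eventually_elim simp
 next
  case False
  have A: "0 < A" using False pm unfolding A_def by (metis Bochner_Integration.integral_nonneg less_eq_real_def)
  define D :: "(real => real) => real measure" where "D f = density lborel (\<lambda>y. ennreal (f y / A))" for f
  have D: "real_distribution (D f)" "\<And>t. char (D f) t = (LINT y|lborel. complex_of_real (f y) * iexp (t * y)) / of_real A"
   if f: "integrable lborel f" "\<And>y. 0 <= f y" "(LINT y|lborel. f y) = A" for f
  proof -
   have [measurable]: "f \<in> borel_measurable borel" using borel_measurable_integrable[OF f(1)] by simp
   have "emeasure (D f) (space (D f)) = (\<integral>\<^sup>+y. ennreal (f y / A) \<partial>lborel)" unfolding D_def by (simp add: emeasure_density)
   also have "\<dots> = ennreal (LINT y|lborel. f y / A)" using f A by (intro nn_integral_eq_integral) auto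
   also have "\<dots> = 1" using f(3) A by simp
   finally have "prob_space (D f)" by (rule prob_spaceI)
   thus "real_distribution (D f)" unfolding real_distribution_def real_distribution_axioms_def by (simp add: D_def)
   fix t
   have "char (D f) t = (LINT y|lborel. (f y / A) *\<^sub>R iexp (t * y))" unfolding char_def D_def using f(2) A by (subst integral_density) auto
   also have "\<dots> = (LINT y|lborel. complex_of_real (f y) * iexp (t * y) / of_real A)"
    by (intro Bochner_Integration.integral_cong refl) (simp add: scaleR_conv_of_real)
   also have "\<dots> = (LINT y|lborel. complex_of_real (f y) * iexp (t * y)) / of_real A" by simp
   finally show "char (D f) t = (LINT y|lborel. complex_of_real (f y) * iexp (t * y)) / of_real A" .
  qed
  have "D p = D m" using D[OF ip(1) pm(2) A_def[symmetric]] D[OF ip(2) pm(3) A'] F0 by (intro Levy_uniqueness) (auto simp: fun_eq_iff)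
  hence "AE y in lborel. ennreal (p y / A) = ennreal (m y / A)"
   unfolding D_def by (subst (asm) sigma_finite_measure.density_unique_iff[OF lborel.sigma_finite_measure_axioms]) auto
  thus ?thesis
  proof eventually_elim
   case (elim y)
   hence "p y / A = m y / A" using pm(2,3)[of y] A by (subst (asm) ennreal_inj) auto
   thus ?case using A by simp
  qed
 qed
 thus ?thesis
 proof eventually_elim
  case (elim y)
  hence "g y = 0" using pm(1)[of y] by simp
  thus ?case by (simp add: g_def)
 qed
qed

end

text \<open>Stated for all large \<open>l\<close> only, so that no abscissa of convergence has to be
  carried along; uniqueness works on any right half-line.\<close>

definition has_LT :: "(real => real) => (real => real) => bool" where
 "has_LT f \<phi> \<longleftrightarrow> (\<forall>\<^sub>F l in at_top. has_bochner_integral lborel (\<lambda>x. exp (- l * x) * f x) (\<phi> l))"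

definition exp_bounded :: "(real => real) => bool" where
 "exp_bounded f \<longleftrightarrow> (\<exists>C l. 0 <= C \<and> 0 <= l \<and> (\<forall>x. \<bar>f x\<bar> <= C * exp (l * max 0 x)))"

lemma shift_laplace:
 fixes h :: "real => real"
 assumes "sigma_finite_measure \<mu>" and Z[measurable]: "Z \<in> borel_measurable \<mu>"
  and iZ: "integrable \<mu> (\<lambda>w. exp (l * Z w))" and ih: "integrable lborel (\<lambda>x. exp (- l * x) * h x)"
  and h[measurable]: "h \<in> borel_measurable borel"
 shows "has_bochner_integral lborel (\<lambda>y. exp (- l * y) * (LINT w|\<mu>. h (y + Z w)))
  ((LINT w|\<mu>. exp (l * Z w)) * (LINT x|lborel. exp (- l * x) * h x))"
proof -
 interpret \<mu>: sigma_finite_measure \<mu> by fact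
 interpret P: pair_sigma_finite \<mu> lborel ..
 interpret Q: pair_sigma_finite lborel \<mu> ..
 define k where "k x = exp (- l * x) * h x" for x
 have [measurable]: "k \<in> borel_measurable borel" unfolding k_def by measurable
 define g where "g p = exp (- l * snd p) * h (snd p + Z (fst p))" for p
 have [measurable]: "g \<in> borel_measurable (\<mu> \<Otimes>\<^sub>M lborel)" unfolding g_def by measurable
 have gk: "g (w, y) = exp (l * Z w) * k (Z w + 1 * y)" for w y by (simp add: g_def k_def exp_add[symmetric] algebra_simps)
 have in1: "integrable lborel (\<lambda>y. g (w, y))" for w
 proof -
  have "integrable lborel k" using ih by (simp add: k_def[abs_def])
  thus ?thesis unfolding gk by (intro integrable_mult_right lborel_integrable_real_affine) simp_all
 qed
 have int1: "(LINT y|lborel. g (w, y)) = exp (l * Z w) * (LINT x|lborel. k x)" for w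
  unfolding gk using lborel_integral_real_affine[of 1 k "Z w"] by simp
 have int2: "(LINT y|lborel. \<bar>g (w, y)\<bar>) = exp (l * Z w) * (LINT x|lborel. \<bar>k x\<bar>)" for w
  unfolding gk using lborel_integral_real_affine[of 1 "\<lambda>x. \<bar>k x\<bar>" "Z w"] by (simp add: abs_mult)
 have G: "integrable (\<mu> \<Otimes>\<^sub>M lborel) g" by (rule P.Fubini_integrable) (auto simp: int2 in1 iZ)
 have G': "integrable (lborel \<Otimes>\<^sub>M \<mu>) (\<lambda>(y, w). g (w, y))" using P.integrable_product_swap[OF G] by simp
 have e: "(LINT w|\<mu>. g (w, y)) = exp (- l * y) * (LINT w|\<mu>. h (y + Z w))" for y by (simp add: g_def)
 have "integrable lborel (\<lambda>y. LINT w|\<mu>. g (w, y))" using Q.integrable_fst'[OF G'] by simp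
 moreover have "(LINT y|lborel. LINT w|\<mu>. g (w, y)) = (LINT w|\<mu>. LINT y|lborel. g (w, y))"
  using Q.integral_fst'[OF G'] P.integral_fst'[OF G] P.integral_product_swap[of g] by simp
 ultimately show ?thesis unfolding e int1 has_bochner_integral_iff by (simp add: k_def[abs_def])
qed

lemma exp_max_le: "0 <= l ==> y <= B ==> exp (l * max 0 (y + z)) <= exp (l * \<bar>B\<bar>) * (1 + exp (l * z :: real))"
proof -
 assume a: "0 <= l" "y <= B"
 have "exp (l * max 0 (y + z)) <= exp (l * (\<bar>B\<bar> + max 0 z))" using a by (intro iffD2[OF exp_le_cancel_iff] mult_left_mono) auto
 also have "\<dots> = exp (l * \<bar>B\<bar>) * exp (l * max 0 z)" by (simp add: distrib_left exp_add)
 also have "exp (l * max 0 z) <= 1 + exp (l * z)" by (simp add: max_def)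
 finally show ?thesis by simp
qed

lemma (in finite_measure) shift_continuous:
 fixes h :: "real => real"
 assumes Z[measurable]: "Z \<in> borel_measurable M" and iZ: "\<And>l. 0 <= l ==> integrable M (\<lambda>w. exp (l * Z w))"
  and h: "continuous_on UNIV h" "exp_bounded h"
 shows "continuous_on UNIV (\<lambda>y. LINT w|M. h (y + Z w))" "integrable M (\<lambda>w. h (y + Z w))"
proof -
 obtain C l where C: "0 <= C" "0 <= l" "\<And>x. \<bar>h x\<bar> <= C * exp (l * max 0 x)" using h(2) unfolding exp_bounded_def by blast
 have [measurable]: "h \<in> borel_measurable borel" by (rule borel_measurable_continuous_onI[OF h(1)])
 have b: "\<bar>h (y + z)\<bar> <= C * exp (l * \<bar>B\<bar>) * (1 + exp (l * z))" if "y <= B" for y z B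
  using C(3)[of "y + z"] mult_left_mono[OF exp_max_le[OF C(2) that, of z] C(1)] by (simp add: mult.assoc)
 have ib: "integrable M (\<lambda>w. C * exp (l * \<bar>B\<bar>) * (1 + exp (l * Z w)))" for B
  using iZ[OF C(2)] by (intro integrable_mult_right Bochner_Integration.integrable_add) auto
 show "integrable M (\<lambda>w. h (y + Z w))" by (rule Bochner_Integration.integrable_bound[OF ib[of y]]) (use b[of y y] C in "auto intro!: AE_I2")
 show "continuous_on UNIV (\<lambda>y. LINT w|M. h (y + Z w))" unfolding continuous_on_sequentially
 proof (intro ballI allI impI)
  fix u :: "nat => real" and y assume "(\<forall>n. u n \<in> UNIV) \<and> u \<longlonglongrightarrow> y"
  hence u: "u \<longlonglongrightarrow> y" by blast
  then obtain B where B: "\<And>n. \<bar>u n\<bar> <= B" using convergent_imp_Bseq[OF convergentI[OF u]] unfolding Bseq_def by auto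
  show "((\<lambda>y. LINT w|M. h (y + Z w)) \<circ> u) \<longlonglongrightarrow> (LINT w|M. h (y + Z w))" unfolding comp_def
  proof (rule integral_dominated_convergence[OF _ _ ib[of B]])
   show "AE w in M. (\<lambda>n. h (u n + Z w)) \<longlonglongrightarrow> h (y + Z w)"
   proof (rule AE_I2)
    fix w
    have "(\<lambda>n. u n + Z w) \<longlonglongrightarrow> y + Z w" by (intro tendsto_intros u)
    thus "(\<lambda>n. h (u n + Z w)) \<longlonglongrightarrow> h (y + Z w)" using h(1) by (intro isCont_tendsto_compose[of _ h]) (auto simp: continuous_on_eq_continuous_at)
   qed
   show "AE w in M. norm (h (u n + Z w)) <= C * exp (l * \<bar>B\<bar>) * (1 + exp (l * Z w))" for n using b[of "u n" B] B[of n] by (intro AE_I2) auto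
  qed measurable
 qed
qed

lemma continuous_AE_zero:
 fixes f :: "real => real"
 assumes f: "continuous_on UNIV f" and ae: "AE y in lborel. f y = 0"
 shows "f y = 0"
proof (rule ccontr)
 assume "f y \<noteq> 0"
 have "open {x. f x \<noteq> 0}" using f by (intro open_Collect_neq) auto
 then obtain e where e: "0 < e" "ball y e \<subseteq> {x. f x \<noteq> 0}" using `f y \<noteq> 0` by (auto simp: open_contains_ball)
 have "AE x in lborel. x \<notin> {y..y + e / 2}" using ae
 proof eventually_elim
  case (elim x)
  have "x \<notin> ball y e" using e(2) elim by blast
  thus ?case using e(1) by (auto simp: dist_real_def abs_if split: if_splits)
 qed
 hence "{y..y + e / 2} \<in> null_sets lborel" by (subst AE_iff_null_sets) auto
 thus False using e(1) by (simp add: null_sets_def)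
qed

context levy_process
begin

text \<open>Right limits along a grid define a version off a null set of paths; joint measurability
  is what Fubini's theorem in time and \<open>w\<close> requires.\<close>

lemma jointly_measurable_version:
 obtains Z :: "real \<times> 'w => real" where "Z \<in> borel_measurable (borel \<Otimes>\<^sub>M M)"
  "\<forall>s>0. AE w in M. Z (s, w) = X s w"
proof -
 obtain N where N: "{w \<in> space M. \<not> cadlag (\<lambda>t. X t w)} \<subseteq> N" "N \<in> null_sets M" using cadlag_paths unfolding eventually_ae_filter by blast
 define f where "f n p = indicator (space M - N) (snd p) * (if 0 < fst p then X (real (Suc (grid_index (Suc n) (fst p))) / real (Suc n)) (snd p) else 0)" for n and p :: "real \<times> 'w"
 have N': "N \<in> sets M" using N by auto
 have [measurable]: "f n \<in> borel_measurable (borel \<Otimes>\<^sub>M M)" for n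
 proof -
  have X[measurable]: "(\<lambda>p. X (real (Suc k) / real (Suc n)) (snd p)) \<in> borel_measurable (borel \<Otimes>\<^sub>M M)" for k
   by (rule measurable_compose[OF measurable_snd random_variable_X]) simp
  have g: "(\<lambda>p :: real \<times> 'w. grid_index (Suc n) (fst p)) \<in> borel \<Otimes>\<^sub>M M \<rightarrow>\<^sub>M count_space UNIV" by measurable
  have "(\<lambda>p. X (real (Suc (grid_index (Suc n) (fst p))) / real (Suc n)) (snd p)) \<in> borel_measurable (borel \<Otimes>\<^sub>M M)"
   by (rule measurable_compose_countable[OF X g])
  note [measurable] = this N'
  show ?thesis unfolding f_def by measurable
 qed
 define Z where "Z p = lim (\<lambda>n. f n p)" for p
 have Z: "Z \<in> borel_measurable (borel \<Otimes>\<^sub>M M)" unfolding Z_def by measurable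
 have "AE w in M. Z (s, w) = X s w" if "0 < s" for s using AE_not_in[OF N(2)] AE_space
 proof eventually_elim
  case (elim w)
  hence "cadlag (\<lambda>t. X t w)" using N by blast
  hence lim: "((\<lambda>t. X t w) \<longlongrightarrow> X s w) (at_right s)" using that by (auto simp: cadlag_def)
  define u where "u n = real (Suc (grid_index (Suc n) s)) / real (Suc n)" for n
  have u: "s < u n" "u n <= s + 1 / real (Suc n)" for n using grid_index_le[of s "Suc n"] grid_index_gt[of s "Suc n"] that
   by (auto simp: u_def add_divide_distrib)
  have "u \<longlonglongrightarrow> s"
  proof (rule tendsto_sandwich[OF _ _ tendsto_const])
   show "(\<lambda>n. s + 1 / real (Suc n)) \<longlonglongrightarrow> s" using tendsto_add[OF tendsto_const LIMSEQ_Suc[OF lim_1_over_n], of s] by simp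
  qed (use u in "auto intro!: always_eventually less_imp_le")
  hence "(\<lambda>n. X (u n) w) \<longlonglongrightarrow> X s w" by (intro filterlim_compose[OF lim] tendsto_imp_filterlim_at_right always_eventually allI u)
  moreover have "f n (s, w) = X (u n) w" for n using elim that by (simp add: f_def u_def)
  ultimately show ?case unfolding Z_def by (simp add: limI)
 qed
 thus ?thesis using that[OF Z] by blast
qed

end

context sn_levy_triplet
begin

lemma integrable_exp: "0 <= l ==> 0 <= t ==> integrable M (\<lambda>w. exp (l * X t w))" using mgf by (auto simp: has_bochner_integral_iff)

lemma expectation_exp: "0 <= l ==> 0 <= t ==> (EE w. exp (l * X t w)) = exp (t * \<psi> l)" using mgf by (auto simp: has_bochner_integral_iff)

lemma \<psi>_pos_eventually: "\<forall>\<^sub>F l in at_top. 0 < \<psi> l"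
proof -
 obtain g l0 where e: "0 < g" "0 < l0" "\<forall>l\<ge>l0. (\<delta> + g) * l <= \<psi> l" by (rule \<psi>_linear_growth)
 show ?thesis using eventually_ge_at_top[of l0]
 proof eventually_elim
  case (elim l)
  hence "0 < (\<delta> + g) * l" using e \<delta>_nonneg by (intro mult_pos_pos) auto
  thus ?case using e(3) elim by fastforce
 qed
qed

text \<open>The defect \<Delta> of Dynkin's formula has the transform \<open>exp (t * \<psi> l) *
  \<phi> l - \<phi> l - (exp (t * \<psi> l) - 1) / \<psi> l * \<gamma>' l\<close>, which is 0 by
  \<open>gen\<close>. It vanishes almost everywhere by uniqueness and everywhere by continuity. The
  assumption \<open>le\<close> then replaces the time integral by \<open>t * G y\<close>.\<close>

lemma dynkin_formula:
 fixes F G \<phi> \<gamma>' :: "real => real"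
 assumes F: "continuous_on UNIV F" "exp_bounded F" "has_LT F \<phi>"
  and G: "continuous_on UNIV G" "exp_bounded G" "has_LT G \<gamma>'"
  and gen: "\<forall>\<^sub>F l in at_top. \<psi> l * \<phi> l = \<gamma>' l"
  and t: "0 < t" and le: "\<And>s. 0 < s ==> s < t ==> (EE w. \<bar>G (y + X s w) - G y\<bar>) <= e"
 shows "\<bar>(EE w. F (y + X t w)) - F y - t * G y\<bar> <= e * t"
proof -
 obtain Z :: "real \<times> 'w => real" where Z[measurable]: "Z \<in> borel_measurable (borel \<Otimes>\<^sub>M M)"
  and ZX: "\<forall>s>0. AE w in M. Z (s, w) = X s w" by (rule jointly_measurable_version)
 have [measurable]: "F \<in> borel_measurable borel" "G \<in> borel_measurable borel" using F(1) G(1) by (auto intro: borel_measurable_continuous_onI)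
 have [measurable]: "X t \<in> borel_measurable M" using t by (intro random_variable_X) simp
 \<comment> \<open>The time integral is treated as a random shift under the finite measure
   \<open>N\<close> on time and \<open>w\<close>, so that the same lemmas on shifts serve both
   terms.\<close>
 define I where "I = density lborel (indicator {0<..<t} :: real => ennreal)"
 have sI[measurable_cong]: "sets I = sets borel" by (simp add: I_def)
 have "emeasure I (space I) = ennreal t" using t unfolding I_def by (subst emeasure_density) (auto simp: nn_integral_indicator)
 then interpret I: finite_measure I by (intro finite_measureI) simp
 interpret P: pair_sigma_finite I M ..
 define N where "N = I \<Otimes>\<^sub>M M"
 have ZN[measurable]: "Z \<in> borel_measurable N" unfolding N_def using Z sI by (simp cong: measurable_cong_sets sets_pair_measure_cong)
 have "emeasure N (space N) = emeasure I (space I) * emeasure M (space M)"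
  unfolding N_def by (simp add: space_pair_measure emeasure_pair_measure_Times)
 then interpret N: finite_measure N by (intro finite_measureI) (simp add: I.emeasure_eq_measure emeasure_space_1)
 have nnN: "(\<integral>\<^sup>+p. f p \<partial>N) = (\<integral>\<^sup>+s. indicator {0<..<t} s * (\<integral>\<^sup>+w. f (s, w) \<partial>M) \<partial>lborel)"
  if [measurable]: "f \<in> borel_measurable (borel \<Otimes>\<^sub>M M)" for f :: "real \<times> 'w => ennreal"
 proof -
  have "f \<in> borel_measurable (I \<Otimes>\<^sub>M M)" using that sI by (simp cong: measurable_cong_sets sets_pair_measure_cong)
  hence "(\<integral>\<^sup>+p. f p \<partial>N) = (\<integral>\<^sup>+s. (\<integral>\<^sup>+w. f (s, w) \<partial>M) \<partial>I)" unfolding N_def by (rule nn_integral_fst[symmetric])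
  also have "\<dots> = (\<integral>\<^sup>+s. indicator {0<..<t} s * (\<integral>\<^sup>+w. f (s, w) \<partial>M) \<partial>lborel)" unfolding I_def by (rule nn_integral_density) measurable
  finally show ?thesis .
 qed
 have nnZ: "(\<integral>\<^sup>+p. ennreal (exp (l * Z p)) \<partial>N) = (\<integral>\<^sup>+s. ennreal (indicator {0..t} s * exp (s * \<psi> l)) \<partial>lborel)"
  if "0 <= l" for l
 proof -
  have "(\<integral>\<^sup>+p. ennreal (exp (l * Z p)) \<partial>N) =
    (\<integral>\<^sup>+s. indicator {0<..<t} s * (\<integral>\<^sup>+w. ennreal (exp (l * Z (s, w))) \<partial>M) \<partial>lborel)" by (rule nnN) measurable
  also have "\<dots> = (\<integral>\<^sup>+s. ennreal (indicator {0..t} s * exp (s * \<psi> l)) \<partial>lborel)"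
  proof (rule nn_integral_cong_AE)
   have "AE s in lborel. s \<noteq> (0::real)" "AE s in lborel. s \<noteq> t" by (rule AE_lborel_singleton)+
   thus "AE s in lborel. indicator {0<..<t} s * (\<integral>\<^sup>+w. ennreal (exp (l * Z (s, w))) \<partial>M)
     = ennreal (indicator {0..t} s * exp (s * \<psi> l))"
   proof eventually_elim
    case (elim s)
    show ?case
    proof (cases "s \<in> {0<..<t}")
     case True
     hence "(\<integral>\<^sup>+w. ennreal (exp (l * Z (s, w))) \<partial>M) = nn_mgf l s"
      unfolding nn_mgf_def by (intro nn_integral_cong_AE) (use ZX[rule_format, of s] in "auto elim: eventually_mono")
     thus ?thesis using True nn_mgf_eq[OF that, of s] by simp
    next
     case False
     hence "s \<notin> {0..t}" using elim by auto
     thus ?thesis using False by simp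
    qed
   qed
  qed
  finally show ?thesis .
 qed
 have bexp: "has_bochner_integral N (\<lambda>p. exp (l * Z p)) (LINT s|lborel. indicator {0..t} s * exp (s * \<psi> l))"
  if "0 <= l" for l
 proof (rule has_bochner_integral_nn_integral)
  have i: "integrable lborel (\<lambda>s. indicator {0..t} s * exp (s * \<psi> l))" using borel_integrable_atLeastAtMost'[of 0 t "\<lambda>s. exp (s * \<psi> l)"]
   by (simp add: set_integrable_def continuous_intros)
  show "(\<integral>\<^sup>+p. ennreal (exp (l * Z p)) \<partial>N) = ennreal (LINT s|lborel. indicator {0..t} s * exp (s * \<psi> l))"
   unfolding nnZ[OF that] by (rule nn_integral_eq_integral[OF i]) auto
  show "0 <= (LINT s|lborel. indicator {0..t} s * exp (s * \<psi> l))" by (intro Bochner_Integration.integral_nonneg) auto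
 qed measurable
 have cexp: "(LINT s|lborel. indicator {0..t} s * exp (s * \<psi> l)) = (exp (t * \<psi> l) - 1) / \<psi> l" if "0 < \<psi> l" for l
 proof -
  have "(LINT s|lborel. exp (s * \<psi> l) * indicator {0..t} s) = exp (t * \<psi> l) / \<psi> l - exp (0 * \<psi> l) / \<psi> l"
  proof (rule integral_FTC_Icc_real)
   show "0 <= t" using t by simp
   show "DERIV (\<lambda>s. exp (s * \<psi> l) / \<psi> l) s :> exp (s * \<psi> l)" for s using that by (auto intro!: derivative_eq_intros)
  qed (auto intro!: continuous_intros)
  thus ?thesis by (simp add: diff_divide_distrib mult.commute)
 qed
 have iN: "integrable N (\<lambda>p. exp (l * Z p))" if "0 <= l" for l using bexp[OF that] by (simp add: has_bochner_integral_iff)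
 define \<Delta> where "\<Delta> y = (EE w. F (y + X t w)) - F y - (LINT p|N. G (y + Z p))" for y
 have cont: "continuous_on UNIV \<Delta>" unfolding \<Delta>_def using shift_continuous(1)[of "X t" F] N.shift_continuous(1)[OF ZN iN G(1,2)] integrable_exp t F
  by (intro continuous_on_diff) auto
 have "\<forall>\<^sub>F l in at_top. has_bochner_integral lborel (\<lambda>y. exp (- l * y) * \<Delta> y) 0"
  using F(3)[unfolded has_LT_def] G(3)[unfolded has_LT_def] gen \<psi>_pos_eventually eventually_ge_at_top[of 0]
 proof eventually_elim
  case (elim l)
  have 1: "has_bochner_integral lborel (\<lambda>y. exp (- l * y) * (EE w. F (y + X t w))) (exp (t * \<psi> l) * \<phi> l)"
   using shift_laplace[OF sigma_finite_measure_axioms, of "X t" l F] elim integrable_exp[of l t] expectation_exp[of l t] t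
   by (simp add: has_bochner_integral_iff)
  have 2: "has_bochner_integral lborel (\<lambda>y. exp (- l * y) * (LINT p|N. G (y + Z p))) ((exp (t * \<psi> l) - 1) / \<psi> l * \<gamma>' l)"
   using shift_laplace[OF N.sigma_finite_measure_axioms ZN iN, of l G] elim bexp[of l] cexp[of l] by (simp add: has_bochner_integral_iff)
  have "has_bochner_integral lborel (\<lambda>y. exp (- l * y) * (EE w. F (y + X t w)) - exp (- l * y) * F y
    - exp (- l * y) * (LINT p|N. G (y + Z p))) (exp (t * \<psi> l) * \<phi> l - \<phi> l - (exp (t * \<psi> l) - 1) / \<psi> l * \<gamma>' l)"
   by (intro has_bochner_integral_diff 1 2 elim(1))
  moreover have "exp (t * \<psi> l) * \<phi> l - \<phi> l - (exp (t * \<psi> l) - 1) / \<psi> l * \<gamma>' l = 0" using elim(3,4) by (simp add: field_simps flip: elim(3))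
  ultimately show ?case by (simp add: \<Delta>_def right_diff_distrib)
 qed
 then obtain l0 where l0: "\<And>l. l0 <= l ==> has_bochner_integral lborel (\<lambda>y. exp (- l * y) * \<Delta> y) 0" by (auto simp: eventually_at_top_linorder)
 interpret two_sided_laplace_zero \<Delta> l0 by unfold_locales (use l0 in "auto simp: has_bochner_integral_iff")
 have \<Delta>0: "\<Delta> y = 0" by (rule continuous_AE_zero[OF cont AE_zero])
 have iG: "integrable N (\<lambda>p. G (y + Z p))" by (rule N.shift_continuous(2)[OF ZN iN G(1,2)])
 have mN: "measure N (space N) = t" using `emeasure N (space N) = _` `emeasure I (space I) = _` t by (simp add: emeasure_space_1 measure_def)
 have i\<epsilon>: "(\<integral>\<^sup>+p. ennreal \<bar>G (y + Z p) - G y\<bar> \<partial>N) <= ennreal (e * t)"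
 proof -
  have "(\<integral>\<^sup>+p. ennreal \<bar>G (y + Z p) - G y\<bar> \<partial>N) =
    (\<integral>\<^sup>+s. indicator {0<..<t} s * (\<integral>\<^sup>+w. ennreal \<bar>G (y + Z (s, w)) - G y\<bar> \<partial>M) \<partial>lborel)" by (rule nnN) measurable
  also have "\<dots> <= (\<integral>\<^sup>+s. ennreal e * indicator {0<..<t} s \<partial>lborel)"
  proof (rule nn_integral_mono)
   fix s :: real
   show "indicator {0<..<t} s * (\<integral>\<^sup>+w. ennreal \<bar>G (y + Z (s, w)) - G y\<bar> \<partial>M) <= ennreal e * indicator {0<..<t} s"
   proof (cases "s \<in> {0<..<t}")
    case True
    hence [measurable]: "X s \<in> borel_measurable M" by (intro random_variable_X) simp
    have "integrable M (\<lambda>w. G (y + X s w))" using shift_continuous(2)[of "X s" G] integrable_exp True G(1,2) by auto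
    hence i: "integrable M (\<lambda>w. \<bar>G (y + X s w) - G y\<bar>)" by auto
    have "(\<integral>\<^sup>+w. ennreal \<bar>G (y + Z (s, w)) - G y\<bar> \<partial>M) = (\<integral>\<^sup>+w. ennreal \<bar>G (y + X s w) - G y\<bar> \<partial>M)"
     by (intro nn_integral_cong_AE) (use ZX[rule_format, of s] True in "auto elim: eventually_mono")
    also have "\<dots> = ennreal ((EE w. \<bar>G (y + X s w) - G y\<bar>))" by (rule nn_integral_eq_integral[OF i]) auto
    also have "\<dots> <= ennreal e" using le[of s] True by (intro ennreal_leI) auto
    finally show ?thesis using True by simp
   qed simp
  qed
  also have "\<dots> = ennreal e * ennreal t" using t by (simp add: nn_integral_cmult_indicator)
  also have "\<dots> = ennreal (e * t)"
  proof -
   have "0 <= (EE w. \<bar>G (y + X (t / 2) w) - G y\<bar>)" by (intro Bochner_Integration.integral_nonneg) simp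
   hence "0 <= e" using le[of "t / 2"] t by linarith
   thus ?thesis using t by (simp add: ennreal_mult)
  qed
  finally show ?thesis .
 qed
 have i2: "integrable N (\<lambda>p. G (y + Z p) - G y)" using iG by (intro Bochner_Integration.integrable_diff) auto
 have "0 <= e * t"
 proof -
  have "0 <= (EE w. \<bar>G (y + X (t / 2) w) - G y\<bar>)" by (intro Bochner_Integration.integral_nonneg) simp
  hence "0 <= e" using le[of "t / 2"] t by linarith
  thus ?thesis using t by simp
 qed
 hence "(LINT p|N. \<bar>G (y + Z p) - G y\<bar>) <= e * t" using i\<epsilon> i2 by (subst (asm) nn_integral_eq_integral) auto
 moreover have "\<bar>LINT p|N. G (y + Z p) - G y\<bar> <= (LINT p|N. \<bar>G (y + Z p) - G y\<bar>)" using integral_norm_bound[of N "\<lambda>p. G (y + Z p) - G y"] by simp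
 moreover have "(LINT p|N. G (y + Z p) - G y) = (LINT p|N. G (y + Z p)) - t * G y" using iG mN by (subst Bochner_Integration.integral_diff) auto
 ultimately show ?thesis using \<Delta>0 by (simp add: \<Delta>_def)
qed

end

section \<open>First-order expansion of one step with the jump cut at 1\<close>

lemma exp_boundedI:
 assumes "0 <= C" "0 <= l" "\<And>x. \<bar>f x\<bar> <= C * exp (l * max 0 x)"
 shows "exp_bounded f" using assms unfolding exp_bounded_def by blast

lemma exp_bounded_const: "exp_bounded (\<lambda>_. c)" by (rule exp_boundedI[of "\<bar>c\<bar>" 0]) auto

lemma exp_bounded_linear:
 assumes "exp_bounded f" "exp_bounded g"
 shows "exp_bounded (\<lambda>x. a * f x + b * g x)"
proof -
 obtain C l where f: "0 <= C" "0 <= l" "\<And>x. \<bar>f x\<bar> <= C * exp (l * max 0 x)" using assms(1) unfolding exp_bounded_def by blast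
 obtain D \<kappa> where g: "0 <= D" "0 <= \<kappa>" "\<And>x. \<bar>g x\<bar> <= D * exp (\<kappa> * max 0 x)" using assms(2) unfolding exp_bounded_def by blast
 show ?thesis
 proof (rule exp_boundedI[of "\<bar>a\<bar> * C + \<bar>b\<bar> * D" "max l \<kappa>"])
  fix x :: real
  have "C * exp (l * max 0 x) <= C * exp (max l \<kappa> * max 0 x)" "D * exp (\<kappa> * max 0 x) <= D * exp (max l \<kappa> * max 0 x)"
   using f g by (intro mult_left_mono iffD2[OF exp_le_cancel_iff] mult_right_mono; simp)+
  hence "\<bar>f x\<bar> <= C * exp (max l \<kappa> * max 0 x)" "\<bar>g x\<bar> <= D * exp (max l \<kappa> * max 0 x)" using f(3)[of x] g(3)[of x] by linarith+
  hence "\<bar>a\<bar> * \<bar>f x\<bar> + \<bar>b\<bar> * \<bar>g x\<bar> <= \<bar>a\<bar> * (C * exp (max l \<kappa> * max 0 x)) + \<bar>b\<bar> * (D * exp (max l \<kappa> * max 0 x))"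
   by (intro add_mono mult_left_mono) auto
  moreover have "\<bar>a * f x + b * g x\<bar> <= \<bar>a\<bar> * \<bar>f x\<bar> + \<bar>b\<bar> * \<bar>g x\<bar>" using abs_triangle_ineq[of "a * f x" "b * g x"] by (simp add: abs_mult)
  ultimately show "\<bar>a * f x + b * g x\<bar> <= (\<bar>a\<bar> * C + \<bar>b\<bar> * D) * exp (max l \<kappa> * max 0 x)" by (simp add: algebra_simps)
 qed (use f g in auto)
qed

lemma exp_bounded_shift:
 assumes "exp_bounded f"
 shows "exp_bounded (\<lambda>x. f (x + c))"
proof -
 obtain C l where f: "0 <= C" "0 <= l" "\<And>x. \<bar>f x\<bar> <= C * exp (l * max 0 x)" using assms(1) unfolding exp_bounded_def by blast
 show ?thesis
 proof (rule exp_boundedI[of "C * exp (l * \<bar>c\<bar>)" l])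
  fix x
  have "l * max 0 (x + c) <= l * \<bar>c\<bar> + l * max 0 x" using f(2) mult_left_mono[of "max 0 (x + c)" "\<bar>c\<bar> + max 0 x" l] by (simp add: distrib_left)
  hence "exp (l * max 0 (x + c)) <= exp (l * \<bar>c\<bar>) * exp (l * max 0 x)" by (simp add: exp_add[symmetric])
  hence "C * exp (l * max 0 (x + c)) <= C * (exp (l * \<bar>c\<bar>) * exp (l * max 0 x))" using f(1) by (rule mult_left_mono)
  thus "\<bar>f (x + c)\<bar> <= C * exp (l * \<bar>c\<bar>) * exp (l * max 0 x)" using f(3)[of "x + c"] by (simp add: mult.assoc)
 qed (use f in auto)
qed

lemma exp_bounded_le:
 assumes "exp_bounded f"
 obtains B where "0 <= B" "\<forall>x\<le>d. \<bar>f x\<bar> <= B"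
proof -
 obtain C l where f: "0 <= C" "0 <= l" "\<And>x. \<bar>f x\<bar> <= C * exp (l * max 0 x)" using assms(1) unfolding exp_bounded_def by blast
 have "\<bar>f x\<bar> <= C * exp (l * max 0 d)" if "x <= d" for x
 proof -
  have "C * exp (l * max 0 x) <= C * exp (l * max 0 d)" using f that by (intro mult_left_mono iffD2[OF exp_le_cancel_iff]) auto
  thus ?thesis using f(3)[of x] by linarith
 qed
 thus ?thesis using that[of "C * exp (l * max 0 d)"] f by auto
qed

context sn_levy_triplet
begin

text \<open>G is the image of F under the generator of X, in the sense of a locally uniform first-order expansion.\<close>

definition one_step :: "(real => real) => (real => real) => bool" where
 "one_step F G \<longleftrightarrow> continuous_on UNIV F \<and> exp_bounded F \<and> continuous_on UNIV G \<and>
   (\<forall>c d e. 0 < e --> (EV n. \<forall>y\<in>{c..d}.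
    \<bar>(EE w. F (y + min (X (1 / real n) w) 1)) - F y - G y / real n\<bar> <= e / real n))"

lemma measurable_X_grid [measurable]: "X (1 / real n) \<in> borel_measurable M" by (rule random_variable_X) simp

lemma one_step_integrable:
 assumes "continuous_on UNIV F" "exp_bounded F"
 shows "integrable M (\<lambda>w. F (y + min (X (1 / real n) w) 1))"
proof -
 obtain B where B: "0 <= B" "\<forall>x\<le>y + 1. \<bar>F x\<bar> <= B" by (rule exp_bounded_le[OF assms(2)])
 have [measurable]: "F \<in> borel_measurable borel" using assms(1) by (rule borel_measurable_continuous_onI)
 show ?thesis by (rule integrable_const_bound[where B=B]) (use B in auto)
qed

lemma one_step_linear:
 assumes "one_step F G" "one_step F' G'"
 shows "one_step (\<lambda>x. a * F x + b * F' x) (\<lambda>x. a * G x + b * G' x)" unfolding one_step_def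
proof (intro conjI allI impI)
 show "continuous_on UNIV (\<lambda>x. a * F x + b * F' x)" "continuous_on UNIV (\<lambda>x. a * G x + b * G' x)"
  using assms unfolding one_step_def by (auto intro!: continuous_intros)
 show "exp_bounded (\<lambda>x. a * F x + b * F' x)" using assms unfolding one_step_def by (intro exp_bounded_linear) auto
 fix c d e :: real assume "0 < e"
 define e' where "e' = e / (\<bar>a\<bar> + \<bar>b\<bar> + 1)"
 have "0 < e'" using `0 < e` by (simp add: e'_def)
 hence "EV n. \<forall>y\<in>{c..d}.
    \<bar>(EE z. F (y + min (X (1 / real n) z) 1)) - F y - G y / real n\<bar> <= e' / real n"
  "EV n. \<forall>y\<in>{c..d}.
    \<bar>(EE z. F' (y + min (X (1 / real n) z) 1)) - F' y - G' y / real n\<bar> <= e' / real n" using assms unfolding one_step_def by blast+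
 thus "EV n. \<forall>y\<in>{c..d}.
   \<bar>(EE z. a * F (y + min (X (1 / real n) z) 1) + b * F' (y + min (X (1 / real n) z) 1))
    - (a * F y + b * F' y) - (a * G y + b * G' y) / real n\<bar> <= e / real n"
 proof eventually_elim
  case (elim n)
  show ?case
  proof
   fix y assume y: "y \<in> {c..d}"
   define u where "u = (EE z. F (y + min (X (1 / real n) z) 1)) - F y - G y / real n"
   define w where "w = (EE z. F' (y + min (X (1 / real n) z) 1)) - F' y - G' y / real n"
   have "(EE z. a * F (y + min (X (1 / real n) z) 1) + b * F' (y + min (X (1 / real n) z) 1))
    - (a * F y + b * F' y) - (a * G y + b * G' y) / real n = a * u + b * w" using one_step_integrable[of F y n] one_step_integrable[of F' y n] assms
    unfolding one_step_def u_def w_def by (simp add: algebra_simps add_divide_distrib)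
   also have "\<bar>\<dots>\<bar> <= \<bar>a\<bar> * \<bar>u\<bar> + \<bar>b\<bar> * \<bar>w\<bar>" using abs_triangle_ineq[of "a * u" "b * w"] by (simp add: abs_mult)
   also have "\<dots> <= \<bar>a\<bar> * (e' / real n) + \<bar>b\<bar> * (e' / real n)" using elim y unfolding u_def w_def by (intro add_mono mult_left_mono) auto
   also have "\<dots> <= (\<bar>a\<bar> + \<bar>b\<bar> + 1) * (e' / real n)" using `0 < e'` by (simp add: algebra_simps)
   also have "\<dots> = e / real n" by (simp add: e'_def)
   finally show "\<bar>(EE z. a * F (y + min (X (1 / real n) z) 1) + b * F' (y + min (X (1 / real n) z) 1))
    - (a * F y + b * F' y) - (a * G y + b * G' y) / real n\<bar> <= e / real n" .
  qed
 qed
qed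

lemma one_step_shift:
 assumes "one_step F G"
 shows "one_step (\<lambda>x. F (x + r)) (\<lambda>x. G (x + r))" unfolding one_step_def
proof (intro conjI allI impI)
 show "continuous_on UNIV (\<lambda>x. F (x + r))" "continuous_on UNIV (\<lambda>x. G (x + r))"
  using continuous_on_compose2[of UNIV F UNIV "\<lambda>x. x + r"] continuous_on_compose2[of UNIV G UNIV "\<lambda>x. x + r"]
   continuous_on_add[OF continuous_on_id continuous_on_const[of UNIV r]] assms[unfolded one_step_def] by simp_all
 show "exp_bounded (\<lambda>x. F (x + r))" using assms unfolding one_step_def by (intro exp_bounded_shift) auto
 fix c d e :: real assume "0 < e"
 hence "EV n. \<forall>y\<in>{c + r..d + r}.
    \<bar>(EE w. F (y + min (X (1 / real n) w) 1)) - F y - G y / real n\<bar> <= e / real n" using assms unfolding one_step_def by blast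
 thus "EV n. \<forall>y\<in>{c..d}.
   \<bar>(EE w. F (y + min (X (1 / real n) w) 1 + r)) - F (y + r) - G (y + r) / real n\<bar> <= e / real n"
 proof eventually_elim
  case (elim n)
  show ?case
  proof
   fix y assume "y \<in> {c..d}"
   hence "y + r \<in> {c + r..d + r}" by auto
   from elim[rule_format, OF this] show "\<bar>(EE w. F (y + min (X (1 / real n) w) 1 + r)) - F (y + r) - G (y + r) / real n\<bar> <= e / real n"
    by (simp add: ac_simps)
  qed
 qed
qed

lemma one_step_const: "one_step (\<lambda>_. c) (\<lambda>_. 0)" unfolding one_step_def by (auto simp: prob_space exp_bounded_const)

text \<open>An exponential has no two-sided transform, so the expansion is read off from the moment
  generating function; the cut at 1 costs an upper tail of order o(1/n).\<close>

lemma one_step_exp: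
 assumes "0 <= l"
 shows "one_step (\<lambda>x. exp (l * x)) (\<lambda>x. \<psi> l * exp (l * x))" unfolding one_step_def
proof (intro conjI allI impI)
 show "continuous_on UNIV (\<lambda>x. exp (l * x))" "continuous_on UNIV (\<lambda>x. \<psi> l * exp (l * x))" by (intro continuous_intros)+
 show "exp_bounded (\<lambda>x. exp (l * x))" using assms by (intro exp_boundedI[of 1 l]) (auto intro: mult_left_mono)
 fix c d g :: real assume g: "0 < g"
 define g' where "g' = g / exp (l * d) / 2"
 have g': "0 < g'" using g by (simp add: g'_def)
 have "((\<lambda>h. exp (h * \<psi> l)) has_field_derivative \<psi> l) (at 0)" by (auto intro!: derivative_eq_intros)
 hence "((\<lambda>h. (exp (h * \<psi> l) - 1) / h) \<longlongrightarrow> \<psi> l) (at 0)" by (simp add: DERIV_def)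
 moreover have "filterlim (\<lambda>n. 1 / real n) (at 0) sequentially"
  using lim_1_over_n eventually_gt_at_top[of 0] by (auto simp: filterlim_at elim: eventually_mono)
 ultimately have "(\<lambda>n. (exp (1 / real n * \<psi> l) - 1) / (1 / real n)) \<longlonglongrightarrow> \<psi> l" by (rule filterlim_compose)
 from tendstoD[OF this g'] have 1: "EV n. dist ((exp (1 / real n * \<psi> l) - 1) / (1 / real n)) (\<psi> l) < g'" .
 from order_tendstoD(2)[OF tail_o[OF assms zero_less_one] g']
 have 2: "EV n. real n * (EE w. exp (l * X (1 / real n) w) * indicator {1<..} (X (1 / real n) w)) < g'" .
 show "EV n. \<forall>y\<in>{c..d}.
   \<bar>(EE w. exp (l * (y + min (X (1 / real n) w) 1))) - exp (l * y) - \<psi> l * exp (l * y) / real n\<bar> <= g / real n"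
  using 1 2 eventually_gt_at_top[of 0]
 proof eventually_elim
  case (elim n)
  define m where "m = (EE w. exp (l * min (X (1 / real n) w) 1))"
  define T where "T = (EE w. exp (l * X (1 / real n) w) * indicator {1<..} (X (1 / real n) w))"
  have im: "integrable M (\<lambda>w. exp (l * min (X (1 / real n) w) 1))"
   using one_step_integrable[of "\<lambda>x. exp (l * x)" 0 n] `continuous_on UNIV (\<lambda>x. exp (l * x))` `exp_bounded (\<lambda>x. exp (l * x))` by simp
  have iX: "integrable M (\<lambda>w. exp (l * X (1 / real n) w))" using integrable_exp[OF assms, of "1 / real n"] by simp
  have iT: "integrable M (\<lambda>w. exp (l * X (1 / real n) w) * indicator {1<..} (X (1 / real n) w))"
   using tail_bound(1)[OF assms order_refl, of "1 / real n" 1] by simp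
  have eX: "(EE w. exp (l * X (1 / real n) w)) = exp (1 / real n * \<psi> l)" using expectation_exp[OF assms, of "1 / real n"] by simp
  have "m <= exp (1 / real n * \<psi> l)" unfolding m_def eX[symmetric] using assms by (intro integral_mono im iX) (auto intro: mult_left_mono)
  moreover have "exp (1 / real n * \<psi> l) <= m + T" unfolding m_def T_def eX[symmetric] Bochner_Integration.integral_add[OF im iT, symmetric]
   by (intro integral_mono iX Bochner_Integration.integrable_add im iT) (auto simp: indicator_def min_def)
  moreover have "T * real n <= g'" using elim(2) by (simp add: T_def mult.commute)
  hence "T <= g' / real n" using elim(3) by (simp add: le_divide_eq)
  moreover have "\<bar>exp (1 / real n * \<psi> l) - 1 - \<psi> l / real n\<bar> <= g' / real n"
  proof -
   have "\<bar>(exp (1 / real n * \<psi> l) - 1) * real n - \<psi> l\<bar> <= g'" using elim(1) by (simp add: dist_real_def)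
   hence "\<bar>(exp (1 / real n * \<psi> l) - 1) * real n - \<psi> l\<bar> / real n <= g' / real n" by (simp add: divide_right_mono)
   moreover have "exp (1 / real n * \<psi> l) - 1 - \<psi> l / real n = ((exp (1 / real n * \<psi> l) - 1) * real n - \<psi> l) / real n"
    using elim(3) by (simp add: diff_divide_distrib)
   ultimately show ?thesis by (simp only: abs_divide abs_of_nat)
  qed
  ultimately have *: "\<bar>m - 1 - \<psi> l / real n\<bar> <= 2 * (g' / real n)" by linarith
  show ?case
  proof
   fix y assume y: "y \<in> {c..d}"
   have e: "(EE w. exp (l * (y + min (X (1 / real n) w) 1))) = exp (l * y) * m" by (simp add: m_def distrib_left exp_add)
   have "\<bar>exp (l * y) * m - exp (l * y) - \<psi> l * exp (l * y) / real n\<bar> = exp (l * y) * \<bar>m - 1 - \<psi> l / real n\<bar>"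
   proof -
    have "exp (l * y) * m - exp (l * y) - \<psi> l * exp (l * y) / real n = exp (l * y) * (m - 1 - \<psi> l / real n)" by (simp add: algebra_simps)
    thus ?thesis by (simp only: abs_mult abs_exp_cancel)
   qed
   also have "\<dots> <= exp (l * d) * (2 * (g' / real n))" using * y assms by (intro mult_mono) (auto intro: mult_left_mono)
   also have "\<dots> = g / real n" by (simp add: g'_def)
   finally show "\<bar>(EE w. exp (l * (y + min (X (1 / real n) w) 1))) - exp (l * y) - \<psi> l * exp (l * y) / real n\<bar> <= g / real n" unfolding e .
  qed
 qed
qed

lemma small_increment:
 assumes G: "continuous_on UNIV G" "exp_bounded G" and "0 < e"
 obtains s0 where "0 < s0" "\<forall>s y. 0 < s \<and> s < s0 \<and> c <= y \<and> y <= d --> (EE w. \<bar>G (y + X s w) - G y\<bar>) <= e"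
proof -
 obtain C l where C: "0 <= C" "0 <= l" "\<And>x. \<bar>G x\<bar> <= C * exp (l * max 0 x)" using G(2) unfolding exp_bounded_def by blast
 have "uniformly_continuous_on {c - 1..d + 1} G" using G(1) by (intro compact_uniformly_continuous) (auto intro: continuous_on_subset)
 then obtain \<eta>0 where \<eta>0: "0 < \<eta>0" "\<And>x x'. x \<in> {c - 1..d + 1} ==> x' \<in> {c - 1..d + 1} ==> dist x' x < \<eta>0 ==> dist (G x') (G x) < e / 2"
  using half_gt_zero[OF `0 < e`] unfolding uniformly_continuous_on_def by metis
 define \<eta> where "\<eta> = min (\<eta>0 / 2) 1"
 have \<eta>: "0 < \<eta>" "\<eta> <= 1" "\<eta> < \<eta>0" using \<eta>0(1) by (auto simp: \<eta>_def)
 define D where "D = 2 * (C * exp (l * \<bar>d\<bar>)) + 1"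
 have D: "0 < D" using C(1) by (auto simp: D_def intro: add_nonneg_pos)
 obtain s0 where s0: "0 < s0" "\<forall>s. 0 < s \<and> s < s0 --> integrable M (\<lambda>w. (1 + exp (l * X s w)) * indicator {\<eta><..} \<bar>X s w\<bar>) \<and>
   (EE w. (1 + exp (l * X s w)) * indicator {\<eta><..} \<bar>X s w\<bar>) <= e / (2 * D)"
  using small_time[OF C(2) \<eta>(1), of "e / (2 * D)"] `0 < e` D by auto
 show ?thesis
 proof (rule that[OF s0(1)], intro allI impI, elim conjE)
  fix s y assume s: "0 < s" "s < s0" and y: "c <= y" "y <= d"
  have [measurable]: "X s \<in> borel_measurable M" using s by (intro random_variable_X) simp
  define J where "J w = (1 + exp (l * X s w)) * indicator {\<eta><..} \<bar>X s w\<bar>" for w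
  have J: "integrable M J" "expectation J <= e / (2 * D)" using s0(2)[rule_format, of s] s unfolding J_def by auto
  have "\<bar>G (y + X s w) - G y\<bar> <= e / 2 + D * J w" for w
  proof (cases "\<eta> < \<bar>X s w\<bar>")
   case False
   hence "dist (G (y + X s w)) (G y) < e / 2" using y \<eta> by (intro \<eta>0(2)) (auto simp: dist_real_def)
   thus ?thesis using False by (simp add: J_def dist_real_def)
  next
   case True
   have "\<bar>G (y + X s w)\<bar> <= C * (exp (l * \<bar>d\<bar>) * (1 + exp (l * X s w)))"
    using C(3)[of "y + X s w"] mult_left_mono[OF exp_max_le[OF C(2) y(2), of "X s w"] C(1)] by linarith
   moreover have "\<bar>G y\<bar> <= C * (exp (l * \<bar>d\<bar>) * (1 + exp (l * X s w)))"
   proof -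
    have "C * exp (l * max 0 y) <= C * (exp (l * \<bar>d\<bar>) * 1)" using C y by (intro mult_left_mono) (auto intro: mult_left_mono)
    also have "\<dots> <= C * (exp (l * \<bar>d\<bar>) * (1 + exp (l * X s w)))" using C by (intro mult_left_mono) auto
    finally show ?thesis using C(3)[of y] by linarith
   qed
   ultimately have "\<bar>G (y + X s w) - G y\<bar> <= 2 * (C * exp (l * \<bar>d\<bar>)) * (1 + exp (l * X s w))" by (simp add: algebra_simps)
   also have "\<dots> <= D * (1 + exp (l * X s w))" by (intro mult_right_mono) (auto simp: D_def)
   finally show ?thesis using True `0 < e` by (simp add: J_def)
  qed
  hence "(EE w. \<bar>G (y + X s w) - G y\<bar>) <= (EE w. e / 2 + D * J w)"
   by (intro integral_mono' Bochner_Integration.integrable_add integrable_mult_right J(1)) (auto intro: order.trans[OF abs_ge_zero])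
  also have "\<dots> = e / 2 + D * expectation J" using J(1) by (simp add: prob_space)
  also have "\<dots> <= e / 2 + D * (e / (2 * D))" using mult_left_mono[OF J(2), of D] D by linarith
  also have "\<dots> = e" using D by simp
  finally show "(EE w. \<bar>G (y + X s w) - G y\<bar>) <= e" .
 qed
qed

text \<open>Dynkin's formula concerns X without the cut at 1. The cut changes the mean by at most a
  constant times the exponential upper tail, which is o(1/n).\<close>

lemma one_step_dynkin:
 assumes F: "continuous_on UNIV F" "exp_bounded F" "has_LT F \<phi>"
  and G: "continuous_on UNIV G" "exp_bounded G" "has_LT G \<gamma>'"
  and gen: "\<forall>\<^sub>F l in at_top. \<psi> l * \<phi> l = \<gamma>' l"
 shows "one_step F G" unfolding one_step_def
proof (intro conjI allI impI F G)
 fix c d e :: real assume "0 < e"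
 obtain C l where C: "0 <= C" "0 <= l" "\<And>x. \<bar>F x\<bar> <= C * exp (l * max 0 x)" using F(2) unfolding exp_bounded_def by blast
 have [measurable]: "F \<in> borel_measurable borel" using F(1) by (rule borel_measurable_continuous_onI)
 define D where "D = 2 * (C * exp (l * \<bar>d\<bar>)) + 1"
 have D: "0 < D" using C(1) by (auto simp: D_def intro: add_nonneg_pos)
 obtain s0 where s0: "0 < s0" "\<forall>s y. 0 < s \<and> s < s0 \<and> c <= y \<and> y <= d --> (EE w. \<bar>G (y + X s w) - G y\<bar>) <= e / 2"
  using small_increment[OF G(1,2), of "e / 2" c d] `0 < e` by auto
 have "0 < e / (2 * D)" using D `0 < e` by simp
 from order_tendstoD(2)[OF tail_o[OF C(2) zero_less_one] this]
 have 1: "EV n. real n * (EE w. exp (l * X (1 / real n) w) * indicator {1<..} (X (1 / real n) w)) < e / (2 * D)" .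
 have 2: "EV n. 1 / real n < s0" by (rule order_tendstoD(2)[OF lim_1_over_n s0(1)])
 show "EV n. \<forall>y\<in>{c..d}.
   \<bar>(EE w. F (y + min (X (1 / real n) w) 1)) - F y - G y / real n\<bar> <= e / real n" using 1 2 eventually_gt_at_top[of 0]
 proof eventually_elim
  case (elim n)
  define T where "T = (EE w. exp (l * X (1 / real n) w) * indicator {1<..} (X (1 / real n) w))"
  have iT: "integrable M (\<lambda>w. exp (l * X (1 / real n) w) * indicator {1<..} (X (1 / real n) w))"
   using tail_bound(1)[OF C(2) order_refl, of "1 / real n" 1] by simp
  have "T * real n <= e / (2 * D)" using elim(1) by (simp add: T_def mult.commute)
  hence T: "T <= e / (2 * D) / real n" using elim(3) by (subst pos_le_divide_eq) auto
  show ?case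
  proof
   fix y assume y: "y \<in> {c..d}"
   have i1: "integrable M (\<lambda>w. F (y + min (X (1 / real n) w) 1))" by (rule one_step_integrable[OF F(1,2)])
   have i2: "integrable M (\<lambda>w. F (y + X (1 / real n) w))" by (rule shift_continuous(2)[OF _ _ F(1,2)]) (use integrable_exp in auto)
   have "\<bar>F (y + min (X (1 / real n) w) 1) - F (y + X (1 / real n) w)\<bar> <=
     D * (exp (l * X (1 / real n) w) * indicator {1<..} (X (1 / real n) w))" for w
   proof (cases "1 < X (1 / real n) w")
    case True
    define z where "z = X (1 / real n) w"
    have z: "1 < z" using True by (simp add: z_def)
    have b: "\<bar>F (y + u)\<bar> <= C * (exp (l * \<bar>d\<bar>) * exp (l * z))" if "0 <= u" "u <= z" for u
    proof -
     have "l * max 0 (y + u) <= l * (\<bar>d\<bar> + z)" using C(2) y z that by (intro mult_left_mono) auto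
     hence "exp (l * max 0 (y + u)) <= exp (l * \<bar>d\<bar>) * exp (l * z)" by (simp add: exp_add[symmetric] distrib_left)
     from mult_left_mono[OF this C(1)] show ?thesis using C(3)[of "y + u"] by linarith
    qed
    have "\<bar>F (y + 1) - F (y + z)\<bar> <= 2 * (C * (exp (l * \<bar>d\<bar>) * exp (l * z)))" using b[of 1] b[of z] z by linarith
    also have "\<dots> <= D * exp (l * z)" by (simp add: D_def distrib_right mult.assoc)
    finally show ?thesis using True by (simp add: z_def)
   qed (simp add: min_def)
   hence "(EE w. \<bar>F (y + min (X (1 / real n) w) 1) - F (y + X (1 / real n) w)\<bar>) <= D * T"
    unfolding T_def integral_mult_right_zero[symmetric] using iT D by (intro integral_mono') auto
   moreover have "\<bar>(EE w. F (y + min (X (1 / real n) w) 1)) - (EE w. F (y + X (1 / real n) w))\<bar>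
     <= (EE w. \<bar>F (y + min (X (1 / real n) w) 1) - F (y + X (1 / real n) w)\<bar>)"
    unfolding Bochner_Integration.integral_diff[OF i1 i2, symmetric]
    using integral_norm_bound[of M "\<lambda>w. F (y + min (X (1 / real n) w) 1) - F (y + X (1 / real n) w)"] by simp
   moreover have "D * T <= e / 2 / real n" using mult_left_mono[OF T, of D] D by simp
   moreover have "\<bar>(EE w. F (y + X (1 / real n) w)) - F y - 1 / real n * G y\<bar> <= e / 2 * (1 / real n)"
    by (rule dynkin_formula[OF F G gen]) (use elim s0(2) y in auto)
   ultimately show "\<bar>(EE w. F (y + min (X (1 / real n) w) 1)) - F y - G y / real n\<bar> <= e / real n" by (simp add: field_simps)
  qed
 qed
qed

end

subsection \<open>Scale functions and the function R\<close>

definition causal :: "(real => real) => bool" where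
 "causal f \<longleftrightarrow> f \<in> borel_measurable borel \<and> exp_bounded f \<and> (\<forall>x<0. f x = 0)"

definition conv :: "(real => real) => (real => real) => real => real" where
 "conv f g x = (LINT y|lborel. f (x - y) * g y)"

definition laplace :: "(real => real) => real => real" where
 "laplace f l = (LINT x|lborel. exp (- l * x) * f x)"

abbreviation step :: "real => real => real" where
 "step c \<equiv> indicator {c..}"

text \<open>Written as a convolution with a unit step, so that transforms and growth bounds of
  primitives are instances of those of \<open>conv\<close>.\<close>

abbreviation primitive :: "(real => real) => real => real" where
 "primitive \<equiv> conv (step 0)"

lemma causalD:
 assumes "causal f"
 shows "f \<in> borel_measurable borel" "exp_bounded f" "x < 0 ==> f x = 0" using assms by (auto simp: causal_def)

lemma has_bochner_integral_exp_step:
 assumes "0 < (l::real)"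
 shows "has_bochner_integral lborel (\<lambda>x. exp (- l * x) * step 0 x) (1 / l)"
proof -
 have "has_bochner_integral lborel (\<lambda>x. x ^ 0 * exp (- x) * indicator {0..} x :: real) (fact 0)" by (rule has_bochner_integral_I0i_power_exp_m')
 hence "has_bochner_integral lborel (\<lambda>x. exp (- x) * step 0 x) 1" by simp
 from lborel_has_bochner_integral_real_affine_iff[of l _ _ 0, THEN iffD1, OF _ this]
 show ?thesis using assms by (simp add: indicator_def zero_le_mult_iff not_less divide_inverse)
qed

lemma has_LT_linear:
 assumes "has_LT f \<phi>" "has_LT g \<gamma>"
 shows "has_LT (\<lambda>x. a * f x + b * g x) (\<lambda>l. a * \<phi> l + b * \<gamma> l)" using assms unfolding has_LT_def
proof eventually_elim
 case (elim l)
 hence "has_bochner_integral lborel (\<lambda>x. a * (exp (- l * x) * f x) + b * (exp (- l * x) * g x)) (a * \<phi> l + b * \<gamma> l)"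
  by (intro has_bochner_integral_add has_bochner_integral_mult_right)
 thus ?case by (simp add: algebra_simps)
qed

lemma has_LT_shift:
 assumes "has_LT f \<phi>"
 shows "has_LT (\<lambda>x. f (x - c)) (\<lambda>l. exp (- c * l) * \<phi> l)" using assms unfolding has_LT_def
proof eventually_elim
 case (elim l)
 from lborel_has_bochner_integral_real_affine_iff[of 1 _ _ "- c", THEN iffD1, OF _ elim]
 have "has_bochner_integral lborel (\<lambda>x. exp (- l * (x - c)) * f (x - c)) (\<phi> l)" by simp
 hence "has_bochner_integral lborel (\<lambda>x. exp (- c * l) * (exp (- l * (x - c)) * f (x - c))) (exp (- c * l) * \<phi> l)"
  by (rule has_bochner_integral_mult_right)
 moreover have "exp (- c * l) * (exp (- l * (x - c)) * f (x - c)) = exp (- l * x) * f (x - c)" for x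
 proof -
  have "exp (- c * l) * exp (- l * (x - c)) = exp (- l * x)" by (simp add: exp_add[symmetric] algebra_simps)
  thus ?thesis by (simp only: mult.assoc[symmetric])
 qed
 ultimately show ?case by (simp only:)
qed

lemma has_LT_step: "has_LT (step c) (\<lambda>l. exp (- c * l) / l)"
proof -
 have "has_LT (step 0) (\<lambda>l. 1 / l)" unfolding has_LT_def using eventually_gt_at_top[of 0] by eventually_elim (rule has_bochner_integral_exp_step)
 from has_LT_shift[OF this, of c] show ?thesis by (simp add: indicator_def[abs_def])
qed

lemma has_LT_conv:
 assumes "has_LT f \<phi>" "has_LT g \<gamma>" and [measurable]: "f \<in> borel_measurable borel" "g \<in> borel_measurable borel"
 shows "has_LT (conv f g) (\<lambda>l. \<phi> l * \<gamma> l)" using assms(1,2) unfolding has_LT_def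
proof eventually_elim
 case (elim l)
 define F where "F x = exp (- l * x) * f x" for x
 define G where "G x = exp (- l * x) * g x" for x
 have [measurable]: "F \<in> borel_measurable borel" "G \<in> borel_measurable borel" unfolding F_def G_def by measurable
 have F: "has_bochner_integral lborel F (\<phi> l)" and G: "has_bochner_integral lborel G (\<gamma> l)" using elim unfolding F_def G_def by auto
 have t: "has_bochner_integral lborel (\<lambda>x. F (x - y)) (\<phi> l)" for y
  using lborel_has_bochner_integral_real_affine_iff[of 1 _ _ "- y", THEN iffD1, OF _ F] by simp
 have "has_bochner_integral lborel (\<lambda>x. \<bar>F x\<bar>) (LINT x|lborel. \<bar>F x\<bar>)" using F by (auto simp: has_bochner_integral_iff)
 from lborel_has_bochner_integral_real_affine_iff[of 1 _ _ "- y" for y, THEN iffD1, OF _ this]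
 have t': "(LINT x|lborel. \<bar>F (x - y)\<bar>) = (LINT x|lborel. \<bar>F x\<bar>)" for y by (simp add: has_bochner_integral_iff)
 have I: "integrable (lborel \<Otimes>\<^sub>M lborel) (\<lambda>(y, x). F (x - y) * G y)"
 proof (rule lborel_pair.Fubini_integrable)
  show "integrable lborel (\<lambda>y. LINT x|lborel. norm (case (y, x) of (y, x) => F (x - y) * G y))"
   using G by (simp add: abs_mult t' has_bochner_integral_iff)
  show "AE y in lborel. integrable lborel (\<lambda>x. case (y, x) of (y, x) => F (x - y) * G y)" using t by (auto simp: has_bochner_integral_iff)
 qed measurable
 have e: "(LINT y|lborel. F (x - y) * G y) = exp (- l * x) * conv f g x" for x
 proof -
  have "F (x - y) * G y = exp (- l * x) * (f (x - y) * g y)" for y unfolding F_def G_def by (simp add: exp_add[symmetric] algebra_simps)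
  thus ?thesis by (simp add: conv_def)
 qed
 have "integrable lborel (\<lambda>x. LINT y|lborel. F (x - y) * G y)" using lborel_pair.integrable_snd[OF I] by simp
 moreover have "(LINT x|lborel. (LINT y|lborel. F (x - y) * G y)) = (LINT y|lborel. (LINT x|lborel. F (x - y) * G y))"
  using lborel_pair.Fubini_integral[OF I] by simp
 moreover have "\<dots> = \<phi> l * \<gamma> l" using t G by (simp add: has_bochner_integral_iff)
 ultimately show ?case unfolding e has_bochner_integral_iff by simp
qed

lemma has_LT_unique:
 assumes "has_LT f \<phi>" "has_LT f \<gamma>"
 shows "\<forall>\<^sub>F l in at_top. \<phi> l = \<gamma> l" using assms unfolding has_LT_def
proof eventually_elim
 case (elim l)
 thus ?case by (rule has_bochner_integral_eq)
qed

lemma has_LT_cong: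
 assumes "has_LT f \<phi>" "\<forall>\<^sub>F l in at_top. \<phi> l = \<gamma> l"
 shows "has_LT f \<gamma>" using assms unfolding has_LT_def
proof eventually_elim
 case (elim l)
 thus ?case by simp
qed

lemma has_LT_laplace:
 assumes "causal f"
 shows "has_LT f (laplace f)"
proof -
 note [measurable] = causalD(1)[OF assms]
 obtain C l0 where C: "0 <= C" "0 <= l0" "\<And>x. \<bar>f x\<bar> <= C * exp (l0 * max 0 x)" using causalD(2)[OF assms] unfolding exp_bounded_def by blast
 show ?thesis unfolding has_LT_def using eventually_gt_at_top[of l0]
 proof eventually_elim
  case (elim l)
  hence "integrable lborel (\<lambda>x. C * (exp (- (l - l0) * x) * step 0 x))"
   using has_bochner_integral_exp_step[of "l - l0"] by (intro integrable_mult_right) (auto simp: has_bochner_integral_iff)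
  hence "integrable lborel (\<lambda>x. exp (- l * x) * f x)"
  proof (rule Bochner_Integration.integrable_bound)
   show "AE x in lborel. norm (exp (- l * x) * f x) <= norm (C * (exp (- (l - l0) * x) * step 0 x))"
   proof (rule AE_I2)
    fix x :: real
    show "norm (exp (- l * x) * f x) <= norm (C * (exp (- (l - l0) * x) * step 0 x))"
    proof (cases "x < 0")
     case False
     have "exp (- l * x) * \<bar>f x\<bar> <= exp (- l * x) * (C * exp (l0 * x))"
      using C(3)[of x] False by (intro mult_left_mono) (auto simp: max_def split: if_splits)
     also have "\<dots> = C * exp (- (l - l0) * x)" by (simp add: exp_add[symmetric] algebra_simps)
     finally show ?thesis using False C(1) by (simp add: abs_mult)
    qed (use causalD(3)[OF assms] in simp)
   qed
  qed measurable
  thus ?case by (simp add: has_bochner_integral_iff laplace_def)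
 qed
qed

lemma causal_linear: "causal f ==> causal g ==> causal (\<lambda>x. a * f x + b * g x)" unfolding causal_def using exp_bounded_linear[of f g a b] by auto

lemma causal_shift: "causal f ==> 0 <= c ==> causal (\<lambda>x. f (x - c))" unfolding causal_def using exp_bounded_shift[of f "- c"] by auto

lemma causal_step: "0 <= c ==> causal (step c)" unfolding causal_def by (auto intro!: exp_boundedI[of 1 0])

lemma causal_restrict:
 assumes "causal f" and [measurable]: "A \<in> sets borel"
 shows "causal (\<lambda>x. f x * indicator A x)"
proof -
 note [measurable] = causalD(1)[OF assms(1)]
 obtain C l0 where C: "0 <= C" "0 <= l0" "\<And>x. \<bar>f x\<bar> <= C * exp (l0 * max 0 x)" using causalD(2)[OF assms(1)] unfolding exp_bounded_def by blast
 have "exp_bounded (\<lambda>x. f x * indicator A x)" by (rule exp_boundedI[of C l0]) (use C in "auto simp: indicator_def")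
 thus ?thesis using causalD(3)[OF assms(1)] by (auto simp: causal_def)
qed

lemma conv_set:
 assumes "causal f" "causal g"
 shows "conv f g x = (LINT y:{0..x}|lborel. f (x - y) * g y)" unfolding conv_def set_lebesgue_integral_def
proof (rule Bochner_Integration.integral_cong)
 fix y
 show "f (x - y) * g y = indicator {0..x} y *\<^sub>R (f (x - y) * g y)"
  using causalD(3)[OF assms(1), of "x - y"] causalD(3)[OF assms(2), of y] by (cases "0 <= y \<and> y <= x") auto
qed simp

lemma causal_local_bound:
 assumes "causal f"
 obtains B where "0 <= B" "\<forall>x\<le>d. \<bar>f x\<bar> <= B" using exp_bounded_le causalD(2)[OF assms] by blast

lemma conv_integrable:
 assumes "causal f" "causal g"
 shows "integrable lborel (\<lambda>y. f (x - y) * g y)"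
proof -
 note [measurable] = causalD(1)[OF assms(1)] causalD(1)[OF assms(2)]
 obtain B where B: "0 <= B" "\<forall>u\<le>x. \<bar>f u\<bar> <= B" by (rule causal_local_bound[OF assms(1)])
 obtain D where D: "0 <= D" "\<forall>u\<le>x. \<bar>g u\<bar> <= D" by (rule causal_local_bound[OF assms(2)])
 have "integrable lborel (\<lambda>y. B * D * indicator {0..x} y)" by (intro integrable_mult_right) (simp add: emeasure_lborel_Icc_eq)
 thus ?thesis
 proof (rule Bochner_Integration.integrable_bound)
  show "AE y in lborel. norm (f (x - y) * g y) <= norm (B * D * indicator {0..x} y)"
  proof (rule AE_I2)
   fix y
   show "norm (f (x - y) * g y) <= norm (B * D * indicator {0..x} y)" using B D causalD(3)[OF assms(1), of "x - y"] causalD(3)[OF assms(2), of y]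
    by (cases "0 <= y \<and> y <= x") (auto simp: indicator_def abs_mult not_le intro!: mult_mono)
  qed
 qed measurable
qed

lemma conv_bound:
 assumes "causal f" "causal g" "0 <= B" "\<forall>u\<le>x. \<bar>f u\<bar> <= B" "0 <= D" "\<forall>u\<le>x. \<bar>g u\<bar> <= D"
 shows "\<bar>conv f g x\<bar> <= B * D * max 0 x"
proof -
 have "\<bar>conv f g x\<bar> <= (LINT y|lborel. \<bar>f (x - y) * g y\<bar>)" unfolding conv_def using integral_norm_bound[of lborel "\<lambda>y. f (x - y) * g y"] by simp
 also have "\<dots> <= (LINT y|lborel. B * D * indicator {0..x} y)"
 proof (rule integral_mono)
  show "integrable lborel (\<lambda>y. \<bar>f (x - y) * g y\<bar>)" using conv_integrable[OF assms(1,2)] by auto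
  show "integrable lborel (\<lambda>y. B * D * indicator {0..x} y)" by (intro integrable_mult_right) (simp add: emeasure_lborel_Icc_eq)
  fix y
  show "\<bar>f (x - y) * g y\<bar> <= B * D * indicator {0..x} y" using assms causalD(3)[OF assms(1), of "x - y"] causalD(3)[OF assms(2), of y]
   by (cases "0 <= y \<and> y <= x") (auto simp: indicator_def abs_mult not_le intro!: mult_mono)
 qed
 also have "\<dots> = B * D * max 0 x" by (auto simp: max_def measure_def emeasure_lborel_Icc_eq)
 finally show ?thesis .
qed

lemma causal_conv:
 assumes "causal f" "causal g"
 shows "causal (conv f g)" unfolding causal_def
proof (intro conjI allI impI)
 note [measurable] = causalD(1)[OF assms(1)] causalD(1)[OF assms(2)]
 show "conv f g \<in> borel_measurable borel" unfolding conv_def by measurable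
 obtain C l where f: "0 <= C" "0 <= l" "\<And>x. \<bar>f x\<bar> <= C * exp (l * max 0 x)" using causalD(2)[OF assms(1)] unfolding exp_bounded_def by blast
 obtain D \<kappa> where g: "0 <= D" "0 <= \<kappa>" "\<And>x. \<bar>g x\<bar> <= D * exp (\<kappa> * max 0 x)" using causalD(2)[OF assms(2)] unfolding exp_bounded_def by blast
 show "exp_bounded (conv f g)"
 proof (rule exp_boundedI[of "C * D" "l + \<kappa> + 1"])
  fix x :: real
  have "C * exp (l * max 0 u) <= C * exp (l * max 0 x)" "D * exp (\<kappa> * max 0 u) <= D * exp (\<kappa> * max 0 x)" if "u <= x" for u
   using f g that by (intro mult_left_mono iffD2[OF exp_le_cancel_iff]; auto)+
  hence 1: "\<forall>u\<le>x. \<bar>f u\<bar> <= C * exp (l * max 0 x)" and 2: "\<forall>u\<le>x. \<bar>g u\<bar> <= D * exp (\<kappa> * max 0 x)" using f(3) g(3) by (meson order.trans)+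
  have "\<bar>conv f g x\<bar> <= C * exp (l * max 0 x) * (D * exp (\<kappa> * max 0 x)) * max 0 x" using f(1) g(1) by (intro conv_bound[OF assms _ 1 _ 2]) auto
  also have "\<dots> <= C * exp (l * max 0 x) * (D * exp (\<kappa> * max 0 x)) * exp (max 0 x)"
   using f(1) g(1) exp_ge_add_one_self[of "max 0 x"] by (intro mult_left_mono) (linarith, auto)
  also have "\<dots> = C * D * exp ((l + \<kappa> + 1) * max 0 x)" by (simp add: exp_add[symmetric] algebra_simps)
  finally show "\<bar>conv f g x\<bar> <= C * D * exp ((l + \<kappa> + 1) * max 0 x)" .
 qed (use f g in auto)
 show "conv f g x = 0" if "x < 0" for x using that by (subst conv_set[OF assms]) (simp add: set_lebesgue_integral_def)
qed

lemma primitive_set: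
 assumes "causal f"
 shows "primitive f x = (LINT y:{0..x}|lborel. f y)" using conv_set[OF causal_step[of 0] assms, of x]
 by (auto simp: set_lebesgue_integral_def indicator_def intro!: Bochner_Integration.integral_cong)

lemma primitive_nonpos: "causal f ==> x <= 0 ==> primitive f x = 0"
proof -
 assume "causal f" "x <= 0"
 have "AE y in lborel. y \<noteq> (0::real)" by (rule AE_lborel_singleton)
 hence "AE y in lborel. indicator {0..x} y *\<^sub>R f y = 0" using `x <= 0` by (auto elim!: eventually_mono simp: indicator_def)
 thus ?thesis unfolding primitive_set[OF `causal f`] set_lebesgue_integral_def by (rule integral_eq_zero_AE)
qed

lemma primitive_diff:
 assumes "causal f" "x <= x'"
 shows "primitive f x' - primitive f x = (LINT y:{x<..x'}|lborel. f y)"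
proof -
 have i: "integrable lborel (\<lambda>y. step 0 (z - y) * f y)" for z by (rule conv_integrable[OF causal_step[OF order_refl] assms(1)])
 show ?thesis unfolding conv_def set_lebesgue_integral_def Bochner_Integration.integral_diff[OF i i, symmetric]
  using assms(2) by (intro Bochner_Integration.integral_cong) (auto simp: indicator_def)
qed

lemma primitive_diff_const:
 assumes "causal f" "x <= x'" "\<forall>y. x < y \<and> y <= x' --> \<bar>f y - c\<bar> <= B"
 shows "\<bar>primitive f x' - primitive f x - c * (x' - x)\<bar> <= B * (x' - x)"
proof -
 note [measurable] = causalD(1)[OF assms(1)]
 have i: "integrable lborel (\<lambda>y. step 0 (z - y) * f y)" for z by (rule conv_integrable[OF causal_step[OF order_refl] assms(1)])
 have "integrable lborel (\<lambda>y. step 0 (x' - y) * f y - step 0 (x - y) * f y)" by (intro Bochner_Integration.integrable_diff i)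
 also have "(\<lambda>y. step 0 (x' - y) * f y - step 0 (x - y) * f y) = (\<lambda>y. indicator {x<..x'} y * f y)" using assms(2) by (auto simp: indicator_def)
 finally have i1: "integrable lborel (\<lambda>y. indicator {x<..x'} y * f y)" .
 have i2: "integrable lborel (\<lambda>y. indicator {x<..x'} y * a)" for a :: real using assms(2) by (intro integrable_mult_left) simp
 have "primitive f x' - primitive f x - c * (x' - x) = (LINT y|lborel. indicator {x<..x'} y * f y - indicator {x<..x'} y * c)"
  unfolding primitive_diff[OF assms(1,2)] Bochner_Integration.integral_diff[OF i1 i2] set_lebesgue_integral_def using assms(2) by simp
 also have "\<bar>\<dots>\<bar> <= (LINT y|lborel. \<bar>indicator {x<..x'} y * f y - indicator {x<..x'} y * c\<bar>)"
  using integral_norm_bound[of lborel "\<lambda>y. indicator {x<..x'} y * f y - indicator {x<..x'} y * c"] by simp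
 also have "\<dots> <= (LINT y|lborel. indicator {x<..x'} y * B)" by (intro integral_mono i2 integrable_abs Bochner_Integration.integrable_diff i1)
   (use assms(3) in "auto simp: indicator_def")
 also have "\<dots> = B * (x' - x)" using assms(2) by simp
 finally show ?thesis .
qed

lemma primitive_lipschitz:
 assumes "causal f" "\<forall>y\<le>A. \<bar>f y\<bar> <= B" "x <= x'" "x' <= A"
 shows "\<bar>primitive f x' - primitive f x\<bar> <= B * (x' - x)" using primitive_diff_const[OF assms(1,3), of 0 B] assms(2,4) by simp

lemma continuous_if_local_lipschitz:
 fixes f :: "real => real"
 assumes "\<And>A. \<exists>B\<ge>0. \<forall>x x'. x <= x' \<and> x' <= A --> \<bar>f x' - f x\<bar> <= B * (x' - x)"
 shows "continuous_on UNIV f"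
proof -
 have "isCont f x" for x
 proof -
  obtain B where B: "0 <= B" "\<And>u u'. u <= u' ==> u' <= x + 1 ==> \<bar>f u' - f u\<bar> <= B * (u' - u)" using assms[of "x + 1"] by blast
  have b: "\<bar>f u - f x\<bar> <= B * \<bar>u - x\<bar>" if "u < x + 1" for u using B(2)[of u x] B(2)[of x u] that by (cases "u <= x") (auto simp: abs_minus_commute)
  have "\<forall>\<^sub>F u in at x. u < x + 1" by (rule order_tendstoD(2)[OF tendsto_ident_at]) simp
  hence "\<forall>\<^sub>F u in at x. norm (f u - f x) <= B * \<bar>u - x\<bar>" by eventually_elim (simp add: b)
  moreover have "((\<lambda>u. B * \<bar>u - x\<bar>) \<longlongrightarrow> 0) (at x)" by (auto intro!: tendsto_eq_intros)
  ultimately have "((\<lambda>u. f u - f x) \<longlongrightarrow> 0) (at x)" by (rule Lim_null_comparison)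
  thus ?thesis unfolding isCont_def by (simp add: LIM_zero_iff)
 qed
 thus ?thesis by (simp add: continuous_on_eq_continuous_at)
qed

lemma primitive_continuous:
 assumes "causal f"
 shows "continuous_on UNIV (primitive f)"
proof (rule continuous_if_local_lipschitz)
 fix A :: real
 obtain B where "0 <= B" "\<forall>x\<le>A. \<bar>f x\<bar> <= B" by (rule causal_local_bound[OF assms])
 thus "\<exists>B\<ge>0. \<forall>x x'. x <= x' \<and> x' <= A --> \<bar>primitive f x' - primitive f x\<bar> <= B * (x' - x)" using primitive_lipschitz[OF assms] by blast
qed

lemma primitive_deriv:
 assumes "causal f" "continuous_on UNIV f"
 shows "(primitive f has_real_derivative f x) (at x)" unfolding has_field_derivative_def has_derivative_at_alt
proof (intro conjI allI impI)
 show "bounded_linear ((*) (f x))" by (rule bounded_linear_mult_right)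
 fix e :: real assume "0 < e"
 have "isCont f x" using assms(2) by (simp add: continuous_on_eq_continuous_at)
 then obtain d where d: "0 < d" "\<And>y. dist y x < d ==> dist (f y) (f x) < e" using `0 < e` unfolding continuous_at_eps_delta by blast
 show "\<exists>d>0. \<forall>y. norm (y - x) < d --> norm (primitive f y - primitive f x - f x * (y - x)) <= e * norm (y - x)"
 proof (intro exI[of _ d] conjI allI impI d(1))
  fix y assume y: "norm (y - x) < d"
  have b: "\<bar>f u - f x\<bar> <= e" if "\<bar>u - x\<bar> < d" for u using d(2)[of u] that by (simp add: dist_real_def)
  show "norm (primitive f y - primitive f x - f x * (y - x)) <= e * norm (y - x)"
  proof (cases "x <= y")
   case True
   thus ?thesis using primitive_diff_const[OF assms(1) True, of "f x" e] b y by auto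
  next
   case False
   hence "\<bar>primitive f x - primitive f y - f x * (x - y)\<bar> <= e * (x - y)" using primitive_diff_const[OF assms(1), of y x "f x" e] b y by auto
   moreover have "\<bar>primitive f y - primitive f x - f x * (y - x)\<bar> = \<bar>primitive f x - primitive f y - f x * (x - y)\<bar>"
    unfolding abs_minus_commute[of "primitive f y - primitive f x"] by (simp add: algebra_simps)
   ultimately show ?thesis using False by simp
  qed
 qed
qed

lemma has_LT_primitive:
 assumes "has_LT f \<phi>" "f \<in> borel_measurable borel"
 shows "has_LT (primitive f) (\<lambda>l. \<phi> l / l)" using has_LT_conv[OF has_LT_step[of 0] assms(1) _ assms(2)] by simp

lemma conv_commute: "conv f g x = conv g f x" unfolding conv_def
 using lborel_integral_real_affine[of "-1" "\<lambda>y. f (x - y) * g y" x] by (simp add: mult.commute)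

text \<open>\<open>u\<close> may jump at 0, so monotonicity has to do the work: the differences
  \<open>u (x' - y) - u (x - y)\<close> are nonnegative and integrate over \<open>{0..}\<close> to
  an increment of the primitive of \<open>u\<close>, which is Lipschitz.\<close>

lemma conv_lipschitz:
 assumes u: "causal u" "mono u" and g: "causal g" "0 <= D" "\<forall>y\<le>A. \<bar>g y\<bar> <= D" and B: "\<forall>y\<le>A. \<bar>u y\<bar> <= B"
  and x: "x <= x'" "x' <= A"
 shows "\<bar>conv u g x' - conv u g x\<bar> <= D * B * (x' - x)"
proof -
 have iu: "integrable lborel (\<lambda>y. u (z - y) * g y)" for z by (rule conv_integrable[OF u(1) g(1)])
 have iS: "integrable lborel (\<lambda>y. u (z - y) * step 0 y)" for z by (rule conv_integrable[OF u(1) causal_step[OF order_refl]])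
 have "conv u g x' - conv u g x = (LINT y|lborel. u (x' - y) * g y - u (x - y) * g y)" unfolding conv_def by (simp add: iu)
 also have "\<bar>\<dots>\<bar> <= (LINT y|lborel. \<bar>u (x' - y) * g y - u (x - y) * g y\<bar>)"
  using integral_norm_bound[of lborel "\<lambda>y. u (x' - y) * g y - u (x - y) * g y"] by simp
 also have "\<dots> <= (LINT y|lborel. D * (u (x' - y) * step 0 y - u (x - y) * step 0 y))"
 proof (rule integral_mono)
  show "integrable lborel (\<lambda>y. \<bar>u (x' - y) * g y - u (x - y) * g y\<bar>)" by (intro integrable_abs Bochner_Integration.integrable_diff iu)
  show "integrable lborel (\<lambda>y. D * (u (x' - y) * step 0 y - u (x - y) * step 0 y))"
   by (intro integrable_mult_right Bochner_Integration.integrable_diff iS)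
  fix y
  have d: "0 <= u (x' - y) - u (x - y)" using monoD[OF u(2), of "x - y" "x' - y"] x by simp
  have "\<bar>u (x' - y) * g y - u (x - y) * g y\<bar> = (u (x' - y) - u (x - y)) * \<bar>g y\<bar>" using d by (simp add: left_diff_distrib[symmetric] abs_mult)
  also have "\<dots> <= D * (u (x' - y) * step 0 y - u (x - y) * step 0 y)"
  proof (cases "0 <= y \<and> y <= A")
   case True
   thus ?thesis using mult_left_mono[of "\<bar>g y\<bar>" D, OF _ d] g(3) by (simp add: mult.commute)
  next
   case False
   then consider "y < 0" | "A < y" by linarith
   thus ?thesis
   proof cases
    case 1
    thus ?thesis using causalD(3)[OF g(1)] by simp
   next
    case 2
    thus ?thesis using x causalD(3)[OF u(1)] by simp
   qed
  qed
  finally show "\<bar>u (x' - y) * g y - u (x - y) * g y\<bar> <= D * (u (x' - y) * step 0 y - u (x - y) * step 0 y)" .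
 qed
 also have "\<dots> = D * (conv u (step 0) x' - conv u (step 0) x)" unfolding conv_def by (simp add: iS)
 also have "\<dots> = D * (primitive u x' - primitive u x)" by (simp add: conv_commute)
 also have "\<dots> <= D * (B * (x' - x))" using primitive_lipschitz[OF u(1) B x] g(2) by (intro mult_left_mono) auto
 finally show ?thesis by (simp add: mult.assoc)
qed

section \<open>Scale functions as causal functions\<close>

lemma scale_function_laplace:
 assumes sc: "is_scale_function \<Psi> r W"
 obtains l0 where "0 < l0" "\<forall>l\<ge>l0. has_bochner_integral lborel (\<lambda>x. exp (- l * x) * W x) (1 / (\<Psi> l - r))"
proof -
 define l0 where "l0 = max 1 (right_inverse \<Psi> r + 1)"
 have "has_bochner_integral lborel (\<lambda>x. exp (- l * x) * W x) (1 / (\<Psi> l - r))" if "l0 <= l" for l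
 proof -
  have "right_inverse \<Psi> r < l" using that by (simp add: l0_def)
  hence "set_integrable lborel {0..} (\<lambda>x. exp (- l * x) * W x)"
   "(LINT x:{0..}|lborel. exp (- l * x) * W x) = 1 / (\<Psi> l - r)" using sc unfolding is_scale_function_def by blast+
  moreover have "indicator {0..} x *\<^sub>R (exp (- l * x) * W x) = exp (- l * x) * W x" for x
   using sc unfolding is_scale_function_def by (cases "x < 0") auto
  ultimately show ?thesis unfolding set_integrable_def set_lebesgue_integral_def has_bochner_integral_iff by (simp only:)
 qed
 thus ?thesis using that[of l0] by (simp add: l0_def)
qed

text \<open>A negative value at 0 would persist near 0 by continuity, and this stretch dominates the
  transform for large \<open>l\<close>, against the positivity of \<open>1 / (\<Psi> l - r)\<close>.
  Beyond 0 monotonicity takes over.\<close>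

lemma scale_function_nonneg:
 assumes sc: "is_scale_function \<Psi> r W" and pos: "\<forall>\<^sub>F l in at_top. r < \<Psi> l"
 shows "0 <= W x"
proof -
 obtain l0 where l0: "0 < l0" "\<forall>l\<ge>l0. has_bochner_integral lborel (\<lambda>x. exp (- l * x) * W x) (1 / (\<Psi> l - r))" by (rule scale_function_laplace[OF sc])
 have mono: "W u <= W v" if "0 <= u" "u <= v" for u v using sc that by (auto simp: is_scale_function_def mono_on_def)
 have neg: "W u = 0" if "u < 0" for u using sc that by (auto simp: is_scale_function_def)
 have "0 <= W 0"
 proof (rule ccontr)
  assume W0: "\<not> 0 <= W 0"
  define w where "w = - W 0 / 2"
  have w: "0 < w" using W0 by (simp add: w_def)
  have "continuous (at 0 within {0..}) W" using sc by (auto simp: is_scale_function_def continuous_on_eq_continuous_within)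
  hence "\<forall>\<^sub>F u in at 0 within {0..}. W u < - w" using W0 by (intro order_tendstoD) (auto simp: continuous_within w_def)
  then obtain d where d: "0 < d" "\<And>u. u \<in> {0..} ==> u \<noteq> 0 ==> dist u 0 < d ==> W u < - w" unfolding eventually_at by blast
  define c where "c = d / 2"
  have Wc: "W u <= - w" if "0 <= u" "u < c" for u using d(2)[of u] that w W0 by (cases "u = 0") (auto simp: c_def w_def)
  have c: "0 < c" using d by (simp add: c_def)
  define K where "K = (LINT u|lborel. exp (- l0 * u) * \<bar>W u\<bar>)"
  have K: "has_bochner_integral lborel (\<lambda>u. exp (- l0 * u) * \<bar>W u\<bar>) K"
   using integrable_abs[OF integrable.intros[OF l0(2)[rule_format, OF order_refl]]] by (simp add: K_def has_bochner_integral_iff abs_mult)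
  have LT: "has_LT (\<lambda>u. 1 * step 0 u + (- 1) * step c u) (\<lambda>l. 1 * (exp (- 0 * l) / l) + (- 1) * (exp (- c * l) / l))"
   by (intro has_LT_linear has_LT_step)
  \<comment> \<open>The first term bounds the contribution of \<open>{0..<c}\<close> times
    \<open>l\<close>; the second that of \<open>{c..}\<close>, estimated through the absolute
    integral \<open>K\<close> at \<open>l0\<close>.\<close>
  have "((\<lambda>l. - w * (1 - exp (- c * l)) + l * exp (- (l - l0) * c) * K) \<longlongrightarrow> - w) at_top" using c by real_asymp
  hence "\<forall>\<^sub>F l in at_top. - w * (1 - exp (- c * l)) + l * exp (- (l - l0) * c) * K < 0" by (rule order_tendstoD) (use w in simp)
  hence "\<forall>\<^sub>F l::real in at_top. False" using pos LT[unfolded has_LT_def] eventually_ge_at_top[of l0]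
  proof eventually_elim
   case (elim l)
   have "1 / (\<Psi> l - r) <= - w * (1 * (exp (- 0 * l) / l) + (- 1) * (exp (- c * l) / l)) + exp (- (l - l0) * c) * K"
   proof (rule has_bochner_integral_mono[OF l0(2)[rule_format, OF elim(4)] has_bochner_integral_add[OF has_bochner_integral_mult_right[OF elim(3)] has_bochner_integral_mult_right[OF K]]])
    fix u
    show "exp (- l * u) * W u <= - w * (exp (- l * u) * (1 * step 0 u + (- 1) * step c u)) + exp (- (l - l0) * c) * (exp (- l0 * u) * \<bar>W u\<bar>)"
    proof (cases "u < c")
     case True
     have "exp (- l * u) * W u <= - w * (exp (- l * u) * (1 * step 0 u + (- 1) * step c u))"
      using Wc[of u] neg[of u] True mult_left_mono[of "W u" "- w" "exp (- l * u)"] by (cases "u < 0") (auto simp: mult.commute)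
     moreover have "0 <= exp (- (l - l0) * c) * (exp (- l0 * u) * \<bar>W u\<bar>)" by simp
     ultimately show ?thesis by linarith
    next
     case False
     have "exp (- l * u) = exp (- (l - l0) * u) * exp (- l0 * u)" by (simp add: exp_add[symmetric] algebra_simps)
     also have "\<dots> <= exp (- (l - l0) * c) * exp (- l0 * u)" using False elim(4) by (intro mult_right_mono) (auto intro: mult_left_mono_neg)
     finally have "exp (- l * u) * \<bar>W u\<bar> <= exp (- (l - l0) * c) * exp (- l0 * u) * \<bar>W u\<bar>" by (rule mult_right_mono) simp
     moreover have "exp (- l * u) * W u <= exp (- l * u) * \<bar>W u\<bar>" by (rule mult_left_mono) auto
     moreover have "- w * (exp (- l * u) * (1 * step 0 u + (- 1) * step c u)) = 0" using False c by simp
     ultimately show ?thesis unfolding mult.assoc by linarith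
    qed
   qed
   moreover have "0 < 1 / (\<Psi> l - r)" using elim(2) by simp
   ultimately have "0 < l * (- w * (1 * (exp (- 0 * l) / l) + (- 1) * (exp (- c * l) / l)) + exp (- (l - l0) * c) * K)"
    using l0(1) elim(4) by (intro mult_pos_pos) linarith+
   also have "\<dots> = - w * (1 - exp (- c * l)) + l * exp (- (l - l0) * c) * K" using l0(1) elim(4) by (simp add: field_simps)
   finally show False using elim(1) by simp
  qed
  thus False by simp
 qed
 thus ?thesis using mono[of 0 x] neg[of x] by (cases "x < 0") auto
qed

text \<open>By monotonicity the transform is at least the contribution of \<open>W x\<close> on
  \<open>{x..}\<close>, which is \<open>W x * exp (- l * x) / l\<close>. This gives the exponential
  bound and, at 0, the bound on \<open>W 0\<close> that later yields
  \<open>\<delta> * W 0 0 < 1\<close>.\<close>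

lemma scale_function_facts:
 assumes sc: "is_scale_function \<Psi> r W"
  and pos: "\<forall>\<^sub>F l in at_top. r < \<Psi> l"
 shows "causal W" "mono W" "has_LT W (\<lambda>l. 1 / (\<Psi> l - r))" "\<forall>\<^sub>F l in at_top. W 0 <= l / (\<Psi> l - r)"
proof -
 obtain l0 where l0: "0 < l0" "\<forall>l\<ge>l0. has_bochner_integral lborel (\<lambda>x. exp (- l * x) * W x) (1 / (\<Psi> l - r))" by (rule scale_function_laplace[OF sc])
 have nonneg: "0 <= W u" for u by (rule scale_function_nonneg[OF assms])
 have neg: "W u = 0" if "u < 0" for u using sc that by (auto simp: is_scale_function_def)
 show m: "mono W"
 proof (rule monoI)
  fix u v :: real assume "u <= v"
  thus "W u <= W v" using sc nonneg[of v] neg[of u] by (cases "u < 0") (auto simp: is_scale_function_def mono_on_def)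
 qed
 hence [measurable]: "W \<in> borel_measurable borel" by (rule borel_measurable_mono)
 have bound: "W x <= l * exp (l * x) * (1 / (\<Psi> l - r))" if "l0 <= l" "0 <= x" for x l
 proof -
  have l: "0 < l" using that l0 by simp
  from lborel_has_bochner_integral_real_affine_iff[of 1 _ _ "- x", THEN iffD1, OF _ has_bochner_integral_exp_step[OF l]]
  have "has_bochner_integral lborel (\<lambda>u. exp (- l * (u - x)) * step 0 (u - x)) (1 / l)" by simp
  hence "has_bochner_integral lborel (\<lambda>u. exp (- l * x) * W x * (exp (- l * (u - x)) * step 0 (u - x))) (exp (- l * x) * W x * (1 / l))"
   by (rule has_bochner_integral_mult_right)
  hence "exp (- l * x) * W x * (1 / l) <= 1 / (\<Psi> l - r)"
  proof (rule has_bochner_integral_mono[OF _ l0(2)[rule_format, OF that(1)]])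
   fix u
   show "exp (- l * x) * W x * (exp (- l * (u - x)) * step 0 (u - x)) <= exp (- l * u) * W u"
   proof (cases "x <= u")
    case True
    have "exp (- l * x) * exp (- l * (u - x)) = exp (- l * u)" by (simp add: exp_add[symmetric] algebra_simps)
    hence e: "exp (- l * x) * W x * exp (- l * (u - x)) = exp (- l * u) * W x" by (metis mult.assoc mult.commute)
    have s: "step 0 (u - x) = 1" using True by simp
    show ?thesis unfolding s mult_1_right e by (rule mult_left_mono[OF monoD[OF m True]]) simp
   qed (use nonneg in simp)
  qed
  hence "exp (l * x) * l * (exp (- l * x) * W x * (1 / l)) <= exp (l * x) * l * (1 / (\<Psi> l - r))" using l by (intro mult_left_mono) auto
  moreover have "exp (l * x) * l * (exp (- l * x) * W x * (1 / l)) = W x"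
  proof -
   have "exp (l * x) * exp (- l * x) = 1" by (simp add: exp_add[symmetric])
   thus ?thesis using l by (simp add: field_simps)
  qed
  ultimately show ?thesis by (simp add: mult_ac)
 qed
 have "exp_bounded W"
 proof (rule exp_boundedI)
  fix x
  show "\<bar>W x\<bar> <= \<bar>l0 * (1 / (\<Psi> l0 - r))\<bar> * exp (l0 * max 0 x)"
  proof (cases "x < 0")
   case False
   have "\<bar>W x\<bar> <= l0 * exp (l0 * x) * (1 / (\<Psi> l0 - r))" using bound[OF order_refl, of x] False nonneg[of x] by simp
   also have "\<dots> <= \<bar>l0 * (1 / (\<Psi> l0 - r))\<bar> * exp (l0 * x)"
    using l0(1) mult_right_mono[OF abs_ge_self[of "l0 * (1 / (\<Psi> l0 - r))"], of "exp (l0 * x)"] by (simp add: mult_ac)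
   finally show ?thesis using False by simp
  qed (simp add: neg)
 qed (use l0 in auto)
 thus "causal W" using neg by (simp add: causal_def)
 show "has_LT W (\<lambda>l. 1 / (\<Psi> l - r))" unfolding has_LT_def using eventually_ge_at_top[of l0] by eventually_elim (use l0 in blast)
 show "\<forall>\<^sub>F l in at_top. W 0 <= l / (\<Psi> l - r)" using eventually_ge_at_top[of l0] by eventually_elim (use bound[of _ 0] in simp)
qed

lemma W_bar_primitive:
 assumes "causal (W r)"
 shows "W_bar W r x = primitive (W r) x"
proof (cases "0 <= x")
 case True
 thus ?thesis unfolding W_bar_def primitive_set[OF assms] by (rule interval_integral_Icc)
next
 case False
 have "AE y in lborel. y \<noteq> (0::real)" by (rule AE_lborel_singleton)
 hence "AE y in lborel. indicator {x..0} y *\<^sub>R W r y = 0" using causalD(3)[OF assms] by (auto elim!: eventually_mono simp: indicator_def)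
 hence "(LINT y:{x..0}|lborel. W r y) = 0" unfolding set_lebesgue_integral_def by (rule integral_eq_zero_AE)
 moreover have "W_bar W r x = - (LBINT y=ereal x..ereal 0. W r y)" unfolding W_bar_def by (rule interval_integral_endpoints_reverse)
 moreover have "(LBINT y=ereal x..ereal 0. W r y) = (LINT y:{x..0}|lborel. W r y)" using False by (intro interval_integral_Icc) simp
 ultimately show ?thesis using primitive_nonpos[OF assms, of x] False by simp
qed

section \<open>The function R and the generator of its primitive\<close>

locale refracted_scale = sn_levy_triplet M X \<gamma> \<sigma> \<nu> \<delta>
 for M :: "'w measure" and X :: "real => 'w => real" and \<gamma> \<sigma> :: real and \<nu> :: "real measure" and \<delta> :: real +
 fixes b p q :: real and W WY :: "real => real => real"
 assumes b_pos: "0 < b" and p_nonneg: "0 <= p" and q_ge: "- p <= q"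
  and W_scale: "\<And>r. 0 <= r ==> is_scale_function \<psi> r (W r)"
  and WY_scale: "\<And>r. 0 <= r ==> is_scale_function (laplace_exponent M (\<lambda>t w. X t w - \<delta> * t)) r (WY r)"
begin

lemma \<psi>_drift_eventually: "\<forall>\<^sub>F l in at_top. r < \<psi> l - \<delta> * l"
proof -
 obtain g l0 where e: "0 < g" "0 < l0" "\<forall>l\<ge>l0. (\<delta> + g) * l <= \<psi> l" by (rule \<psi>_linear_growth)
 show ?thesis using eventually_ge_at_top[of l0] eventually_gt_at_top[of "r / g"]
 proof eventually_elim
  case (elim l)
  hence "(\<delta> + g) * l <= \<psi> l" "r < g * l" using e by (auto simp: pos_divide_less_eq mult.commute)
  thus ?case by (simp add: distrib_right)
 qed
qed

lemma \<psi>_eventually: "\<forall>\<^sub>F l in at_top. r < \<psi> l" using \<psi>_drift_eventually[of r] eventually_ge_at_top[of 0]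
proof eventually_elim
 case (elim l)
 thus ?case using mult_nonneg_nonneg[OF \<delta>_nonneg, of l] by linarith
qed

lemma \<psi>Y: "0 <= l ==> laplace_exponent M (\<lambda>t w. X t w - \<delta> * t) l = \<psi> l - \<delta> * l"
proof -
 assume l: "0 <= l"
 have "(EE w. exp (l * (X 1 w - \<delta> * 1))) = (EE w. exp (- (\<delta> * l)) * exp (l * X 1 w))"
  by (intro Bochner_Integration.integral_cong) (auto simp: exp_add[symmetric] algebra_simps)
 also have "\<dots> = exp (\<psi> l - \<delta> * l)" using expectation_exp[OF l, of 1] by (simp add: exp_diff exp_minus field_simps)
 finally show ?thesis by (simp add: laplace_exponent_def)
qed

lemma W_facts:
 assumes "0 <= r"
 shows "causal (W r)" "mono (W r)" "has_LT (W r) (\<lambda>l. 1 / (\<psi> l - r))" "\<forall>\<^sub>F l in at_top. W r 0 <= l / (\<psi> l - r)"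
 by (fact scale_function_facts[OF W_scale[OF assms] \<psi>_eventually])+

lemma WY_facts:
 assumes "0 <= r"
 shows "causal (WY r)" "mono (WY r)" "has_LT (WY r) (\<lambda>l. 1 / (\<psi> l - \<delta> * l - r))"
proof -
 have pos: "\<forall>\<^sub>F l in at_top. r < laplace_exponent M (\<lambda>t w. X t w - \<delta> * t) l"
  using \<psi>_drift_eventually[of r] eventually_ge_at_top[of 0] by eventually_elim (simp add: \<psi>Y)
 note * = scale_function_facts[OF WY_scale[OF assms] pos]
 show "causal (WY r)" "mono (WY r)" by (fact *)+
 show "has_LT (WY r) (\<lambda>l. 1 / (\<psi> l - \<delta> * l - r))" by (rule has_LT_cong[OF *(3)]) (use eventually_ge_at_top[of 0] in "eventually_elim, simp add: \<psi>Y")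
qed

text \<open>In the bounded variation case this is \<delta>/c < 1. It is the margin by which a bump
  dominates the refraction drift in \<open>occupation_small\<close>.\<close>

lemma \<delta>_W_0: "\<delta> * W 0 0 < 1"
proof -
 obtain g l0 where e: "0 < g" "0 < l0" "\<forall>l\<ge>l0. (\<delta> + g) * l <= \<psi> l" by (rule \<psi>_linear_growth)
 have "\<forall>\<^sub>F l::real in at_top. W 0 0 <= 1 / (\<delta> + g)" using W_facts(4)[OF order_refl] eventually_ge_at_top[of l0]
 proof eventually_elim
  case (elim l)
  have d: "0 < (\<delta> + g) * l" using e \<delta>_nonneg elim(2) by (intro mult_pos_pos) auto
  have "l / (\<psi> l - 0) <= l / ((\<delta> + g) * l)"
   using d e(1,2,3) elim(2) \<delta>_nonneg add_nonneg_pos[OF \<delta>_nonneg e(1)] less_le_trans[OF d, of "\<psi> l"] by (intro divide_left_mono mult_pos_pos) auto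
  also have "\<dots> = 1 / (\<delta> + g)" using e(2) elim(2) by simp
  finally show ?case using elim(1) by linarith
 qed
 hence "W 0 0 <= 1 / (\<delta> + g)" by simp
 hence "\<delta> * W 0 0 <= \<delta> * (1 / (\<delta> + g))" using \<delta>_nonneg by (rule mult_left_mono)
 also have "\<dots> < 1" using e \<delta>_nonneg by (simp add: divide_less_eq)
 finally show ?thesis .
qed

abbreviation "R \<equiv> R_fun W WY \<delta> b p q"
abbreviation "\<alpha> \<equiv> p + q"

lemma \<alpha>_nonneg: "0 <= \<alpha>" using q_ge by simp

text \<open>The redundant factors in this and the following definitions match the linearity lemmas literally.\<close>

definition Rg :: "real => real" where
 "Rg y = q * (primitive (W \<alpha>) y * step b y) + (- \<delta>) * (W \<alpha> y * step b y)"

text \<open>The function \<open>R\<close> without its constant 1, which makes it causal.\<close>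

definition Rh :: "real => real" where
 "Rh x = 1 * (\<alpha> * primitive (W \<alpha>) x + (- q) * primitive (WY p) (x - b)) + (- \<alpha>) * conv (WY p) Rg x"

lemma causal_parts:
 "causal (W \<alpha>)" "causal (primitive (W \<alpha>))" "causal (WY p)" "causal (primitive (WY p))" "causal Rg" "causal Rh"
proof -
 show 1: "causal (W \<alpha>)" "causal (WY p)" using W_facts(1)[OF \<alpha>_nonneg] WY_facts(1)[OF p_nonneg] by auto
 thus 2: "causal (primitive (W \<alpha>))" "causal (primitive (WY p))" by (auto intro: causal_conv causal_step)
 show 3: "causal Rg" unfolding Rg_def by (intro causal_linear causal_restrict 1 2) auto
 show "causal Rh" unfolding Rh_def using b_pos by (intro causal_linear causal_conv causal_shift 1 2 3 causal_step) auto
qed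

lemma R_eq: "R x = 1 + Rh x"
proof -
 have "(LINT y:{b..x}|lborel. WY p (x - y) * (q * W_bar W \<alpha> y - \<delta> * W \<alpha> y)) = conv (WY p) Rg x" unfolding conv_def set_lebesgue_integral_def
 proof (rule Bochner_Integration.integral_cong)
  fix y
  show "indicator {b..x} y *\<^sub>R (WY p (x - y) * (q * W_bar W \<alpha> y - \<delta> * W \<alpha> y)) = WY p (x - y) * Rg y" using causalD(3)[OF causal_parts(3), of "x - y"]
   by (cases "b <= y"; cases "y <= x") (auto simp: Rg_def W_bar_primitive[of W, OF causal_parts(1)])
 qed simp
 thus ?thesis unfolding R_fun_def Z_scale_def Rh_def
  by (simp add: W_bar_primitive[of W, OF causal_parts(1)] W_bar_primitive[of WY, OF causal_parts(3)] del: minus_add_distrib)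
qed

lemma conv_Rg_le: "x <= b ==> conv (WY p) Rg x = 0"
proof -
 assume "x <= b"
 have "AE y in lborel. y \<noteq> (b::real)" by (rule AE_lborel_singleton)
 hence "AE y in lborel. WY p (x - y) * Rg y = 0"
 proof eventually_elim
  case (elim y)
  thus ?case using causalD(3)[OF causal_parts(3), of "x - y"] `x <= b` by (cases "y < b") (auto simp: Rg_def)
 qed
 thus ?thesis unfolding conv_def by (rule integral_eq_zero_AE)
qed

lemma R_nonpos: "x <= 0 ==> R x = 1"
 unfolding R_eq Rh_def using b_pos conv_Rg_le[of x] primitive_nonpos[OF causal_parts(1), of x] primitive_nonpos[OF causal_parts(3), of "x - b"]
 by simp

lemma R_b: "R b = 1 + \<alpha> * primitive (W \<alpha>) b" unfolding R_eq Rh_def using conv_Rg_le[of b] primitive_nonpos[OF causal_parts(3), of "b - b"] by simp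

lemma R_lipschitz: "\<exists>B\<ge>0. \<forall>x x'. x <= x' \<and> x' <= A --> \<bar>R x' - R x\<bar> <= B * (x' - x)"
proof -
 obtain B1 where B1: "0 <= B1" "\<forall>x\<le>A. \<bar>W \<alpha> x\<bar> <= B1" by (rule causal_local_bound[OF causal_parts(1)])
 obtain B2 where B2: "0 <= B2" "\<forall>x\<le>A. \<bar>WY p x\<bar> <= B2" by (rule causal_local_bound[OF causal_parts(3)])
 obtain D where D: "0 <= D" "\<forall>x\<le>A. \<bar>Rg x\<bar> <= D" by (rule causal_local_bound[OF causal_parts(5)])
 define B where "B = \<bar>\<alpha>\<bar> * B1 + \<bar>q\<bar> * B2 + \<bar>\<alpha>\<bar> * (D * B2)"
 show ?thesis
 proof (intro exI[of _ B] conjI allI impI)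
  show "0 <= B" using B1 B2 D by (simp add: B_def)
  fix x x' assume x: "x <= x' \<and> x' <= A"
  have "\<bar>primitive (W \<alpha>) x' - primitive (W \<alpha>) x\<bar> <= B1 * (x' - x)" using primitive_lipschitz[OF causal_parts(1) B1(2)] x by auto
  from mult_left_mono[OF this, of "\<bar>\<alpha>\<bar>"]
  have 1: "\<bar>\<alpha> * (primitive (W \<alpha>) x' - primitive (W \<alpha>) x)\<bar> <= \<bar>\<alpha>\<bar> * (B1 * (x' - x))" by (simp add: abs_mult)
  have "\<bar>primitive (WY p) (x' - b) - primitive (WY p) (x - b)\<bar> <= B2 * (x' - x)"
   using primitive_lipschitz[OF causal_parts(3) B2(2), of "x - b" "x' - b"] x b_pos by auto
  from mult_left_mono[OF this, of "\<bar>q\<bar>"]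
  have 2: "\<bar>q * (primitive (WY p) (x' - b) - primitive (WY p) (x - b))\<bar> <= \<bar>q\<bar> * (B2 * (x' - x))" by (simp add: abs_mult)
  have "\<bar>conv (WY p) Rg x' - conv (WY p) Rg x\<bar> <= D * B2 * (x' - x)"
   using conv_lipschitz[OF causal_parts(3) WY_facts(2)[OF p_nonneg] causal_parts(5) D B2(2)] x by auto
  from mult_left_mono[OF this, of "\<bar>\<alpha>\<bar>"]
  have 3: "\<bar>\<alpha> * (conv (WY p) Rg x' - conv (WY p) Rg x)\<bar> <= \<bar>\<alpha>\<bar> * (D * B2 * (x' - x))" by (simp add: abs_mult)
  have "R x' - R x = \<alpha> * (primitive (W \<alpha>) x' - primitive (W \<alpha>) x) - q * (primitive (WY p) (x' - b) - primitive (WY p) (x - b))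
    - \<alpha> * (conv (WY p) Rg x' - conv (WY p) Rg x)" unfolding R_eq Rh_def by (simp add: algebra_simps)
  moreover have "B * (x' - x) = \<bar>\<alpha>\<bar> * (B1 * (x' - x)) + \<bar>q\<bar> * (B2 * (x' - x)) + \<bar>\<alpha>\<bar> * (D * B2 * (x' - x))"
   unfolding B_def by (simp only: distrib_right mult.assoc)
  ultimately show "\<bar>R x' - R x\<bar> <= B * (x' - x)" using 1 2 3 by linarith
 qed
qed

lemma R_continuous: "continuous_on UNIV R" by (rule continuous_if_local_lipschitz) (rule R_lipschitz)

lemma Rh_continuous: "continuous_on UNIV Rh"
proof -
 have "Rh = (\<lambda>x. R x - 1)" by (simp add: R_eq)
 thus ?thesis using R_continuous by (auto intro!: continuous_intros)
qed

text \<open>The restriction of \<open>R\<close> to \<open>{b..}\<close>.\<close>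

definition RH :: "real => real" where
 "RH x = 1 * (Rh x * step b x) + 1 * step b x"

text \<open>Equal to \<open>\<alpha> * R y\<close> on \<open>{0..<b}\<close> and to
  \<open>p * R y\<close> on \<open>{b..}\<close>: the killing term, cut off to the left of
  0.\<close>

definition Rk :: "real => real" where
 "Rk y = 1 * (\<alpha> * step 0 y + \<alpha> * Rh y) + (- q) * RH y"

text \<open>The increment of \<open>R\<close> above \<open>b\<close>, on which the refraction drift
  acts once the equation for \<open>R\<close> is integrated.\<close>

definition Re :: "real => real" where
 "Re x = 1 * RH x + (- R b) * step b x"

text \<open>Integrated form of the equation by which the generator of X maps \<open>R\<close> to the
  killing term plus \<delta> times its slope above \<open>b\<close>.\<close>

definition RQ :: "real => real" where
 "RQ x = 1 * primitive Rk x + \<delta> * Re x"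

lemma causal_parts2: "causal RH" "causal Rk" "causal Re" "causal RQ"
proof -
 show 1: "causal RH" unfolding RH_def using b_pos by (intro causal_linear causal_restrict causal_step causal_parts) auto
 show 2: "causal Rk" unfolding Rk_def using 1 by (intro causal_linear causal_step causal_parts) auto
 show 3: "causal Re" unfolding Re_def using 1 b_pos by (intro causal_linear causal_step) auto
 show "causal RQ" unfolding RQ_def using 2 3 by (intro causal_linear causal_conv causal_step) auto
qed

lemma Re_eq: "Re x = R (max x b) - R b" by (cases "b <= x") (auto simp: Re_def RH_def R_eq[of x] R_eq[of "max x b"] max_def)

lemma RQ_continuous: "continuous_on UNIV RQ"
proof -
 have "continuous_on UNIV (\<lambda>x. R (max x b))" by (rule continuous_on_compose2[OF R_continuous]) (auto intro!: continuous_intros)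
 hence "continuous_on UNIV Re" unfolding Re_eq by (auto intro!: continuous_intros)
 thus ?thesis unfolding RQ_def using primitive_continuous[OF causal_parts2(2)] by (auto intro!: continuous_intros)
qed

text \<open>Integration by parts on \<open>{b..}\<close>: the restricted primitive has the
  restricted \<open>W \<alpha>\<close> as density and a jump of height
  \<open>primitive (W \<alpha>) b\<close> at \<open>b\<close>.\<close>

lemma laplace_restricted:
 "\<forall>\<^sub>F l in at_top. laplace (\<lambda>y. W \<alpha> y * step b y) l =
   l * laplace (\<lambda>y. primitive (W \<alpha>) y * step b y) l - primitive (W \<alpha>) b * exp (- b * l)"
proof -
 let ?A = "\<lambda>y. W \<alpha> y * step b y" and ?B = "\<lambda>y. primitive (W \<alpha>) y * step b y"
 have A: "causal ?A" and B: "causal ?B" by (intro causal_restrict causal_parts; simp)+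
 have e: "primitive ?A = (\<lambda>x. 1 * ?B x + (- primitive (W \<alpha>) b) * step b x)"
 proof
  fix x
  show "primitive ?A x = 1 * ?B x + (- primitive (W \<alpha>) b) * step b x"
  proof (cases "b <= x")
   case True
   have "AE y in lborel. y \<noteq> (b::real)" by (rule AE_lborel_singleton)
   hence "AE y in lborel. indicator {0..x} y *\<^sub>R ?A y = indicator {b<..x} y *\<^sub>R W \<alpha> y"
    using b_pos by (auto elim!: eventually_mono simp: indicator_def)
   hence "(LINT y:{0..x}|lborel. ?A y) = (LINT y:{b<..x}|lborel. W \<alpha> y)"
    unfolding set_lebesgue_integral_def using causalD(1)[OF causal_parts(1)] by (intro integral_cong_AE) simp_all
   also have "\<dots> = primitive (W \<alpha>) x - primitive (W \<alpha>) b" by (rule primitive_diff[OF causal_parts(1) True, symmetric])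
   finally show ?thesis using True unfolding primitive_set[OF A] by simp
  next
   case False
   have "(LINT y:{0..x}|lborel. ?A y) = (LINT y::real|lborel. 0)"
    unfolding set_lebesgue_integral_def by (rule Bochner_Integration.integral_cong) (use False in "auto simp: indicator_def")
   thus ?thesis using False unfolding primitive_set[OF A] by simp
  qed
 qed
 have 1: "has_LT (primitive ?A) (\<lambda>l. laplace ?A l / l)" by (rule has_LT_primitive[OF has_LT_laplace[OF A] causalD(1)[OF A]])
 have 2: "has_LT (primitive ?A) (\<lambda>l. 1 * laplace ?B l + (- primitive (W \<alpha>) b) * (exp (- b * l) / l))"
  unfolding e by (intro has_LT_linear has_LT_laplace B has_LT_step)
 show ?thesis using has_LT_unique[OF 1 2] eventually_gt_at_top[of 0] by eventually_elim (simp add: field_simps)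
qed

text \<open>Convolution with \<open>WY p\<close> divides a transform by \<open>u l\<close>, and
  \<open>W \<alpha>\<close> contributes \<open>1 / (\<psi> l - \<alpha>)\<close>. As these
  denominators differ by \<open>\<delta> * l - q\<close> only, multiplication by
  \<open>\<psi> l - \<alpha>\<close> leaves the transform of \<open>RQ\<close>; the transforms of
  functions restricted to \<open>{b..}\<close> stay implicit and cancel.\<close>

lemma one_step_R: "one_step (primitive Rh) RQ"
proof -
 let ?A = "\<lambda>y. W \<alpha> y * step b y" and ?B = "\<lambda>y. primitive (W \<alpha>) y * step b y"
 have A: "causal ?A" and B: "causal ?B" by (intro causal_restrict causal_parts; simp)+
 define u where "u l = \<psi> l - \<delta> * l - p" for l
 define g where "g l = q * laplace ?B l + (- \<delta>) * laplace ?A l" for l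
 have g: "has_LT Rg g" unfolding Rg_def g_def by (intro has_LT_linear has_LT_laplace A B)
 have pW: "has_LT (primitive (W \<alpha>)) (\<lambda>l. 1 / (\<psi> l - \<alpha>) / l)" by (rule has_LT_primitive[OF W_facts(3)[OF \<alpha>_nonneg] causalD(1)[OF causal_parts(1)]])
 have LY: "has_LT (WY p) (\<lambda>l. 1 / u l)" unfolding u_def by (rule WY_facts(3)[OF p_nonneg])
 have pY: "has_LT (\<lambda>x. primitive (WY p) (x - b)) (\<lambda>l. exp (- b * l) * (1 / u l / l))"
  by (rule has_LT_shift[OF has_LT_primitive[OF LY causalD(1)[OF causal_parts(3)]]])
 have cY: "has_LT (conv (WY p) Rg) (\<lambda>l. 1 / u l * g l)" by (rule has_LT_conv[OF LY g causalD(1)[OF causal_parts(3)] causalD(1)[OF causal_parts(5)]])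
 define h where "h l = 1 * (\<alpha> * (1 / (\<psi> l - \<alpha>) / l) + (- q) * (exp (- b * l) * (1 / u l / l))) + (- \<alpha>) * (1 / u l * g l)" for l
 have h: "has_LT Rh h" unfolding Rh_def h_def by (intro has_LT_linear pW pY cY)
 define H where "H l = 1 * (1 * (1 * (exp (- b * l) / l) + \<alpha> * laplace ?B l) + (- q) * (exp (- b * l) * (1 / u l / l))) + (- \<alpha>) * (1 / u l * g l)" for l
 have "RH x = 1 * (1 * (1 * step b x + \<alpha> * ?B x) + (- q) * primitive (WY p) (x - b)) + (- \<alpha>) * conv (WY p) Rg x" for x
  using conv_Rg_le[of x] primitive_nonpos[OF causal_parts(3), of "x - b"] by (cases "b <= x") (auto simp: RH_def Rh_def)
 hence RH: "RH = (\<lambda>x. 1 * (1 * (1 * step b x + \<alpha> * ?B x) + (- q) * primitive (WY p) (x - b)) + (- \<alpha>) * conv (WY p) Rg x)" by blast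
 have H: "has_LT RH H" unfolding RH H_def by (intro has_LT_linear has_LT_step has_LT_laplace B pY cY)
 have k: "has_LT Rk (\<lambda>l. 1 * (\<alpha> * (exp (- 0 * l) / l) + \<alpha> * h l) + (- q) * H l)" unfolding Rk_def by (intro has_LT_linear has_LT_step h H)
 have e: "has_LT Re (\<lambda>l. 1 * H l + (- R b) * (exp (- b * l) / l))" unfolding Re_def by (intro has_LT_linear has_LT_step H)
 have Q: "has_LT RQ (\<lambda>l. 1 * ((1 * (\<alpha> * (exp (- 0 * l) / l) + \<alpha> * h l) + (- q) * H l) / l) + \<delta> * (1 * H l + (- R b) * (exp (- b * l) / l)))"
  unfolding RQ_def by (intro has_LT_linear has_LT_primitive k e causalD(1)[OF causal_parts2(2)])
 have P: "has_LT (primitive Rh) (\<lambda>l. h l / l)" by (rule has_LT_primitive[OF h causalD(1)[OF causal_parts(6)]])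
 show ?thesis
 proof (rule one_step_dynkin[OF primitive_continuous[OF causal_parts(6)] causalD(2)[OF causal_conv[OF causal_step[OF order_refl] causal_parts(6)]] P
    RQ_continuous causalD(2)[OF causal_parts2(4)] Q])
  show "\<forall>\<^sub>F l in at_top. \<psi> l * (h l / l) =
   1 * ((1 * (\<alpha> * (exp (- 0 * l) / l) + \<alpha> * h l) + (- q) * H l) / l) + \<delta> * (1 * H l + (- R b) * (exp (- b * l) / l))"
   using laplace_restricted eventually_gt_at_top[of 0] \<psi>_eventually[of \<alpha>] \<psi>_drift_eventually[of p]
  proof eventually_elim
   case (elim l)
   \<comment> \<open>Among these abbreviations \<open>s\<close> is the transform of all terms built
     from \<open>WY p\<close>, while \<open>B'\<close> and \<open>w\<close> describe the restricted
     primitive of \<open>W \<alpha>\<close>. The value \<open>R b = 1 + \<alpha> * w\<close> enters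
     in \<open>key\<close>.\<close>
   define E where "E = exp (- b * l)"
   define B' where "B' = laplace ?B l"
   define w where "w = primitive (W \<alpha>) b"
   define t where "t = E / l"
   define v where "v = \<psi> l - \<alpha>"
   define s where "s = (q * t + \<alpha> * g l) / u l"
   have nz: "l \<noteq> 0" "v \<noteq> 0" "u l \<noteq> 0" using elim by (auto simp: v_def u_def)
   have E: "E = l * t" using nz by (simp add: t_def)
   have g': "g l = q * B' - \<delta> * (l * B' - w * E)" unfolding g_def elim(1) B'_def w_def E_def by simp
   have us: "u l * s = q * t + \<alpha> * g l" using nz by (simp add: s_def)
   have h': "h l = \<alpha> / (v * l) - s"
    unfolding h_def s_def t_def E_def v_def by (simp add: add_divide_distrib mult.commute[of l] del: minus_add_distrib)
   have vh: "v * h l = \<alpha> / l - v * s" unfolding h' using nz by (simp add: right_diff_distrib)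
   have H': "H l = t + \<alpha> * B' - s"
    unfolding H_def s_def t_def E_def B'_def by (simp add: add_divide_distrib mult.commute[of l] del: minus_add_distrib)
   have v: "v = u l + \<delta> * l - q" by (simp add: v_def u_def)
   have vs: "v * s = q * t + \<alpha> * g l + (\<delta> * l - q) * s" unfolding v us[symmetric] by (simp add: algebra_simps)
   have key: "v * h l = \<alpha> / l - q * H l + \<delta> * (l * H l - R b * E)" unfolding vh vs H' R_b w_def[symmetric] g' E by (simp add: algebra_simps)
   have "\<psi> l * h l = v * h l + \<alpha> * h l" by (simp add: v_def algebra_simps)
   hence "\<psi> l * h l / l = (\<alpha> / l + \<alpha> * h l - q * H l + \<delta> * (l * H l - R b * E)) / l" unfolding key by simp
   also have "\<dots> = (\<alpha> / l + \<alpha> * h l - q * H l) / l + \<delta> * (H l - R b * (E / l))" using nz by (simp add: field_simps)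
   finally show ?case by (simp add: E_def)
  qed
 qed
qed

end

context refracted_scale
begin

abbreviation "es n \<equiv> euler_step \<delta> b (1 / real n)"
abbreviation "step_mean n F u \<equiv> (EE w. F (es n u (X (1 / real n) w)))"

subsection \<open>Estimates for the Euler chain\<close>

text \<open>\<open>G\<close> is the image of \<open>F\<close> under the generator of X; the
  derivative \<open>D\<close> is carried separately because the refraction drift acts only above
  \<open>b\<close>.\<close>

definition smooth_pair :: "(real => real) => (real => real) => (real => real) => bool" where
 "smooth_pair F G D \<longleftrightarrow> one_step F G \<and> (\<forall>x. (F has_real_derivative D x) (at x)) \<and> continuous_on UNIV D"

lemma smooth_pairD:
 assumes "smooth_pair F G D"
 shows "one_step F G" "continuous_on UNIV F" "exp_bounded F" "continuous_on UNIV G" "continuous_on UNIV D"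
  "(F has_real_derivative D x) (at x)" using assms by (auto simp: smooth_pair_def one_step_def)

lemma smooth_pair_linear:
 assumes "smooth_pair F G D" "smooth_pair F' G' D'"
 shows "smooth_pair (\<lambda>x. c * F x + d * F' x) (\<lambda>x. c * G x + d * G' x) (\<lambda>x. c * D x + d * D' x)" unfolding smooth_pair_def
proof (intro conjI allI)
 show "one_step (\<lambda>x. c * F x + d * F' x) (\<lambda>x. c * G x + d * G' x)"
  using smooth_pairD(1)[OF assms(1)] smooth_pairD(1)[OF assms(2)] by (rule one_step_linear)
 show "continuous_on UNIV (\<lambda>x. c * D x + d * D' x)" using smooth_pairD(5)[OF assms(1)] smooth_pairD(5)[OF assms(2)] by (intro continuous_intros)
 show "((\<lambda>x. c * F x + d * F' x) has_real_derivative c * D x + d * D' x) (at x)" for x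
  by (intro DERIV_add DERIV_cmult smooth_pairD(6)[OF assms(1)] smooth_pairD(6)[OF assms(2)])
qed

lemma smooth_pair_shift:
 assumes "smooth_pair F G D"
 shows "smooth_pair (\<lambda>x. F (x + r)) (\<lambda>x. G (x + r)) (\<lambda>x. D (x + r))" unfolding smooth_pair_def
proof (intro conjI allI)
 show "one_step (\<lambda>x. F (x + r)) (\<lambda>x. G (x + r))" using smooth_pairD(1)[OF assms] by (rule one_step_shift)
 show "continuous_on UNIV (\<lambda>x. D (x + r))" by (rule continuous_on_compose2[OF smooth_pairD(5)[OF assms]]) (auto intro!: continuous_intros)
 show "((\<lambda>x. F (x + r)) has_real_derivative D (x + r)) (at x)" for x using smooth_pairD(6)[OF assms, of "x + r"] by (simp add: DERIV_shift)
qed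

lemma smooth_pair_const: "smooth_pair (\<lambda>_. c) (\<lambda>_. 0) (\<lambda>_. 0)" unfolding smooth_pair_def by (simp add: one_step_const)

lemma smooth_pair_exp:
 assumes "0 <= l"
 shows "smooth_pair (\<lambda>x. exp (l * x)) (\<lambda>x. \<psi> l * exp (l * x)) (\<lambda>x. l * exp (l * x))" unfolding smooth_pair_def using one_step_exp[OF assms]
 by (auto intro!: derivative_eq_intros continuous_intros)

text \<open>The drift is applied before the jump, so the expansion is taken at the shifted point,
  and \<open>G\<close> and \<open>D\<close> are brought back to \<open>v\<close> by uniform
  continuity. The estimate is uniform across \<open>b\<close>, since the jump of the drift occurs on
  both sides of it.\<close>

lemma euler_drift:
 assumes F: "smooth_pair F G D" and "0 < g"
 shows "EV n. \<forall>v\<in>{0..A}.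
  \<bar>(EE w. F (v - (if b < v then \<delta> * (1 / real n) else 0) + min (X (1 / real n) w) 1)) - F v
   - (G v - (if b < v then \<delta> * D v else 0)) / real n\<bar> <= g / real n"
proof -
 define g' where "g' = g / 3 / (\<delta> + 1)"
 have g': "0 < g'" "g' <= g / 3" "g' * \<delta> <= g / 3"
 proof -
  show "0 < g'" using `0 < g` \<delta>_nonneg by (simp add: g'_def)
  moreover have "\<delta> + 1 \<noteq> 0" using \<delta>_nonneg by linarith
  hence "g' * (\<delta> + 1) = g / 3" by (simp add: g'_def del: divide_divide_eq_left)
  hence "g' * \<delta> + g' = g / 3" by (simp add: distrib_left)
  moreover have "0 <= g' * \<delta>" using `0 < g'` \<delta>_nonneg by simp
  ultimately show "g' <= g / 3" "g' * \<delta> <= g / 3" by linarith+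
 qed
 \<comment> \<open>The drift of one step is at most \<delta>, so shifted points stay in this
   interval.\<close>
 define I where "I = {- \<delta>..max A 0}"
 have "uniformly_continuous_on I G" "uniformly_continuous_on I D"
  unfolding I_def using smooth_pairD(4,5)[OF F] by (auto intro!: compact_uniformly_continuous intro: continuous_on_subset)
 then obtain r1 r2 where r1: "0 < r1" "\<And>u u'. u \<in> I ==> u' \<in> I ==> dist u' u < r1 ==> dist (G u') (G u) < g'"
  and r2: "0 < r2" "\<And>u u'. u \<in> I ==> u' \<in> I ==> dist u' u < r2 ==> dist (D u') (D u) < g'" unfolding uniformly_continuous_on_def using g'(1) by metis
 have "EV n. \<forall>y\<in>I.
    \<bar>(EE w. F (y + min (X (1 / real n) w) 1)) - F y - G y / real n\<bar> <= g' / real n"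
  unfolding I_def using smooth_pairD(1)[OF F] g'(1) unfolding one_step_def by blast
 moreover have "EV n. \<delta> * (1 / real n) < min r1 r2"
  by (rule order_tendstoD(2)[OF tendsto_mult_right_zero[OF lim_1_over_n]]) (use r1 r2 in simp)
 ultimately show ?thesis using eventually_gt_at_top[of 0]
 proof eventually_elim
  case (elim n)
  show ?case
  proof
   fix v assume v: "v \<in> {0..A}"
   define s where "s = (if b < v then \<delta> * (1 / real n) else 0)"
   define e where "e = (if b < v then \<delta> else 0)"
   have e: "0 <= e" "e <= \<delta>" "s = e / real n" using \<delta>_nonneg by (auto simp: e_def s_def)
   have "\<delta> * (1 / real n) <= \<delta> * 1" using \<delta>_nonneg elim(3) by (intro mult_left_mono) auto
   hence s: "0 <= s" "s <= \<delta>" "s < r1" "s < r2" using elim(2) r1 r2 \<delta>_nonneg by (auto simp: s_def)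
   have vI: "v - t \<in> I" if "0 <= t" "t <= s" for t using v s that by (auto simp: I_def)
   have 1: "\<bar>(EE w. F (v - s + min (X (1 / real n) w) 1)) - F (v - s) - G (v - s) / real n\<bar> <= g' / real n" using elim(1) vI[of s] s by auto
   have "dist (G (v - s)) (G v) < g'" using vI[of s] vI[of 0] s by (intro r1(2)) (auto simp: dist_real_def)
   hence "\<bar>G (v - s) - G v\<bar> / real n <= g' / real n" by (intro divide_right_mono) (auto simp: dist_real_def)
   hence 2: "\<bar>G (v - s) / real n - G v / real n\<bar> <= g' / real n" by (simp add: diff_divide_distrib[symmetric] abs_divide)
   have 3: "\<bar>F (v - s) - F v + s * D v\<bar> <= s * g'"
   proof (cases "s = 0")
    case False
    hence "v - s < v" using s by simp
    from MVT2[OF this, of F D] smooth_pairD(6)[OF F] obtain z where z: "v - s < z" "z < v" "F v - F (v - s) = s * D z" by auto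
    have "dist (D z) (D v) < g'" using vI[of "v - z"] vI[of 0] s z by (intro r2(2)) (auto simp: dist_real_def)
    hence "s * \<bar>D v - D z\<bar> <= s * g'" using s by (intro mult_left_mono) (auto simp: dist_real_def)
    moreover have "F (v - s) - F v + s * D v = s * (D v - D z)" using z(3) by (simp add: algebra_simps)
    ultimately show ?thesis using s by (simp add: abs_mult)
   qed simp
   have "s * g' <= g / 3 / real n"
   proof -
    have "e * g' <= \<delta> * g'" using e g'(1) by (intro mult_right_mono) auto
    hence "e * g' / real n <= g / 3 / real n" using g'(3) by (intro divide_right_mono) (auto simp: mult.commute)
    thus ?thesis by (simp add: e(3))
   qed
   moreover have "g' / real n <= g / 3 / real n" using g'(2) by (intro divide_right_mono) auto
   moreover have "(G v - (if b < v then \<delta> * D v else 0)) / real n = G v / real n - s * D v" by (auto simp: s_def diff_divide_distrib)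
   moreover have "g / real n = g / 3 / real n + g / 3 / real n + g / 3 / real n" by simp
   ultimately show "\<bar>(EE w. F (v - (if b < v then \<delta> * (1 / real n) else 0) + min (X (1 / real n) w) 1)) - F v
     - (G v - (if b < v then \<delta> * D v else 0)) / real n\<bar> <= g / real n" using 1 2 3 unfolding s_def[symmetric] by linarith
  qed
 qed
qed

lemma measurable_euler_step [measurable]:
 "(\<lambda>p. euler_step \<delta> b h (fst p) (snd p)) \<in> borel_measurable (borel \<Otimes>\<^sub>M borel)" unfolding euler_step_def by measurable

lemma euler_step_le: "0 <= h ==> 0 <= a ==> u <= a ==> euler_step \<delta> b h u z <= a + 1"
 using mult_nonneg_nonneg[OF \<delta>_nonneg, of h] by (auto simp: euler_step_def min_def)

lemma frozen_euler_nonneg: "0 <= x ==> 0 <= fst (frozen (euler_step \<delta> b h) \<kappa> a x \<zeta> i)"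
proof (induction i)
 case (Suc i)
 thus ?case by (simp add: case_prod_unfold Let_def euler_step_def)
qed simp

lemma frozen_fst_indep: "fst (frozen \<phi> \<kappa> a x \<zeta> i) = fst (frozen \<phi> \<kappa>' a x \<zeta> i)" by (induction i) (simp_all add: case_prod_unfold Let_def)

text \<open>Dynkin's inequality for the stopped chain: a pointwise lower bound \<open>l\<close> on
  the discounted one-step drift, on the range \<open>{0..a}\<close> where the chain moves, is summed
  over the steps.\<close>

lemma euler_chain_sum:
 fixes F \<kappa> l :: "real => real" and n :: nat
 assumes \<kappa>[measurable]: "\<kappa> \<in> borel_measurable borel" and F[measurable]: "F \<in> borel_measurable borel"
  and l[measurable]: "l \<in> borel_measurable borel"
  and x: "0 <= x" "x <= a" and \<kappa>01: "\<And>u. 0 <= \<kappa> u" "\<And>u. \<kappa> u <= 1"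
  and B: "\<forall>u\<le>a + 1. \<bar>F u\<bar> <= B" and B': "\<forall>u. 0 <= u \<and> u <= a --> \<bar>l u\<bar> <= B'"
  and le: "\<forall>u. 0 <= u \<and> u <= a -->
   l u <= \<kappa> u * step_mean n F u - F u"
 defines "V \<equiv> \<lambda>i w. fst (frozen (es n) \<kappa> a x (incs n w) i)"
  and "K \<equiv> \<lambda>i w. snd (frozen (es n) \<kappa> a x (incs n w) i)"
 shows "integrable M (\<lambda>w. K N w * F (V N w))"
  and "integrable M (\<lambda>w. indicator {..a} (V i w) * K i w * l (V i w))"
  and "F x + (\<Sum>i<N. (EE w. indicator {..a} (V i w) * K i w * l (V i w))) <=
   (EE w. K N w * F (V N w))"
proof -
 have \<phi>: "\<forall>u z. u <= a --> es n u z <= a + 1" using x euler_step_le[of "1 / real n" a] by auto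
 have x': "x <= a + 1" using x by simp
 have VK: "fst (frozen (es n) \<kappa> a x (incs n w) i) = V i w"
  "snd (frozen (es n) \<kappa> a x (incs n w) i) = K i w" for i w by (simp_all add: V_def K_def)
 note inc = frozen_increment[where \<phi>="es n" and \<kappa>=\<kappa> and F=F and n=n and x=x and a=a and B=B,
  OF measurable_euler_step \<kappa> F \<phi> x' \<kappa>01 B, unfolded VK]
 have bd: "0 <= K i w" "K i w <= 1" for i w unfolding K_def using frozen_bounds[OF \<phi> x', of \<kappa>] \<kappa>01 by auto
 have V0: "0 <= V i w" for i w unfolding V_def by (rule frozen_euler_nonneg[OF x(1)])
 have S[measurable]: "(\<lambda>w. frozen (es n) \<kappa> a x (incs n w) i) \<in> M \<rightarrow>\<^sub>M borel \<Otimes>\<^sub>M borel" for i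
  by (rule measurable_frozen) measurable
 have [measurable]: "V i \<in> borel_measurable M" "K i \<in> borel_measurable M" for i unfolding V_def K_def by measurable
 have B'0: "0 <= B'" using B'[rule_format, of a] x by auto
 show i2: "integrable M (\<lambda>w. indicator {..a} (V i w) * K i w * l (V i w))" for i
 proof (rule integrable_const_bound[where B=B'], rule AE_I2)
  fix w
  show "norm (indicator {..a} (V i w) * K i w * l (V i w)) <= B'"
  proof (cases "V i w <= a")
   case True
   hence "\<bar>l (V i w)\<bar> <= B'" using B' V0[of i w] by auto
   thus ?thesis using True bd[of i w] B'0 mult_mono[of "K i w" 1 "\<bar>l (V i w)\<bar>" B'] by (simp add: abs_mult)
  qed (use B'0 in simp)
 qed measurable
 show "integrable M (\<lambda>w. K N w * F (V N w))" by (rule inc(1))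
 show "F x + (\<Sum>i<N. (EE w. indicator {..a} (V i w) * K i w * l (V i w))) <=
   (EE w. K N w * F (V N w))"
 proof (induction N)
  case 0
  thus ?case by (simp add: K_def V_def prob_space)
 next
  case (Suc N)
  have "(EE w. indicator {..a} (V N w) * K N w * l (V N w)) <=
   (EE w. indicator {..a} (V N w) * K N w *
    (\<kappa> (V N w) * step_mean n F (V N w) - F (V N w)))"
  proof (rule integral_mono[OF i2 inc(2)])
   fix w
   show "indicator {..a} (V N w) * K N w * l (V N w) <= indicator {..a} (V N w) * K N w *
    (\<kappa> (V N w) * step_mean n F (V N w) - F (V N w))"
    using le V0[of N w] bd(1)[of N w] by (cases "V N w <= a") (auto intro: mult_left_mono)
  qed
  thus ?case using Suc inc(3)[of N] by simp
 qed
qed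

end

lemma continuous_bound:
 fixes f :: "real => real"
 assumes "continuous_on UNIV f"
 obtains B where "0 <= B" "\<forall>u. c <= u \<and> u <= d --> \<bar>f u\<bar> <= B"
proof -
 have "bounded (f ` {c..d})" using assms by (intro compact_imp_bounded compact_continuous_image) (auto intro: continuous_on_subset)
 then obtain B where B: "0 < B" "\<forall>y\<in>f ` {c..d}. norm y <= B" unfolding bounded_pos by blast
 hence "\<forall>u. c <= u \<and> u <= d --> \<bar>f u\<bar> <= B" by auto
 thus ?thesis using that[of B] B(1) by simp
qed

lemma primitive_mono_bounds:
 assumes "causal f" "mono f" "x <= x'"
 shows "f x * (x' - x) <= primitive f x' - primitive f x" "primitive f x' - primitive f x <= f x' * (x' - x)"
proof -
 \<comment> \<open>A monotone function deviates from the mean of its end values by at most half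
   their difference.\<close>
 have "\<forall>y. x < y \<and> y <= x' --> \<bar>f y - (f x + f x') / 2\<bar> <= (f x' - f x) / 2"
 proof (intro allI impI)
  fix y assume "x < y \<and> y <= x'"
  hence "f x <= f y" "f y <= f x'" using monoD[OF assms(2)] by auto
  thus "\<bar>f y - (f x + f x') / 2\<bar> <= (f x' - f x) / 2" unfolding abs_le_iff by (simp add: field_simps)
 qed
 from primitive_diff_const[OF assms(1,3) this]
 have *: "\<bar>primitive f x' - primitive f x - (f x + f x') / 2 * (x' - x)\<bar> <= (f x' - f x) / 2 * (x' - x)" .
 have "L - r <= d \<and> d <= L + r" if "\<bar>d - L\<bar> <= r" for d L r :: real using that by auto
 from this[OF *] have "(f x + f x') / 2 * (x' - x) - (f x' - f x) / 2 * (x' - x) <= primitive f x' - primitive f x"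
  "primitive f x' - primitive f x <= (f x + f x') / 2 * (x' - x) + (f x' - f x) / 2 * (x' - x)" by auto
 moreover have "(f x + f x') / 2 * (x' - x) - (f x' - f x) / 2 * (x' - x) = f x * (x' - x)"
  "(f x + f x') / 2 * (x' - x) + (f x' - f x) / 2 * (x' - x) = f x' * (x' - x)" by (simp_all add: field_simps)
 ultimately show "f x * (x' - x) <= primitive f x' - primitive f x" "primitive f x' - primitive f x <= f x' * (x' - x)" by (simp_all only:)
qed

lemma primitive_linear:
 assumes "causal f" "causal g"
 shows "primitive (\<lambda>x. c * f x + d * g x) x = c * primitive f x + d * primitive g x"
proof -
 have i: "integrable lborel (\<lambda>y. step 0 (x - y) * f y)" "integrable lborel (\<lambda>y. step 0 (x - y) * g y)"
  by (intro conv_integrable causal_step assms order_refl)+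
 have "primitive (\<lambda>x. c * f x + d * g x) x = (LINT y|lborel. c * (step 0 (x - y) * f y) + d * (step 0 (x - y) * g y))"
  unfolding conv_def by (simp add: algebra_simps)
 also have "\<dots> = c * primitive f x + d * primitive g x" unfolding conv_def using i by simp
 finally show ?thesis .
qed

lemma primitive_step: "primitive (step 0) x = max 0 x" unfolding primitive_set[OF causal_step[OF order_refl]] set_lebesgue_integral_def
proof -
 have "(LINT y|lborel. indicator {0..x} y *\<^sub>R step 0 y) = (LINT y|lborel. indicator {0..x} y)"
  by (intro Bochner_Integration.integral_cong) (auto simp: indicator_def)
 also have "\<dots> = max 0 x" by (auto simp: max_def measure_def emeasure_lborel_Icc_eq)
 finally show "(LINT y|lborel. indicator {0..x} y *\<^sub>R step 0 y) = max 0 x" .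
qed

lemma frozen_snd_one: "snd (frozen \<phi> (\<lambda>_. 1) a x \<zeta> i) = 1" by (induction i) (simp_all add: case_prod_unfold Let_def)

section \<open>Exit time, overshoot and time spent near a level\<close>

context refracted_scale
begin

definition cV :: "nat => real => real => nat => 'w => real" where
 "cV n a x i w = fst (frozen (es n) (\<lambda>_. 1) a x (incs n w) i)"

lemma measurable_cV [measurable]: "cV n a x i \<in> borel_measurable M"
proof -
 have "(\<lambda>w. frozen (es n) (\<lambda>_. 1) a x (incs n w) i) \<in> M \<rightarrow>\<^sub>M borel \<Otimes>\<^sub>M borel" by (rule measurable_frozen) measurable
 from measurable_compose[OF this measurable_fst] show ?thesis by (simp add: cV_def[abs_def])
qed

lemma cV_bounds: "0 <= x ==> x <= a ==> 0 <= cV n a x i w \<and> cV n a x i w <= a + 1" unfolding cV_def using frozen_euler_nonneg[of x]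
  frozen_bounds(1)[of a "es n" x "\<lambda>_. 1" "incs n w" i] euler_step_le[of "1 / real n" a] by auto

text \<open>Reflection moves the chain upwards and can only increase a nondecreasing
  \<open>F\<close>. So the expansion without reflection is a lower bound, and the slack
  \<open>e\<close> covers its error.\<close>

lemma euler_mono_sum:
 assumes F: "smooth_pair F G D" "mono F" and "0 < e" and x: "0 <= x" "x <= a"
  and l: "\<forall>u. 0 <= u \<and> u <= a --> l u + e <= G u - (if b < u then \<delta> * D u else 0)" "l \<in> borel_measurable borel"
   "\<forall>u. 0 <= u \<and> u <= a --> \<bar>l u\<bar> <= B"
 shows "EV n. \<forall>N. F x + (\<Sum>i<N. (EE w. indicator {..a} (cV n a x i w) * l (cV n a x i w))) / real n
  <= (EE w. F (cV n a x N w))" using euler_drift[OF F(1) `0 < e`, of a] eventually_gt_at_top[of 0]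
proof eventually_elim
 case (elim n)
 note Fp = smooth_pairD[OF F(1)]
 obtain BF where BF: "0 <= BF" "\<forall>u\<le>a + 1. \<bar>F u\<bar> <= BF" by (rule exp_bounded_le[OF Fp(3)])
 have mF[measurable]: "F \<in> borel_measurable borel" using Fp(2) by (rule borel_measurable_continuous_onI)
 have ml: "(\<lambda>u. l u / real n) \<in> borel_measurable borel" using l(2) by measurable
 have lB: "\<forall>u. 0 <= u \<and> u <= a --> \<bar>l u / real n\<bar> <= B / real n" using l(3) by (auto simp: abs_divide intro: divide_right_mono)
 have le: "\<forall>u. 0 <= u \<and> u <= a -->
   l u / real n <= (\<lambda>_. 1) u * step_mean n F u - F u"
 proof (intro allI impI)
  fix u assume u: "0 <= u \<and> u <= a"
  define s where "s = (if b < u then \<delta> * (1 / real n) else 0)"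
  have s: "0 <= s" using \<delta>_nonneg by (simp add: s_def)
  have "(EE w. F (u - s + min (X (1 / real n) w) 1)) <= step_mean n F u"
  proof (rule integral_mono)
   show "integrable M (\<lambda>w. F (u - s + min (X (1 / real n) w) 1))" by (rule one_step_integrable[OF Fp(2,3)])
   show "integrable M (\<lambda>w. F (es n u (X (1 / real n) w)))"
   proof (rule integrable_const_bound[where B=BF])
    show "AE w in M. norm (F (es n u (X (1 / real n) w))) <= BF" using BF(2) euler_step_le[of "1 / real n" a u] u by auto
    show "(\<lambda>w. F (es n u (X (1 / real n) w))) \<in> borel_measurable M" unfolding euler_step_def by measurable
   qed
   show "F (u - s + min (X (1 / real n) w) 1) <= F (es n u (X (1 / real n) w))" for w
    by (rule monoD[OF F(2)]) (simp add: euler_step_def s_def)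
  qed
  moreover have "\<bar>(EE w. F (u - s + min (X (1 / real n) w) 1)) - F u - (G u - (if b < u then \<delta> * D u else 0)) / real n\<bar> <= e / real n"
   using elim(1) u unfolding s_def by auto
  moreover have "(l u + e) / real n <= (G u - (if b < u then \<delta> * D u else 0)) / real n" using l(1) u by (intro divide_right_mono) auto
  ultimately show "l u / real n <= (\<lambda>_. 1) u * step_mean n F u - F u"
   unfolding add_divide_distrib by linarith
 qed
 have k: "(\<lambda>_. 1) \<in> borel_measurable (borel :: real measure)" "\<And>u::real. (0::real) <= (\<lambda>_. 1) u" "\<And>u::real. (\<lambda>_. 1) u <= (1::real)" by auto
 show ?case
 proof
  fix N
  show "F x + (\<Sum>i<N. (EE w. indicator {..a} (cV n a x i w) * l (cV n a x i w))) / real n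
   <= (EE w. F (cV n a x N w))" using euler_chain_sum(3)[OF k(1) mF ml x k(2,3) BF(2) lB le, of N]
   by (simp add: frozen_snd_one cV_def[symmetric] sum_divide_distrib)
 qed
qed

lemma alive_indicator: "i <= N ==> cV n a x N w <= a ==> cV n a x i w <= a"
 using frozen_alive[of "es n" a x "incs n w" _ "\<lambda>_. 1"] unfolding cV_def alive_def by auto

text \<open>If \<open>1 < \<psi> l - \<delta> * l\<close>, the mean of \<open>exp (l * u)\<close>
  gains at least 1/2 per unit of running time, while the function stays below
  \<open>exp (l * (a + 2))\<close>. This bounds the mean running time by \<open>C\<close>, so the
  chain is still running at time \<open>m\<close> with probability at most
  \<open>C / real m\<close>.\<close>

lemma exit_bound:
 assumes x: "0 <= x" "x <= a"
 obtains C where "0 <= C" "\<forall>m>0. EV n.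
  (EE w. indicator {..a + 1 / real m} (cV n (a + 1 / real m) x (m * n) w)) <= C / real m"
proof -
 have "\<exists>l>0. 1 < \<psi> l - \<delta> * l" using eventually_happens'[OF _ eventually_conj[OF eventually_gt_at_top[of 0] \<psi>_drift_eventually[of 1]]] by auto
 then obtain l where l: "0 < l" "1 < \<psi> l - \<delta> * l" by blast
 define C where "C = 2 * exp (l * (a + 2))"
 show ?thesis
 proof (rule that[of C], goal_cases)
  case 2
  show ?case
  proof (intro allI impI)
   fix m :: nat assume m: "0 < m"
   define am where "am = a + 1 / real m"
   have am: "x <= am" "am <= a + 1" using m x add_mono[of x a 0 "1 / real m"] by (auto simp: am_def)
   have mono: "mono (\<lambda>x. exp (l * x))" using l by (auto intro!: monoI mult_left_mono)
   have L: "\<forall>u. 0 <= u \<and> u <= am --> (1/2::real) + 1/2 <= \<psi> l * exp (l * u) - (if b < u then \<delta> * (l * exp (l * u)) else 0)"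
   proof (intro allI impI)
    fix u assume u: "0 <= u \<and> u <= am"
    have "1 * 1 <= (\<psi> l - \<delta> * l) * exp (l * u)" using l u by (intro mult_mono) auto
    also have "\<dots> <= \<psi> l * exp (l * u) - (if b < u then \<delta> * (l * exp (l * u)) else 0)" using l \<delta>_nonneg by (simp add: algebra_simps)
    finally show "(1/2::real) + 1/2 <= \<psi> l * exp (l * u) - (if b < u then \<delta> * (l * exp (l * u)) else 0)" by simp
   qed
   have "EV n. \<forall>N. exp (l * x) + (\<Sum>i<N. (EE w. indicator {..am} (cV n am x i w) * (1/2))) / real n
    <= (EE w. exp (l * cV n am x N w))" by (rule euler_mono_sum[OF smooth_pair_exp mono _ x(1) am(1) L, where B=1]) (use l in auto)
   thus "EV n.
    (EE w. indicator {..a + 1 / real m} (cV n (a + 1 / real m) x (m * n) w)) <= C / real m"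
    unfolding am_def[symmetric] using eventually_gt_at_top[of 0]
   proof eventually_elim
    case (elim n)
    define P :: "nat => real" where "P i = (EE w. indicator {..am} (cV n am x i w))" for i
    have iP: "integrable M (\<lambda>w. indicator {..am} (cV n am x i w) :: real)" for i by (rule integrable_const_bound[where B=1]) auto
    have "P (m * n) <= P i" if "i < m * n" for i unfolding P_def
    proof (rule integral_mono[OF iP iP])
     fix w
     show "indicator {..am} (cV n am x (m * n) w) <= (indicator {..am} (cV n am x i w) :: real)"
      using alive_indicator[of i "m * n" n am x w] that by (auto simp: indicator_def)
    qed
    hence "(\<Sum>i<m * n. P (m * n)) <= (\<Sum>i<m * n. P i)" by (intro sum_mono) auto
    hence "real (m * n) * P (m * n) / 2 / real n <= (\<Sum>i<m * n. P i / 2) / real n"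
     by (intro divide_right_mono) (auto simp: sum_divide_distrib[symmetric])
    also have "\<dots> <= exp (l * x) + (\<Sum>i<m * n. P i / 2) / real n" by simp
    also have "\<dots> = exp (l * x) + (\<Sum>i<m * n. (EE w. indicator {..am} (cV n am x i w) * (1/2))) / real n" by (simp add: P_def)
    also have "\<dots> <= (EE w. exp (l * cV n am x (m * n) w))" using elim(1) by blast
    also have "\<dots> <= (EE w. exp (l * (a + 2)))"
    proof (rule integral_mono')
     show "exp (l * cV n am x (m * n) w) <= exp (l * (a + 2))" for w
      using cV_bounds[OF x(1) am(1), of n "m * n" w] am l by (intro iffD2[OF exp_le_cancel_iff] mult_left_mono) auto
    qed auto
    finally have "real m * P (m * n) <= C" using elim(2) by (simp add: C_def prob_space)
    thus ?case using m by (simp add: P_def le_divide_eq mult.commute)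
   qed
  qed
 qed (simp add: C_def)
qed

text \<open>An overshoot beyond \<eta> requires one of the \<open>m * n\<close> steps to exceed
  \<eta>, each with probability o(1/n). The union bound is expressed by
  \<open>euler_chain_sum\<close> for a negative indicator.\<close>

lemma overshoot_bound:
 fixes \<eta> e :: real
 assumes x: "0 <= x" "x <= a" and "0 < \<eta>" "0 < e"
 shows "EV n. (EE w. indicator {a + \<eta><..} (cV n a x (m * n) w)) <= e"
proof -
 have "(\<lambda>n. real m * (real n * (EE w. exp (0 * X (1 / real n) w) * indicator {\<eta><..} (X (1 / real n) w)))) \<longlonglongrightarrow> 0"
  by (rule tendsto_mult_right_zero[OF tail_o[OF order_refl `0 < \<eta>`]])
 hence "EV n. real m * (real n * (EE w. exp (0 * X (1 / real n) w) * indicator {\<eta><..} (X (1 / real n) w))) < e"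
  using `0 < e` by (rule order_tendstoD)
 thus ?thesis
 proof eventually_elim
  case (elim n)
  define pn :: real where "pn = (EE w. indicator {\<eta><..} (X (1 / real n) w))"
  have pn: "0 <= pn" unfolding pn_def by (intro Bochner_Integration.integral_nonneg) auto
  have ip: "integrable M (\<lambda>w. indicator {\<eta><..} (X (1 / real n) w) :: real)" by (rule integrable_const_bound[where B=1]) auto
  define F :: "real => real" where "F u = - indicator {a + \<eta><..} u" for u
  have mF: "F \<in> borel_measurable borel" unfolding F_def by measurable
  have BF: "\<forall>u\<le>a + 1. \<bar>F u\<bar> <= 1" by (auto simp: F_def indicator_def)
  have lB: "\<forall>u. 0 <= u \<and> u <= a --> \<bar>(\<lambda>_. - pn) u\<bar> <= pn" using pn by auto
  have k: "(\<lambda>_. 1) \<in> borel_measurable (borel :: real measure)" "\<And>u::real. (0::real) <= (\<lambda>_. 1) u" "\<And>u::real. (\<lambda>_. 1) u <= (1::real)" by auto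
  have le: "\<forall>u. 0 <= u \<and> u <= a -->
   (\<lambda>_. - pn) u <= (\<lambda>_. 1) u * step_mean n F u - F u"
  proof (intro allI impI)
   fix u assume u: "0 <= u \<and> u <= a"
   have "(EE w. - indicator {\<eta><..} (X (1 / real n) w)) <= step_mean n F u"
   proof (rule integral_mono)
    show "integrable M (\<lambda>w. - indicator {\<eta><..} (X (1 / real n) w) :: real)" using ip by simp
    show "integrable M (\<lambda>w. F (es n u (X (1 / real n) w)))"
    proof (rule integrable_const_bound[where B=1])
     show "(\<lambda>w. F (es n u (X (1 / real n) w))) \<in> borel_measurable M" unfolding euler_step_def F_def by measurable
    qed (auto simp: F_def indicator_def)
    fix w
    have "0 <= \<delta> * (1 / real n)" using \<delta>_nonneg by simp
    thus "- indicator {\<eta><..} (X (1 / real n) w) <= F (es n u (X (1 / real n) w))"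
     using u `0 < \<eta>` by (auto simp: F_def indicator_def euler_step_def min_def split: if_splits)
   qed
   moreover have "F u = 0" using u `0 < \<eta>` by (simp add: F_def)
   ultimately show "(\<lambda>_. - pn) u <= (\<lambda>_. 1) u * step_mean n F u - F u" by (simp add: pn_def)
  qed
  have "F x = 0" using x `0 < \<eta>` by (simp add: F_def)
  with euler_chain_sum(3)[OF k(1) mF _ x k(2,3) BF lB le, of "m * n"]
  have "(\<Sum>i<m * n. (EE w. indicator {..a} (cV n a x i w) * - pn)) <= - (EE w. indicator {a + \<eta><..} (cV n a x (m * n) w))"
   by (simp add: frozen_snd_one cV_def[symmetric] F_def)
  moreover have "- pn <= (EE w. indicator {..a} (cV n a x i w) * - pn)" for i
  proof -
   have "\<bar>(EE w. indicator {..a} (cV n a x i w) * - pn)\<bar> <= pn" by (rule abs_expectation_le) (use pn in "auto simp: indicator_def")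
   thus ?thesis by linarith
  qed
  hence "(\<Sum>i<m * n. - pn) <= (\<Sum>i<m * n. (EE w. indicator {..a} (cV n a x i w) * - pn))" by (intro sum_mono)
  moreover have "(\<Sum>i<m * n. - pn) = - (real m * (real n * pn))" by simp
  moreover have "real m * (real n * pn) < e" using elim by (simp add: pn_def)
  ultimately show ?case by linarith
 qed
qed

text \<open>For f = max 0 this is a trapezoidal bump around c.\<close>

definition ramp :: "real => (real => real) => real => real => real" where
 "ramp h f c u = (1 / h) * (1 * f (u + (2 * h - c)) + (- 1) * f (u + (h - c))) + (- (1 / h)) * (1 * f (u + (- h - c)) + (- 1) * f (u + (- 2 * h - c)))"

lemma ramp_eq: "ramp h f c u = (f (u - c + 2 * h) - f (u - c + h)) / h - (f (u - c - h) - f (u - c - 2 * h)) / h"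
proof -
 have e: "u + (2 * h - c) = u - c + 2 * h" "u + (h - c) = u - c + h" "u + (- h - c) = u - c - h" "u + (- 2 * h - c) = u - c - 2 * h" by simp_all
 show ?thesis unfolding ramp_def e by simp
qed

lemma ramp_linear: "ramp h (\<lambda>z. k * f z + k' * g z) c u = k * ramp h f c u + k' * ramp h g c u"
 unfolding ramp_eq diff_divide_distrib add_divide_distrib by (simp add: algebra_simps)

lemma ramp_positive_part:
 assumes "0 < h"
 shows "0 <= ramp h (max 0) c u" "\<bar>u - c\<bar> <= h ==> 1 <= ramp h (max 0) c u"
proof -
 have e: "h * ramp h (max 0) c u = (max 0 (u - c + 2 * h) - max 0 (u - c + h)) - (max 0 (u - c - h) - max 0 (u - c - 2 * h))"
  using assms unfolding ramp_eq right_diff_distrib by simp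
 have "0 <= h * ramp h (max 0) c u" using assms unfolding e by (simp add: max_def)
 thus "0 <= ramp h (max 0) c u" using assms by (simp add: zero_le_mult_iff)
 assume "\<bar>u - c\<bar> <= h"
 hence "h <= h * ramp h (max 0) c u" using assms unfolding e by (auto simp: max_def abs_le_iff)
 thus "1 <= ramp h (max 0) c u" using assms by simp
qed

text \<open>The two difference quotients are means of \<open>f\<close> over intervals of length
  \<open>h\<close> on either side of the window around \<open>c\<close>; monotonicity compares them
  with the values of \<open>f\<close> at the ends.\<close>

lemma ramp_primitive_bounds:
 assumes f: "causal f" "mono f" and "0 < h"
 shows "0 <= ramp h (primitive f) c u" "ramp h (primitive f) c u <= f (u - c + 2 * h) - f (u - c - 2 * h)"
proof -
 have a: "f (u - c + h) * h <= primitive f (u - c + 2 * h) - primitive f (u - c + h)"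
  "primitive f (u - c + 2 * h) - primitive f (u - c + h) <= f (u - c + 2 * h) * h"
  "f (u - c - 2 * h) * h <= primitive f (u - c - h) - primitive f (u - c - 2 * h)"
  "primitive f (u - c - h) - primitive f (u - c - 2 * h) <= f (u - c - h) * h"
  using primitive_mono_bounds[OF f, of "u - c + h" "u - c + 2 * h"] primitive_mono_bounds[OF f, of "u - c - 2 * h" "u - c - h"] `0 < h`
  by (auto simp: algebra_simps)
 hence d: "f (u - c + h) <= (primitive f (u - c + 2 * h) - primitive f (u - c + h)) / h"
  "(primitive f (u - c + 2 * h) - primitive f (u - c + h)) / h <= f (u - c + 2 * h)"
  "f (u - c - 2 * h) <= (primitive f (u - c - h) - primitive f (u - c - 2 * h)) / h"
  "(primitive f (u - c - h) - primitive f (u - c - 2 * h)) / h <= f (u - c - h)" using `0 < h` by (simp_all only: pos_le_divide_eq pos_divide_le_eq)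
 have "f (u - c - h) <= f (u - c + h)" using monoD[OF f(2)] `0 < h` by simp
 thus "0 <= ramp h (primitive f) c u" "ramp h (primitive f) c u <= f (u - c + 2 * h) - f (u - c - 2 * h)" unfolding ramp_eq using d by linarith+
qed

lemma smooth_pair_ramp:
 assumes "smooth_pair F G D"
 shows "smooth_pair (ramp h F c) (ramp h G c) (ramp h D c)" unfolding ramp_def by (intro smooth_pair_linear smooth_pair_shift assms)

text \<open>The second primitive of \<open>W 0\<close> has a transform with
  \<open>\<psi> l * l * l\<close> in the denominator, so the generator maps it to the positive part.
  Its ramp \<open>F\<close> is nonnegative, nondecreasing and of order \<open>h\<close>, while the
  image \<open>G\<close> is a bump of height at least 1 on the window. The refraction drift costs
  \<open>\<delta> * D u\<close>, where \<open>D\<close> is the ramp of \<open>primitive w\<close>: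
  the jump \<open>w0\<close> of \<open>w\<close> at 0 gives \<open>w0 * G u\<close>, the continuous
  remainder \<open>r\<close> at most \<open>e\<close>. What is left is
  \<open>\<Lambda> * G u\<close> up to small errors, with \<Lambda> > 0.\<close>

lemma occupation_small:
 assumes x: "0 <= x" "x <= a" and \<eta>: "0 < \<eta>"
 obtains h where "0 < h" "EV n.
  (\<Sum>i<m * n. (EE \<omega>. indicator {..a} (cV n a x i \<omega>) * indicator {c - h..c + h} (cV n a x i \<omega>))) / real n <= \<eta>"
proof -
 define w where "w = W 0"
 define w0 where "w0 = w 0"
 define r where "r z = 1 * w z + (- w0) * step 0 z" for z
 have w: "causal w" "mono w" "has_LT w (\<lambda>j. 1 / (\<psi> j - 0))" unfolding w_def using W_facts[OF order_refl] by auto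
 have w0: "0 <= w0" using monoD[OF w(2), of "-1" 0] causalD(3)[OF w(1), of "-1"] by (simp add: w0_def)
 define \<Lambda> where "\<Lambda> = 1 - \<delta> * w0"
 have \<Lambda>: "0 < \<Lambda>" using \<delta>_W_0 by (simp add: \<Lambda>_def w0_def w_def)
 have r_eq: "r z = w (max 0 z) - w0" for z using causalD(3)[OF w(1), of z] by (auto simp: r_def w0_def max_def)
 have r: "causal r" unfolding r_def by (intro causal_linear w causal_step order_refl)
 have r_mono: "mono r" unfolding r_eq by (intro monoI diff_right_mono monoD[OF w(2)]) auto
 have r_cont: "continuous_on UNIV r"
 proof -
  have "continuous_on {0..} w" using W_scale[OF order_refl] by (simp add: is_scale_function_def w_def)
  hence "continuous_on UNIV (\<lambda>z. w (max 0 z))" by (rule continuous_on_compose2) (auto intro!: continuous_intros)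
  thus ?thesis unfolding r_eq by (intro continuous_intros)
 qed
 have pw: "causal (primitive w)" "causal (primitive r)" using w r by (auto intro: causal_conv causal_step)
 have smooth: "smooth_pair (primitive (primitive w)) (max 0) (primitive w)" unfolding smooth_pair_def
 proof (intro conjI allI)
  have LT1: "has_LT (primitive w) (\<lambda>j. 1 / (\<psi> j - 0) / j)" by (rule has_LT_primitive[OF w(3) causalD(1)[OF w(1)]])
  have LT2: "has_LT (primitive (primitive w)) (\<lambda>j. 1 / (\<psi> j - 0) / j / j)" by (rule has_LT_primitive[OF LT1 causalD(1)[OF pw(1)]])
  have LT3: "has_LT (primitive (step 0)) (\<lambda>j. exp (- 0 * j) / j / j)" by (rule has_LT_primitive[OF has_LT_step]) simp
  have e: "primitive (step 0) = max 0" by (rule ext) (rule primitive_step)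
  have c: "causal (primitive (step 0))" by (intro causal_conv causal_step order_refl)
  have cc: "causal (primitive (primitive w))" using pw by (auto intro: causal_conv causal_step)
  show "one_step (primitive (primitive w)) (max 0)" unfolding e[symmetric]
  proof (rule one_step_dynkin[OF primitive_continuous[OF pw(1)] causalD(2)[OF cc] LT2 primitive_continuous[OF causal_step[OF order_refl]] causalD(2)[OF c] LT3])
   show "\<forall>\<^sub>F j in at_top. \<psi> j * (1 / (\<psi> j - 0) / j / j) = exp (- 0 * j) / j / j" using \<psi>_eventually[of 0] by eventually_elim simp
  qed
  show "continuous_on UNIV (primitive w)" by (rule primitive_continuous[OF w(1)])
  thus "(primitive (primitive w) has_real_derivative primitive w x) (at x)" for x by (rule primitive_deriv[OF pw(1)])
 qed
 have pw_mono: "mono (primitive w)"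
 proof (rule monoI)
  fix u v :: real assume "u <= v"
  have "0 <= w u" using causalD(3)[OF w(1), of "min u (-1)"] monoD[OF w(2), of "min u (-1)" u] by simp
  hence "0 <= w u * (v - u)" using `u <= v` by simp
  thus "primitive w u <= primitive w v" using primitive_mono_bounds(1)[OF w(1,2) `u <= v`] by linarith
 qed
 \<comment> \<open>Over the horizon the accumulated error
   \<open>real m * ((\<delta> + 1) * e)\<close> is at most a third of
   \<open>\<Lambda> * \<eta>\<close>; the bound on \<open>F\<close> takes another third.\<close>
 define e where "e = \<Lambda> * \<eta> / 3 / (real m + 1) / (\<delta> + 1)"
 have e: "0 < e" using \<Lambda> \<eta> \<delta>_nonneg unfolding e_def by (intro divide_pos_pos mult_pos_pos) auto
 have e1: "(real m + 1) * ((\<delta> + 1) * e) = \<Lambda> * \<eta> / 3"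
 proof -
  have nz: "real m + 1 \<noteq> 0" "\<delta> + 1 \<noteq> 0" using \<delta>_nonneg by auto
  have c: "k * (A / k) = A" if "k \<noteq> 0" for k A :: real using that by simp
  show ?thesis unfolding e_def c[OF nz(2)] c[OF nz(1)] ..
 qed
 have "uniformly_continuous_on {- c - 2..a - c + 2} r" using r_cont by (intro compact_uniformly_continuous) (auto intro: continuous_on_subset)
 then obtain d where d: "0 < d" "\<And>u u'. u \<in> {- c - 2..a - c + 2} ==> u' \<in> {- c - 2..a - c + 2} ==> dist u' u < d ==> dist (r u') (r u) < e"
  unfolding uniformly_continuous_on_def using e by metis
 obtain B where B: "0 <= B" "\<forall>z\<le>a - c + 3. \<bar>w z\<bar> <= B" by (rule causal_local_bound[OF w(1)])
 define Z where "Z = \<Lambda> * \<eta> / 3 / (4 * (B + 1))"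
 have Z: "0 < Z" unfolding Z_def using \<Lambda> \<eta> B(1) by (intro divide_pos_pos mult_pos_pos) auto
 \<comment> \<open>Below \<open>d / 4\<close>, since the two arguments of \<open>r\<close> in
   \<open>D_le\<close> differ by \<open>4 * h\<close>; below \<open>Z\<close>, to make
   \<open>F\<close> small.\<close>
 define h where "h = min 1 (min (d / 5) Z)"
 have h: "0 < h" "h <= 1" "h <= d / 5" "h <= \<Lambda> * \<eta> / 3 / (4 * (B + 1))" unfolding Z_def[symmetric] using d(1) Z unfolding h_def by linarith+
 define D where "D = ramp h (primitive w) c"
 define G where "G = ramp h (max 0) c"
 define F where "F = ramp h (primitive (primitive w)) c"
 have sp: "smooth_pair F G D" unfolding F_def G_def D_def by (rule smooth_pair_ramp[OF smooth])
 have D0: "0 <= D u" for u unfolding D_def by (rule ramp_primitive_bounds(1)[OF w(1,2) h(1)])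
 have F0: "0 <= F u" for u unfolding F_def by (rule ramp_primitive_bounds(1)[OF pw(1) pw_mono h(1)])
 have Fmono: "mono F" using smooth_pairD(6)[OF sp] D0 by (auto intro!: monoI intro: DERIV_nonneg_imp_nondecreasing)
 have F_le: "F u <= \<Lambda> * \<eta> / 3" if "u <= a + 1" for u
 proof -
  have "F u <= primitive w (u - c + 2 * h) - primitive w (u - c - 2 * h)" unfolding F_def by (rule ramp_primitive_bounds(2)[OF pw(1) pw_mono h(1)])
  also have "\<dots> <= B * ((u - c + 2 * h) - (u - c - 2 * h))" using primitive_lipschitz[OF w(1) B(2), of "u - c - 2 * h" "u - c + 2 * h"] h that by auto
  also have "\<dots> <= 4 * (B + 1) * h" using h(1) by (simp add: algebra_simps)
  also have "\<dots> <= \<Lambda> * \<eta> / 3"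
  proof -
   have "4 * (B + 1) * h <= 4 * (B + 1) * (\<Lambda> * \<eta> / 3 / (4 * (B + 1)))" using h(4) B(1) by (intro mult_left_mono) auto
   also have "\<dots> = \<Lambda> * \<eta> / 3" using B(1) by (subst nonzero_mult_div_cancel_left[symmetric, of "4 * (B + 1)"]) auto
   finally show ?thesis .
  qed
  finally show ?thesis .
 qed
 have D_le: "D u <= w0 * G u + e" if "0 <= u" "u <= a" for u
 proof -
  have "primitive r z = 1 * primitive w z + (- w0) * max 0 z" for z
   using primitive_linear[OF w(1) causal_step[OF order_refl], of 1 "- w0" z] unfolding r_def primitive_step .
  hence "primitive r = (\<lambda>z. 1 * primitive w z + (- w0) * max 0 z)" by blast
  hence "ramp h (primitive r) c u = D u - w0 * G u" using ramp_linear[of h 1 "primitive w" "- w0" "max 0" c u] by (simp add: D_def G_def)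
  moreover have "ramp h (primitive r) c u <= r (u - c + 2 * h) - r (u - c - 2 * h)" by (rule ramp_primitive_bounds(2)[OF r r_mono h(1)])
  moreover have "dist (r (u - c + 2 * h)) (r (u - c - 2 * h)) < e" using h that d(1) by (intro d(2)) (auto simp: dist_real_def)
  hence "r (u - c + 2 * h) - r (u - c - 2 * h) <= e" by (simp add: dist_real_def)
  ultimately show ?thesis by linarith
 qed
 define l where "l u = \<Lambda> * indicator {c - h..c + h} u - (\<delta> + 1) * e" for u
 have L: "\<forall>u. 0 <= u \<and> u <= a --> l u + e <= G u - (if b < u then \<delta> * D u else 0)"
 proof (intro allI impI)
  fix u assume u: "0 <= u \<and> u <= a"
  have "indicator {c - h..c + h} u <= G u"
  proof (cases "\<bar>u - c\<bar> <= h")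
   case True
   thus ?thesis unfolding G_def using ramp_positive_part(2)[OF h(1) True] by (auto simp: indicator_def)
  next
   case False
   hence "u \<notin> {c - h..c + h}" by (auto simp: abs_le_iff)
   thus ?thesis unfolding G_def using ramp_positive_part(1)[OF h(1)] by simp
  qed
  hence "\<Lambda> * indicator {c - h..c + h} u <= \<Lambda> * G u" using \<Lambda> by (intro mult_left_mono) auto
  also have "\<Lambda> * G u - \<delta> * e = G u - \<delta> * (w0 * G u + e)" by (simp add: \<Lambda>_def algebra_simps)
  hence "\<Lambda> * G u <= G u - \<delta> * D u + \<delta> * e" using mult_left_mono[OF D_le[of u] \<delta>_nonneg] u by linarith
  also have "\<dots> <= G u - (if b < u then \<delta> * D u else 0) + \<delta> * e" using mult_nonneg_nonneg[OF \<delta>_nonneg D0[of u]] by simp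
  finally show "l u + e <= G u - (if b < u then \<delta> * D u else 0)" by (simp add: l_def algebra_simps)
 qed
 have lm: "l \<in> borel_measurable borel" unfolding l_def by measurable
 have lB: "\<forall>u. 0 <= u \<and> u <= a --> \<bar>l u\<bar> <= \<Lambda> + (\<delta> + 1) * e"
  using \<Lambda> e \<delta>_nonneg mult_nonneg_nonneg[of "\<delta> + 1" e] by (auto simp: l_def indicator_def abs_le_iff)
 have "EV n. \<forall>N. F x + (\<Sum>i<N. (EE \<omega>. indicator {..a} (cV n a x i \<omega>) * l (cV n a x i \<omega>))) / real n
  <= (EE \<omega>. F (cV n a x N \<omega>))" by (rule euler_mono_sum[OF sp Fmono e x L lm lB])
 hence "EV n.
  (\<Sum>i<m * n. (EE \<omega>. indicator {..a} (cV n a x i \<omega>) * indicator {c - h..c + h} (cV n a x i \<omega>))) / real n <= \<eta>"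
  using eventually_gt_at_top[of 0]
 proof eventually_elim
  case (elim n)
  define O' :: "nat => real" where "O' i = (EE \<omega>. indicator {..a} (cV n a x i \<omega>) * indicator {c - h..c + h} (cV n a x i \<omega>))" for i
  have t: "\<Lambda> * O' i - (\<delta> + 1) * e <= (EE \<omega>. indicator {..a} (cV n a x i \<omega>) * l (cV n a x i \<omega>))" for i
  proof -
   have i1: "integrable M (\<lambda>\<omega>. indicator {..a} (cV n a x i \<omega>) * indicator {c - h..c + h} (cV n a x i \<omega>) :: real)"
    by (rule integrable_const_bound[where B=1]) (auto simp: indicator_def)
   have i2: "integrable M (\<lambda>\<omega>. indicator {..a} (cV n a x i \<omega>) * ((\<delta> + 1) * e))"
    by (rule integrable_const_bound[where B="\<bar>(\<delta> + 1) * e\<bar>"]) (auto simp: indicator_def)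
   have "(EE \<omega>. indicator {..a} (cV n a x i \<omega>) * l (cV n a x i \<omega>)) =
    (EE \<omega>. \<Lambda> * (indicator {..a} (cV n a x i \<omega>) * indicator {c - h..c + h} (cV n a x i \<omega>)) - indicator {..a} (cV n a x i \<omega>) * ((\<delta> + 1) * e))"
    by (intro Bochner_Integration.integral_cong) (auto simp: l_def indicator_def)
   also have "\<dots> = \<Lambda> * O' i - (EE \<omega>. indicator {..a} (cV n a x i \<omega>) * ((\<delta> + 1) * e))"
    unfolding O'_def using i1 i2 by (subst Bochner_Integration.integral_diff) auto
   finally have eq: "(EE \<omega>. indicator {..a} (cV n a x i \<omega>) * l (cV n a x i \<omega>)) =
    \<Lambda> * O' i - (EE \<omega>. indicator {..a} (cV n a x i \<omega>) * ((\<delta> + 1) * e))" .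
   have "(EE \<omega>. indicator {..a} (cV n a x i \<omega>) * ((\<delta> + 1) * e)) <= (\<delta> + 1) * e"
   proof -
    have "\<bar>(EE \<omega>. indicator {..a} (cV n a x i \<omega>) * ((\<delta> + 1) * e))\<bar> <= (\<delta> + 1) * e"
     by (rule abs_expectation_le) (use e \<delta>_nonneg in "auto simp: indicator_def")
    thus ?thesis by linarith
   qed
   thus ?thesis unfolding eq by linarith
  qed
  have "(\<Sum>i<m * n. \<Lambda> * O' i - (\<delta> + 1) * e) / real n <= (\<Sum>i<m * n. (EE \<omega>. indicator {..a} (cV n a x i \<omega>) * l (cV n a x i \<omega>))) / real n"
   by (intro divide_right_mono sum_mono t) auto
  also have "\<dots> <= F x + (\<Sum>i<m * n. (EE \<omega>. indicator {..a} (cV n a x i \<omega>) * l (cV n a x i \<omega>))) / real n" using F0[of x] by simp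
  also have "\<dots> <= (EE \<omega>. F (cV n a x (m * n) \<omega>))" using elim(1) by blast
  also have "\<dots> <= \<Lambda> * \<eta> / 3"
  proof -
   have "\<bar>(EE \<omega>. F (cV n a x (m * n) \<omega>))\<bar> <= \<Lambda> * \<eta> / 3" by (rule abs_expectation_le) (use F0 F_le cV_bounds[OF x] in auto)
   thus ?thesis by linarith
  qed
  also have "(\<Sum>i<m * n. \<Lambda> * O' i - (\<delta> + 1) * e) / real n = \<Lambda> * ((\<Sum>i<m * n. O' i) / real n) - real m * ((\<delta> + 1) * e)"
   using elim(2) by (simp add: sum_subtractf sum_distrib_left diff_divide_distrib)
  finally have "\<Lambda> * ((\<Sum>i<m * n. O' i) / real n) <= \<Lambda> * \<eta> / 3 + real m * ((\<delta> + 1) * e)" by linarith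
  also have "\<dots> <= \<Lambda> * \<eta> / 3 + (real m + 1) * ((\<delta> + 1) * e)" using e \<delta>_nonneg by (intro add_left_mono mult_right_mono) auto
  also have "\<dots> <= \<Lambda> * \<eta>" unfolding e1 using mult_pos_pos[OF \<Lambda> \<eta>] by simp
  finally have "(\<Sum>i<m * n. O' i) / real n <= \<eta>" using \<Lambda> by (simp only: mult_le_cancel_left_pos)
  thus ?case by (simp only: O'_def)
 qed
 with h(1) show ?thesis by (rule that)
qed

end

lemma primitive_diff_affine:
 assumes f: "causal f" and g: "causal g" and "x <= x'" and eq: "\<forall>y. x < y \<and> y <= x' --> f y = c + d * g y"
 shows "primitive f x' - primitive f x = c * (x' - x) + d * (primitive g x' - primitive g x)"
proof -
 define k where "k y = 1 * f y + (- d) * g y" for y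
 have k: "causal k" unfolding k_def by (intro causal_linear f g)
 have p: "primitive k z = primitive f z - d * primitive g z" for z using primitive_linear[OF f g, of 1 "- d" z] unfolding k_def by simp
 have "\<forall>y. x < y \<and> y <= x' --> \<bar>k y - c\<bar> <= 0" using eq by (simp add: k_def)
 from primitive_diff_const[OF k `x <= x'` this] have "primitive k x' - primitive k x = c * (x' - x)" by simp
 thus ?thesis unfolding p by (simp add: algebra_simps)
qed

context refracted_scale
begin

subsection \<open>The mollified function R along the chain\<close>

definition rate :: "real => real" where
 "rate u = p + q * indicator {..<b} u"

lemma rate_bounds: "0 <= rate u" "rate u <= p + \<bar>q\<bar>" using p_nonneg q_ge by (auto simp: rate_def indicator_def)

definition discount :: "nat => real => real" where
 "discount n u = exp (- (rate u / real n))"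

lemma discount_bounds: "0 <= discount n u" "discount n u <= 1" using rate_bounds(1)[of u] by (auto simp: discount_def)

lemma measurable_discount [measurable]: "discount n \<in> borel_measurable borel" unfolding discount_def rate_def by measurable

text \<open>The assumption \<open>refl\<close> makes the reflection invisible to \<open>F\<close>.
  The discount contributes \<open>- rate u * F u / real n\<close>; the quadratic remainder of the
  exponential and its product with the drift are of order 1/n^2.\<close>

lemma discounted_step:
 assumes F: "smooth_pair F G D" and refl: "\<And>z. F (max 0 z) = F z" and "0 < h"
 shows "EV n. \<forall>u\<in>{0..a}.
  \<bar>discount n u * step_mean n F u - F u
   - (G u - (if b < u then \<delta> * D u else 0) - rate u * F u) / real n\<bar> <= h / real n"
proof -
 obtain BF where BF: "0 <= BF" "\<forall>u. 0 <= u \<and> u <= a --> \<bar>F u\<bar> <= BF" by (rule continuous_bound[OF smooth_pairD(2)[OF F]])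
 obtain BG where BG: "0 <= BG" "\<forall>u. 0 <= u \<and> u <= a --> \<bar>G u\<bar> <= BG" by (rule continuous_bound[OF smooth_pairD(4)[OF F]])
 obtain BD where BD: "0 <= BD" "\<forall>u. 0 <= u \<and> u <= a --> \<bar>D u\<bar> <= BD" by (rule continuous_bound[OF smooth_pairD(5)[OF F]])
 define r0 where "r0 = p + \<bar>q\<bar>"
 define Bg where "Bg = BG + \<delta> * BD"
 have r0: "0 <= r0" "0 <= Bg" using p_nonneg BG(1) BD(1) \<delta>_nonneg by (auto simp: r0_def Bg_def)
 have "0 < h / 2" using `0 < h` by simp
 have "(\<lambda>n. (r0\<^sup>2 * BF + r0 * Bg) * (1 / real n)) \<longlonglongrightarrow> 0" by (rule tendsto_mult_right_zero[OF lim_1_over_n])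
 hence "EV n. (r0\<^sup>2 * BF + r0 * Bg) * (1 / real n) < h / 2" using `0 < h / 2` by (rule order_tendstoD)
 thus ?thesis using euler_drift[OF F `0 < h / 2`, of a] eventually_gt_at_top[of 0]
 proof eventually_elim
  case (elim n)
  show ?case
  proof
   fix u assume u: "u \<in> {0..a}"
   define g where "g = G u - (if b < u then \<delta> * D u else 0)"
   define k where "k = discount n u"
   define Q where "Q = step_mean n F u"
   have "Q = (EE w. F (u - (if b < u then \<delta> * (1 / real n) else 0) + min (X (1 / real n) w) 1))"
    unfolding Q_def euler_step_def refl by (simp add: algebra_simps)
   hence T: "\<bar>Q - F u - g / real n\<bar> <= h / 2 / real n" using elim(2) u unfolding g_def by simp
   have Fu: "\<bar>F u\<bar> <= BF" using BF u by simp
   have "\<bar>\<delta> * D u\<bar> <= \<delta> * BD" using BD u \<delta>_nonneg by (auto simp: abs_mult intro: mult_left_mono)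
   moreover have "\<bar>G u\<bar> <= BG" using BG u by simp
   ultimately have gu: "\<bar>g\<bar> <= Bg" using mult_nonneg_nonneg[OF \<delta>_nonneg BD(1)] unfolding g_def Bg_def by (cases "b < u") auto
   define v where "v = rate u / real n"
   have v: "0 <= v" "v <= r0 / real n" using rate_bounds[of u] by (auto simp: v_def r0_def intro: divide_right_mono)
   have "k <= 1 - v + v\<^sup>2" "1 - v <= k" using exp_minus_le_quadratic[OF v(1)] exp_ge_add_one_self[of "- v"] by (auto simp: k_def discount_def v_def)
   hence k1: "\<bar>k - 1 + v\<bar> <= v\<^sup>2" by (simp add: abs_le_iff)
   have k2: "\<bar>k - 1\<bar> <= v" using `1 - v <= k` discount_bounds(2)[of n u] by (simp add: k_def abs_le_iff)
   have e: "k * Q - F u - (g - rate u * F u) / real n = k * (Q - F u - g / real n) + (k - 1 + v) * F u + (k - 1) * (g / real n)"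
    by (simp add: v_def algebra_simps diff_divide_distrib)
   have "\<bar>k * (Q - F u - g / real n)\<bar> <= 1 * (h / 2 / real n)" using T discount_bounds[of n u] unfolding k_def abs_mult by (intro mult_mono) auto
   moreover have "\<bar>(k - 1 + v) * F u\<bar> <= (r0 / real n)\<^sup>2 * BF"
   proof -
    have "\<bar>(k - 1 + v) * F u\<bar> <= v\<^sup>2 * BF" unfolding abs_mult using k1 Fu by (intro mult_mono) auto
    also have "\<dots> <= (r0 / real n)\<^sup>2 * BF" using v BF(1) by (intro mult_right_mono power_mono) auto
    finally show ?thesis .
   qed
   moreover have "\<bar>(k - 1) * (g / real n)\<bar> <= r0 / real n * (Bg / real n)"
   proof -
    have "\<bar>(k - 1) * (g / real n)\<bar> <= v * (Bg / real n)"
     unfolding abs_mult using k2 gu v by (intro mult_mono) (auto simp: abs_divide intro: divide_right_mono)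
    also have "\<dots> <= r0 / real n * (Bg / real n)" using v r0 by (intro mult_right_mono) auto
    finally show ?thesis .
   qed
   moreover have "\<bar>t1 + t2 + t3\<bar> <= y1 + y2 + y3" if "\<bar>t1\<bar> <= 1 * y1" "\<bar>t2\<bar> <= y2" "\<bar>t3\<bar> <= y3" for t1 t2 t3 y1 y2 y3 :: real using that by linarith
   ultimately have "\<bar>k * Q - F u - (g - rate u * F u) / real n\<bar> <= h / 2 / real n + (r0 / real n)\<^sup>2 * BF + r0 / real n * (Bg / real n)"
    unfolding e by blast
   also have "\<dots> = (h / 2 + (r0\<^sup>2 * BF + r0 * Bg) * (1 / real n)) / real n" using elim(3) by (simp add: field_simps power2_eq_square)
   also have "\<dots> <= h / real n"
   proof -
    have "h / 2 + y <= h" if "y < h / 2" for y using that by linarith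
    from this[OF elim(1)] show ?thesis by (rule divide_right_mono) simp
   qed
   finally show "\<bar>discount n u * step_mean n F u - F u
    - (G u - (if b < u then \<delta> * D u else 0) - rate u * F u) / real n\<bar> <= h / real n" unfolding k_def Q_def g_def .
  qed
 qed
qed

definition moll :: "real => (real => real) => real => real" where
 "moll h f x = (1 / h) * f x + (- (1 / h)) * f (x + (- h))"

lemma moll_eq: "moll h f x = (f x - f (x - h)) / h" by (simp add: moll_def diff_divide_distrib)

text \<open>Only the causal part is mollified, and by a backward difference; so the function is
  constantly 1 on the negative half-line, which gives the invariance under reflection used in
  \<open>discounted_step\<close>.\<close>

definition mR :: "real => real => real" where
 "mR h x = 1 * moll h (primitive Rh) x + 1 * 1"

lemma smooth_pair_mR: "smooth_pair (mR h) (\<lambda>x. 1 * moll h RQ x + 1 * 0) (\<lambda>x. 1 * moll h Rh x + 1 * 0)"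
proof -
 have 1: "smooth_pair (primitive Rh) RQ Rh"
  unfolding smooth_pair_def using one_step_R Rh_continuous primitive_deriv[OF causal_parts(6) Rh_continuous] by blast
 note 2 = smooth_pair_linear[OF 1 smooth_pair_shift[OF 1, of "- h"], of "1 / h" "- (1 / h)"]
 from smooth_pair_linear[OF 2 smooth_pair_const[of 1], of 1 1]
 show ?thesis unfolding mR_def[abs_def] moll_def .
qed

lemma mR_max: "0 < h ==> mR h (max 0 z) = mR h z" using primitive_nonpos[OF causal_parts(6)] by (cases "z <= 0") (auto simp: mR_def moll_eq max_def)

text \<open>The coefficient of 1/n in the discounted one-step expansion of \<open>mR h\<close>, that
  is, the discounted generator of V applied to it.\<close>

definition mL :: "real => real => real" where
 "mL h u = moll h RQ u - (if b < u then \<delta> * moll h Rh u else 0) - rate u * mR h u"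

text \<open>The window from \<open>u - h\<close> to \<open>u\<close> has neither 0 nor
  \<open>b\<close> in its interior. On it the killing term is a fixed multiple of \<open>R\<close>,
  and the increment of \<open>Re\<close> is 0 below \<open>b\<close> and that of \<open>R\<close>
  above, where it cancels the refraction drift.\<close>

lemma mL_zero:
 assumes "0 < h" "h <= u" "u < b \<or> b + h <= u"
 shows "mL h u = 0"
proof (cases "u < b")
 case True
 have eq: "\<forall>y. u - h < y \<and> y <= u --> Rk y = \<alpha> + \<alpha> * Rh y" using True assms by (auto simp: Rk_def RH_def)
 have "primitive Rk u - primitive Rk (u - h) = \<alpha> * h + \<alpha> * (primitive Rh u - primitive Rh (u - h))"
  using primitive_diff_affine[OF causal_parts2(2) causal_parts(6) _ eq] assms by simp
 moreover have "Re u = 0" "Re (u - h) = 0" using True assms by (auto simp: Re_eq max_def)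
 ultimately have "moll h RQ u = (\<alpha> * h + \<alpha> * (primitive Rh u - primitive Rh (u - h))) / h" unfolding moll_eq RQ_def by simp
 also have "\<dots> = \<alpha> * mR h u" using assms(1) by (simp add: mR_def moll_eq field_simps)
 finally show ?thesis using True unfolding mL_def by (simp add: rate_def)
next
 case False
 hence u: "b + h <= u" using assms by simp
 have eq: "\<forall>y. u - h < y \<and> y <= u --> Rk y = p + p * Rh y" using u assms b_pos by (auto simp: Rk_def RH_def algebra_simps)
 have 1: "primitive Rk u - primitive Rk (u - h) = p * h + p * (primitive Rh u - primitive Rh (u - h))"
  using primitive_diff_affine[OF causal_parts2(2) causal_parts(6) _ eq] assms by simp
 have "max u b = u" "max (u - h) b = u - h" using u assms by auto
 hence 2: "Re u - Re (u - h) = Rh u - Rh (u - h)" by (simp add: Re_eq R_eq)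
 have "RQ u - RQ (u - h) = (primitive Rk u - primitive Rk (u - h)) + \<delta> * (Re u - Re (u - h))" unfolding RQ_def by (simp add: algebra_simps)
 hence "moll h RQ u = (p * h + p * (primitive Rh u - primitive Rh (u - h)) + \<delta> * (Rh u - Rh (u - h))) / h" unfolding moll_eq 1 2 by simp
 also have "\<dots> = p * mR h u + \<delta> * moll h Rh u" using assms(1) by (simp add: mR_def moll_eq field_simps)
 finally show ?thesis using u assms(1) unfolding mL_def by (simp add: rate_def)
qed

text \<open>The defect \<open>mL h\<close> is built from difference quotients of \<open>RQ\<close>
  and \<open>Rh\<close>, which stay bounded as \<open>h\<close> tends to 0 because both functions
  are locally Lipschitz. A bound that does not depend on \<open>h\<close> is what makes shrinking
  windows negligible.\<close>

lemma mollified_bounds: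
 obtains C where "0 <= C" "\<forall>h u. 0 < h \<and> h <= 1 \<and> u <= A --> \<bar>mL h u\<bar> <= C \<and> \<bar>mR h u - R u\<bar> <= C * h"
  "\<forall>u\<le>A. \<bar>R u\<bar> <= C" "\<forall>u u'. u <= u' \<and> u' <= A --> \<bar>R u' - R u\<bar> <= C * (u' - u)"
proof -
 define A' where "A' = max A b"
 obtain Bk where Bk: "0 <= Bk" "\<forall>x\<le>A. \<bar>Rk x\<bar> <= Bk" by (rule causal_local_bound[OF causal_parts2(2)])
 obtain Bh where Bh: "0 <= Bh" "\<forall>x\<le>A. \<bar>Rh x\<bar> <= Bh" by (rule causal_local_bound[OF causal_parts(6)])
 obtain Lp where Lp: "0 <= Lp" "\<And>x x'. x <= x' ==> x' <= A' ==> \<bar>R x' - R x\<bar> <= Lp * (x' - x)" using R_lipschitz[of A'] by blast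
 define C where "C = Bk + 2 * (\<delta> * Lp) + (p + \<bar>q\<bar>) * (Bh + 1 + Lp) + Lp + Bh + 1"
 have A': "A <= A'" "b <= A'" by (auto simp: A'_def)
 have pos: "0 <= \<delta> * Lp" "0 <= (p + \<bar>q\<bar>) * (Bh + 1 + Lp)" using Lp(1) Bh(1) \<delta>_nonneg p_nonneg by simp_all
 have C: "0 <= C" "Lp <= C" "Bh + 1 <= C" "Bk + \<delta> * Lp + \<delta> * Lp + (p + \<bar>q\<bar>) * (Bh + 1 + Lp) <= C" unfolding C_def using pos Bk(1) Bh(1) Lp(1) by linarith+
 have RB: "\<bar>R u\<bar> <= Bh + 1" if "u <= A" for u using Bh(2) that unfolding R_eq[of u] by fastforce
 show ?thesis
 proof (rule that[OF C(1)])
  show "\<forall>u\<le>A. \<bar>R u\<bar> <= C" using RB C(3) by fastforce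
  show "\<forall>u u'. u <= u' \<and> u' <= A --> \<bar>R u' - R u\<bar> <= C * (u' - u)"
  proof (intro allI impI, elim conjE)
   fix u u' :: real assume u: "u <= u'" "u' <= A"
   have "Lp * (u' - u) <= C * (u' - u)" using C u by (intro mult_right_mono) auto
   thus "\<bar>R u' - R u\<bar> <= C * (u' - u)" using Lp(2)[of u u'] u A' by (meson order.trans)
  qed
  show "\<forall>h u. 0 < h \<and> h <= 1 \<and> u <= A --> \<bar>mL h u\<bar> <= C \<and> \<bar>mR h u - R u\<bar> <= C * h"
  proof (intro allI impI, elim conjE)
   fix h u :: real assume h: "0 < h" "h <= 1" and u: "u <= A"
   have Rlip: "\<forall>y. u - h < y \<and> y <= u --> \<bar>Rh y - Rh u\<bar> <= Lp * h"
   proof (intro allI impI)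
    fix y assume y: "u - h < y \<and> y <= u"
    have "\<bar>Rh y - Rh u\<bar> <= Lp * (u - y)" using Lp(2)[of y u] y u A' by (simp add: R_eq abs_minus_commute)
    also have "\<dots> <= Lp * h" using y Lp(1) by (intro mult_left_mono) auto
    finally show "\<bar>Rh y - Rh u\<bar> <= Lp * h" .
   qed
   have "\<bar>primitive Rh u - primitive Rh (u - h) - Rh u * (u - (u - h))\<bar> <= Lp * h * (u - (u - h))"
    by (rule primitive_diff_const[OF causal_parts(6) _ Rlip]) (use h in simp)
   hence "\<bar>primitive Rh u - primitive Rh (u - h) - Rh u * h\<bar> / h <= Lp * h * h / h" using h by (intro divide_right_mono) auto
   moreover have "mR h u - R u = (primitive Rh u - primitive Rh (u - h) - Rh u * h) / h"
    using h by (simp add: mR_def moll_eq R_eq diff_divide_distrib)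
   ultimately have m: "\<bar>mR h u - R u\<bar> <= Lp * h" using h by (simp add: abs_divide)
   also have "\<dots> <= C * h" using C h by (intro mult_right_mono) auto
   finally have 1: "\<bar>mR h u - R u\<bar> <= C * h" .
   have "Lp * h <= Lp * 1" using Lp(1) h by (intro mult_left_mono) auto
   hence mb: "\<bar>mR h u\<bar> <= Bh + 1 + Lp" using m RB[OF u] by linarith
   have dm: "\<bar>y\<bar> / h <= B" if "\<bar>y\<bar> <= B * h" for y B using that h(1) by (simp add: pos_divide_le_eq)
   have a1: "\<bar>primitive Rk u - primitive Rk (u - h)\<bar> / h <= Bk"
    using primitive_lipschitz[OF causal_parts2(2) Bk(2), of "u - h" u] h u by (intro dm) simp
   have "\<bar>Re u - Re (u - h)\<bar> <= Lp * (max u b - max (u - h) b)" unfolding Re_eq using Lp(2)[of "max (u - h) b" "max u b"] h u A' by simp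
   also have "\<dots> <= Lp * h" using Lp(1) h by (intro mult_left_mono) auto
   finally have a2: "\<bar>Re u - Re (u - h)\<bar> / h <= Lp" by (rule dm)
   have a3: "\<bar>moll h Rh u\<bar> <= Lp" unfolding moll_eq abs_divide using dm[of "Rh u - Rh (u - h)" Lp] Lp(2)[of "u - h" u] h u A' by (simp add: R_eq)
   have e: "moll h RQ u = (primitive Rk u - primitive Rk (u - h)) / h + \<delta> * ((Re u - Re (u - h)) / h)"
    using h by (simp add: moll_eq RQ_def field_simps)
   have b1: "\<bar>(primitive Rk u - primitive Rk (u - h)) / h\<bar> <= Bk" using a1 h by (simp add: abs_divide)
   have "\<bar>(Re u - Re (u - h)) / h\<bar> <= Lp" using a2 h by (simp add: abs_divide)
   from mult_left_mono[OF this \<delta>_nonneg] have b2: "\<bar>\<delta> * ((Re u - Re (u - h)) / h)\<bar> <= \<delta> * Lp" unfolding abs_mult using \<delta>_nonneg by simp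
   have b3: "\<bar>if b < u then \<delta> * moll h Rh u else 0\<bar> <= \<delta> * Lp" using mult_left_mono[OF a3 \<delta>_nonneg] pos(1) \<delta>_nonneg by (simp add: abs_mult)
   have b4: "\<bar>rate u * mR h u\<bar> <= (p + \<bar>q\<bar>) * (Bh + 1 + Lp)" unfolding abs_mult using rate_bounds[of u] mb by (intro mult_mono) auto
   have "\<bar>mL h u\<bar> <= C" unfolding mL_def e using b1 b2 b3 b4 C(4) by linarith
   thus "\<bar>mL h u\<bar> <= C \<and> \<bar>mR h u - R u\<bar> <= C * h" using 1 by simp
  qed
 qed
qed

end

section \<open>Summing the mollified function up to the exit of the chain\<close>

context refracted_scale
begin

definition cK :: "nat => real => real => nat => 'w => real" where
 "cK n a x i w = snd (frozen (es n) (discount n) a x (incs n w) i)"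

lemma measurable_cK [measurable]: "cK n a x i \<in> borel_measurable M"
proof -
 have "(\<lambda>w. frozen (es n) (discount n) a x (incs n w) i) \<in> M \<rightarrow>\<^sub>M borel \<Otimes>\<^sub>M borel" by (rule measurable_frozen) measurable
 from measurable_compose[OF this measurable_snd] show ?thesis by (simp add: cK_def[abs_def])
qed

lemma cK_bounds: "0 <= x ==> x <= a ==> 0 <= cK n a x i w \<and> cK n a x i w <= 1"
 unfolding cK_def using frozen_bounds(2,3)[of a "es n" x "discount n" "incs n w" i]
  euler_step_le[of "1 / real n" a] discount_bounds by auto

definition occ :: "nat => real => real => real => real => nat => real" where
 "occ n a x c h i = (EE w. indicator {..a} (cV n a x i w) * indicator {c - h..c + h} (cV n a x i w))"

lemma occ_mono: "h <= h' ==> occ n a x c h i <= occ n a x c h' i" unfolding occ_def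
 by (intro integral_mono integrable_const_bound[where B=1]) (auto simp: indicator_def)

lemma discounted_sum_lower:
 fixes F l :: "real => real"
 assumes x: "0 <= x" "x <= a" and F[measurable]: "F \<in> borel_measurable borel" and BF: "\<forall>u\<le>a + 1. \<bar>F u\<bar> <= BF" and n: "0 < n"
  and C: "0 <= C" "0 <= e"
  and le: "\<forall>u. 0 <= u \<and> u <= a -->
   - ((C * (indicator {0 - h..0 + h} u + indicator {b - h..b + h} u) + e) / real n)
    <= discount n u * step_mean n F u - F u"
 shows "F x - (C * (\<Sum>i<m * n. occ n a x 0 h i) / real n + C * (\<Sum>i<m * n. occ n a x b h i) / real n + real m * e)
  <= (EE w. cK n a x (m * n) w * F (cV n a x (m * n) w))"
proof -
 define l where "l u = - ((C * (indicator {0 - h..0 + h} u + indicator {b - h..b + h} u) + e) / real n)" for u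
 have ml: "l \<in> borel_measurable borel" unfolding l_def by measurable
 have lB: "\<forall>u. 0 <= u \<and> u <= a --> \<bar>l u\<bar> <= (2 * C + e) / real n" using C by (auto simp: l_def abs_divide indicator_def intro!: divide_right_mono)
 have VK: "fst (frozen (es n) (discount n) a x (incs n w) i) = cV n a x i w"
  "snd (frozen (es n) (discount n) a x (incs n w) i) = cK n a x i w" for i w
  by (simp_all add: cK_def cV_def frozen_fst_indep[of _ "discount n" a x _ i "\<lambda>_. 1"])
 note sum = euler_chain_sum[OF measurable_discount F ml x discount_bounds BF lB le[folded l_def], unfolded VK]
 have t: "- ((C * (occ n a x 0 h i + occ n a x b h i) + e) / real n) <= (EE w. indicator {..a} (cV n a x i w) * cK n a x i w * l (cV n a x i w))" for i
 proof -
  define f where "f c w = (indicator {..a} (cV n a x i w) * indicator {c - h..c + h} (cV n a x i w) :: real)" for c w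
  have i0: "integrable M (f c)" for c unfolding f_def by (rule integrable_const_bound[where B=1]) (auto simp: indicator_def)
  have "- ((C * (occ n a x 0 h i + occ n a x b h i) + e) / real n) = (EE w. - ((C * (f 0 w + f b w) + e) / real n))"
   unfolding occ_def f_def[symmetric] using i0 by (simp add: prob_space)
  also have "\<dots> <= (EE w. indicator {..a} (cV n a x i w) * cK n a x i w * l (cV n a x i w))"
  proof (rule integral_mono[OF _ sum(2)])
   show "integrable M (\<lambda>w. - ((C * (f 0 w + f b w) + e) / real n))"
    by (intro Bochner_Integration.integrable_minus integrable_divide Bochner_Integration.integrable_add integrable_mult_right i0) auto
   fix w
   have "0 <= - l u" for u using C by (simp add: l_def)
   hence l0: "l u <= 0" for u by simp
   show "- ((C * (f 0 w + f b w) + e) / real n)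
    <= indicator {..a} (cV n a x i w) * cK n a x i w * l (cV n a x i w)"
   proof (cases "cV n a x i w <= a")
    case True
    \<comment> \<open>\<open>l\<close> is nonpositive, so dropping the discount factor gives a lower
      bound.\<close>
    have "1 * l (cV n a x i w) <= cK n a x i w * l (cV n a x i w)" by (rule mult_right_mono_neg) (use l0 cK_bounds[OF x] in auto)
    thus ?thesis using True by (simp add: l_def f_def)
   next
    case False
    thus ?thesis using C by (simp add: f_def)
   qed
  qed
  finally show ?thesis .
 qed
 have "(\<Sum>i<m * n. - ((C * (occ n a x 0 h i + occ n a x b h i) + e) / real n)) =
   - (C * (\<Sum>i<m * n. occ n a x 0 h i) / real n + C * (\<Sum>i<m * n. occ n a x b h i) / real n + real m * e)"
  unfolding sum_negf sum_divide_distrib[symmetric] sum.distrib sum_distrib_left[symmetric] using n by (simp add: add_divide_distrib distrib_left)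
 moreover have "(\<Sum>i<m * n. - ((C * (occ n a x 0 h i + occ n a x b h i) + e) / real n)) <=
   (\<Sum>i<m * n. (EE w. indicator {..a} (cV n a x i w) * cK n a x i w * l (cV n a x i w)))" by (intro sum_mono t)
 ultimately show ?thesis using sum(3)[of "m * n"] by linarith
qed

text \<open>The lower bound for the stopped sum is applied to \<open>mR h\<close> and to its
  negative; the defect lives on the windows counted by \<open>occ\<close>.\<close>

lemma mollified_sum:
 assumes x: "0 <= x" "x <= a" and h: "0 < h" and e: "0 < e" and C: "0 <= C" "\<forall>u\<le>a. \<bar>mL h u\<bar> <= C"
 shows "EV n. \<bar>(EE w. cK n a x (m * n) w * mR h (cV n a x (m * n) w)) - mR h x\<bar>
  <= C * (\<Sum>i<m * n. occ n a x 0 h i) / real n + C * (\<Sum>i<m * n. occ n a x b h i) / real n + real m * e"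
 using discounted_step[OF smooth_pair_mR mR_max[OF h] e, of a] eventually_gt_at_top[of 0]
proof eventually_elim
 case (elim n)
 note sp = smooth_pair_mR[of h]
 have mF[measurable]: "mR h \<in> borel_measurable borel" using smooth_pairD(2)[OF sp] by (rule borel_measurable_continuous_onI)
 obtain BF where BF: "0 <= BF" "\<forall>u\<le>a + 1. \<bar>mR h u\<bar> <= BF" by (rule exp_bounded_le[OF smooth_pairD(3)[OF sp]])
 define J where "J u = C * (indicator {0 - h..0 + h} u + indicator {b - h..b + h} u)" for u
 have key: "\<bar>discount n u * step_mean n (mR h) u - mR h u\<bar> <= (J u + e) / real n"
  if u: "0 <= u \<and> u <= a" for u
 proof -
  have "\<bar>mL h u\<bar> <= J u"
  proof (cases "u \<in> {0 - h..0 + h} \<or> u \<in> {b - h..b + h}")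
   case True
   have "C * 1 <= J u" unfolding J_def using C(1) True by (intro mult_left_mono) (auto simp: indicator_def)
   thus ?thesis using C(2) u by fastforce
  next
   case False
   hence "mL h u = 0" using u h by (intro mL_zero) auto
   thus ?thesis using C(1) by (simp add: J_def)
  qed
  hence "\<bar>mL h u\<bar> / real n <= J u / real n" by (intro divide_right_mono) auto
  moreover have "\<bar>discount n u * step_mean n (mR h) u - mR h u - mL h u / real n\<bar> <= e / real n"
   using elim(1)[rule_format, of u] u by (cases "b < u") (simp_all add: mL_def)
  moreover have "\<bar>mL h u / real n\<bar> = \<bar>mL h u\<bar> / real n" by (simp add: abs_divide)
  ultimately show ?thesis unfolding add_divide_distrib by linarith
 qed
 have l1: "\<forall>u. 0 <= u \<and> u <= a --> - ((C * (indicator {0 - h..0 + h} u + indicator {b - h..b + h} u) + e) / real n)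
    <= discount n u * step_mean n (mR h) u - mR h u"
  using key unfolding J_def[symmetric] by (force simp: abs_le_iff)
 have l2: "\<forall>u. 0 <= u \<and> u <= a --> - ((C * (indicator {0 - h..0 + h} u + indicator {b - h..b + h} u) + e) / real n)
    <= discount n u * (EE w. - mR h (es n u (X (1 / real n) w))) - (- mR h u)"
  using key unfolding J_def[symmetric] by (force simp: abs_le_iff)
 have mF2: "(\<lambda>u. - mR h u) \<in> borel_measurable borel" by measurable
 have BF2: "\<forall>u\<le>a + 1. \<bar>- mR h u\<bar> <= BF" using BF(2) by simp
 show ?case using discounted_sum_lower[OF x mF BF(2) elim(2) C(1) less_imp_le[OF e] l1, of m]
   discounted_sum_lower[OF x mF2 BF2 elim(2) C(1) less_imp_le[OF e] l2, of m] by (simp add: abs_le_iff)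
qed

text \<open>Errors of order 1/m come from the defect on the windows, from the mollification at the
  start, from the distance of the exit value to \<open>a\<close>, and from the events that the chain
  has not left by time \<open>m\<close> or overshoots. The stopping level
  \<open>a + 1 / real m\<close> leaves room for the error of the chain when its exit is compared
  with the passage of V.\<close>

lemma main_estimate:
 assumes x: "0 <= x" "x <= a"
 obtains C where "0 <= C" "\<forall>m>0. EV n.
  \<bar>R x - R a * expectation (cK n (a + 1 / real m) x (m * n))\<bar> <= C / real m"
proof -
 obtain Ce where Ce: "0 <= Ce" "\<forall>m>0. EV n.
  (EE w. indicator {..a + 1 / real m} (cV n (a + 1 / real m) x (m * n) w)) <= Ce / real m" by (rule exit_bound[OF x])
 obtain D where D: "0 <= D" "\<forall>g u. 0 < g \<and> g <= 1 \<and> u <= a + 2 --> \<bar>mL g u\<bar> <= D \<and> \<bar>mR g u - R u\<bar> <= D * g"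
  "\<forall>u\<le>a + 2. \<bar>R u\<bar> <= D" "\<forall>u u'. u <= u' \<and> u' <= a + 2 --> \<bar>R u' - R u\<bar> <= D * (u' - u)" by (rule mollified_bounds)
 \<comment> \<open>The summands stand for windows and discretisation, mollification at
   \<open>x\<close>, and the exit value, where \<open>Ce + 1\<close> bounds the two exceptional
   probabilities.\<close>
 define C where "C = (2 * D + 1) + D + (3 * D + 2 * D * (Ce + 1))"
 show ?thesis
 proof (rule that)
  show "0 <= C" using D(1) Ce(1) unfolding C_def by (intro add_nonneg_nonneg mult_nonneg_nonneg) auto
  show "\<forall>m>0. EV n. \<bar>R x - R a * expectation (cK n (a + 1 / real m) x (m * n))\<bar> <= C / real m"
  proof (intro allI impI)
   fix m :: nat assume m: "0 < m"
   define h where "h = 1 / real m"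
   have h: "0 < h" "h <= 1" using m by (auto simp: h_def)
   define am where "am = a + h"
   have am: "x <= am" "a <= am" "am <= a + 1" using x h by (auto simp: am_def)
   obtain g1 where g1: "0 < g1" "EV n. (\<Sum>i<m * n. occ n am x 0 g1 i) / real n <= h"
    unfolding occ_def by (rule occupation_small[OF x(1) am(1) h(1), where m=m and c=0])
   obtain g2 where g2: "0 < g2" "EV n. (\<Sum>i<m * n. occ n am x b g2 i) / real n <= h"
    unfolding occ_def by (rule occupation_small[OF x(1) am(1) h(1), where m=m and c=b])
   \<comment> \<open>The windows are found for the tolerance \<open>h\<close> first, and the
     mollification width is then taken below them; this order is possible because \<open>D\<close>
     does not depend on \<open>g\<close>.\<close>
   define g where "g = min h (min g1 g2)"
   have g: "0 < g" "g <= h" "g <= g1" "g <= g2" "g <= 1" using h g1(1) g2(1) unfolding g_def by linarith+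
   \<comment> \<open>The error \<open>h * h\<close> per unit of time is multiplied by the horizon
     \<open>m\<close> and returns \<open>h\<close>.\<close>
   have h2: "0 < h * h" using h by simp
   have mL: "\<forall>u\<le>am. \<bar>mL g u\<bar> <= D" using D(2) g am by auto
   have sums: "EV n. \<bar>(EE w. cK n am x (m * n) w * mR g (cV n am x (m * n) w)) - mR g x\<bar>
    <= D * (\<Sum>i<m * n. occ n am x 0 g i) / real n + D * (\<Sum>i<m * n. occ n am x b g i) / real n + real m * (h * h)"
    by (rule mollified_sum[OF x(1) am(1) g(1) h2 D(1) mL])
   have exit: "EV n. (EE w. indicator {..am} (cV n am x (m * n) w)) <= Ce * h" using Ce(2) m unfolding am_def h_def by auto
   have over: "EV n. (EE w. indicator {am + h<..} (cV n am x (m * n) w)) <= h"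
    by (rule overshoot_bound[OF x(1) am(1) h(1) h(1)])
   show "EV n. \<bar>R x - R a * expectation (cK n (a + 1 / real m) x (m * n))\<bar> <= C / real m" unfolding h_def[symmetric] am_def[symmetric]
    using sums exit over g1(2) g2(2)
   proof eventually_elim
    case (elim n)
    let ?V = "cV n am x (m * n)" and ?K = "cK n am x (m * n)"
    have "(\<Sum>i<m * n. occ n am x 0 g i) / real n <= (\<Sum>i<m * n. occ n am x 0 g1 i) / real n" by (intro divide_right_mono sum_mono occ_mono g) auto
    hence o1: "D * (\<Sum>i<m * n. occ n am x 0 g i) / real n <= D * h"
     using elim(4) D(1) mult_left_mono[of "(\<Sum>i<m * n. occ n am x 0 g i) / real n" h D] by simp
    have "(\<Sum>i<m * n. occ n am x b g i) / real n <= (\<Sum>i<m * n. occ n am x b g2 i) / real n" by (intro divide_right_mono sum_mono occ_mono g) auto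
    hence o2: "D * (\<Sum>i<m * n. occ n am x b g i) / real n <= D * h"
     using elim(5) D(1) mult_left_mono[of "(\<Sum>i<m * n. occ n am x b g i) / real n" h D] by simp
    have mh: "real m * (h * h) = h" using m by (simp add: h_def)
    have 1: "\<bar>(EE w. ?K w * mR g (?V w)) - mR g x\<bar> <= (2 * D + 1) * h" using elim(1) o1 o2 unfolding mh by (simp add: distrib_right)
    have "\<bar>mR g x - R x\<bar> <= D * g" using D(2) g am by auto
    also have "\<dots> <= D * h" using D(1) g by (intro mult_left_mono) auto
    finally have 2: "\<bar>mR g x - R x\<bar> <= D * h" .
    define I1 where "I1 w = (indicator {..am} (?V w) :: real)" for w
    define I2 where "I2 w = (indicator {am + h<..} (?V w) :: real)" for w
    have i12: "integrable M I1" "integrable M I2" unfolding I1_def I2_def by (rule integrable_const_bound[where B=1]; auto)+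
    have mF[measurable]: "mR g \<in> borel_measurable borel" using smooth_pairD(2)[OF smooth_pair_mR] by (rule borel_measurable_continuous_onI)
    have pt: "\<bar>mR g (?V w) - R a\<bar> <= 3 * D * h + 2 * D * (I1 w + I2 w)" for w
    proof -
     have V: "0 <= ?V w" "?V w <= a + 2" using cV_bounds[OF x(1) am(1), of n "m * n" w] am by auto
     have "\<bar>mR g (?V w) - R (?V w)\<bar> <= D * g" using D(2) g V by auto
     also have "\<dots> <= D * h" using D(1) g by (intro mult_left_mono) auto
     finally have a: "\<bar>mR g (?V w) - R (?V w)\<bar> <= D * h" .
     have "\<bar>R (?V w) - R a\<bar> <= 2 * D * h + 2 * D * (I1 w + I2 w)"
     proof (cases "am < ?V w \<and> ?V w <= am + h")
      case True
      hence "\<bar>R (?V w) - R a\<bar> <= D * (?V w - a)" using D(4) am V by auto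
      also have "\<dots> <= D * (2 * h)" using D(1) True by (intro mult_left_mono) (auto simp: am_def)
      also have "\<dots> <= 2 * D * h + 2 * D * (I1 w + I2 w)" using D(1) by (simp add: I1_def I2_def)
      finally show ?thesis .
     next
      case False
      have "\<bar>R (?V w)\<bar> <= D" "\<bar>R a\<bar> <= D" using D(3) V by auto
      hence "\<bar>R (?V w) - R a\<bar> <= 2 * D * 1" by linarith
      also have "\<dots> <= 2 * D * (I1 w + I2 w)" using D(1) False by (intro mult_left_mono) (auto simp: I1_def I2_def indicator_def)
      also have "\<dots> <= 2 * D * h + 2 * D * (I1 w + I2 w)" using D(1) h by simp
      finally show ?thesis .
     qed
     moreover have "3 * D * h = D * h + 2 * D * h" by simp
     ultimately show ?thesis using a by linarith
    qed
    have Kb: "0 <= ?K w" "?K w <= 1" for w using cK_bounds[OF x(1) am(1)] by auto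
    have iK: "integrable M ?K" by (rule integrable_const_bound[where B=1]) (use Kb in auto)
    have iKm: "integrable M (\<lambda>w. ?K w * mR g (?V w))"
    proof -
     obtain BF where BF: "0 <= BF" "\<forall>u\<le>a + 2. \<bar>mR g u\<bar> <= BF" by (rule exp_bounded_le[OF smooth_pairD(3)[OF smooth_pair_mR]])
     show ?thesis
     proof (rule integrable_const_bound[where B=BF], rule AE_I2)
      fix w
      have "\<bar>mR g (?V w)\<bar> <= BF" using BF(2) cV_bounds[OF x(1) am(1), of n "m * n" w] am by auto
      thus "norm (?K w * mR g (?V w)) <= BF" using Kb[of w] BF(1) mult_mono[of "?K w" 1 "\<bar>mR g (?V w)\<bar>" BF] by (simp add: abs_mult)
     qed measurable
    qed
    have "\<bar>(EE w. ?K w * mR g (?V w)) - R a * expectation ?K\<bar> = \<bar>(EE w. ?K w * mR g (?V w) - R a * ?K w)\<bar>" using iK iKm by simp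
    also have "\<dots> <= (EE w. \<bar>?K w * mR g (?V w) - R a * ?K w\<bar>)" using integral_norm_bound[of M "\<lambda>w. ?K w * mR g (?V w) - R a * ?K w"] by simp
    also have "\<dots> <= (EE w. 3 * D * h + 2 * D * (I1 w + I2 w))"
    proof (rule integral_mono')
     fix w
     have "\<bar>?K w * mR g (?V w) - R a * ?K w\<bar> = ?K w * \<bar>mR g (?V w) - R a\<bar>"
     proof -
      have "?K w * mR g (?V w) - R a * ?K w = ?K w * (mR g (?V w) - R a)" by (simp add: algebra_simps)
      thus ?thesis using Kb(1)[of w] by (simp only: abs_mult abs_of_nonneg)
     qed
     also have "\<dots> <= 1 * \<bar>mR g (?V w) - R a\<bar>" using Kb(2)[of w] by (intro mult_right_mono) auto
     also have "\<dots> <= 3 * D * h + 2 * D * (I1 w + I2 w)" using pt[of w] by simp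
     finally show "\<bar>?K w * mR g (?V w) - R a * ?K w\<bar> <= 3 * D * h + 2 * D * (I1 w + I2 w)" .
     show "0 <= 3 * D * h + 2 * D * (I1 w + I2 w)" using D(1) h by (simp add: I1_def I2_def)
    qed (intro Bochner_Integration.integrable_add integrable_mult_right i12 integrable_const)
    also have "\<dots> = 3 * D * h + 2 * D * (expectation I1 + expectation I2)" using i12 by (simp add: prob_space)
    also have "\<dots> <= 3 * D * h + 2 * D * (Ce * h + h)"
     using elim(2,3) D(1) unfolding I1_def I2_def by (intro add_left_mono mult_left_mono add_mono) auto
    also have "\<dots> = (3 * D + 2 * D * (Ce + 1)) * h" by (simp add: algebra_simps)
    finally have 3: "\<bar>(EE w. ?K w * mR g (?V w)) - R a * expectation ?K\<bar> <= (3 * D + 2 * D * (Ce + 1)) * h" .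
    have C: "C * h = (2 * D + 1) * h + D * h + (3 * D + 2 * D * (Ce + 1)) * h" by (simp only: C_def distrib_right)
    have tri: "\<bar>r - s\<bar> <= y1 + y2 + y3" if "\<bar>t - t'\<bar> <= y1" "\<bar>t' - r\<bar> <= y2" "\<bar>t - s\<bar> <= y3" for r s t t' y1 y2 y3 :: real using that by linarith
    have "\<bar>R x - R a * expectation ?K\<bar> <= C * h" unfolding C by (rule tri[OF 1 2 3])
    thus ?case by (simp add: h_def)
   qed
  qed
 qed
qed

end

subsection \<open>Passage to the limit\<close>

lemma le_liminf_if_tendsto:
 fixes l :: "nat => real"
 assumes "l \<longlonglongrightarrow> z" "EV n. ennreal (l n) <= f n"
 shows "ennreal z <= liminf f"
proof -
 have "(\<lambda>n. ennreal (l n)) \<longlonglongrightarrow> ennreal z" using assms(1) by (rule tendsto_ennrealI)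
 hence "ennreal z = liminf (\<lambda>n. ennreal (l n))" by (intro lim_imp_Liminf[symmetric]) auto
 also have "\<dots> <= liminf f" by (rule Liminf_mono) (rule assms(2))
 finally show ?thesis .
qed

context prob_space
begin

lemma nn_integral_unit_interval:
 assumes [measurable]: "f \<in> borel_measurable M" and "\<And>w. 0 <= f w" "\<And>w. f w <= (B::real)"
 shows "(\<integral>\<^sup>+w. ennreal (f w) \<partial>M) = ennreal (expectation f)"
proof (rule nn_integral_eq_integral)
 show "integrable M f" by (rule integrable_const_bound[where B=B]) (use assms in auto)
qed (use assms in auto)

lemma nn_integral_liminf_le:
 fixes g :: "nat => 'a => real"
 assumes [measurable]: "\<And>n. g n \<in> borel_measurable M" and g: "\<And>n w. 0 <= g n w" "\<And>n w. g n w <= B"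
  and e: "EV n. expectation (g n) <= C"
 shows "(\<integral>\<^sup>+w. liminf (\<lambda>n. ennreal (g n w)) \<partial>M) <= ennreal C"
proof -
 have "(\<integral>\<^sup>+w. liminf (\<lambda>n. ennreal (g n w)) \<partial>M) <= liminf (\<lambda>n. \<integral>\<^sup>+w. ennreal (g n w) \<partial>M)" by (rule nn_integral_liminf) measurable
 also have "\<dots> = liminf (\<lambda>n. ennreal (expectation (g n)))" using g by (subst nn_integral_unit_interval[where B=B]) auto
 also have "\<dots> <= liminf (\<lambda>n::nat. ennreal C)" by (rule Liminf_mono) (use e in eventually_elim, simp add: ennreal_leI)
 also have "\<dots> = ennreal C" by (simp add: Liminf_const)
 finally show ?thesis .
qed

text \<open>Fatou's lemma in \<open>n\<close> and then in \<open>m\<close>. As \<open>z\<close> may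
  fail to be measurable, the outcome is a measurable majorant with a bound on its integral.\<close>

lemma liminf_bound:
 fixes z :: "'a => real" and f :: "nat => nat => 'a => real"
 assumes f[measurable]: "\<And>m n. f m n \<in> borel_measurable M" "\<And>m n w. 0 <= f m n w" "\<And>m n w. f m n w <= B"
  and e: "\<And>m. EV n. expectation (f m n) <= c + C / real (Suc m)"
  and z: "AE w in M. \<exists>lo. lo \<longlonglongrightarrow> z w \<and> (\<forall>m. \<exists>l. l \<longlonglongrightarrow> lo m \<and> (EV n. l n <= f m n w))"
 obtains A where "A \<in> borel_measurable M" "(\<integral>\<^sup>+w. A w \<partial>M) <= ennreal c" "AE w in M. ennreal (z w) <= A w"
proof (rule that[of "\<lambda>w. liminf (\<lambda>m. liminf (\<lambda>n. ennreal (f m n w)))"])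
 have Cm: "(\<lambda>m. c + C / real (Suc m)) \<longlonglongrightarrow> c" using tendsto_add[OF tendsto_const LIMSEQ_Suc[OF lim_const_over_n[of C]], of c] by simp
 have "(\<integral>\<^sup>+w. liminf (\<lambda>m. liminf (\<lambda>n. ennreal (f m n w))) \<partial>M) <= liminf (\<lambda>m. \<integral>\<^sup>+w. liminf (\<lambda>n. ennreal (f m n w)) \<partial>M)"
  by (rule nn_integral_liminf) measurable
 also have "\<dots> <= liminf (\<lambda>m. ennreal (c + C / real (Suc m)))" by (rule Liminf_mono) (intro always_eventually allI nn_integral_liminf_le[OF f e])
 also have "\<dots> = ennreal c" by (rule lim_imp_Liminf[OF _ tendsto_ennrealI[OF Cm]]) simp
 finally show "(\<integral>\<^sup>+w. liminf (\<lambda>m. liminf (\<lambda>n. ennreal (f m n w))) \<partial>M) <= ennreal c" .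
 show "AE w in M. ennreal (z w) <= liminf (\<lambda>m. liminf (\<lambda>n. ennreal (f m n w)))" using z
 proof eventually_elim
  case (elim w)
  then obtain lo where lo: "lo \<longlonglongrightarrow> z w" "\<And>m. \<exists>l. l \<longlonglongrightarrow> lo m \<and> (EV n. l n <= f m n w)" by blast
  show ?case
  proof (intro le_liminf_if_tendsto[OF lo(1)] always_eventually allI)
   fix m
   obtain l where l: "l \<longlonglongrightarrow> lo m" "EV n. l n <= f m n w" using lo(2) by blast
   show "ennreal (lo m) <= liminf (\<lambda>n. ennreal (f m n w))" by (rule le_liminf_if_tendsto[OF l(1)]) (use l(2) in eventually_elim, rule ennreal_leI)
  qed
 qed
qed measurable

lemma AE_nonpos_if_liminf:
 fixes z :: "'a => real" and g :: "nat => nat => 'a => real"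
 assumes g: "\<And>k n. g k n \<in> borel_measurable M" "\<And>k n w. 0 <= g k n w" "\<And>k n w. g k n w <= B"
  and e: "\<And>k. EV n. expectation (g k n) <= C / real (Suc k)"
  and z: "AE w in M. \<forall>k. \<exists>lo. lo \<longlonglongrightarrow> z w \<and> (EV n. lo n <= g k n w)"
 shows "AE w in M. z w <= 0"
proof -
 have z': "AE w in M. \<exists>lo. lo \<longlonglongrightarrow> z w \<and> (\<forall>m. \<exists>l. l \<longlonglongrightarrow> lo m \<and> (EV n. l n <= g m n w))" using z
 proof eventually_elim
  case (elim w)
  thus ?case by (intro exI[of _ "\<lambda>_. z w"]) simp
 qed
 obtain A where A[measurable]: "A \<in> borel_measurable M" "(\<integral>\<^sup>+w. A w \<partial>M) <= ennreal 0" "AE w in M. ennreal (z w) <= A w"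
  by (rule liminf_bound[OF g _ z', where c=0 and C=C]) (use e in simp)
 have "AE w in M. A w = 0" using A(2) by (simp add: nn_integral_0_iff_AE)
 with A(3) show ?thesis by eventually_elim (simp add: ennreal_eq_0_iff)
qed

lemma borel_measurable_completion_cong:
 fixes Y Z :: "'a => real"
 assumes Y: "Y \<in> borel_measurable (completion M)" and eq: "AE w in completion M. Y w = Z w"
 shows "Z \<in> borel_measurable (completion M)"
proof (rule measurableI)
 fix A :: "real set" assume A: "A \<in> sets borel"
 show "Z -` A \<inter> space (completion M) \<in> sets (completion M)"
 proof (rule completion.in_sets_AE)
  show "AE w in completion M. w \<in> Y -` A \<inter> space (completion M) \<longleftrightarrow> w \<in> Z -` A \<inter> space (completion M)" using eq by eventually_elim simp
  show "Y -` A \<inter> space (completion M) \<in> sets (completion M)" using Y A by (rule measurable_sets)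
 qed auto
qed auto

text \<open>If one function fails to be measurable for the completion, so does the other, and both
  integrals take the default value 0.\<close>

lemma integral_completion_cong_AE:
 fixes Y Z :: "'a => real"
 assumes "AE w in M. Y w = Z w"
 shows "(LINT w|completion M. Y w) = (LINT w|completion M. Z w)"
proof (cases "Y \<in> borel_measurable (completion M)")
 case True
 have eq: "AE w in completion M. Y w = Z w" using assms by (rule AE_completion)
 show ?thesis by (rule integral_cong_AE[OF True borel_measurable_completion_cong[OF True eq] eq])
next
 case False
 have eq: "AE w in completion M. Z w = Y w" using AE_completion[OF assms] by eventually_elim simp
 hence "Z \<notin> borel_measurable (completion M)" using False borel_measurable_completion_cong by blast
 with False show ?thesis by (metis borel_measurable_integrable not_integrable_integral_eq)
qed

text \<open>The majorants \<open>A\<close> of \<open>Z\<close> and \<open>B\<close> of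
  \<open>1 - Z\<close> have total mass at most 1, yet their sum is at least 1. So the sum is 1
  almost everywhere and both majorants are attained, which makes \<open>Z\<close> almost everywhere
  equal to a measurable function of mean \<open>r\<close>.\<close>

lemma sandwich_expectation:
 fixes Z :: "'a => real" and k :: "nat => nat => 'a => real"
 assumes k[measurable]: "\<And>m n. k m n \<in> borel_measurable M" "\<And>m n w. 0 <= k m n w" "\<And>m n w. k m n w <= 1"
  and e: "\<And>m. EV n. \<bar>expectation (k m n) - r\<bar> <= C / real (Suc m)"
  and lower: "AE w in M. \<exists>lo. lo \<longlonglongrightarrow> Z w \<and> (\<forall>m. \<exists>l. l \<longlonglongrightarrow> lo m \<and> (EV n. l n <= k m n w))"
  and upper: "AE w in M. \<exists>hi. hi \<longlonglongrightarrow> 1 - Z w \<and> (\<forall>m. \<exists>l. l \<longlonglongrightarrow> hi m \<and> (EV n. l n <= 1 - k m n w))"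
 shows "(LINT w|completion M. Z w) = r"
proof -
 have ik: "integrable M (k m n)" for m n by (rule integrable_const_bound[where B=1]) (use k in auto)
 have ek: "0 <= expectation (k m n)" "expectation (k m n) <= 1" for m n
  using k Bochner_Integration.integral_nonneg[of M "k m n"] abs_expectation_le[of "k m n" 1] by auto
 have r: "0 <= r" "r <= 1"
 proof -
  have *: "r <= 1 + C / real (Suc m)" "0 <= r + C / real (Suc m)" for m
  proof -
   obtain n where "\<bar>expectation (k m n) - r\<bar> <= C / real (Suc m)" using e[of m] by (auto simp: eventually_sequentially)
   thus "r <= 1 + C / real (Suc m)" "0 <= r + C / real (Suc m)" using ek[of m n] by linarith+
  qed
  have Cm: "(\<lambda>m. c + C / real (Suc m)) \<longlonglongrightarrow> c" for c using tendsto_add[OF tendsto_const LIMSEQ_Suc[OF lim_const_over_n[of C]], of c] by simp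
  show "r <= 1" by (rule LIMSEQ_le_const[OF Cm]) (use * in auto)
  show "0 <= r" by (rule LIMSEQ_le_const[OF Cm]) (use * in auto)
 qed
 have e1: "EV n. expectation (k m n) <= r + C / real (Suc m)" for m using e[of m] by eventually_elim (simp add: abs_le_iff)
 have e2: "EV n. (EE w. 1 - k m n w) <= (1 - r) + C / real (Suc m)" for m
  using e[of m] by eventually_elim (use ik in "simp add: prob_space abs_le_iff")
 obtain A where A[measurable]: "A \<in> borel_measurable M" "(\<integral>\<^sup>+w. A w \<partial>M) <= ennreal r" "AE w in M. ennreal (Z w) <= A w"
  by (rule liminf_bound[OF k e1 lower])
 obtain B where B[measurable]: "B \<in> borel_measurable M" "(\<integral>\<^sup>+w. B w \<partial>M) <= ennreal (1 - r)" "AE w in M. ennreal (1 - Z w) <= B w"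
  by (rule liminf_bound[OF _ _ _ e2 upper, where B=1]) (use k in auto)
 have ge: "AE w in M. 1 <= A w + B w" using A(3) B(3)
 proof eventually_elim
  case (elim w)
  have "1 <= ennreal (Z w) + ennreal (1 - Z w)"
   by (cases "0 <= Z w"; cases "Z w <= 1") (auto simp: ennreal_neg ennreal_1[symmetric] ennreal_plus[symmetric] simp del: ennreal_1 ennreal_plus intro: ennreal_leI)
  thus ?case using add_mono[OF elim] by (rule order.trans)
 qed
 have "(\<integral>\<^sup>+w. A w + B w \<partial>M) <= ennreal r + ennreal (1 - r)" using add_mono[OF A(2) B(2)] by (simp add: nn_integral_add)
 hence "(\<integral>\<^sup>+w. A w + B w \<partial>M) - (\<integral>\<^sup>+w. 1 \<partial>M) = 0"
  using r by (auto simp: emeasure_space_1 diff_eq_0_iff_ennreal ennreal_plus[symmetric] simp del: ennreal_plus intro: le_less_trans)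
 hence "(\<integral>\<^sup>+w. (A w + B w) - 1 \<partial>M) = 0" using nn_integral_diff[OF _ _ _ ge] by (simp add: emeasure_space_1)
 hence "AE w in M. A w + B w - 1 = 0" by (subst (asm) nn_integral_0_iff_AE) auto
 define g where "g w = enn2real (A w)" for w
 have [measurable]: "g \<in> borel_measurable M" unfolding g_def by measurable
 have AB: "AE w in M. Z w = g w \<and> A w = ennreal (g w) \<and> B w = ennreal (1 - g w) \<and> 0 <= g w \<and> g w <= 1" using ge A(3) B(3) `AE w in M. A w + B w - 1 = 0`
 proof eventually_elim
  case (elim w)
  have 1: "A w + B w = 1" using elim by (simp add: diff_eq_0_iff_ennreal order_antisym)
  then obtain a b where ab: "A w = ennreal a" "B w = ennreal b" "0 <= a" "0 <= b" by (cases "A w"; cases "B w") auto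
  hence "b = 1 - a" using 1 by (simp add: ennreal_plus[symmetric] ennreal_eq_1 del: ennreal_plus)
  thus ?case using elim ab by (simp add: g_def ennreal_le_iff)
 qed
 have ig: "integrable M g" by (rule integrable_const_bound[where B=1]) (use AB in "auto elim: eventually_mono")
 have "ennreal (expectation g) = (\<integral>\<^sup>+w. A w \<partial>M)"
  by (subst nn_integral_eq_integral[OF ig, symmetric]) (use AB in "auto elim: eventually_mono intro!: nn_integral_cong_AE")
 hence 1: "expectation g <= r" using A(2) r by (metis ennreal_le_iff)
 have "ennreal ((EE w. 1 - g w)) = (\<integral>\<^sup>+w. B w \<partial>M)"
  by (subst nn_integral_eq_integral[symmetric]) (use ig AB in "auto elim: eventually_mono intro!: nn_integral_cong_AE")
 hence "(EE w. 1 - g w) <= 1 - r" using B(2) r by (metis ennreal_le_iff diff_ge_0_iff_ge)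
 hence "expectation g = r" using 1 ig by (simp add: prob_space)
 moreover have "AE w in M. Z w = g w" using AB by eventually_elim simp
 ultimately show ?thesis using integral_completion_cong_AE[of Z g] by (simp add: integral_completion)
qed

end

lemma grid_index_nat: "grid_index n (real m) = m * n" unfolding grid_index_def by (simp flip: of_nat_mult)

lemma passage_above_mono: "a <= a' ==> passage_above a v <= passage_above a' v"
 unfolding passage_above_def first_time_after_def by (rule INF_superset_mono) auto

lemma AE_ereal_neq: "AE s in lborel. ereal s \<noteq> t"
proof (cases t)
 case (real r)
 have "AE s in lborel. s \<noteq> (r::real)" by (rule AE_lborel_singleton)
 thus ?thesis using real by simp
qed auto

section \<open>The passage of V above a\<close>

locale passage_setting = refracted_scale M X \<gamma> \<sigma> \<nu> \<delta> b p q W WY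
 for M :: "'w measure" and X :: "real => 'w => real" and \<gamma> \<sigma> :: real and \<nu> :: "real measure" and \<delta> :: real
  and b p q :: real and W WY :: "real => real => real" +
 fixes a x :: real and V :: "real => 'w => real"
 assumes a_pos: "0 < a" and x_le: "x <= a" and process: "refracted_reflected_process M X \<delta> b x V"
begin

abbreviation "x0 \<equiv> max x 0"

lemma x0: "0 <= x0" "x0 <= a" using a_pos x_le by auto

definition good :: "'w => bool" where
 "good w \<longleftrightarrow> X 0 w = 0 \<and> rr_path \<delta> b (\<lambda>t. x + X t w) (\<lambda>t. V t w)"

lemma AE_good: "AE w in M. good w" using starts_at_0 cadlag_paths no_positive_jumps_paths process[unfolded refracted_reflected_process_def]
proof eventually_elim
 case (elim w)
 have "cadlag (\<lambda>t. x + X t w)" unfolding cadlag_def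
 proof (intro conjI allI impI)
  show "((\<lambda>t. x + X t w) \<longlongrightarrow> x + X t w) (at_right t)" if "0 <= t" for t using elim(2) that unfolding cadlag_def by (intro tendsto_add tendsto_const) simp
  fix t :: real assume "0 < t"
  then obtain l where "((\<lambda>t. X t w) \<longlongrightarrow> l) (at_left t)" using elim(2) unfolding cadlag_def by auto
  hence "((\<lambda>t. x + X t w) \<longlongrightarrow> x + l) (at_left t)" by (intro tendsto_add tendsto_const)
  thus "\<exists>l. ((\<lambda>t. x + X t w) \<longlongrightarrow> l) (at_left t)" by (rule exI)
 qed
 moreover have "no_positive_jumps (\<lambda>t. x + X t w)" unfolding no_positive_jumps_def
 proof (intro allI impI)
  fix t l :: real assume t: "0 < t" and l: "((\<lambda>t. x + X t w) \<longlongrightarrow> l) (at_left t)"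
  have "((\<lambda>t. x + X t w - x) \<longlongrightarrow> l - x) (at_left t)" by (intro tendsto_intros l)
  hence "((\<lambda>t. X t w) \<longlongrightarrow> l - x) (at_left t)" by simp
  hence "X t w <= l - x" using elim(3) t unfolding no_positive_jumps_def by blast
  thus "x + X t w <= l" by simp
 qed
 ultimately show ?case using elim b_pos \<delta>_nonneg unfolding good_def by (simp add: rr_path_def)
qed

lemma goodD:
 assumes "good w"
 shows "rr_path \<delta> b (\<lambda>t. x + X t w) (\<lambda>t. V t w)" "V 0 w = x0"
  "increments n (\<lambda>t. x + X t w) = incs n w"
proof -
 show rr: "rr_path \<delta> b (\<lambda>t. x + X t w) (\<lambda>t. V t w)" using assms by (simp add: good_def)
 show "V 0 w = x0" using rr_path.start_value[OF rr] assms by (simp add: good_def)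
 show "increments n (\<lambda>t. x + X t w) = incs n w" by (auto simp: increments_def)
qed

lemma alive_cV: "alive (es n) a' y (incs n w) j \<longleftrightarrow> cV n a' y j w <= a'"
 "alive (es n) a' y (incs n w) j ==> cV n a' y j w = euler (es n) y (incs n w) j" unfolding cV_def
 using frozen_alive[of "es n" a' y "incs n w" j "\<lambda>_. 1"] by auto

lemma cK_eq: "cK n a' y N w = exp (- ((\<Sum>j<N. if alive (es n) a' y (incs n w) j
  then rate (euler (es n) y (incs n w) j) else 0) / real n))"
proof -
 have "cK n a' y N w = (\<Prod>j<N. exp (- ((if alive (es n) a' y (incs n w) j
  then rate (euler (es n) y (incs n w) j) else 0) / real n)))"
  unfolding cK_def using frozen_alive[of "es n" a' y "incs n w" N "discount n"] by (auto simp: discount_def intro!: prod.cong)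
 also have "\<dots> = exp (\<Sum>j<N. - ((if alive (es n) a' y (incs n w) j
  then rate (euler (es n) y (incs n w) j) else 0) / real n))" by (rule exp_sum[symmetric]) simp
 finally show ?thesis by (simp add: sum_negf sum_divide_distrib)
qed

text \<open>Without a passage the chain is still running at every horizon on fine meshes, and for
  the horizon \<open>Suc k\<close> this has asymptotic probability at most
  \<open>C / real (Suc k)\<close>.\<close>

lemma passage_finite: "AE w in M. passage_above a (\<lambda>t. V t w) \<noteq> \<infinity>"
proof -
 obtain C where C: "0 <= C" "\<forall>m>0. EV n.
  (EE w. indicator {..a + 1 / real m} (cV n (a + 1 / real m) x0 (m * n) w)) <= C / real m" by (rule exit_bound[OF x0])
 define g where "g k n w = (indicator {..a + 1 / real (Suc k)} (cV n (a + 1 / real (Suc k)) x0 (Suc k * n) w) :: real)" for k n w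
 define z where "z w = (if good w \<and> passage_above a (\<lambda>t. V t w) = \<infinity> then 1 else 0 :: real)" for w
 have "AE w in M. z w <= 0"
 proof (rule AE_nonpos_if_liminf[where g=g and B=1 and C=C])
  show "g k n \<in> borel_measurable M" for k n unfolding g_def by measurable
  show "EV n. expectation (g k n) <= C / real (Suc k)" for k unfolding g_def using C(2) by blast
  show "AE w in M. \<forall>k. \<exists>lo. lo \<longlonglongrightarrow> z w \<and> (EV n. lo n <= g k n w)"
  proof (intro AE_I2 allI)
   fix w k
   show "\<exists>lo. lo \<longlonglongrightarrow> z w \<and> (EV n. lo n <= g k n w)"
   proof (intro exI[of _ "\<lambda>_. z w"] conjI tendsto_const)
    show "EV n. z w <= g k n w"
    proof (cases "good w \<and> passage_above a (\<lambda>t. V t w) = \<infinity>")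
     case True
     then interpret P: rr_path \<delta> b "\<lambda>t. x + X t w" "\<lambda>t. V t w" using goodD by blast
     have v0: "V 0 w = x0" using True goodD(2) by blast
     have "EV n. alive (es n) (a + 1 / real (Suc k)) (V 0 w) (increments n (\<lambda>t. x + X t w)) (grid_index n (real (Suc k)))"
      by (rule P.alive_eventually) (use True v0 x0 in auto)
     hence "EV n. cV n (a + 1 / real (Suc k)) x0 (Suc k * n) w <= a + 1 / real (Suc k)"
      unfolding grid_index_nat v0 goodD(3)[OF conjunct1[OF True]] alive_cV(1) .
     hence "EV n. g k n w = 1" by eventually_elim (simp add: g_def)
     thus ?thesis by eventually_elim (simp add: z_def)
    qed (auto simp: z_def g_def)
   qed
  qed
 qed (auto simp: g_def)
 with AE_good show ?thesis by eventually_elim (auto simp: z_def split: if_splits)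
qed

text \<open>The time of V at \<open>b\<close> is bounded by the time of the chain in arbitrarily
  small windows, which \<open>occupation_small\<close> makes negligible. The level
  \<open>a + 3\<close> exceeds all levels \<open>a + 2 * (1 / real (Suc m))\<close> at which the
  upper estimate will be used.\<close>

lemma no_time_at_b: "AE w in M. AE s in lborel. 0 < s --> ereal s < passage_above (a + 3) (\<lambda>t. V t w) --> V s w \<noteq> b"
proof -
 define f where "f w s = (if ereal s < passage_above (a + 3) (\<lambda>t. V t w) \<and> V (max 0 s) w = b then 1 else 0 :: real)" for w s
 have "AE w in M. (if good w then LINT s|lborel. indicator {0..<real m} s * f w s else 0) <= 0" for m
 proof -
  define a' where "a' = a + 3 + 1"
  have a': "x0 <= a'" using x0 by (simp add: a'_def)
  have "\<forall>k. \<exists>\<rho>. 0 < \<rho> \<and> (EV n. (\<Sum>i<m * n. occ n a' x0 b \<rho> i) / real n <= 1 / real (Suc k))"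
  proof
   fix k
   obtain \<rho> where "0 < \<rho>" "EV n. (\<Sum>i<m * n. occ n a' x0 b \<rho> i) / real n <= 1 / real (Suc k)"
    unfolding occ_def by (rule occupation_small[OF x0(1) a', where m=m and c=b and \<eta>="1 / real (Suc k)"]) simp
   thus "\<exists>\<rho>. 0 < \<rho> \<and> (EV n. (\<Sum>i<m * n. occ n a' x0 b \<rho> i) / real n <= 1 / real (Suc k))" by blast
  qed
  from choice[OF this] obtain \<rho> where \<rho>: "\<And>k. 0 < \<rho> k" "\<And>k. EV n. (\<Sum>i<m * n. occ n a' x0 b (\<rho> k) i) / real n <= 1 / real (Suc k)"
   by blast
  define g where "g k n w = (\<Sum>j<m * n. indicator {..a'} (cV n a' x0 j w) * indicator {b - \<rho> k..b + \<rho> k} (cV n a' x0 j w) :: real) / real n" for k n w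
  show ?thesis
  proof (rule AE_nonpos_if_liminf[where g=g and B="real m" and C=1])
   show "g k n \<in> borel_measurable M" for k n unfolding g_def by measurable
   show "0 <= g k n w" for k n w unfolding g_def by (intro divide_nonneg_nonneg sum_nonneg) auto
   show "g k n w <= real m" for k n w
   proof (cases "n = 0")
    case False
    have "(\<Sum>j<m * n. indicator {..a'} (cV n a' x0 j w) * indicator {b - \<rho> k..b + \<rho> k} (cV n a' x0 j w) :: real) <= (\<Sum>j<m * n. 1)"
     by (intro sum_mono) (auto simp: indicator_def)
    thus ?thesis using False by (simp add: g_def divide_le_eq)
   qed (simp add: g_def)
   show "EV n. expectation (g k n) <= 1 / real (Suc k)" for k using \<rho>(2)[of k]
   proof eventually_elim
    case (elim n)
    define h where "h j w = (indicator {..a'} (cV n a' x0 j w) * indicator {b - \<rho> k..b + \<rho> k} (cV n a' x0 j w) :: real)" for j w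
    have "integrable M (h j)" for j unfolding h_def by (rule integrable_const_bound[where B=1]) (auto simp: indicator_def)
    hence "(EE w. (\<Sum>j<m * n. h j w) / real n) = (\<Sum>j<m * n. expectation (h j)) / real n" by simp
    hence "expectation (g k n) = (\<Sum>i<m * n. occ n a' x0 b (\<rho> k) i) / real n" unfolding g_def h_def occ_def .
    thus ?case using elim by simp
   qed
   show "AE w in M. \<forall>k. \<exists>lo. lo \<longlonglongrightarrow> (if good w then LINT s|lborel. indicator {0..<real m} s * f w s else 0) \<and> (EV n. lo n <= g k n w)"
   proof (intro AE_I2 allI)
    fix w k
    show "\<exists>lo. lo \<longlonglongrightarrow> (if good w then LINT s|lborel. indicator {0..<real m} s * f w s else 0) \<and> (EV n. lo n <= g k n w)"
    proof (cases "good w")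
     case True
     interpret P: rr_path \<delta> b "\<lambda>t. x + X t w" "\<lambda>t. V t w" using goodD True by blast
     have v0: "V 0 w = x0" using True goodD(2) by blast
     have v0': "V 0 w <= a + 3" using v0 x0 by simp
     obtain lo where lo: "lo \<longlonglongrightarrow> (LINT s|lborel. indicator {0..<real m} s * f w s)"
      "\<forall>n>0. lo n <= (\<Sum>j<m * n. if alive (es n) (a + 3 + 1) (V 0 w) (increments n (\<lambda>t. x + X t w)) j
       \<and> \<bar>P.E n j - b\<bar> <= \<rho> k then 1 else 0) / real n" using P.occupation_limit_lower[OF zero_less_one v0' \<rho>(1)[of k], of m] unfolding f_def by blast
     have "lo n <= g k n w" if "0 < n" for n
     proof -
      have "(\<Sum>j<m * n. if alive (es n) (a + 3 + 1) (V 0 w) (increments n (\<lambda>t. x + X t w)) j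
       \<and> \<bar>P.E n j - b\<bar> <= \<rho> k then 1 else 0) / real n <= g k n w" unfolding g_def v0 goodD(3)[OF True] a'_def[symmetric]
      proof (intro divide_right_mono sum_mono)
       fix j
       show "(if alive (es n) a' x0 (incs n w) j \<and> \<bar>euler (es n) x0 (incs n w) j - b\<bar> <= \<rho> k then 1 else 0)
        <= (indicator {..a'} (cV n a' x0 j w) * indicator {b - \<rho> k..b + \<rho> k} (cV n a' x0 j w) :: real)"
        using alive_cV[of n a' x0 w j] by (auto simp: indicator_def abs_le_iff)
      qed simp
      from order.trans[OF lo(2)[rule_format, OF that] this] show ?thesis .
     qed
     hence "EV n. lo n <= g k n w" by (intro eventually_mono[OF eventually_gt_at_top[of 0]])
     thus ?thesis using lo(1) True by (intro exI[of _ lo]) simp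
    next
     case False
     have "0 <= g k n w" for n unfolding g_def by (intro divide_nonneg_nonneg sum_nonneg) auto
     thus ?thesis using False by (intro exI[of _ "\<lambda>_. 0"]) auto
    qed
   qed
  qed
 qed
 hence "AE w in M. \<forall>m. (if good w then LINT s|lborel. indicator {0..<real m} s * f w s else 0) <= 0" unfolding AE_all_countable by blast
 with AE_good show ?thesis
 proof eventually_elim
  case (elim w)
  interpret P: rr_path \<delta> b "\<lambda>t. x + X t w" "\<lambda>t. V t w" using goodD elim by blast
  note P.path_measurable[measurable]
  have fm[measurable]: "f w \<in> borel_measurable borel" unfolding f_def by measurable
  have "AE s in lborel. indicator {0..<real m} s * f w s = 0" for m
  proof -
   have i: "integrable lborel (\<lambda>s. indicator {0..<real m} s * f w s)"
   proof (rule Bochner_Integration.integrable_bound)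
    show "integrable lborel (\<lambda>s. indicator {0..<real m} s :: real)" by simp
   qed (auto simp: f_def indicator_def)
   have "0 <= (LINT s|lborel. indicator {0..<real m} s * f w s)" by (rule Bochner_Integration.integral_nonneg) (auto simp: f_def)
   hence "(LINT s|lborel. indicator {0..<real m} s * f w s) = 0" using elim by (simp add: order_antisym)
   with integral_nonneg_eq_0_iff_AE[OF i] show ?thesis by (auto simp: f_def)
  qed
  hence "AE s in lborel. \<forall>m. indicator {0..<real m} s * f w s = 0" unfolding AE_all_countable by blast
  thus ?case
  proof eventually_elim
   case (elim s)
   show ?case
   proof (intro impI notI)
    assume s: "0 < s" "ereal s < passage_above (a + 3) (\<lambda>t. V t w)" "V s w = b"
    obtain m where "s < real m" using reals_Archimedean2 by blast
    thus False using elim[rule_format, of m] s by (simp add: f_def indicator_def)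
   qed
  qed
 qed
qed

end

context passage_setting
begin

abbreviation "vp w \<equiv> \<lambda>t. V t w"

lemma rate_measurable [measurable]: "rate \<in> borel_measurable borel" unfolding rate_def by measurable

lemma rate_locally_constant:
 assumes "u \<noteq> b"
 shows "\<forall>\<^sub>F w in nhds u. rate w = rate u"
proof (cases "u < b")
 case True
 hence "\<forall>\<^sub>F w in nhds u. w < b" by (rule eventually_nhds_in_open[OF open_lessThan, of u b, simplified])
 thus ?thesis by eventually_elim (use True in "simp add: rate_def")
next
 case False
 hence "\<forall>\<^sub>F w in nhds u. b < w" using assms by (intro eventually_nhds_in_open[OF open_greaterThan, of u b, simplified]) auto
 thus ?thesis by eventually_elim (use False in "simp add: rate_def")
qed

lemma rate_integral:
 assumes g: "good w" and t: "passage_above a (vp w) = ereal t"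
 shows "0 <= t" "passage_functional p q {..<b} a (vp w) = exp (- (LINT s|lborel. indicator {0..<t} s * rate (V (max 0 s) w)))"
proof -
 interpret P: rr_path \<delta> b "\<lambda>t. x + X t w" "vp w" using goodD g by blast
 note P.path_measurable[measurable]
 show "0 <= t" using first_time_after_ge[of 0 "\<lambda>t. V t w > a"] t unfolding passage_above_def by simp
 have i: "integrable lborel (\<lambda>s. indicator {0..<t} s :: real)" using `0 <= t` by simp
 have i2: "integrable lborel (\<lambda>s. indicator {0..<t} s * indicator {..<b} (V (max 0 s) w) :: real)"
  by (rule Bochner_Integration.integrable_bound[OF i]) (auto simp: indicator_def)
 have "(LINT s|lborel. indicator {0..<t} s * rate (V (max 0 s) w)) =
  (LINT s|lborel. p * indicator {0..<t} s + q * (indicator {0..<t} s * indicator {..<b} (V (max 0 s) w)))"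
  by (intro Bochner_Integration.integral_cong) (auto simp: rate_def algebra_simps)
 also have "\<dots> = p * (LINT s|lborel. indicator {0..<t} s) + q * (LINT s|lborel. indicator {0..<t} s * indicator {..<b} (V (max 0 s) w))"
  using i i2 by simp
 also have "(LINT s|lborel. indicator {0..<t} s) = t" using `0 <= t` by simp
 also have "(LINT s|lborel. indicator {0..<t} s * indicator {..<b} (V (max 0 s) w)) = occupation_time {..<b} t (vp w)"
  unfolding occupation_time_def set_lebesgue_integral_def
 proof (rule integral_cong_AE)
  have "(\<lambda>s. indicator {0..t} s *\<^sub>R indicator {..<b} (V s w) :: real) = (\<lambda>s. indicator {0..t} s *\<^sub>R indicator {..<b} (V (max 0 s) w))"
   by (auto simp: indicator_def)
  thus "(\<lambda>s. indicator {0..t} s *\<^sub>R indicator {..<b} (V s w) :: real) \<in> borel_measurable lborel" by simp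
  have "AE s in lborel. s \<noteq> (t::real)" by (rule AE_lborel_singleton)
  thus "AE s in lborel. indicator {0..<t} s * indicator {..<b} (V (max 0 s) w) = indicator {0..t} s *\<^sub>R (indicator {..<b} (V s w) :: real)"
   by (auto elim!: eventually_mono simp: indicator_def)
 qed simp
 finally show "passage_functional p q {..<b} a (vp w) = exp (- (LINT s|lborel. indicator {0..<t} s * rate (V (max 0 s) w)))"
  using t by (simp add: passage_functional_def)
qed

text \<open>The first sequence is eventually constant. For the second, V exceeds \<open>a\<close>
  strictly at times arbitrarily close to the passage time, hence there also exceeds slightly higher
  levels; the passage times above these come down to the passage time above
  \<open>a\<close>.\<close>

lemma rate_limits:
 assumes g: "good w" and t: "passage_above a (vp w) = ereal t"
 defines "I \<equiv> LINT s|lborel. indicator {0..<t} s * rate (V (max 0 s) w)"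
 shows "(\<lambda>m. LINT s|lborel. indicator {0..<real (Suc m)} s * (if ereal s < passage_above a (vp w) then rate (V (max 0 s) w) else 0)) \<longlonglongrightarrow> I"
  and "(\<lambda>m. LINT s|lborel. indicator {0..<real (Suc m)} s * (if ereal s <= passage_above (a + 2 * (1 / real (Suc m))) (vp w) then rate (V (max 0 s) w) else 0)) \<longlonglongrightarrow> I"
proof -
 interpret P: rr_path \<delta> b "\<lambda>t. x + X t w" "vp w" using goodD g by blast
 note P.path_measurable[measurable]
 have big: "EV m. t <= real (Suc m)"
  using filterlim_real_sequentially unfolding filterlim_at_top by (auto elim!: eventually_mono allE[of _ t])
 have "EV m. (LINT s|lborel. indicator {0..<real (Suc m)} s * (if ereal s < passage_above a (vp w) then rate (V (max 0 s) w) else 0)) = I"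
  using big
 proof eventually_elim
  case (elim m)
  show ?case unfolding I_def t by (rule Bochner_Integration.integral_cong) (use elim in "auto simp: indicator_def")
 qed
 thus "(\<lambda>m. LINT s|lborel. indicator {0..<real (Suc m)} s * (if ereal s < passage_above a (vp w) then rate (V (max 0 s) w) else 0)) \<longlonglongrightarrow> I"
  by (rule tendsto_eventually)
 define r0 where "r0 = p + \<bar>q\<bar>"
 have r0: "0 <= r0" "\<And>u. 0 <= rate u" "\<And>u. rate u <= r0" using rate_bounds p_nonneg by (auto simp: r0_def)
 define J where "J m = (LINT s|lborel. indicator {0..<real (Suc m)} s * (if ereal s <= passage_above (a + 2 * (1 / real (Suc m))) (vp w) then rate (V (max 0 s) w) else 0))" for m
 have ib: "integrable lborel (\<lambda>s. indicator {c..<d} s * h s)" if [measurable]: "h \<in> borel_measurable borel" and "\<And>s. \<bar>h s\<bar> <= r0" for c d and h :: "real => real"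
 proof -
  have "integrable lborel (\<lambda>s. r0 * indicator {c..<d} s)" by (cases "c <= d") auto
  thus ?thesis by (rule Bochner_Integration.integrable_bound) (use that(2) r0(1) in "auto simp: indicator_def")
 qed
 have iI: "integrable lborel (\<lambda>s. indicator {0..<t} s * rate (V (max 0 s) w))" by (rule ib) (use r0 in auto)
 have iJ: "integrable lborel (\<lambda>s. indicator {0..<real (Suc m)} s * (if ereal s <= passage_above (a + 2 * (1 / real (Suc m))) (vp w) then rate (V (max 0 s) w) else 0))" for m
  by (rule ib) (use r0 in auto)
 have "J \<longlonglongrightarrow> I"
 proof (rule tendstoI)
  fix e :: real assume "0 < e"
  define d where "d = e / (r0 + 1)"
  have d: "0 < d" "r0 * d < e"
  proof -
   show "0 < d" using `0 < e` r0 by (simp add: d_def)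
   moreover have "(r0 + 1) * d = e" using r0(1) by (simp add: d_def)
   ultimately show "r0 * d < e" by (simp add: distrib_right)
  qed
  have "passage_above a (vp w) < ereal (t + d)" using t d by simp
  then obtain u where u: "0 < u" "a < V u w" "u < t + d"
   using first_time_after_approx[of 0 "\<lambda>t. a < V t w" "ereal (t + d)"] unfolding passage_above_def by auto
  have "(\<lambda>m. 2 * (1 / real (Suc m))) \<longlonglongrightarrow> 0" by (rule tendsto_mult_right_zero) (rule LIMSEQ_Suc[OF lim_1_over_n])
  hence "EV m. 2 * (1 / real (Suc m)) < V u w - a" by (rule order_tendstoD) (use u in simp)
  thus "EV m. dist (J m) I < e" using big
  proof eventually_elim
   case (elim m)
   have "passage_above (a + 2 * (1 / real (Suc m))) (vp w) <= ereal u"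
    unfolding passage_above_def first_time_after_def by (rule INF_lower) (use u elim(1) in auto)
   hence T1: "s < t + d" if "ereal s <= passage_above (a + 2 * (1 / real (Suc m))) (vp w)" for s
    using that u(3) by (meson ereal_less_eq(3) le_less_trans order.trans)
   have T2: "ereal s <= passage_above (a + 2 * (1 / real (Suc m))) (vp w)" if "s < t" for s
    using passage_above_mono[of a "a + 2 * (1 / real (Suc m))" "vp w"] that t by (simp add: order.trans[of "ereal s" "ereal t"])
   have "I <= J m" unfolding I_def J_def
   proof (rule integral_mono[OF iI iJ])
    show "indicator {0..<t} s * rate (V (max 0 s) w) <= indicator {0..<real (Suc m)} s *
     (if ereal s <= passage_above (a + 2 * (1 / real (Suc m))) (vp w) then rate (V (max 0 s) w) else 0)" for s
     using T2[of s] elim(2) r0 by (auto simp: indicator_def)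
   qed
   moreover have "J m <= (LINT s|lborel. indicator {0..<t} s * rate (V (max 0 s) w) + r0 * indicator {t..<t + d} s)" unfolding J_def
   proof (rule integral_mono[OF iJ])
    show "integrable lborel (\<lambda>s. indicator {0..<t} s * rate (V (max 0 s) w) + r0 * indicator {t..<t + d} s)"
     using d by (intro Bochner_Integration.integrable_add iI integrable_mult_right) simp
    show "indicator {0..<real (Suc m)} s *
     (if ereal s <= passage_above (a + 2 * (1 / real (Suc m))) (vp w) then rate (V (max 0 s) w) else 0) <= indicator {0..<t} s * rate (V (max 0 s) w) + r0 * indicator {t..<t + d} s" for s
     using T1[of s] r0 by (auto simp: indicator_def)
   qed
   moreover have "(LINT s|lborel. indicator {0..<t} s * rate (V (max 0 s) w) + r0 * indicator {t..<t + d} s) = I + r0 * d"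
    unfolding I_def using iI d by (subst Bochner_Integration.integral_add) auto
   ultimately show ?case using d by (simp add: dist_real_def)
  qed
 qed
 thus "(\<lambda>m. LINT s|lborel. indicator {0..<real (Suc m)} s * (if ereal s <= passage_above (a + 2 * (1 / real (Suc m))) (vp w) then rate (V (max 0 s) w) else 0)) \<longlonglongrightarrow> I"
  unfolding J_def .
qed

text \<open>As \<open>R 0 = 1\<close>, the estimate started at 0 with \<open>R a = 0\<close> would
  read \<open>1 <= C / real m\<close> for every \<open>m\<close>.\<close>

lemma R_nonzero: "R a \<noteq> 0"
proof
 assume "R a = 0"
 have "0 <= a" using a_pos by simp
 obtain C where C: "0 <= C" "\<forall>m>0. EV n.
  \<bar>R 0 - R a * expectation (cK n (a + 1 / real m) 0 (m * n))\<bar> <= C / real m" by (rule main_estimate[OF order_refl `0 <= a`])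
 have "1 <= C / real (Suc m)" for m
 proof -
  have "\<forall>\<^sub>F n::nat in sequentially. 1 <= C / real (Suc m)" using C(2)[rule_format, of "Suc m"] `R a = 0` R_nonpos[of 0] by simp
  thus ?thesis by simp
 qed
 hence "1 <= (0::real)" by (intro LIMSEQ_le_const[OF LIMSEQ_Suc[OF lim_const_over_n[of C]]]) auto
 thus False by simp
qed

theorem passage_expectation_R: "passage_expectation M V p q {..<b} a = R x / R a" unfolding passage_expectation_def
proof -
 obtain C where C: "0 <= C" "\<forall>m>0. EV n.
  \<bar>R x0 - R a * expectation (cK n (a + 1 / real m) x0 (m * n))\<bar> <= C / real m" by (rule main_estimate[OF x0])
 \<comment> \<open>A negative start is moved to 0 by the reflection, and \<open>R\<close> equals 1
   at both points.\<close>
 have Rx: "R x0 = R x" using R_nonpos[of x] R_nonpos[of 0] by (simp add: max_def)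
 define k where "k m n w = cK n (a + 1 / real (Suc m)) x0 (Suc m * n) w" for m n w
 have kb: "0 <= k m n w \<and> k m n w <= 1" for m n w unfolding k_def by (rule cK_bounds) (use x0 in "auto intro: add_increasing2")
 show "(LINT w|completion M. passage_functional p q {..<b} a (vp w)) = R x / R a"
 proof (rule sandwich_expectation[where k=k and C="C / \<bar>R a\<bar>"])
  show "k m n \<in> borel_measurable M" for m n unfolding k_def by measurable
  show "0 <= k m n w" "k m n w <= 1" for m n w using kb by auto
  show "EV n. \<bar>expectation (k m n) - R x / R a\<bar> <= C / \<bar>R a\<bar> / real (Suc m)" for m
  proof -
   have "EV n. \<bar>R x0 - R a * expectation (k m n)\<bar> <= C / real (Suc m)" unfolding k_def using C(2) by blast
   thus ?thesis
   proof eventually_elim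
    case (elim n)
    have "expectation (k m n) - R x / R a = - (R x0 - R a * expectation (k m n)) / R a" using R_nonzero by (simp add: Rx field_simps)
    hence "\<bar>expectation (k m n) - R x / R a\<bar> = \<bar>R x0 - R a * expectation (k m n)\<bar> / \<bar>R a\<bar>" by (simp only: abs_divide abs_minus_cancel)
    also have "\<dots> <= C / real (Suc m) / \<bar>R a\<bar>" using elim by (rule divide_right_mono) simp
    also have "\<dots> = C / \<bar>R a\<bar> / real (Suc m)" by (simp only: divide_divide_eq_left mult.commute)
    finally show ?case .
   qed
  qed
  have "AE w in M. (\<exists>lo. lo \<longlonglongrightarrow> passage_functional p q {..<b} a (vp w) \<and>
    (\<forall>m. \<exists>l. l \<longlonglongrightarrow> lo m \<and> (EV n. l n <= k m n w))) \<and>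
   (\<exists>hi. hi \<longlonglongrightarrow> 1 - passage_functional p q {..<b} a (vp w) \<and>
    (\<forall>m. \<exists>l. l \<longlonglongrightarrow> hi m \<and> (EV n. l n <= 1 - k m n w)))" using AE_good passage_finite no_time_at_b
  proof eventually_elim
   case (elim w)
   interpret P: rr_path \<delta> b "\<lambda>t. x + X t w" "vp w" using goodD elim(1) by blast
   have v0: "V 0 w = x0" using elim(1) goodD(2) by blast
   have v0': "V 0 w <= a" using v0 x0 by simp
   have "0 <= passage_above a (vp w)" using first_time_after_ge[of 0] unfolding passage_above_def zero_ereal_def by blast
   then obtain t where t: "passage_above a (vp w) = ereal t" using elim(2) by (cases "passage_above a (vp w)") auto
   define Im where "Im m = (LINT s|lborel. indicator {0..<real (Suc m)} s * (if ereal s < passage_above a (vp w) then rate (V (max 0 s) w) else 0))" for m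
   define Jm where "Jm m = (LINT s|lborel. indicator {0..<real (Suc m)} s * (if ereal s <= passage_above (a + 2 * (1 / real (Suc m))) (vp w) then rate (V (max 0 s) w) else 0))" for m
   have lim: "Im \<longlonglongrightarrow> (LINT s|lborel. indicator {0..<t} s * rate (V (max 0 s) w))" "Jm \<longlonglongrightarrow> (LINT s|lborel. indicator {0..<t} s * rate (V (max 0 s) w))"
    unfolding Im_def[abs_def] Jm_def[abs_def] by (rule rate_limits[OF elim(1) t])+
   note Z = rate_integral(2)[OF elim(1) t]
   define S where "S m n = (\<Sum>j<Suc m * n. if alive (es n) (a + 1 / real (Suc m)) (V 0 w) (increments n (\<lambda>t. x + X t w)) j
    then rate (P.E n j) else 0) / real n" for m n
   have kS: "k m n w = exp (- S m n)" for m n unfolding k_def cK_eq S_def v0 goodD(3)[OF elim(1)] ..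
   have h: "0 < 1 / real (Suc m)" for m by simp
   have null1: "AE s in lborel. 0 < s --> ereal s < passage_above a (vp w) --> V s w \<noteq> b" using elim(3)
   proof eventually_elim
    case (elim s)
    thus ?case using passage_above_mono[of a "a + 3" "vp w"] by (auto intro: less_le_trans)
   qed
   have null2: "AE s in lborel. 0 < s --> ereal s <= passage_above (a + 2 * (1 / real (Suc m))) (vp w) --> V s w \<noteq> b" for m
    using elim(3) AE_ereal_neq[of "passage_above (a + 2 * (1 / real (Suc m))) (vp w)"]
   proof eventually_elim
    case (elim s)
    have "2 * (1 / real (Suc m)) <= 3" by (simp add: divide_le_eq)
    hence "passage_above (a + 2 * (1 / real (Suc m))) (vp w) <= passage_above (a + 3) (vp w)" by (intro passage_above_mono) simp
    thus ?case using elim by (auto simp: order_less_le intro: less_le_trans)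
   qed
   have rb: "rate u <= p + \<bar>q\<bar>" "0 <= rate u" for u using rate_bounds by auto
   \<comment> \<open>In the limit the accumulated rate of the chain stopped above
     \<open>a + 1 / real (Suc m)\<close> lies between \<open>Im m\<close> and \<open>Jm m\<close>,
     and both tend to the rate integral up to the passage.\<close>
   have lower: "\<exists>u. u \<longlonglongrightarrow> 1 - exp (- Im m) \<and> (EV n. u n <= 1 - k m n w)" for m
   proof -
    obtain lo where lo: "lo \<longlonglongrightarrow> Im m" "\<forall>n>0. lo n <= S m n"
     using P.weight_limit_lower[OF h[of m] v0' rate_measurable rb(2,1) rate_locally_constant null1, of "Suc m"] unfolding Im_def S_def by auto
    show ?thesis
    proof (intro exI conjI)
     show "(\<lambda>n. 1 - exp (- lo n)) \<longlonglongrightarrow> 1 - exp (- Im m)" by (intro tendsto_intros lo)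
     show "EV n. 1 - exp (- lo n) <= 1 - k m n w" using eventually_gt_at_top[of 0] by eventually_elim (use lo(2) in "simp add: kS")
    qed
   qed
   have upper: "\<exists>l. l \<longlonglongrightarrow> exp (- Jm m) \<and> (EV n. l n <= k m n w)" for m
   proof -
    obtain hi where hi: "hi \<longlonglongrightarrow> Jm m" "\<forall>n>0. S m n <= hi n"
     using P.weight_limit_upper[OF h[of m] rate_measurable rb(2,1) rate_locally_constant null2[of m], of "Suc m"] unfolding Jm_def S_def by auto
    show ?thesis
    proof (intro exI conjI)
     show "(\<lambda>n. exp (- hi n)) \<longlonglongrightarrow> exp (- Jm m)" by (intro tendsto_intros hi)
     show "EV n. exp (- hi n) <= k m n w" using eventually_gt_at_top[of 0] by eventually_elim (use hi(2) in "simp add: kS")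
    qed
   qed
   show ?case unfolding Z using lim upper lower
    by (intro conjI exI[of _ "\<lambda>m. exp (- Jm m)"] exI[of _ "\<lambda>m. 1 - exp (- Im m)"]) (auto intro!: tendsto_intros)
  qed
  thus "AE w in M. \<exists>lo. lo \<longlonglongrightarrow> passage_functional p q {..<b} a (vp w) \<and>
    (\<forall>m. \<exists>l. l \<longlonglongrightarrow> lo m \<and> (EV n. l n <= k m n w))"
   and "AE w in M. \<exists>hi. hi \<longlonglongrightarrow> 1 - passage_functional p q {..<b} a (vp w) \<and>
    (\<forall>m. \<exists>l. l \<longlonglongrightarrow> hi m \<and> (EV n. l n <= 1 - k m n w))" by simp_all
 qed
qed

end

section \<open>Exchanging the time above b for the time below, and both identities together\<close>

context passage_setting
begin

text \<open>As V spends no time at \<open>b\<close>, the time above \<open>b\<close> is the passage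
  time minus the time below \<open>b\<close>; this moves \<open>q\<close> into the killing rate and
  reverses its sign in front of the occupation time.\<close>

lemma occupation_complement:
 "AE w in M. passage_functional p q {b<..} a (vp w) = passage_functional (p + q) (- q) {..<b} a (vp w)" using AE_good passage_finite no_time_at_b
proof eventually_elim
 case (elim w)
 interpret P: rr_path \<delta> b "\<lambda>t. x + X t w" "vp w" using goodD elim(1) by blast
 note P.path_measurable[measurable]
 have "0 <= passage_above a (vp w)" using first_time_after_ge[of 0] unfolding passage_above_def zero_ereal_def by blast
 then obtain t where t: "passage_above a (vp w) = ereal t" "0 <= t" using elim(2) by (cases "passage_above a (vp w)") auto
 have null: "AE s in lborel. 0 < s --> s < t --> V s w \<noteq> b" using elim(3)
 proof eventually_elim
  case (elim s)
  thus ?case using passage_above_mono[of a "a + 3" "vp w"] t by (auto intro: less_le_trans[of "ereal s" "ereal t"])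
 qed
 have occ: "occupation_time B t (vp w) = (LINT s|lborel. indicator {0..t} s * indicator B (V (max 0 s) w))" for B
  unfolding occupation_time_def set_lebesgue_integral_def by (intro Bochner_Integration.integral_cong) (auto simp: indicator_def)
 have i: "integrable lborel (\<lambda>s. indicator {0..t} s * indicator B (V (max 0 s) w) :: real)" if [measurable]: "B \<in> sets borel" for B
 proof (rule Bochner_Integration.integrable_bound)
  show "integrable lborel (\<lambda>s. indicator {0..t} s :: real)" using t by simp
 qed (auto simp: indicator_def)
 have "occupation_time {..<b} t (vp w) + occupation_time {b<..} t (vp w) =
  (LINT s|lborel. indicator {0..t} s * indicator {..<b} (V (max 0 s) w) + indicator {0..t} s * indicator {b<..} (V (max 0 s) w))"
  unfolding occ using i by simp
 also have "\<dots> = (LINT s|lborel. indicator {0..t} s)"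
 proof (rule integral_cong_AE)
  have "AE s in lborel. s \<noteq> (0::real)" "AE s in lborel. s \<noteq> t" by (rule AE_lborel_singleton)+
  with null show "AE s in lborel. indicator {0..t} s * indicator {..<b} (V (max 0 s) w) + indicator {0..t} s * indicator {b<..} (V (max 0 s) w) = (indicator {0..t} s :: real)"
  proof eventually_elim
   case (elim s)
   thus ?case by (cases "0 < s \<and> s < t") (auto simp: indicator_def)
  qed
 qed auto
 also have "\<dots> = t" using t by simp
 finally have e: "occupation_time {b<..} t (vp w) = t - occupation_time {..<b} t (vp w)" by simp
 have "- p * t - q * occupation_time {b<..} t (vp w) = - (p + q) * t - - q * occupation_time {..<b} t (vp w)" unfolding e by (simp add: algebra_simps)
 thus ?case using t by (simp add: passage_functional_def)
qed

end

lemma L_fun_eq: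
 "L_fun W WY \<delta> b p q z = Z_scale W p z + q * W_bar WY (p + q) (z - b)
  + p * (LINT y:{b..z}|lborel. WY (p + q) (z - y) * (q * W_bar W p y + \<delta> * W p y))"
proof -
 have "WY (p + q) (z - y) * (- q * W_bar W p y - \<delta> * W p y) = - (WY (p + q) (z - y) * (q * W_bar W p y + \<delta> * W p y))" for y
  by (simp add: algebra_simps)
 hence "(LINT y:{b..z}|lborel. WY (p + q) (z - y) * (- q * W_bar W p y - \<delta> * W p y)) =
  (LINT y:{b..z}|lborel. - (WY (p + q) (z - y) * (q * W_bar W p y + \<delta> * W p y)))" by (simp only:)
 also have "\<dots> = - (LINT y:{b..z}|lborel. WY (p + q) (z - y) * (q * W_bar W p y + \<delta> * W p y))" unfolding set_lebesgue_integral_def by simp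
 finally show ?thesis unfolding L_fun_def R_fun_def by simp
qed

theorem proposition6p1:
  fixes M :: "'w measure" and X V :: "real \<Rightarrow> 'w \<Rightarrow> real"
    and \<gamma> \<sigma> \<delta> b p q a x :: real and \<nu> :: "real measure"
    and W WY :: "real \<Rightarrow> real \<Rightarrow> real"
  assumes "spectrally_negative_levy_process M X"
    and "has_levy_triplet M X \<gamma> \<sigma> \<nu>"
    and "b > 0" and "\<delta> \<ge> 0"
    and "bounded_variation_paths M X \<Longrightarrow> \<delta> < bv_drift \<gamma> \<nu>"
    and "\<And>r. r \<ge> 0 \<Longrightarrow> is_scale_function (laplace_exponent M X) r (W r)"
    and "\<And>r. r \<ge> 0 \<Longrightarrow>
           is_scale_function (laplace_exponent M (\<lambda>t \<omega>. X t \<omega> - \<delta> * t)) r (WY r)"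
    and "p \<ge> 0" and "q \<ge> - p" and "a > 0" and "x \<le> a"
    and "refracted_reflected_process M X \<delta> b x V"
  shows "passage_expectation M V p q {..<b} a = R_fun W WY \<delta> b p q x / R_fun W WY \<delta> b p q a
    \<and> passage_expectation M V p q {b<..} a = L_fun W WY \<delta> b p q x / L_fun W WY \<delta> b p q a
    \<and> (\<forall>z. L_fun W WY \<delta> b p q z =
          Z_scale W p z + q * W_bar WY (p + q) (z - b)
          + p * (LINT y:{b..z}|lborel.
              WY (p + q) (z - y) * (q * W_bar W p y + \<delta> * W p y)))
    \<and> (\<forall>z\<le>0. R_fun W WY \<delta> b p q z = 1 \<and> L_fun W WY \<delta> b p q z = 1)"
proof -
 interpret X: spectrally_negative_levy_process M X by fact
 interpret X: sn_levy_triplet M X \<gamma> \<sigma> \<nu> \<delta> by unfold_locales (use assms in auto)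
 interpret R: passage_setting M X \<gamma> \<sigma> \<nu> \<delta> b p q W WY a x V by unfold_locales (use assms in auto)
 \<comment> \<open>These parameters are admissible: \<open>p + q\<close> is nonnegative by the bound
   on \<open>q\<close>, and \<open>- (p + q) <= - q\<close> is the nonnegativity of
   \<open>p\<close>.\<close>
 interpret L: passage_setting M X \<gamma> \<sigma> \<nu> \<delta> b "p + q" "- q" W WY a x V by unfold_locales (use assms in auto)
 have "passage_expectation M V p q {b<..} a = passage_expectation M V (p + q) (- q) {..<b} a"
  unfolding passage_expectation_def by (rule X.integral_completion_cong_AE[OF R.occupation_complement])
 thus ?thesis using R.passage_expectation_R L.passage_expectation_R R.R_nonpos L.R_nonpos by (auto simp: L_fun_def L_fun_eq[unfolded L_fun_def])
qed

end
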